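(* Let $\widetilde{\lambda}\ge1$ and for $N\ge1$ put $\theta_N=\widetilde{\lambda}/N$. Then, with implied constants depending only on $\widetilde{\lambda}$, \[h_N^{\theta_N}\ge\frac{1}{2\widetilde{\lambda}-1+2\sqrt{\widetilde{\lambda}^2-\widetilde{\lambda}}}-O(N^{-1})\ge\frac{1}{4\widetilde{\lambda}}-O(N^{-1}),\qquad N\ge1,\ \widetilde{\lambda}\ge1.\] On the other hand, \[h_N^{\theta_N}\le\frac{1}{\widetilde{\lambda}-2}+O(N^{-1}),\qquad N\ge1,\ \widetilde{\lambda}\ge3,\] and \[h_N^{\theta_N}\le\frac{2\widetilde{\lambda}}{2\widetilde{\lambda}-1+\sqrt{4\widetilde{\lambda}^2-8\widetilde{\lambda}+1}}+O(N^{-1}),\qquad N\ge1,\ \widetilde{\lambda}\ge2.\] Moreover, for every even $N\ge2$, $g_N^{2/N}\le\frac{N+2}{N+4}$.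
   Context: $\lambda_N(\zeta)$ is the supremum of $\lambda$ such that $1\le|x|\le X$, $\max_{1\le i\le N}|\zeta^ix-y_i|\le X^{-\lambda}$ has a solution $(x,y_1,\dots,y_N)\in\mathbb{Z}^{N+1}$ for arbitrarily large $X$. For $N\ge1$ and $\lambda$ real, $h_N^\lambda=\dim\{\zeta\in\mathbb{R}:\lambda_N(\zeta)\ge\lambda\}$ and $g_N^\lambda=\dim\{\zeta\in\mathbb{R}:\lambda_N(\zeta)>\lambda\}$, where $\dim$ is Hausdorff dimension. *)

theory Defs
  imports "HOL-Analysis.Analysis"
begin

text \<open>The summand \<open>(diam U)\<^sup>s\<close> of the Hausdorff measure. The cases are separated because
  \<open>0 powr 0 = 0\<close>, whereas a nonempty set has to contribute 1 when \<open>s = 0\<close> (so that the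
  0-dimensional measure is counting measure) and the empty set always contributes 0.\<close>

definition diam_pow :: "real \<Rightarrow> 'a::metric_space set \<Rightarrow> real" where
  "diam_pow s U = (if U = {} then 0 else if s = 0 then 1 else diameter U powr s)"

text \<open>Boundedness of the covering sets is required explicitly since \<^const>\<open>diameter\<close> is only
  meaningful for bounded sets.\<close>

definition hausdorff_premeasure :: "real \<Rightarrow> real \<Rightarrow> 'a::metric_space set \<Rightarrow> ennreal" where
  "hausdorff_premeasure s \<delta> A =
     (INF U \<in> {U :: nat \<Rightarrow> 'a set. A \<subseteq> (\<Union>i. U i) \<and> (\<forall>i. bounded (U i) \<and> diameter (U i) \<le> \<delta>)}.
        \<Sum>i. ennreal (diam_pow s (U i)))"

definition hausdorff_measure :: "real \<Rightarrow> 'a::metric_space set \<Rightarrow> ennreal" where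
  "hausdorff_measure s A = (SUP \<delta>\<in>{0<..}. hausdorff_premeasure s \<delta> A)"

definition hausdorff_dim :: "'a::metric_space set \<Rightarrow> ereal" where
  "hausdorff_dim A = Inf (ereal ` {s. 0 \<le> s \<and> hausdorff_measure s A = 0})"

text \<open>The exponent \<open>\<lambda>\<^sub>N(\<zeta>)\<close>; it may be infinite. Only the values of \<open>y\<close> on \<open>{1..N}\<close> matter,
  and the notion is meant for \<open>N \<ge> 1\<close>.\<close>

definition approx_exponent :: "nat \<Rightarrow> real \<Rightarrow> ereal" where
  "approx_exponent N \<zeta> =
     Sup (ereal ` {l :: real. \<exists>\<^sub>F X :: real in at_top.
        \<exists>(x :: int) (y :: nat \<Rightarrow> int).
          1 \<le> \<bar>x\<bar> \<and> real_of_int \<bar>x\<bar> \<le> X \<and>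
          (MAX i\<in>{1..N}. \<bar>\<zeta> ^ i * real_of_int x - real_of_int (y i)\<bar>) \<le> X powr (- l)})"

definition h_dim :: "nat \<Rightarrow> real \<Rightarrow> ereal" where
  "h_dim N l = hausdorff_dim {\<zeta> :: real. approx_exponent N \<zeta> \<ge> ereal l}"

definition g_dim :: "nat \<Rightarrow> real \<Rightarrow> ereal" where
  "g_dim N l = hausdorff_dim {\<zeta> :: real. approx_exponent N \<zeta> > ereal l}"

end

theory Submission
  imports Defs "Berlekamp_Zassenhaus.Square_Free_Int_To_Square_Free_GFp" "Berlekamp_Zassenhaus.Factor_Bound"
    "Jordan_Normal_Form.Determinant"
begin

text \<open>
  Upper bounds: if \<open>(x, y\<^sub>1, \<dots>, y\<^sub>N)\<close> is a good approximation, a pigeonhole argument yields many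
  small integer polynomials \<open>\<Sum> c\<^sub>i T\<^sup>i\<close> of low degree with \<open>\<Sum> c\<^sub>i y\<^sub>i = 0\<close>, and they are all multiples of
  the one of minimal degree. Counting these multiples bounds the height of that polynomial by about
  \<open>|x|\<^sup>1\<^sup>/\<^sup>N\<close>, so its value at \<open>\<zeta>\<close> is tiny. Multiplicativity of the Mahler measure passes this on to an
  irreducible factor \<open>Q\<close>, and since the resultant of \<open>Q\<close> and \<open>Q'\<close> is a nonzero integer, \<open>\<zeta>\<close> lies very
  close to a root of \<open>Q\<close>. The Borel-Cantelli covering by neighbourhoods of such roots gives the dimension.

  Lower bounds: let \<open>\<alpha>\<close> be a root of an integer polynomial of degree \<open>n\<close>. The linear recurrence satisfied
  by the powers of \<open>\<alpha>\<close> produces simultaneous approximations to \<open>\<alpha>, \<dots>, \<alpha>\<^sup>N\<close> that are still good for every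
  number close to \<open>\<alpha>\<close>. Quantitative nondivergence on the moment curve and an effective Kronecker theorem
  show that these roots are well distributed, so a Cantor set of numbers close to infinitely many of
  them has the claimed dimension; \<open>n\<close> is chosen as about \<open>(1 - \<surd>(1 - 1 / L)) N\<close>.
\<close>

subsection \<open>A Remez-type inequality\<close>

text \<open>Put L = N l. Upper bound, for L > 2: there are about 2^(j (k + 1)) integer polynomials
  of degree at most k and height about 2^j, and their roots get neighbourhoods of radius 2^(-j (w -
  k + 1)) with w just below N (1 + l) - 1. The sum of s-th powers converges for s > (k + 1) / (N (1
  + l) - k); for k = floor (N / L) + 1 this threshold is 1 / (L - 1) + O(1 / N), which is enough for
  both stated bounds. The pigeonhole argument needs k l > 1 strictly, so l is taken slightly below L
  / N for \<open>h_dim\<close> and slightly above 2 / N for \<open>g_dim\<close>. Lower bound: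
  height t yields about t^(n + 1) separated roots of degree n, each with a neighbourhood of radius
  X^(-1 - l), where X^(1 - n l) = t^(N + 1 - n). The quotient (n + 1) (1 - n l) / ((N + 1 - n) (1 +
  l)) tends to \<nu> (1 - \<nu> L) / (1 - \<nu>) for n = \<nu> N, and the choice of n maximises
  this. The obstacle is the distribution of the roots: Kronecker's theorem gives one near \<zeta>
  only if the powers of \<zeta> are badly approximable at scale t; nondivergence provides such
  \<zeta> in a fixed proportion of every subinterval of [0, 1].\<close>

lemma poly_bound_from_separated_points:
  fixes p :: "real poly" and x :: "nat \<Rightarrow> real"
  assumes "degree p \<le> n" "s > 0" "a \<le> b"
    and "\<And>i. i \<le> n \<Longrightarrow> x i \<in> {a..b}"
    and "\<And>i j. i < j \<Longrightarrow> j \<le> n \<Longrightarrow> s \<le> \<bar>x i - x j\<bar>"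
    and "\<And>i. i \<le> n \<Longrightarrow> \<bar>poly p (x i)\<bar> \<le> m"
    and "y \<in> {a..b}"
  shows "\<bar>poly p y\<bar> \<le> m * (1 + 2 * (b - a) / s) ^ n"
  using assms
proof (induction n arbitrary: p m)
  case 0
  then obtain c where "p = [:c:]" using degree_eq_zeroE by auto
  with 0 show ?case by auto
next
  case (Suc n)
  define c where "c = x (Suc n)"
  \<comment> \<open>q is the divided difference of p at the node c: its degree drops by one, and at
    the remaining nodes its values are at most 2 m / s because these nodes stay s away from c.
    Reassembling p from q costs one factor 1 + 2 (b - a) / s.\<close>
  define q where "q = synthetic_div p c"
  have pq: "poly p z = poly p c + (z - c) * poly q z" for z
  proof -
    have "p = [:poly p c:] + [:-c, 1:] * q"
      unfolding q_def using synthetic_div_correct'[of c p] by (simp add: add.commute)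
    hence "poly p z = poly ([:poly p c:] + [:-c, 1:] * q) z" by simp
    also have "\<dots> = poly p c + (z - c) * poly q z"
      unfolding poly_add poly_mult by simp
    finally show ?thesis .
  qed
  have m0: "0 \<le> m" using Suc.prems(6)[of 0] by linarith
  have qx: "\<bar>poly q (x i)\<bar> \<le> 2 * m / s" if "i \<le> n" for i
  proof -
    have sep: "s \<le> \<bar>x i - c\<bar>" using Suc.prems(5)[of i "Suc n"] that by (simp add: c_def)
    have "\<bar>x i - c\<bar> * \<bar>poly q (x i)\<bar> = \<bar>poly p (x i) - poly p c\<bar>"
      using pq[of "x i"] by (simp add: abs_mult)
    also have "\<dots> \<le> 2 * m"
      using Suc.prems(6)[of i] Suc.prems(6)[of "Suc n"] that by (auto simp: c_def)
    finally have "\<bar>x i - c\<bar> * \<bar>poly q (x i)\<bar> \<le> 2 * m" .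
    moreover have "s * \<bar>poly q (x i)\<bar> \<le> \<bar>x i - c\<bar> * \<bar>poly q (x i)\<bar>"
      using sep by (intro mult_right_mono) auto
    ultimately have "s * \<bar>poly q (x i)\<bar> \<le> 2 * m" by linarith
    thus ?thesis using \<open>s > 0\<close> by (simp add: field_simps)
  qed
  have degq: "degree q \<le> n" using Suc.prems(1) by (simp add: q_def degree_synthetic_div)
  have qy: "\<bar>poly q y\<bar> \<le> (2 * m / s) * (1 + 2 * (b - a) / s) ^ n"
    by (rule Suc.IH[OF degq]) (use Suc.prems qx in auto)
  have yc: "\<bar>y - c\<bar> \<le> b - a"
    using Suc.prems(4)[of "Suc n"] Suc.prems(7) by (auto simp: c_def)
  let ?B = "(1 + 2 * (b - a) / s) ^ n"
  have B1: "1 \<le> ?B" using Suc.prems by (intro one_le_power) auto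
  have "\<bar>poly p y\<bar> \<le> \<bar>poly p c\<bar> + \<bar>y - c\<bar> * \<bar>poly q y\<bar>"
    using pq[of y] by (metis abs_mult abs_triangle_ineq)
  also have "\<dots> \<le> m + (b - a) * ((2 * m / s) * ?B)"
    using Suc.prems(6)[of "Suc n"] yc qy m0
    by (intro add_mono mult_mono) (auto simp: c_def)
  also have "\<dots> \<le> m * ?B + (b - a) * ((2 * m / s) * ?B)"
    using mult_left_mono[OF B1 m0] by simp
  also have "\<dots> = m * (1 + 2 * (b - a) / s) ^ Suc n"
    by (simp add: algebra_simps)
  finally show ?case .
qed

text \<open>Greedy choice: as long as the intervals of length 2 s about the points found so far do
  not exhaust the measure of E, a further point of E remains.\<close>

lemma separated_points_in_set:
  fixes E :: "real set"
  assumes E: "E \<in> lmeasurable" and s: "s > 0" and big: "2 * s * real k < measure lebesgue E"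
  shows "\<exists>x :: nat \<Rightarrow> real. (\<forall>i\<le>k. x i \<in> E) \<and> (\<forall>i j. i < j \<longrightarrow> j \<le> k \<longrightarrow> s \<le> \<bar>x i - x j\<bar>)"
  using big
proof (induction k)
  case 0
  hence "E \<noteq> {}" by auto
  then obtain e where "e \<in> E" by auto
  thus ?case by (intro exI[of _ "\<lambda>_. e"]) auto
next
  case (Suc k)
  have "2 * s * real k < measure lebesgue E" using Suc.prems s by (simp add: algebra_simps)
  then obtain x where x: "\<forall>i\<le>k. x i \<in> E" "\<forall>i j. i < j \<longrightarrow> j \<le> k \<longrightarrow> s \<le> \<bar>x i - x j\<bar>"
    using Suc.IH by blast
  have "\<not> E \<subseteq> (\<Union>i\<in>{..k}. ball (x i) s)"
  proof
    assume sub: "E \<subseteq> (\<Union>i\<in>{..k}. ball (x i) s)"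
    have "measure lebesgue E \<le> measure lebesgue (\<Union>i\<in>{..k}. ball (x i) s)"
      using E sub by (intro measure_mono_fmeasurable) (auto intro!: fmeasurable.finite_UN simp: fmeasurableD)
    also have "\<dots> \<le> (\<Sum>i\<in>{..k}. measure lebesgue (ball (x i) s))"
      by (intro measure_UNION_le) auto
    also have "\<dots> = (\<Sum>i\<in>{..k}. 2 * s)"
      using s by (intro sum.cong refl) (simp add: ball_eq_greaterThanLessThan)
    also have "\<dots> = 2 * s * real (Suc k)" by simp
    finally show False using Suc.prems by simp
  qed
  then obtain e where e: "e \<in> E" "\<And>i. i \<le> k \<Longrightarrow> s \<le> dist (x i) e"
    by (force simp: not_less)
  show ?case
    using x e by (intro exI[of _ "x(Suc k := e)"])
      (auto simp: dist_real_def le_Suc_eq)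
qed

text \<open>The interpolation factor 1 + 2 (b - a) / s for n + 1 nodes at mutual distance s =
  \<delta> (b - a) / (4 (n + 1)), which a set of relative measure \<delta> always contains.\<close>

definition remez_const :: "nat \<Rightarrow> real \<Rightarrow> real" where
  "remez_const n \<delta> = (1 + 8 * (real n + 1) / \<delta>) ^ n"

lemma remez_const_ge_1: "\<delta> > 0 \<Longrightarrow> 1 \<le> remez_const n \<delta>"
  unfolding remez_const_def by (intro one_le_power) auto

text \<open>The (C, \<alpha>)-good property of polynomials in the form used below: smallness on a
  set of relative measure \<delta> spreads to the whole interval at a cost depending only on n and
  \<delta>.\<close>

lemma remez_poly:
  fixes p :: "real poly"
  assumes deg: "degree p \<le> n" and ab: "a < b" and E: "E \<in> lmeasurable" "E \<subseteq> {a..b}"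
    and \<delta>: "\<delta> > 0" "\<delta> * (b - a) \<le> measure lebesgue E"
    and m: "\<And>y. y \<in> E \<Longrightarrow> \<bar>poly p y\<bar> \<le> m" and y: "y \<in> {a..b}"
  shows "\<bar>poly p y\<bar> \<le> remez_const n \<delta> * m"
proof -
  define s where "s = \<delta> * (b - a) / (4 * (real n + 1))"
  have s: "s > 0" using \<delta> ab by (simp add: s_def)
  have "2 * s * real n < \<delta> * (b - a)"
  proof -
    have "2 * s * real n = \<delta> * (b - a) * (real n / (2 * (real n + 1)))"
      by (simp add: s_def field_simps)
    also have "\<dots> < \<delta> * (b - a) * 1"
      using \<delta> ab by (intro mult_strict_left_mono) auto
    finally show ?thesis by simp
  qed
  then obtain x where x: "\<forall>i\<le>n. x i \<in> E" "\<forall>i j. i < j \<longrightarrow> j \<le> n \<longrightarrow> s \<le> \<bar>x i - x j\<bar>"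
    using separated_points_in_set[OF E(1) s, of n] \<delta>(2) by auto
  have "\<bar>poly p y\<bar> \<le> m * (1 + 2 * (b - a) / s) ^ n"
    by (rule poly_bound_from_separated_points[OF deg s, of a b x]) (use x E ab y m in auto)
  also have "2 * (b - a) / s = 8 * (real n + 1) / \<delta>"
    using ab \<delta> by (simp add: s_def field_simps)
  finally show ?thesis by (simp add: remez_const_def mult.commute)
qed

subsection \<open>Quantitative nondivergence\<close>

definition chain_in :: "'s set \<Rightarrow> ('s \<Rightarrow> 's \<Rightarrow> bool) \<Rightarrow> 's set \<Rightarrow> bool" where
  "chain_in S R F \<longleftrightarrow> finite F \<and> F \<subseteq> S \<and> pairwise R F"

text \<open>Marked points in the sense of Dani and Kleinbock-Margulis: the flag F has members
  neither too small nor too large at y, and nothing compatible with all of F is smaller than \<rho>.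
  The upper bound M is what later turns a short vector into a small covolume one dimension
  higher.\<close>

definition marked ::
    "'s set \<Rightarrow> ('s \<Rightarrow> real \<Rightarrow> real) \<Rightarrow> ('s \<Rightarrow> 's \<Rightarrow> bool) \<Rightarrow> real \<Rightarrow> real \<Rightarrow> real \<Rightarrow> real \<Rightarrow> bool" where
  "marked S \<psi> R e \<rho> M y \<longleftrightarrow>
     (\<exists>F. chain_in S R F \<and> (\<forall>s\<in>F. e \<le> \<psi> s y \<and> \<psi> s y \<le> M) \<and>
          (\<forall>s\<in>S - F. (\<forall>t\<in>F. R s t) \<longrightarrow> \<rho> \<le> \<psi> s y))"

lemma marked_mono:
  assumes "marked S \<psi> R e \<rho> M y" "e' \<le> e" "\<rho>' \<le> \<rho>" "M \<le> M'"
  shows "marked S \<psi> R e' \<rho>' M' y"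
  using assms unfolding marked_def by (meson order_trans)

text \<open>All that the marking argument needs of the functions: flags have at most K members, and
  smallness on a set of relative measure \<delta> propagates to the interval with factor
  \<open>C \<delta>\<close>. Lattices do not enter, so the induction stays abstract.\<close>

definition good_family ::
    "nat \<Rightarrow> (real \<Rightarrow> real) \<Rightarrow> 's set \<Rightarrow> ('s \<Rightarrow> real \<Rightarrow> real) \<Rightarrow> ('s \<Rightarrow> 's \<Rightarrow> bool) \<Rightarrow> bool" where
  "good_family K C S \<psi> R \<longleftrightarrow>
     symp R \<and> (\<forall>F. chain_in S R F \<longrightarrow> card F \<le> K) \<and>
     (\<forall>s\<in>S. continuous_on UNIV (\<psi> s)) \<and>
     (\<forall>s\<in>S. \<forall>a b E \<delta> m. a < b \<longrightarrow> E \<in> lmeasurable \<longrightarrow> E \<subseteq> {a..b} \<longrightarrow> 0 < \<delta> \<longrightarrow>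
        \<delta> * (b - a) \<le> measure lebesgue E \<longrightarrow> (\<forall>y\<in>E. \<psi> s y \<le> m) \<longrightarrow> (\<forall>y\<in>{a..b}. \<psi> s y \<le> C \<delta> * m))"

lemma good_familyD:
  assumes "good_family K C S \<psi> R"
  shows "R s t \<Longrightarrow> R t s" "chain_in S R F \<Longrightarrow> card F \<le> K"
    "s \<in> S \<Longrightarrow> continuous_on UNIV (\<psi> s)"
    "\<lbrakk>s \<in> S; a < b; E \<in> lmeasurable; E \<subseteq> {a..b}; 0 < \<delta>; \<delta> * (b - a) \<le> measure lebesgue E;
      \<And>y. y \<in> E \<Longrightarrow> \<psi> s y \<le> m; y \<in> {a..b}\<rbrakk> \<Longrightarrow> \<psi> s y \<le> C \<delta> * m"
  using assms unfolding good_family_def symp_def by (blast, blast, blast, metis)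

lemma lmeasurable_Int_compact:
  fixes T :: "real set"
  assumes "T \<in> sets lebesgue" "compact B"
  shows "T \<inter> B \<in> lmeasurable"
  using fmeasurable_Int_fmeasurable[OF lmeasurable_compact[OF assms(2)] assms(1)]
  by (simp add: Int_commute)

text \<open>Vitali: the balls around points of U - T have a countable disjoint subfamily whose
  fivefold enlargements still cover. An enlarged interval has length 10 r against at least c r of T
  in the original one, hence the factor c / 10.\<close>

lemma measure_ge_of_local:
  fixes T U :: "real set"
  assumes T: "T \<in> sets lebesgue" and U: "U \<in> sets lebesgue" "U \<subseteq> {a..b}"
    and c: "c > 0"
    and loc: "\<And>y. y \<in> U - T \<Longrightarrow> \<exists>r>0. cball y r \<subseteq> {a..b} \<and> c * r \<le> measure lebesgue (T \<inter> cball y r)"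
  shows "c / 10 * measure lebesgue (U - T) \<le> measure lebesgue (T \<inter> {a..b})"
proof -
  define r where "r y = (SOME r. r > 0 \<and> cball y r \<subseteq> {a..b} \<and> c * r \<le> measure lebesgue (T \<inter> cball y r))" for y
  have r: "r y > 0" "cball y (r y) \<subseteq> {a..b}" "c * r y \<le> measure lebesgue (T \<inter> cball y (r y))"
    if "y \<in> U - T" for y
    using someI_ex[OF loc[OF that]] unfolding r_def[symmetric] by auto
  have rB: "0 < r y \<and> r y \<le> b - a" if "y \<in> U - T" for y
  proof -
    have "y \<in> cball y (r y)" "y + r y \<in> cball y (r y)" using r(1)[OF that] by (auto simp: dist_real_def)
    hence "y \<in> {a..b}" "y + r y \<in> {a..b}" using r(2)[OF that] by blast+
    thus ?thesis using r(1)[OF that] by auto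
  qed
  have cov: "U - T \<subseteq> (\<Union>i\<in>U-T. cball i (r i))"
    using r(1) by (force simp: less_imp_le)
  obtain D where D: "countable D" "D \<subseteq> U - T"
     "pairwise (\<lambda>i j. disjnt (cball i (r i)) (cball j (r j))) D"
     "U - T \<subseteq> (\<Union>i\<in>D. cball i (5 * r i))"
    using Vitali_covering_lemma_cballs[OF cov rB] by auto
  \<comment> \<open>The selected centres are numbered by naturals, with empty sets at the remaining
    numbers, so that countable additivity and subadditivity apply to sequences.\<close>
  define I where "I = to_nat_on D ` D"
  define g where "g = inv_into D (to_nat_on D)"
  have inj: "inj_on (to_nat_on D) D" using D(1) by (rule inj_on_to_nat_on)
  have gD: "g i \<in> D" if "i \<in> I" for i using that unfolding g_def I_def by (simp add: inv_into_into)
  have ginj: "i = j" if "i \<in> I" "j \<in> I" "g i = g j" for i j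
    using that unfolding g_def I_def by (metis inv_into_injective)
  have gsurj: "\<exists>i\<in>I. g i = y" if "y \<in> D" for y
    using that inj unfolding g_def I_def by (intro bexI[of _ "to_nat_on D y"]) auto
  define A where "A i = (if i \<in> I then cball (g i) (5 * r (g i)) else {})" for i
  define B where "B i = (if i \<in> I then T \<inter> cball (g i) (r (g i)) else {})" for i
  have Bm: "B i \<in> sets lebesgue" for i unfolding B_def using T by auto
  have disB: "disjoint_family B"
    unfolding disjoint_family_on_def
  proof (intro ballI impI)
    fix i j :: nat assume "i \<noteq> j"
    show "B i \<inter> B j = {}"
    proof (cases "i \<in> I \<and> j \<in> I")
      case True
      hence "g i \<noteq> g j" using ginj \<open>i \<noteq> j\<close> by blast
      hence "disjnt (cball (g i) (r (g i))) (cball (g j) (r (g j)))"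
        using D(3) gD True unfolding pairwise_def by blast
      thus ?thesis unfolding B_def disjnt_def by auto
    qed (auto simp: B_def)
  qed
  have Tab: "T \<inter> {a..b} \<in> lmeasurable" using lmeasurable_Int_compact[OF T, of "{a..b}"] by simp
  have "B i \<subseteq> T \<inter> {a..b}" for i
    unfolding B_def using gD[of i] r(2)[of "g i"] D(2) by auto
  hence sub: "(\<Union>i. B i) \<subseteq> T \<inter> {a..b}" by blast
  have AB: "ennreal (c / 10) * emeasure lebesgue (A i) \<le> emeasure lebesgue (B i)" for i
  proof (cases "i \<in> I")
    case True
    hence gi: "g i \<in> U - T" using gD D(2) by blast
    have "emeasure lebesgue (A i) = ennreal (10 * r (g i))"
      using True r(1)[OF gi] unfolding A_def by (simp add: cball_eq_atLeastAtMost)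
    hence "ennreal (c / 10) * emeasure lebesgue (A i) = ennreal (c * r (g i))"
      using c r(1)[OF gi] by (simp add: ennreal_mult[symmetric])
    also have "\<dots> \<le> ennreal (measure lebesgue (B i))"
      using r(3)[OF gi] True by (intro ennreal_leI) (simp add: B_def)
    also have "\<dots> = emeasure lebesgue (B i)"
    proof -
      have "B i \<in> lmeasurable" unfolding B_def using lmeasurable_Int_compact[OF T, of "cball (g i) (r (g i))"]
        by simp
      thus ?thesis by (metis emeasure_eq_measure2)
    qed
    finally show ?thesis .
  qed (auto simp: A_def)
  have UT: "U - T \<subseteq> (\<Union>i. A i)"
  proof
    fix y assume "y \<in> U - T"
    then obtain d where "d \<in> D" "y \<in> cball d (5 * r d)" using D(4) by auto
    moreover then obtain i where "i \<in> I" "g i = d" using gsurj by auto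
    ultimately show "y \<in> (\<Union>i. A i)" unfolding A_def by (intro UN_I[of i]) auto
  qed
  have UTm: "U - T \<in> lmeasurable"
  proof -
    have "(U - T) \<inter> {a..b} \<in> lmeasurable" using U T by (intro lmeasurable_Int_compact) auto
    moreover have "(U - T) \<inter> {a..b} = U - T" using U by auto
    ultimately show ?thesis by simp
  qed
  have "ennreal (c / 10) * emeasure lebesgue (U - T) \<le> ennreal (c / 10) * (\<Sum>i. emeasure lebesgue (A i))"
  proof (intro mult_left_mono)
    have "emeasure lebesgue (U - T) \<le> emeasure lebesgue (\<Union>i. A i)"
      using UT by (intro emeasure_mono) (auto simp: A_def)
    also have "\<dots> \<le> (\<Sum>i. emeasure lebesgue (A i))"
      by (intro emeasure_subadditive_countably) (auto simp: A_def)
    finally show "emeasure lebesgue (U - T) \<le> (\<Sum>i. emeasure lebesgue (A i))" .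
  qed auto
  also have "\<dots> = (\<Sum>i. ennreal (c / 10) * emeasure lebesgue (A i))" by simp
  also have "\<dots> \<le> (\<Sum>i. emeasure lebesgue (B i))"
    by (intro suminf_le AB) auto
  also have "\<dots> = emeasure lebesgue (\<Union>i. B i)"
    using Bm disB by (intro suminf_emeasure) auto
  also have "\<dots> \<le> emeasure lebesgue (T \<inter> {a..b})"
    using sub T by (intro emeasure_mono) auto
  also have "\<dots> = ennreal (measure lebesgue (T \<inter> {a..b}))"
    using Tab by (metis emeasure_eq_measure2)
  finally have "ennreal (c / 10) * ennreal (measure lebesgue (U - T)) \<le> ennreal (measure lebesgue (T \<inter> {a..b}))"
    using emeasure_eq_measure2[OF UTm] by simp
  thus ?thesis using c by (simp add: ennreal_mult[symmetric] ennreal_le_iff)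
qed

text \<open>One extension of the flag F. A point y of U - T is not marked by F, so some function
  compatible with F is small at y. Take a nearly maximal ball on which such a function s stays at
  most \<rho>1, and double it: there every compatible function reaches \<rho>1 somewhere, so
  \<open>insert s F\<close> meets the hypotheses of the next stage, and Vitali adds up what that
  stage yields.\<close>

lemma nondivergence_step:
  fixes C :: "real \<Rightarrow> real"
  assumes C1: "\<And>\<delta>. \<delta> > 0 \<Longrightarrow> 1 \<le> C \<delta>"
    and gf: "good_family K C S \<psi> R"
    and ab: "a < b" and ch: "chain_in S R F"
    and pos: "0 < e0" "0 < \<rho>0"
    and up: "\<And>s y. s \<in> F \<Longrightarrow> y \<in> {a..b} \<Longrightarrow> \<psi> s y \<le> M0"
    and lo: "\<And>s. s \<in> F \<Longrightarrow> \<exists>y\<in>{a..b}. e0 \<le> \<psi> s y"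
    and oth: "\<And>s. s \<in> S - F \<Longrightarrow> (\<And>t. t \<in> F \<Longrightarrow> R s t) \<Longrightarrow> \<exists>y\<in>{a..b}. \<rho>0 \<le> \<psi> s y"
    and e1: "e1 = e0 / (2 * C (1 / (4 * (real K + 1))))"
    and \<rho>1: "\<rho>1 = \<rho>0 / (2 * C (1 / 4))"
    and M1: "M1 = max M0 (C (1 / 2) * \<rho>1)"
    and e: "e \<le> e1" and \<rho>: "\<rho> \<le> \<rho>1" and M: "M0 \<le> M"
    and T: "T \<in> sets lebesgue" "\<And>y. y \<in> {a..b} \<Longrightarrow> marked S \<psi> R e \<rho> M y \<Longrightarrow> y \<in> T"
    and c': "c' > 0"
    and IH: "\<And>a' b' s. \<lbrakk>a' < b'; {a'..b'} \<subseteq> {a..b}; s \<in> S - F; chain_in S R (insert s F);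
         \<And>t y. t \<in> insert s F \<Longrightarrow> y \<in> {a'..b'} \<Longrightarrow> \<psi> t y \<le> M1;
         \<And>t. t \<in> insert s F \<Longrightarrow> \<exists>y\<in>{a'..b'}. min e1 \<rho>1 \<le> \<psi> t y;
         \<And>t. t \<in> S - insert s F \<Longrightarrow> (\<And>u. u \<in> insert s F \<Longrightarrow> R t u) \<Longrightarrow> \<exists>y\<in>{a'..b'}. \<rho>1 \<le> \<psi> t y\<rbrakk>
       \<Longrightarrow> c' * (b' - a') \<le> measure lebesgue (T \<inter> {a'..b'})"
  shows "min (1 / 8) (c' / 40) * (b - a) \<le> measure lebesgue (T \<inter> {a..b})"
proof -
  note gfD = good_familyD[OF gf]
  define \<delta> where "\<delta> = 1 / (4 * (real K + 1))"
  have \<delta>: "\<delta> > 0" by (simp add: \<delta>_def)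
  have Cpos: "C t > 0" if "t > 0" for t using C1[OF that] by linarith
  have e1p: "e1 > 0" using pos Cpos[OF \<delta>] unfolding e1 \<delta>_def by simp
  have \<rho>1p: "\<rho>1 > 0" using pos Cpos[of "1/4"] unfolding \<rho>1 by simp
  have finF: "finite F" and FS: "F \<subseteq> S" and pwF: "pairwise R F" using ch by (auto simp: chain_in_def)
  have cardF: "card F \<le> K" using gfD(2)[OF ch] .
  define E where "E s = {y \<in> {a..b}. \<psi> s y \<le> e1}" for s
  have Ecl: "closed (E s)" if "s \<in> F" for s
  proof -
    have "continuous_on {a..b} (\<psi> s)" using gfD(3)[of s] FS that continuous_on_subset by blast
    thus ?thesis unfolding E_def by (intro continuous_on_closed_Collect_le) auto
  qed
  have Em: "E s \<in> lmeasurable" if "s \<in> F" for s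
    using Ecl[OF that] by (intro lmeasurable_compact) (auto simp: compact_eq_bounded_closed E_def intro: bounded_subset[of "{a..b}"])
  have Esmall: "measure lebesgue (E s) \<le> \<delta> * (b - a)" if sF: "s \<in> F" for s
  proof (rule ccontr)
    assume "\<not> ?thesis"
    hence big: "\<delta> * (b - a) \<le> measure lebesgue (E s)" by simp
    obtain y where y: "y \<in> {a..b}" "e0 \<le> \<psi> s y" using lo[OF sF] by auto
    have "\<psi> s y \<le> C \<delta> * e1"
      by (rule gfD(4)[of s a b "E s"]) (use sF FS ab Em[OF sF] \<delta> big y in \<open>auto simp: E_def\<close>)
    also have "\<dots> < e0" using pos Cpos[OF \<delta>] unfolding e1 \<delta>_def by simp
    finally show False using y by simp
  qed
  \<comment> \<open>The quarter margins leave room for the doubled balls, whose radius is at most (b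
    - a) / 4. The sets \<open>E s\<close> remove at most another (b - a) / 4 from this middle half,
    so U keeps at least a quarter of the interval.\<close>
  define mid where "mid = {a + (b - a) / 4 .. b - (b - a) / 4}"
  define U where "U = mid - (\<Union>s\<in>F. E s)"
  have UnE: "(\<Union>s\<in>F. E s) \<in> lmeasurable" using finF Em by auto
  have Um: "U \<in> lmeasurable" unfolding U_def mid_def using UnE by (intro fmeasurable_Diff) (auto simp: fmeasurableD)
  have Usub: "U \<subseteq> {a..b}" using ab by (auto simp: U_def mid_def field_simps)
  have "measure lebesgue (\<Union>s\<in>F. E s) \<le> (\<Sum>s\<in>F. measure lebesgue (E s))"
    using finF Em by (intro measure_UNION_le) (auto simp: fmeasurableD)
  also have "\<dots> \<le> (\<Sum>s\<in>F. \<delta> * (b - a))" by (intro sum_mono Esmall)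
  also have "\<dots> = real (card F) * (\<delta> * (b - a))" by simp
  also have "\<dots> \<le> (real K + 1) * (\<delta> * (b - a))" using cardF \<delta> ab by (intro mult_right_mono) auto
  also have "\<dots> = (b - a) / 4"
  proof -
    have "(real K + 1) * \<delta> = 1 / 4" unfolding \<delta>_def using of_nat_0_le_iff[of K] by (simp add: divide_simps)
    thus ?thesis by (simp add: mult.assoc[symmetric])
  qed
  finally have Esum: "measure lebesgue (\<Union>s\<in>F. E s) \<le> (b - a) / 4" .
  have "measure lebesgue mid = (b - a) / 2"
    using ab by (simp add: mid_def field_simps)
  moreover have "measure lebesgue mid \<le> measure lebesgue U + measure lebesgue (\<Union>s\<in>F. E s)"
  proof -
    have "measure lebesgue mid \<le> measure lebesgue (U \<union> (\<Union>s\<in>F. E s))"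
      using Um UnE by (intro measure_mono_fmeasurable) (auto simp: U_def mid_def)
    also have "\<dots> \<le> measure lebesgue U + measure lebesgue (\<Union>s\<in>F. E s)"
      using Um UnE by (intro measure_Un_le) (auto simp: fmeasurableD)
    finally show ?thesis .
  qed
  ultimately have Ubig: "(b - a) / 4 \<le> measure lebesgue U" using Esum by linarith
  have loc: "\<exists>r>0. cball y r \<subseteq> {a..b} \<and> 2 * c' * r \<le> measure lebesgue (T \<inter> cball y r)"
    if y: "y \<in> U - T" for y
  proof -
    have yab: "y \<in> {a..b}" using y Usub by auto
    have ymid: "a + (b - a) / 4 \<le> y" "y \<le> b - (b - a) / 4" using y by (auto simp: U_def mid_def)
    have ye: "e1 < \<psi> s y" if "s \<in> F" for s using y that yab by (auto simp: U_def E_def)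
    define P where "P = {s \<in> S - F. \<forall>t\<in>F. R s t}"
    have "\<not> marked S \<psi> R e \<rho> M y" using T(2)[OF yab] y by auto
    hence "\<not> ((\<forall>s\<in>F. e \<le> \<psi> s y \<and> \<psi> s y \<le> M) \<and> (\<forall>s\<in>S - F. (\<forall>t\<in>F. R s t) \<longrightarrow> \<rho> \<le> \<psi> s y))"
      unfolding marked_def using ch by blast
    moreover have "\<forall>s\<in>F. e \<le> \<psi> s y \<and> \<psi> s y \<le> M" using ye e up[OF _ yab] M by fastforce
    ultimately obtain s0 where s0: "s0 \<in> P" "\<psi> s0 y < \<rho>1" using \<rho> unfolding P_def by fastforce
    \<comment> \<open>Radii on which some compatible function stays at most \<rho>1. They are
      bounded by (b - a) / 8: beyond that the function would be small on a quarter of the interval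
      and hence, by the choice of \<rho>1, below \<rho>0 everywhere.\<close>
    define Rad where "Rad = {r. 0 < r \<and> (\<exists>s\<in>P. \<forall>z\<in>cball y r. \<psi> s z \<le> \<rho>1)}"
    have RadU: "r \<le> (b - a) / 8" if "r \<in> Rad" for r
    proof (rule ccontr)
      assume r: "\<not> r \<le> (b - a) / 8"
      obtain s where s: "s \<in> P" "\<forall>z\<in>cball y r. \<psi> s z \<le> \<rho>1" using \<open>r \<in> Rad\<close> by (auto simp: Rad_def)
      obtain z where z: "z \<in> {a..b}" "\<rho>0 \<le> \<psi> s z" using oth[of s] s(1) by (auto simp: P_def)
      have "\<psi> s z \<le> C (1/4) * \<rho>1"
      proof (rule gfD(4)[of s a b "cball y ((b - a) / 8)"])
        show "cball y ((b - a) / 8) \<subseteq> {a..b}" using ymid ab by (auto simp: cball_eq_atLeastAtMost field_simps)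
        show "1 / 4 * (b - a) \<le> measure lebesgue (cball y ((b - a) / 8))"
          using ab by (simp add: cball_eq_atLeastAtMost)
        show "\<psi> s x \<le> \<rho>1" if "x \<in> cball y ((b - a) / 8)" for x
          using s(2) that r by auto
      qed (use s ab z in \<open>auto simp: P_def\<close>)
      also have "\<dots> < \<rho>0" using pos Cpos[of "1/4"] unfolding \<rho>1 by simp
      finally show False using z by simp
    qed
    have Radne: "Rad \<noteq> {}"
    proof -
      have "continuous (at y) (\<psi> s0)" using gfD(3)[of s0] s0(1)
        by (auto simp: P_def continuous_on_eq_continuous_within)
      hence "\<forall>\<^sub>F z in nhds y. \<psi> s0 z < \<rho>1"
        using s0(2) by (simp add: continuous_at_imp_continuous_at_within isCont_def tendsto_at_iff_tendsto_nhds order_tendstoD(2))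
      then obtain d where d: "d > 0" "\<And>z. dist z y < d \<Longrightarrow> \<psi> s0 z < \<rho>1" by (auto simp: eventually_nhds_metric)
      hence "d / 2 \<in> Rad" using s0(1) unfolding Rad_def
        by (auto intro!: bexI[of _ s0] less_imp_le simp: dist_commute)
      thus ?thesis by auto
    qed
    have bdd: "bdd_above Rad" using RadU by (rule bdd_aboveI)
    have Suppos: "Sup Rad > 0"
    proof -
      obtain x where "x \<in> Rad" using Radne by auto
      thus ?thesis using cSup_upper[OF _ bdd, of x] by (auto simp: Rad_def)
    qed
    obtain r where r: "r \<in> Rad" "Sup Rad / 2 < r"
      using less_cSup_iff[OF Radne bdd, of "Sup Rad / 2"] Suppos by auto
    have r0: "r > 0" using r(1) by (simp add: Rad_def)
    \<comment> \<open>As 2 r exceeds the supremum, no compatible function stays at most \<rho>1 on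
      the doubled ball. The chosen s does so on the ball of radius r, which is half of it, so
      \<open>C (1 / 2) * \<rho>1\<close> bounds s on the doubled ball.\<close>
    have r2: "2 * r \<notin> Rad" using cSup_upper[OF _ bdd, of "2 * r"] r(2) by auto
    obtain s where s: "s \<in> P" "\<And>z. z \<in> cball y r \<Longrightarrow> \<psi> s z \<le> \<rho>1" using r(1) by (auto simp: Rad_def)
    have cb: "cball y (2 * r) = {y - 2 * r .. y + 2 * r}" by (simp add: cball_eq_atLeastAtMost)
    have sub: "cball y (2 * r) \<subseteq> {a..b}"
      unfolding cb using RadU[OF r(1)] ymid ab by (auto simp: field_simps)
    have exc: "\<exists>z\<in>{y - 2 * r .. y + 2 * r}. \<rho>1 \<le> \<psi> t z" if "t \<in> P" for t
      using r2 r0 that unfolding Rad_def cb[symmetric] by force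
    have "c' * ((y + 2 * r) - (y - 2 * r)) \<le> measure lebesgue (T \<inter> {y - 2 * r .. y + 2 * r})"
    proof (rule IH[of _ _ s])
      show "y - 2 * r < y + 2 * r" using r0 by simp
      show "{y - 2 * r .. y + 2 * r} \<subseteq> {a..b}" using sub cb by simp
      show "s \<in> S - F" using s(1) by (simp add: P_def)
      show "chain_in S R (insert s F)"
        using ch s(1) gfD(1) unfolding chain_in_def P_def by (auto simp: pairwise_insert)
    next
      fix t z assume tz: "t \<in> insert s F" "z \<in> {y - 2 * r .. y + 2 * r}"
      show "\<psi> t z \<le> M1"
      proof (cases "t = s")
        case True
        have "\<psi> s z \<le> C (1 / 2) * \<rho>1"
          by (rule gfD(4)[of s "y - 2 * r" "y + 2 * r" "cball y r"])
             (use s r0 tz in \<open>auto simp: P_def cball_eq_atLeastAtMost\<close>)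
        thus ?thesis using True by (simp add: M1)
      next
        case False
        hence "\<psi> t z \<le> M0" using tz up sub cb by auto
        thus ?thesis by (simp add: M1)
      qed
    next
      fix t assume t: "t \<in> insert s F"
      show "\<exists>z\<in>{y - 2 * r .. y + 2 * r}. min e1 \<rho>1 \<le> \<psi> t z"
      proof (cases "t = s")
        case True
        thus ?thesis using exc[OF s(1)] by force
      next
        case False
        thus ?thesis using ye[of t] t r0 by (intro bexI[of _ y]) auto
      qed
    next
      fix t assume "t \<in> S - insert s F" "\<And>u. u \<in> insert s F \<Longrightarrow> R t u"
      thus "\<exists>z\<in>{y - 2 * r .. y + 2 * r}. \<rho>1 \<le> \<psi> t z" by (intro exc) (auto simp: P_def)
    qed
    thus ?thesis using r0 sub cb by (intro exI[of _ "2 * r"]) (auto simp: algebra_simps)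
  qed
  have A: "2 * c' / 10 * measure lebesgue (U - T) \<le> measure lebesgue (T \<inter> {a..b})"
    by (rule measure_ge_of_local[OF T(1) _ Usub _ loc]) (use Um c' in \<open>auto simp: fmeasurableD\<close>)
  have Tab: "T \<inter> {a..b} \<in> lmeasurable" using lmeasurable_Int_compact[OF T(1), of "{a..b}"] by simp
  have B: "measure lebesgue (U \<inter> T) \<le> measure lebesgue (T \<inter> {a..b})"
    using Usub Um T Tab by (intro measure_mono_fmeasurable) (auto simp: fmeasurableD)
  have "measure lebesgue U \<le> measure lebesgue (U \<inter> T) + measure lebesgue (U - T)"
  proof -
    have "measure lebesgue ((U \<inter> T) \<union> (U - T)) \<le> measure lebesgue (U \<inter> T) + measure lebesgue (U - T)"
      using Um T by (intro measure_Un_le) (auto simp: fmeasurableD)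
    thus ?thesis by (simp add: Int_Diff_Un)
  qed
  \<comment> \<open>Either T fills an eighth of the interval inside U, or U - T has that much
    measure and the covering estimate applies: 2 c' / 10 times 1 / 8 is c' / 40.\<close>
  hence "(b - a) / 8 \<le> measure lebesgue (U \<inter> T) \<or> (b - a) / 8 \<le> measure lebesgue (U - T)"
    using Ubig by linarith
  thus ?thesis
  proof
    assume "(b - a) / 8 \<le> measure lebesgue (U \<inter> T)"
    hence "1 / 8 * (b - a) \<le> measure lebesgue (T \<inter> {a..b})" using B by simp
    moreover have "min (1 / 8) (c' / 40) * (b - a) \<le> 1 / 8 * (b - a)" using ab by (intro mult_right_mono) auto
    ultimately show ?thesis by linarith
  next
    assume h: "(b - a) / 8 \<le> measure lebesgue (U - T)"
    have "c' / 40 * (b - a) = 2 * c' / 10 * ((b - a) / 8)" by simp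
    also have "\<dots> \<le> 2 * c' / 10 * measure lebesgue (U - T)" using h c' by (intro mult_left_mono) auto
    finally have "c' / 40 * (b - a) \<le> measure lebesgue (T \<inter> {a..b})" using A by linarith
    moreover have "min (1 / 8) (c' / 40) * (b - a) \<le> c' / 40 * (b - a)" using ab by (intro mult_right_mono) auto
    ultimately show ?thesis by linarith
  qed
qed

text \<open>Induction on m = K + 1 - card F, the room left for extending the flag; for m = 0 the
  bound on the size of flags makes the claim vacuous. The constants come before S and \<psi>, and
  e0, \<rho>0, M0 are general, because each stage passes worse values to the next.\<close>

lemma nondivergence_induction:
  fixes C :: "real \<Rightarrow> real"
  assumes C1: "\<And>\<delta>. \<delta> > 0 \<Longrightarrow> 1 \<le> C \<delta>" and pos: "0 < e0" "0 < \<rho>0" "0 < M0"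
  shows "\<exists>e \<rho> M c. 0 < e \<and> 0 < \<rho> \<and> 0 < M \<and> 0 < c \<and>
    (\<forall>(S :: 's set) \<psi> R F a b T.
       good_family K C S \<psi> R \<and> a < b \<and> chain_in S R F \<and> card F + m = K + 1 \<and>
       (\<forall>s\<in>F. (\<forall>y\<in>{a..b}. \<psi> s y \<le> M0) \<and> (\<exists>y\<in>{a..b}. e0 \<le> \<psi> s y)) \<and>
       (\<forall>s\<in>S - F. (\<forall>t\<in>F. R s t) \<longrightarrow> (\<exists>y\<in>{a..b}. \<rho>0 \<le> \<psi> s y)) \<and>
       T \<in> sets lebesgue \<and> (\<forall>y\<in>{a..b}. marked S \<psi> R e \<rho> M y \<longrightarrow> y \<in> T)
       \<longrightarrow> c * (b - a) \<le> measure lebesgue (T \<inter> {a..b}))"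
  using pos
proof (induction m arbitrary: e0 \<rho>0 M0)
  case 0
  show ?case
    by (rule exI[of _ 1], rule exI[of _ 1], rule exI[of _ 1], rule exI[of _ 1])
       (auto dest!: good_familyD(2))
next
  case (Suc m)
  define e1 where "e1 = e0 / (2 * C (1 / (4 * (real K + 1))))"
  define \<rho>1 where "\<rho>1 = \<rho>0 / (2 * C (1 / 4))"
  define M1 where "M1 = max M0 (C (1 / 2) * \<rho>1)"
  have Cpos: "C t > 0" if "t > 0" for t using C1[OF that] by linarith
  have e1p: "e1 > 0" unfolding e1_def using Suc.prems Cpos by simp
  have \<rho>1p: "\<rho>1 > 0" unfolding \<rho>1_def using Suc.prems Cpos by simp
  have M1p: "M1 > 0" unfolding M1_def using Suc.prems by auto
  have "0 < min e1 \<rho>1" using e1p \<rho>1p by simp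
  from Suc.IH[OF this \<rho>1p M1p] show ?case
  proof (elim exE)
  fix e' \<rho>' M' c'
  assume IH0: "0 < e' \<and> 0 < \<rho>' \<and> 0 < M' \<and> 0 < c' \<and>
    (\<forall>(S :: 's set) \<psi> R F a b T.
       good_family K C S \<psi> R \<and> a < b \<and> chain_in S R F \<and> card F + m = K + 1 \<and>
       (\<forall>s\<in>F. (\<forall>y\<in>{a..b}. \<psi> s y \<le> M1) \<and> (\<exists>y\<in>{a..b}. min e1 \<rho>1 \<le> \<psi> s y)) \<and>
       (\<forall>s\<in>S - F. (\<forall>t\<in>F. R s t) \<longrightarrow> (\<exists>y\<in>{a..b}. \<rho>1 \<le> \<psi> s y)) \<and>
       T \<in> sets lebesgue \<and> (\<forall>y\<in>{a..b}. marked S \<psi> R e' \<rho>' M' y \<longrightarrow> y \<in> T)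
       \<longrightarrow> c' * (b - a) \<le> measure lebesgue (T \<inter> {a..b}))"
  note pp = IH0[THEN conjunct1] IH0[THEN conjunct2, THEN conjunct1]
    IH0[THEN conjunct2, THEN conjunct2, THEN conjunct1]
    IH0[THEN conjunct2, THEN conjunct2, THEN conjunct2, THEN conjunct1]
  note IH1 = IH0[THEN conjunct2, THEN conjunct2, THEN conjunct2, THEN conjunct2]
  define e where "e = min e' e1"
  define \<rho> where "\<rho> = min \<rho>' \<rho>1"
  define M where "M = max M' M0"
  have main: "min (1 / 8) (c' / 40) * (b - a) \<le> measure lebesgue (T \<inter> {a..b})"
    if H: "good_family K C (S :: 's set) \<psi> R" "a < b" "chain_in S R F" "card F + Suc m = K + 1"
       "\<forall>s\<in>F. (\<forall>y\<in>{a..b}. \<psi> s y \<le> M0) \<and> (\<exists>y\<in>{a..b}. e0 \<le> \<psi> s y)"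
       "\<forall>s\<in>S - F. (\<forall>t\<in>F. R s t) \<longrightarrow> (\<exists>y\<in>{a..b}. \<rho>0 \<le> \<psi> s y)"
       "T \<in> sets lebesgue" "\<forall>y\<in>{a..b}. marked S \<psi> R e \<rho> M y \<longrightarrow> y \<in> T"
    for S \<psi> R F a b T
  proof (rule nondivergence_step[OF C1 H(1-3), of e0 \<rho>0 M0 e1 \<rho>1 M1 e \<rho> M T c'])
    fix a' b' s
    assume A: "a' < b'" "{a'..b'} \<subseteq> {a..b}" "s \<in> S - F" "chain_in S R (insert s F)"
         "\<And>t y. t \<in> insert s F \<Longrightarrow> y \<in> {a'..b'} \<Longrightarrow> \<psi> t y \<le> M1"
         "\<And>t. t \<in> insert s F \<Longrightarrow> \<exists>y\<in>{a'..b'}. min e1 \<rho>1 \<le> \<psi> t y"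
         "\<And>t. t \<in> S - insert s F \<Longrightarrow> (\<And>u. u \<in> insert s F \<Longrightarrow> R t u) \<Longrightarrow> \<exists>y\<in>{a'..b'}. \<rho>1 \<le> \<psi> t y"
    have "card (insert s F) + m = K + 1"
      using A(3) H(3,4) by (simp add: chain_in_def)
    moreover have "y \<in> T" if "y \<in> {a'..b'}" "marked S \<psi> R e' \<rho>' M' y" for y
      using marked_mono[OF that(2), of e \<rho> M] H(8) that(1) A(2) by (auto simp: e_def \<rho>_def M_def)
    moreover have "\<forall>t\<in>S - insert s F. (\<forall>u\<in>insert s F. R t u) \<longrightarrow> (\<exists>y\<in>{a'..b'}. \<rho>1 \<le> \<psi> t y)"
      using A(7) by blast
    moreover have "\<forall>t\<in>insert s F. (\<forall>y\<in>{a'..b'}. \<psi> t y \<le> M1) \<and> (\<exists>y\<in>{a'..b'}. min e1 \<rho>1 \<le> \<psi> t y)"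
      using A(5,6) by blast
    ultimately show "c' * (b' - a') \<le> measure lebesgue (T \<inter> {a'..b'})"
      using A(1,4) H(1,7) IH1[THEN spec[of _ S], THEN spec[of _ \<psi>], THEN spec[of _ R],
        THEN spec[of _ "insert s F"], THEN spec[of _ a'], THEN spec[of _ b'], THEN spec[of _ T]]
      by blast
  qed (use H Suc.prems pp in \<open>auto simp: e1_def \<rho>1_def M1_def e_def \<rho>_def M_def\<close>)
  have "0 < e" "0 < \<rho>" "0 < M" "0 < min (1 / 8) (c' / 40)"
    using pp e1p \<rho>1p Suc.prems by (auto simp: e_def \<rho>_def M_def)
  thus ?case
    by (intro exI[of _ e] exI[of _ \<rho>] exI[of _ M] exI[of _ "min (1 / 8) (c' / 40)"] conjI allI impI)
       (assumption | rule main, (elim conjE, assumption)+)+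
  qed
qed

text \<open>The induction started from the empty flag, where the only requirement left is that every
  function reaches 1 on the interval. The constants depend on K and C alone, in particular not on
  the interval.\<close>

theorem nondivergence:
  fixes C :: "real \<Rightarrow> real"
  assumes C1: "\<And>\<delta>. \<delta> > 0 \<Longrightarrow> 1 \<le> C \<delta>"
  shows "\<exists>e \<rho> M c. 0 < e \<and> 0 < \<rho> \<and> 0 < M \<and> 0 < c \<and>
    (\<forall>(S :: 's set) \<psi> R a b T.
       good_family K C S \<psi> R \<longrightarrow> a < b \<longrightarrow> (\<forall>s\<in>S. \<exists>y\<in>{a..b}. 1 \<le> \<psi> s y) \<longrightarrow>
       T \<in> sets lebesgue \<longrightarrow> (\<forall>y\<in>{a..b}. marked S \<psi> R e \<rho> M y \<longrightarrow> y \<in> T)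
       \<longrightarrow> c * (b - a) \<le> measure lebesgue (T \<inter> {a..b}))"
proof -
  have one: "(0::real) < 1" by simp
  show ?thesis
  proof (rule nondivergence_induction[where C = C and K = K and m = "Suc K" and ?'s = 's, OF _ one one one, THEN exE], erule C1, elim exE)
  fix e \<rho> M c
  assume H: "0 < e \<and> 0 < \<rho> \<and> 0 < M \<and> 0 < c \<and>
    (\<forall>(S :: 's set) \<psi> R F a b T.
       good_family K C S \<psi> R \<and> a < b \<and> chain_in S R F \<and> card F + Suc K = K + 1 \<and>
       (\<forall>s\<in>F. (\<forall>y\<in>{a..b}. \<psi> s y \<le> 1) \<and> (\<exists>y\<in>{a..b}. 1 \<le> \<psi> s y)) \<and>
       (\<forall>s\<in>S - F. (\<forall>t\<in>F. R s t) \<longrightarrow> (\<exists>y\<in>{a..b}. 1 \<le> \<psi> s y)) \<and>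
       T \<in> sets lebesgue \<and> (\<forall>y\<in>{a..b}. marked S \<psi> R e \<rho> M y \<longrightarrow> y \<in> T)
       \<longrightarrow> c * (b - a) \<le> measure lebesgue (T \<inter> {a..b}))"
  have E: "chain_in S R {}" for S :: "'s set" and R by (simp add: chain_in_def)
  have "c * (b - a) \<le> measure lebesgue (T \<inter> {a..b})"
    if "good_family K C S \<psi> R" "a < b" "\<forall>s\<in>S. \<exists>y\<in>{a..b}. 1 \<le> \<psi> s y" "T \<in> sets lebesgue"
      "\<forall>y\<in>{a..b}. marked S \<psi> R e \<rho> M y \<longrightarrow> y \<in> T" for S :: "'s set" and \<psi> R a b T
    by (rule H[THEN conjunct2, THEN conjunct2, THEN conjunct2, THEN conjunct2, THEN spec[of _ S],
        THEN spec[of _ \<psi>], THEN spec[of _ R], THEN spec[of _ "{}"], THEN spec[of _ a],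
        THEN spec[of _ b], THEN spec[of _ T], THEN mp]) (use that E in simp)
  thus ?thesis
    using H by (intro exI[of _ e] exI[of _ \<rho>] exI[of _ M] exI[of _ c]) simp
  qed
qed

subsection \<open>Minors\<close>

text \<open>Plucker coordinates of the frame X, indexed by lists of columns. Lists may be unsorted
  or repeat a column; this only changes signs or yields zero, and it lets columns be deleted and
  appended freely.\<close>

definition minor :: "(nat \<Rightarrow> real) list \<Rightarrow> nat list \<Rightarrow> real" where
  "minor X J = det (mat (length X) (length X) (\<lambda>(i, j). (X ! i) (J ! j)))"

definition del_nth :: "nat \<Rightarrow> 'a list \<Rightarrow> 'a list" where
  "del_nth j J = take j J @ drop (Suc j) J"

definition col_lists :: "nat \<Rightarrow> nat \<Rightarrow> nat list set" where
  "col_lists n r = {J. set J \<subseteq> {..n} \<and> length J = r}"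

lemma finite_col_lists [simp]: "finite (col_lists n r)"
  unfolding col_lists_def by (rule finite_lists_length_eq) auto

lemma col_lists_nonempty [simp]: "col_lists n r \<noteq> {}"
  unfolding col_lists_def by (auto intro!: exI[of _ "replicate r 0"])

lemma length_del_nth: "j < length J \<Longrightarrow> length (del_nth j J) = length J - 1"
  by (simp add: del_nth_def)

lemma nth_del_nth: "j < length J \<Longrightarrow> i < length J - 1 \<Longrightarrow>
    del_nth j J ! i = J ! (if i < j then i else Suc i)"
  by (auto simp: del_nth_def nth_append min_def)

lemma del_nth_col_lists: "J \<in> col_lists n (Suc r) \<Longrightarrow> j < Suc r \<Longrightarrow> del_nth j J \<in> col_lists n r"
  using set_take_subset[of j J] set_drop_subset[of "Suc j" J]
  unfolding col_lists_def by (auto simp: length_del_nth) (auto simp: del_nth_def)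

lemma col_lists_nth: "J \<in> col_lists n r \<Longrightarrow> j < r \<Longrightarrow> J ! j \<le> n"
  unfolding col_lists_def using nth_mem by fastforce

lemma minor_expand_row:
  assumes "length J = Suc (length X + length Z)"
  shows "minor (X @ [x] @ Z) J =
    (\<Sum>j<Suc (length X + length Z). (-1) ^ (length X + j) * x (J ! j) * minor (X @ Z) (del_nth j J))"
proof -
  let ?m = "Suc (length X + length Z)" and ?r = "length X"
  let ?A = "mat ?m ?m (\<lambda>(i, j). ((X @ [x] @ Z) ! i) (J ! j))"
  have "minor (X @ [x] @ Z) J = det ?A" by (simp add: minor_def)
  also have "\<dots> = (\<Sum>j<?m. ?A $$ (?r, j) * cofactor ?A ?r j)"
    by (rule laplace_expansion_row) auto
  also have "\<dots> = (\<Sum>j<?m. (-1) ^ (?r + j) * x (J ! j) * minor (X @ Z) (del_nth j J))"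
  proof (intro sum.cong refl)
    fix j assume "j \<in> {..<?m}"
    hence j: "j < ?m" by simp
    have "mat_delete ?A ?r j = mat (length (X @ Z)) (length (X @ Z)) (\<lambda>(i, k). ((X @ Z) ! i) (del_nth j J ! k))"
      unfolding mat_delete_def
      using assms j by (intro eq_matI) (auto simp: nth_append nth_del_nth Suc_diff_le)
    thus "?A $$ (?r, j) * cofactor ?A ?r j = (-1) ^ (?r + j) * x (J ! j) * minor (X @ Z) (del_nth j J)"
      using j by (simp add: cofactor_def minor_def)
  qed
  finally show ?thesis .
qed

lemma minor_snoc:
  assumes "length J = Suc (length X)"
  shows "minor (X @ [x]) J = (\<Sum>j<Suc (length X). (-1) ^ (length X + j) * x (J ! j) * minor X (del_nth j J))"
  using minor_expand_row[of J X "[]" x] assms by simp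

lemma minor_lincomb:
  assumes J: "J \<in> col_lists n (length X)" and len: "length Y = length X"
    and Y: "\<And>i j. i < length X \<Longrightarrow> j \<le> n \<Longrightarrow> (Y ! i) j = (\<Sum>k<length X. m i k * (X ! k) j)"
  shows "minor Y J = det (mat (length X) (length X) (\<lambda>(i, k). m i k)) * minor X J"
proof -
  let ?r = "length X"
  let ?M = "mat ?r ?r (\<lambda>(i, k). m i k)" and ?X = "mat ?r ?r (\<lambda>(i, j). (X ! i) (J ! j))"
  have "mat ?r ?r (\<lambda>(i, j). (Y ! i) (J ! j)) = ?M * ?X"
    by (intro eq_matI) (auto simp: Y col_lists_nth[OF J] scalar_prod_def lessThan_atLeast0)
  hence "minor Y J = det (?M * ?X)" by (simp add: minor_def len)
  also have "\<dots> = det ?M * det ?X" by (rule det_mult) auto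
  finally show ?thesis by (simp add: minor_def)
qed

lemma minor_dup_row:
  assumes "i < k" "k < length X" "X ! i = X ! k"
  shows "minor X J = 0"
  unfolding minor_def
  by (rule det_identical_rows[of _ "length X" i k]) (use assms in \<open>auto intro!: eq_vecI\<close>)

lemma minor_dup_col:
  assumes "i < k" "k < length X" "J ! i = J ! k"
  shows "minor X J = 0"
  unfolding minor_def
  by (rule det_identical_columns[of _ "length X" i k]) (use assms in \<open>auto intro!: eq_vecI\<close>)

lemma minor_Ints:
  assumes "\<And>x j. x \<in> set X \<Longrightarrow> x j \<in> \<int>"
  shows "minor X J \<in> \<int>"
proof -
  have "(X ! i) (J ! p i) \<in> \<int>" if "i < length X" for i p
    using assms nth_mem[OF that] by blast
  moreover have "p i < length X" if "p permutes {0..<length X}" "i < length X" for p i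
    using permutes_in_image[OF that(1), of i] that(2) by auto
  ultimately show ?thesis unfolding minor_def det_def
    by (auto intro!: Ints_sum Ints_mult Ints_prod)
qed

text \<open>In the expansion along the last column the cofactors see only I, so as a function of j
  the minor is a fixed combination of the rows of X.\<close>

lemma minor_last_col:
  assumes "length I = r" "length X = Suc r"
  shows "\<exists>g. \<forall>j. minor X (I @ [j]) = (\<Sum>k<Suc r. g k * (X ! k) j)"
proof -
  let ?A = "\<lambda>j. mat (Suc r) (Suc r) (\<lambda>(i, k). (X ! i) ((I @ [j]) ! k))"
  have "minor X (I @ [j]) = (\<Sum>k<Suc r. cofactor (?A 0) k r * (X ! k) j)" for j
  proof -
    have "minor X (I @ [j]) = det (?A j)" using assms by (simp add: minor_def)
    also have "\<dots> = (\<Sum>k<Suc r. ?A j $$ (k, r) * cofactor (?A j) k r)"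
      by (rule laplace_expansion_column) auto
    also have "\<dots> = (\<Sum>k<Suc r. cofactor (?A 0) k r * (X ! k) j)"
    proof (intro sum.cong refl)
      fix k assume k: "k \<in> {..<Suc r}"
      have "mat_delete (?A j) k r = mat_delete (?A 0) k r"
        unfolding mat_delete_def using assms by (intro eq_matI) (auto simp: nth_append)
      thus "?A j $$ (k, r) * cofactor (?A j) k r = cofactor (?A 0) k r * (X ! k) j"
        using k assms by (simp add: cofactor_def nth_append)
    qed
    finally show ?thesis .
  qed
  thus ?thesis by (intro exI[of _ "\<lambda>k. cofactor (?A 0) k r"]) blast
qed

section \<open>Spans and rank in terms of minors\<close>

definition rspan :: "nat \<Rightarrow> (nat \<Rightarrow> real) list \<Rightarrow> (nat \<Rightarrow> real) set" where
  "rspan n X = {x. \<exists>c. \<forall>j\<le>n. x j = (\<Sum>k<length X. c k * (X ! k) j)}"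

definition full_rank :: "nat \<Rightarrow> (nat \<Rightarrow> real) list \<Rightarrow> bool" where
  "full_rank n X \<longleftrightarrow> (\<exists>J\<in>col_lists n (length X). minor X J \<noteq> 0)"

text \<open>If all minors bordered by x vanish, expanding those on \<open>J0 @ [j]\<close> along the
  row x solves for x j as in Cramer's rule, with denominator \<open>minor X J0\<close>; the other
  minors in the expansion are combinations of the entries \<open>(X ! k) j\<close>.\<close>

lemma not_in_rspan_imp_full_rank:
  assumes "full_rank n X" "x \<notin> rspan n X"
  shows "full_rank n (X @ [x])"
proof (rule ccontr)
  assume "\<not> full_rank n (X @ [x])"
  hence z: "minor (X @ [x]) J = 0" if "J \<in> col_lists n (Suc (length X))" for J
    using that unfolding full_rank_def by auto
  obtain J0 where J0: "J0 \<in> col_lists n (length X)" "minor X J0 \<noteq> 0" using assms(1) by (auto simp: full_rank_def)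
  let ?r = "length X"
  have lJ: "length J0 = ?r" using J0 by (simp add: col_lists_def)
  have "\<exists>g. \<forall>j. minor X (del_nth t J0 @ [j]) = (\<Sum>k<?r. g k * (X ! k) j)" if "t < ?r" for t
    using minor_last_col[of "del_nth t J0" "?r - 1" X] that lJ by (simp add: length_del_nth)
  then obtain g where g: "\<And>t j. t < ?r \<Longrightarrow> minor X (del_nth t J0 @ [j]) = (\<Sum>k<?r. g t k * (X ! k) j)"
    by metis
  have "x j = (\<Sum>k<?r. (- (\<Sum>t<?r. (-1) ^ (?r + t) * x (J0 ! t) * g t k) / minor X J0) * (X ! k) j)"
    if j: "j \<le> n" for j
  proof -
    have "0 = minor (X @ [x]) (J0 @ [j])" using z[of "J0 @ [j]"] J0 j by (auto simp: col_lists_def)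
    also have "\<dots> = (\<Sum>t<?r. (-1) ^ (?r + t) * x ((J0 @ [j]) ! t) * minor X (del_nth t (J0 @ [j])))
        + x j * minor X (del_nth ?r (J0 @ [j]))"
      using minor_snoc[of "J0 @ [j]" X x] lJ by (simp add: nth_append)
    also have "del_nth ?r (J0 @ [j]) = J0" using lJ by (simp add: del_nth_def)
    also have "(\<Sum>t<?r. (-1) ^ (?r + t) * x ((J0 @ [j]) ! t) * minor X (del_nth t (J0 @ [j])))
        = (\<Sum>t<?r. (-1) ^ (?r + t) * x (J0 ! t) * (\<Sum>k<?r. g t k * (X ! k) j))"
    proof (intro sum.cong refl)
      fix t assume "t \<in> {..<?r}"
      hence t: "t < ?r" by simp
      have "del_nth t (J0 @ [j]) = del_nth t J0 @ [j]" using t lJ by (simp add: del_nth_def)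
      thus "(-1) ^ (?r + t) * x ((J0 @ [j]) ! t) * minor X (del_nth t (J0 @ [j])) =
        (-1) ^ (?r + t) * x (J0 ! t) * (\<Sum>k<?r. g t k * (X ! k) j)"
        using g[OF t] t lJ by (simp add: nth_append)
    qed
    also have "\<dots> = (\<Sum>k<?r. (\<Sum>t<?r. (-1) ^ (?r + t) * x (J0 ! t) * g t k) * (X ! k) j)"
      by (simp add: sum_distrib_left sum_distrib_right mult.assoc) (rule sum.swap)
    finally have "x j * minor X J0 = - (\<Sum>k<?r. (\<Sum>t<?r. (-1) ^ (?r + t) * x (J0 ! t) * g t k) * (X ! k) j)"
      by linarith
    moreover have "x j = x j * minor X J0 / minor X J0" using J0(2) by simp
    ultimately have "x j = - (\<Sum>k<?r. (\<Sum>t<?r. (-1) ^ (?r + t) * x (J0 ! t) * g t k) * (X ! k) j) / minor X J0"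
      by simp
    moreover have "- (\<Sum>k<?r. S k * (X ! k) j) / minor X J0 = (\<Sum>k<?r. (- S k / minor X J0) * (X ! k) j)" for S
      by (simp add: sum_negf[symmetric] sum_divide_distrib)
    ultimately show ?thesis by simp
  qed
  hence "x \<in> rspan n X"
    unfolding rspan_def
    by (intro CollectI exI[of _ "\<lambda>k. - (\<Sum>t<?r. (-1) ^ (?r + t) * x (J0 ! t) * g t k) / minor X J0"]) blast
  thus False using assms(2) by simp
qed

lemma rspan_trans:
  assumes "x \<in> rspan n Y" "set Y \<subseteq> rspan n X"
  shows "x \<in> rspan n X"
proof -
  obtain c where c: "\<And>j. j \<le> n \<Longrightarrow> x j = (\<Sum>k<length Y. c k * (Y ! k) j)"
    using assms(1) by (auto simp: rspan_def)
  have "\<forall>k<length Y. \<exists>d. \<forall>j\<le>n. (Y ! k) j = (\<Sum>i<length X. d i * (X ! i) j)"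
    using assms(2) by (auto simp: rspan_def subset_iff)
  then obtain d where d: "\<And>k j. k < length Y \<Longrightarrow> j \<le> n \<Longrightarrow> (Y ! k) j = (\<Sum>i<length X. d k i * (X ! i) j)"
    by metis
  have "x j = (\<Sum>i<length X. (\<Sum>k<length Y. c k * d k i) * (X ! i) j)" if "j \<le> n" for j
  proof -
    have "x j = (\<Sum>k<length Y. c k * (\<Sum>i<length X. d k i * (X ! i) j))"
      using c[OF that] d that by simp
    also have "\<dots> = (\<Sum>i<length X. (\<Sum>k<length Y. c k * d k i) * (X ! i) j)"
      by (simp add: sum_distrib_left sum_distrib_right mult.assoc) (rule sum.swap)
    finally show ?thesis .
  qed
  thus ?thesis unfolding rspan_def by (intro CollectI exI[of _ "\<lambda>i. \<Sum>k<length Y. c k * d k i"]) blast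
qed

lemma set_in_rspan: "set X \<subseteq> rspan n X"
proof
  fix x assume "x \<in> set X"
  then obtain i where i: "i < length X" "x = X ! i" by (auto simp: in_set_conv_nth)
  have "x j = (\<Sum>k<length X. (if k = i then 1 else 0) * (X ! k) j)" for j
    using i by (subst sum.cong[OF refl, of _ _ "\<lambda>k. if k = i then (X ! k) j else 0"]) (auto simp: sum.delta)
  thus "x \<in> rspan n X" unfolding rspan_def by (intro CollectI exI[of _ "\<lambda>k. if k = i then 1 else 0"]) blast
qed

lemma rspan_mono: "set Y \<subseteq> rspan n X \<Longrightarrow> rspan n Y \<subseteq> rspan n X"
  using rspan_trans by blast

lemma rspan_minor_proportional:
  assumes "set Y \<subseteq> rspan n X" "length Y = length X"
  shows "\<exists>c. \<forall>J\<in>col_lists n (length X). minor Y J = c * minor X J"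
proof -
  have "\<forall>i<length X. \<exists>d. \<forall>j\<le>n. (Y ! i) j = (\<Sum>k<length X. d k * (X ! k) j)"
  proof (intro allI impI)
    fix i assume "i < length X"
    hence "Y ! i \<in> rspan n X" using assms by (simp add: subset_iff)
    thus "\<exists>d. \<forall>j\<le>n. (Y ! i) j = (\<Sum>k<length X. d k * (X ! k) j)" by (simp add: rspan_def)
  qed
  then obtain d where d: "\<And>i j. i < length X \<Longrightarrow> j \<le> n \<Longrightarrow> (Y ! i) j = (\<Sum>k<length X. d i k * (X ! k) j)"
    by metis
  show ?thesis using minor_lincomb[OF _ assms(2) d] by blast
qed

text \<open>The minors of a longer Y would be proportional to those of X padded with zero rows, and
  these all vanish.\<close>

lemma full_rank_length_le:
  assumes Y: "full_rank n Y" "set Y \<subseteq> rspan n X"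
  shows "length Y \<le> length X"
proof (rule ccontr)
  assume "\<not> ?thesis"
  then obtain q where q: "length Y = Suc (length X + q)" by (metis less_natE not_le)
  define X' where "X' = X @ [\<lambda>_. 0] @ replicate q (\<lambda>_. 0)"
  have lX': "length X' = length Y" by (simp add: X'_def q)
  have "rspan n X \<subseteq> rspan n X'"
    by (rule rspan_mono) (use set_in_rspan[of X'] in \<open>auto simp: X'_def\<close>)
  then obtain c where c: "\<forall>J\<in>col_lists n (length X'). minor Y J = c * minor X' J"
    using rspan_minor_proportional[of Y n X'] Y(2) lX' by auto
  have "minor X' J = 0" if "J \<in> col_lists n (length X')" for J
    unfolding X'_def by (subst minor_expand_row) (use that in \<open>auto simp: X'_def col_lists_def\<close>)
  thus False using c Y(1) lX' unfolding full_rank_def by auto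
qed

lemma full_rank_length_le_Suc:
  assumes "full_rank n X"
  shows "length X \<le> Suc n"
proof (rule ccontr)
  assume "\<not> ?thesis"
  obtain J where J: "J \<in> col_lists n (length X)" "minor X J \<noteq> 0" using assms by (auto simp: full_rank_def)
  have "card (set J) \<le> Suc n" using J(1) card_mono[of "{..n}" "set J"] by (auto simp: col_lists_def)
  hence "\<not> distinct J" using J(1) \<open>\<not> length X \<le> Suc n\<close> distinct_card[of J] by (auto simp: col_lists_def)
  then obtain i k where "i < k" "k < length J" "J ! i = J ! k"
    by (metis distinct_conv_nth nat_neq_iff)
  thus False using minor_dup_col[of i k X J] J by (auto simp: col_lists_def)
qed

subsection \<open>Primitive integer frames\<close>

definition int_frame :: "nat \<Rightarrow> (nat \<Rightarrow> real) list \<Rightarrow> bool" where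
  "int_frame n X \<longleftrightarrow> (\<forall>x\<in>set X. \<forall>j. x j \<in> \<int>) \<and> full_rank n X"

text \<open>A basis of the lattice of integer points in its rational span, expressed by minimality:
  passing to another integer frame of the same span multiplies all Plucker coordinates by a factor
  of modulus at least 1.\<close>

definition primitive_frame :: "nat \<Rightarrow> (nat \<Rightarrow> real) list \<Rightarrow> bool" where
  "primitive_frame n X \<longleftrightarrow> int_frame n X \<and>
     (\<forall>Y. int_frame n Y \<longrightarrow> length Y = length X \<longrightarrow> set Y \<subseteq> rspan n X \<longrightarrow>
        (\<exists>c. 1 \<le> \<bar>c\<bar> \<and> (\<forall>J\<in>col_lists n (length X). minor Y J = c * minor X J)))"

lemma rspan_eq_of_same_length:
  assumes "full_rank n Y" "full_rank n X" "length Y = length X" "set Y \<subseteq> rspan n X"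
  shows "set X \<subseteq> rspan n Y"
proof (rule ccontr)
  assume "\<not> ?thesis"
  then obtain x where x: "x \<in> set X" "x \<notin> rspan n Y" by blast
  have "full_rank n (Y @ [x])" using not_in_rspan_imp_full_rank assms(1) x(2) by blast
  moreover have "set (Y @ [x]) \<subseteq> rspan n X" using assms(4) x(1) set_in_rspan by auto
  ultimately show False using full_rank_length_le[of n "Y @ [x]" X] assms(3) by simp
qed

text \<open>Among the integer frames of the same length in the span of X, take one whose minor at
  J0, a nonzero integer, is least in modulus. Minors of frames with the same span are proportional,
  so minimality at J0 is minimality for all column lists.\<close>

lemma exists_primitive_frame:
  assumes X: "int_frame n X"
  shows "\<exists>X'. primitive_frame n X' \<and> length X' = length X \<and> set X' \<subseteq> rspan n X \<and> set X \<subseteq> rspan n X' \<and>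
     (\<exists>c. 1 \<le> \<bar>c\<bar> \<and> (\<forall>J\<in>col_lists n (length X). minor X J = c * minor X' J))"
proof -
  obtain J0 where J0: "J0 \<in> col_lists n (length X)" "minor X J0 \<noteq> 0"
    using X by (auto simp: int_frame_def full_rank_def)
  define P where "P Y \<longleftrightarrow> int_frame n Y \<and> length Y = length X \<and> set Y \<subseteq> rspan n X" for Y
  define \<mu> where "\<mu> Y = nat \<lfloor>\<bar>minor Y J0\<bar>\<rfloor>" for Y
  have PX: "P X" using X set_in_rspan by (auto simp: P_def)
  obtain X' where X': "P X'" "\<And>Y. P Y \<Longrightarrow> \<mu> X' \<le> \<mu> Y"
    using exists_least_iff[of "\<lambda>k. \<exists>Y. P Y \<and> \<mu> Y = k"] PX by (metis leI)
  have int: "real (\<mu> Y) = \<bar>minor Y J0\<bar>" if "P Y" for Y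
  proof -
    have "\<bar>minor Y J0\<bar> \<in> \<int>" using minor_Ints[of Y J0] that by (auto simp: P_def int_frame_def)
    thus ?thesis unfolding \<mu>_def by (auto elim!: Ints_cases)
  qed
  have nz: "minor Y J0 \<noteq> 0" if "P Y" for Y
  proof -
    obtain c where c: "\<And>J. J \<in> col_lists n (length X) \<Longrightarrow> minor Y J = c * minor X J"
      using rspan_minor_proportional[of Y n X] \<open>P Y\<close> by (auto simp: P_def)
    obtain J where "J \<in> col_lists n (length X)" "minor Y J \<noteq> 0"
      using \<open>P Y\<close> by (auto simp: P_def int_frame_def full_rank_def)
    hence "c \<noteq> 0" using c by auto
    thus ?thesis using c J0 by simp
  qed
  have sub': "set X' \<subseteq> rspan n X" "length X' = length X" "int_frame n X'" using X'(1) by (auto simp: P_def)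
  have key: "\<exists>c. 1 \<le> \<bar>c\<bar> \<and> (\<forall>J\<in>col_lists n (length X'). minor Y J = c * minor X' J)"
    if Y: "int_frame n Y" "length Y = length X'" "set Y \<subseteq> rspan n X'" for Y
  proof -
    have PY: "P Y" using Y sub' rspan_mono[OF sub'(1)] by (auto simp: P_def)
    obtain c where c: "\<And>J. J \<in> col_lists n (length X') \<Longrightarrow> minor Y J = c * minor X' J"
      using rspan_minor_proportional[OF Y(3,2)] by auto
    have "\<bar>minor X' J0\<bar> \<le> \<bar>minor Y J0\<bar>" using X'(2)[OF PY] int[OF PY] int[OF X'(1)] by linarith
    also have "\<dots> = \<bar>c\<bar> * \<bar>minor X' J0\<bar>" using c[of J0] J0 sub' by (simp add: abs_mult)
    finally have "1 \<le> \<bar>c\<bar>" using nz[OF X'(1)] by simp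
    thus ?thesis using c by blast
  qed
  have XX: "set X \<subseteq> rspan n X'"
    by (rule rspan_eq_of_same_length) (use sub' X in \<open>auto simp: int_frame_def\<close>)
  have "primitive_frame n X'" unfolding primitive_frame_def using sub' key by blast
  thus ?thesis using sub' XX key[OF X] by (intro exI[of _ X']) auto
qed

subsection \<open>Nondivergence along the moment curve\<close>

definition pmax :: "real poly set \<Rightarrow> real \<Rightarrow> real" where
  "pmax P y = Max ((\<lambda>p. \<bar>poly p y\<bar>) ` P)"

lemma pmax_le_iff: "finite P \<Longrightarrow> P \<noteq> {} \<Longrightarrow> pmax P y \<le> m \<longleftrightarrow> (\<forall>p\<in>P. \<bar>poly p y\<bar> \<le> m)"
  unfolding pmax_def by (subst Max_le_iff) auto

lemma pmax_ge: "finite P \<Longrightarrow> p \<in> P \<Longrightarrow> \<bar>poly p y\<bar> \<le> pmax P y"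
  unfolding pmax_def by (intro Max_ge) auto

lemma continuous_on_pmax: "finite P \<Longrightarrow> P \<noteq> {} \<Longrightarrow> continuous_on S (pmax P)"
proof (induction P rule: finite_ne_induct)
  case (singleton p)
  show ?case unfolding pmax_def by (auto intro!: continuous_intros)
next
  case (insert p P)
  have "pmax (insert p P) = (\<lambda>y. max \<bar>poly p y\<bar> (pmax P y))"
    unfolding pmax_def using insert.hyps by (intro ext) simp
  thus ?case using insert.IH by (auto intro!: continuous_intros)
qed

lemma pmax_remez:
  assumes P: "finite P" "P \<noteq> {}" "\<And>p. p \<in> P \<Longrightarrow> degree p \<le> n"
    and ab: "a < b" and E: "E \<in> lmeasurable" "E \<subseteq> {a..b}"
    and \<delta>: "\<delta> > 0" "\<delta> * (b - a) \<le> measure lebesgue E"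
    and m: "\<And>y. y \<in> E \<Longrightarrow> pmax P y \<le> m" and y: "y \<in> {a..b}"
  shows "pmax P y \<le> remez_const n \<delta> * m"
  unfolding pmax_le_iff[OF P(1,2)]
proof
  fix p assume p: "p \<in> P"
  show "\<bar>poly p y\<bar> \<le> remez_const n \<delta> * m"
    by (rule remez_poly[OF P(3)[OF p] ab E \<delta> _ y]) (use m p P pmax_ge order_trans in blast)
qed

text \<open>Write p = c + y q with c = p(0). On [1/2, 1] the division by y is harmless and bounds q
  by 4 m; the Remez inequality carries this to [0, 1], and the induction hypothesis treats
  q.\<close>

lemma coeff_bound_unit_interval:
  "\<exists>K>0. \<forall>(p::real poly) m. degree p \<le> n \<longrightarrow> (\<forall>y\<in>{0..1}. \<bar>poly p y\<bar> \<le> m) \<longrightarrow> (\<forall>i. \<bar>poly.coeff p i\<bar> \<le> K * m)"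
proof (induction n)
  case 0
  have "\<bar>poly.coeff p i\<bar> \<le> 1 * m" if p: "degree p \<le> 0" "\<forall>y\<in>{0..1}. \<bar>poly p y\<bar> \<le> m" for p :: "real poly" and m i
  proof -
    obtain c where "p = [:c:]" using p(1) degree_eq_zeroE by auto
    moreover have "\<bar>poly p 0\<bar> \<le> m" using p(2) by auto
    ultimately show ?thesis by (cases i) auto
  qed
  thus ?case by (intro exI[of _ 1]) auto
next
  case (Suc n)
  then obtain K where K: "K > 0" "\<And>(p::real poly) m i. degree p \<le> n \<Longrightarrow> (\<forall>y\<in>{0..1}. \<bar>poly p y\<bar> \<le> m) \<Longrightarrow> \<bar>poly.coeff p i\<bar> \<le> K * m"
    by blast
  define D where "D = K * (remez_const n (1/2) * 4) + 1"
  have Dp: "D > 0" unfolding D_def using K(1) remez_const_ge_1[of "1/2" n] by (auto intro!: add_nonneg_pos mult_nonneg_nonneg)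
  have "\<bar>poly.coeff p i\<bar> \<le> D * m"
    if p: "degree p \<le> Suc n" "\<forall>y\<in>{0..1}. \<bar>poly p y\<bar> \<le> m" for p :: "real poly" and m i
  proof -
    obtain c q where pc: "p = pCons c q" by (cases p) auto
    have c: "\<bar>c\<bar> \<le> m" using p(2)[rule_format, of 0] pc by simp
    hence m0: "m \<ge> 0" by linarith
    have degq: "degree q \<le> n" using p(1) pc by (cases "q = 0") auto
    have q1: "\<bar>poly q y\<bar> \<le> 4 * m" if "y \<in> {1/2..1}" for y
    proof -
      have "\<bar>c + y * poly q y\<bar> \<le> m" using p(2)[rule_format, of y] that pc by auto
      hence "\<bar>y * poly q y\<bar> \<le> 2 * m" using c by linarith
      hence "y * \<bar>poly q y\<bar> \<le> 2 * m" using that by (simp add: abs_mult)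
      moreover have "1/2 * \<bar>poly q y\<bar> \<le> y * \<bar>poly q y\<bar>" using that by (intro mult_right_mono) auto
      ultimately show ?thesis by linarith
    qed
    have q2: "\<bar>poly q y\<bar> \<le> remez_const n (1/2) * (4 * m)" if "y \<in> {0..1}" for y
      by (rule remez_poly[OF degq, of 0 1 "{1/2..1}"]) (use that q1 in auto)
    have q3: "\<bar>poly.coeff q j\<bar> \<le> K * (remez_const n (1/2) * (4 * m))" for j
      by (rule K(2)[OF degq]) (use q2 in blast)
    show ?thesis
    proof (cases i)
      case 0
      have "1 * m \<le> D * m" unfolding D_def
        using m0 K(1) remez_const_ge_1[of "1/2" n] by (intro mult_right_mono) (auto intro!: mult_nonneg_nonneg)
      thus ?thesis using 0 pc c by simp
    next
      case (Suc j)
      have "\<bar>poly.coeff p i\<bar> \<le> K * (remez_const n (1/2) * (4 * m))" using q3[of j] Suc pc by simp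
      also have "\<dots> \<le> D * m" unfolding D_def using m0 by (simp add: algebra_simps)
      finally show ?thesis .
    qed
  qed
  thus ?case using Dp by (intro exI[of _ D]) auto
qed

lemma poly_large_somewhere:
  assumes ab: "0 \<le> a" "a < b" "b \<le> 1"
  shows "\<exists>\<kappa>>0. \<forall>p::real poly. degree p \<le> n \<longrightarrow> (\<exists>i. 1 \<le> \<bar>poly.coeff p i\<bar>) \<longrightarrow> (\<exists>y\<in>{a..b}. \<kappa> \<le> \<bar>poly p y\<bar>)"
proof -
  obtain K where K: "K > 0" "\<And>(p::real poly) m i. degree p \<le> n \<Longrightarrow> (\<forall>y\<in>{0..1}. \<bar>poly p y\<bar> \<le> m) \<Longrightarrow> \<bar>poly.coeff p i\<bar> \<le> K * m"
    using coeff_bound_unit_interval[of n] by blast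
  define R where "R = remez_const n (b - a)"
  have R: "R \<ge> 1" unfolding R_def using ab by (intro remez_const_ge_1) auto
  define \<kappa> where "\<kappa> = 1 / (2 * K * R)"
  have \<kappa>: "\<kappa> > 0" using K R by (simp add: \<kappa>_def)
  have "\<exists>y\<in>{a..b}. \<kappa> \<le> \<bar>poly p y\<bar>" if p: "degree p \<le> n" "1 \<le> \<bar>poly.coeff p i\<bar>" for p :: "real poly" and i
  proof (rule ccontr)
    assume "\<not> ?thesis"
    hence s: "\<bar>poly p y\<bar> \<le> \<kappa>" if "y \<in> {a..b}" for y using that by (auto simp: not_le intro: less_imp_le)
    have "\<bar>poly p y\<bar> \<le> R * \<kappa>" if "y \<in> {0..1}" for y
      unfolding R_def by (rule remez_poly[OF p(1), of 0 1 "{a..b}"]) (use that s ab in auto)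
    hence "\<bar>poly.coeff p i\<bar> \<le> K * (R * \<kappa>)" using K(2)[OF p(1)] by blast
    also have "\<dots> = 1 / 2" using K(1) R by (simp add: \<kappa>_def)
    finally show False using p(2) by simp
  qed
  thus ?thesis using \<kappa> by blast
qed

text \<open>Coordinates of the wedge of X with the moment vector (1, y, ..., y^n), as polynomials in
  y: the Laplace expansion along the row of powers.\<close>

definition wedge_poly :: "(nat \<Rightarrow> real) list \<Rightarrow> nat list \<Rightarrow> real poly" where
  "wedge_poly X J = (\<Sum>t<Suc (length X). Polynomial.monom ((-1) ^ (length X + t) * minor X (del_nth t J)) (J ! t))"

lemma poly_wedge_poly:
  "length J = Suc (length X) \<Longrightarrow> poly (wedge_poly X J) y = minor (X @ [\<lambda>j. y ^ j]) J"
  by (simp add: wedge_poly_def minor_snoc poly_sum poly_monom algebra_simps del: sum.lessThan_Suc)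

lemma degree_wedge_poly: "J \<in> col_lists n (Suc (length X)) \<Longrightarrow> degree (wedge_poly X J) \<le> n"
  unfolding wedge_poly_def
  by (intro degree_sum_le) (auto intro!: order_trans[OF degree_monom_le] col_lists_nth)

text \<open>Up to bounded factors these are the coordinates of the wedge of X after the unimodular
  map with entries x 0 / A^n and A (x j - x 0 y^j), 1 \<le> j \<le> n. For r rows, coordinates
  avoiding the first entry carry A^r and are minors of X extended by the moment vector; those using
  it carry A^(r - 1 - n).\<close>

definition frame_polys :: "nat \<Rightarrow> real \<Rightarrow> (nat \<Rightarrow> real) list \<Rightarrow> real poly set" where
  "frame_polys n A X = (\<lambda>J. [:A ^ length X / A ^ Suc n * minor X J:]) ` col_lists n (length X)
      \<union> (\<lambda>J. Polynomial.smult (A ^ length X) (wedge_poly X J)) ` col_lists n (Suc (length X))"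

lemma frame_polys_props:
  "finite (frame_polys n A X)" "frame_polys n A X \<noteq> {}" "p \<in> frame_polys n A X \<Longrightarrow> degree p \<le> n"
  unfolding frame_polys_def by (auto intro: degree_wedge_poly)

definition covol :: "nat \<Rightarrow> real \<Rightarrow> (nat \<Rightarrow> real) list \<Rightarrow> real \<Rightarrow> real" where
  "covol n A X = pmax (frame_polys n A X)"

lemma covol_le_iff:
  assumes A: "A > 0"
  shows "covol n A X y \<le> m \<longleftrightarrow>
    (\<forall>J\<in>col_lists n (length X). A ^ length X / A ^ Suc n * \<bar>minor X J\<bar> \<le> m) \<and>
    (\<forall>J\<in>col_lists n (Suc (length X)). A ^ length X * \<bar>minor (X @ [\<lambda>j. y ^ j]) J\<bar> \<le> m)"
proof -
  have "covol n A X y \<le> m \<longleftrightarrow> (\<forall>p\<in>frame_polys n A X. \<bar>poly p y\<bar> \<le> m)"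
    unfolding covol_def by (rule pmax_le_iff[OF frame_polys_props(1,2)])
  also have "\<dots> \<longleftrightarrow> (\<forall>J\<in>col_lists n (length X). \<bar>poly [:A ^ length X / A ^ Suc n * minor X J:] y\<bar> \<le> m) \<and>
    (\<forall>J\<in>col_lists n (Suc (length X)). \<bar>poly (Polynomial.smult (A ^ length X) (wedge_poly X J)) y\<bar> \<le> m)"
    unfolding frame_polys_def by (simp only: ball_Un ball_simps)
  also have "(\<forall>J\<in>col_lists n (length X). \<bar>poly [:A ^ length X / A ^ Suc n * minor X J:] y\<bar> \<le> m) \<longleftrightarrow>
     (\<forall>J\<in>col_lists n (length X). A ^ length X / A ^ Suc n * \<bar>minor X J\<bar> \<le> m)"
    using A by (simp add: abs_mult)
  also have "(\<forall>J\<in>col_lists n (Suc (length X)). \<bar>poly (Polynomial.smult (A ^ length X) (wedge_poly X J)) y\<bar> \<le> m) \<longleftrightarrow>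
    (\<forall>J\<in>col_lists n (Suc (length X)). A ^ length X * \<bar>minor (X @ [\<lambda>j. y ^ j]) J\<bar> \<le> m)"
    using A by (intro ball_cong refl) (simp add: abs_mult poly_wedge_poly col_lists_def)
  finally show ?thesis .
qed

lemmas covol_bounds = iffD1[OF covol_le_iff, OF _ order_refl]

text \<open>Used with a primitive X: no integer frame of the same span has a smaller
  covolume.\<close>

lemma covol_proportional:
  assumes A: "A > 0" and len: "length Y = length X" and c: "1 \<le> \<bar>c\<bar>"
    and prp: "\<And>J. J \<in> col_lists n (length X) \<Longrightarrow> minor Y J = c * minor X J"
  shows "covol n A X y \<le> covol n A Y y"
proof -
  have prop2: "minor (Y @ [u]) J = c * minor (X @ [u]) J" if "J \<in> col_lists n (Suc (length X))" for J u
  proof -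
    have "length J = Suc (length X)" using that by (simp add: col_lists_def)
    thus ?thesis
      using del_nth_col_lists[OF that] prp
      by (simp add: minor_snoc len sum_distrib_left algebra_simps del: sum.lessThan_Suc)
  qed
  have le: "x \<le> \<bar>c\<bar> * x" if "x \<ge> 0" for x :: real using mult_right_mono[OF c that] by simp
  note B = covol_bounds[OF A, of n Y y, unfolded len]
  show ?thesis unfolding covol_le_iff[OF A]
  proof (intro conjI ballI)
    fix J assume J: "J \<in> col_lists n (length X)"
    have "A ^ length X / A ^ Suc n * \<bar>minor X J\<bar> \<le> A ^ length X / A ^ Suc n * \<bar>minor Y J\<bar>"
      using A prp[OF J] le[of "\<bar>minor X J\<bar>"] by (intro mult_left_mono) (auto simp: abs_mult)
    thus "A ^ length X / A ^ Suc n * \<bar>minor X J\<bar> \<le> covol n A Y y"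
      using B J by force
  next
    fix J assume J: "J \<in> col_lists n (Suc (length X))"
    have "A ^ length X * \<bar>minor (X @ [\<lambda>j. y ^ j]) J\<bar> \<le> A ^ length X * \<bar>minor (Y @ [\<lambda>j. y ^ j]) J\<bar>"
      using A prop2[OF J, of "\<lambda>j. y ^ j"] le[of "\<bar>minor (X @ [\<lambda>j. y ^ j]) J\<bar>"]
      by (intro mult_left_mono) (auto simp: abs_mult)
    thus "A ^ length X * \<bar>minor (X @ [\<lambda>j. y ^ j]) J\<bar> \<le> covol n A Y y"
      using B J by force
  qed
qed

text \<open>Modulo the row \<open>u = (1, y, \<dots>, y\<^sup>n)\<close> the new row \<open>x\<close> may be replaced by \<open>x - x\<^sub>0 u\<close>, whose entries
  are the approximation errors.\<close>

lemma covol_snoc_le: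
  assumes A: "A > 0" and X: "length X \<le> n"
    and N1: "\<bar>x 0\<bar> \<le> \<epsilon> * A ^ n"
    and N2: "\<And>j. j \<le> n \<Longrightarrow> A * \<bar>x j - x 0 * y ^ j\<bar> \<le> \<epsilon>"
  shows "covol n A (X @ [x]) y \<le> (real n + 2) * covol n A X y * \<epsilon>"
proof -
  let ?r = "length X" and ?u = "\<lambda>j. y ^ j"
  define e where "e j = x j - x 0 * y ^ j" for j
  define \<psi> where "\<psi> = covol n A X y"
  have b1: "A ^ ?r / A ^ Suc n * \<bar>minor X J\<bar> \<le> \<psi>" if "J \<in> col_lists n ?r" for J
    using covol_bounds[OF A, of n X y] that by (simp add: \<psi>_def)
  have b2: "A ^ ?r * \<bar>minor (X @ [?u]) J\<bar> \<le> \<psi>" if "J \<in> col_lists n (Suc ?r)" for J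
    using covol_bounds[OF A, of n X y] that by (simp add: \<psi>_def)
  have \<psi>0: "\<psi> \<ge> 0"
  proof -
    obtain J where "J \<in> col_lists n ?r" using col_lists_nonempty by blast
    moreover have "0 \<le> A ^ ?r / A ^ Suc n * \<bar>minor X J\<bar>" using A by simp
    ultimately show ?thesis using b1[of J] by linarith
  qed
  have \<epsilon>0: "\<epsilon> \<ge> 0" using N2[of 0] by simp
  have E: "A * \<bar>e j\<bar> \<le> \<epsilon>" if "j \<le> n" for j using N2[OF that] by (simp add: e_def)
  have sumb: "A * \<bar>\<Sum>j<Suc k. (-1) ^ (?r + j) * e (J ! j) * g j\<bar> \<le> (real k + 1) * (\<epsilon> * G)"
    if J: "J \<in> col_lists n (Suc k)" and G: "\<And>j. j < Suc k \<Longrightarrow> \<bar>g j\<bar> \<le> G" for J k g G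
  proof -
    have "A * \<bar>\<Sum>j<Suc k. (-1) ^ (?r + j) * e (J ! j) * g j\<bar> \<le> A * (\<Sum>j<Suc k. \<bar>(-1) ^ (?r + j) * e (J ! j) * g j\<bar>)"
      using A by (intro mult_left_mono sum_abs) auto
    also have "\<dots> = (\<Sum>j<Suc k. (A * \<bar>e (J ! j)\<bar>) * \<bar>g j\<bar>)"
      by (simp add: sum_distrib_left abs_mult power_abs mult.assoc del: sum.lessThan_Suc)
    also have "\<dots> \<le> (\<Sum>j<Suc k. \<epsilon> * G)"
      using E col_lists_nth[OF J] G \<epsilon>0 by (intro sum_mono mult_mono) auto
    also have "\<dots> = (real k + 1) * (\<epsilon> * G)" by (simp add: algebra_simps)
    finally show ?thesis .
  qed
  show ?thesis unfolding covol_le_iff[OF A]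
  proof (intro conjI ballI)
    fix J assume "J \<in> col_lists n (length (X @ [x]))"
    hence J: "J \<in> col_lists n (Suc ?r)" by simp
    hence lJ: "length J = Suc ?r" by (simp add: col_lists_def)
    have "minor (X @ [x]) J = (\<Sum>j<Suc ?r. (-1) ^ (?r + j) * (x 0 * y ^ (J ! j) + e (J ! j)) * minor X (del_nth j J))"
      using minor_snoc[OF lJ, of x] by (simp add: e_def del: sum.lessThan_Suc)
    also have "\<dots> = x 0 * minor (X @ [?u]) J + (\<Sum>j<Suc ?r. (-1) ^ (?r + j) * e (J ! j) * minor X (del_nth j J))"
      by (simp add: minor_snoc[OF lJ] sum_distrib_left algebra_simps sum.distrib del: sum.lessThan_Suc)
    finally have mx: "minor (X @ [x]) J = x 0 * minor (X @ [?u]) J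
        + (\<Sum>j<Suc ?r. (-1) ^ (?r + j) * e (J ! j) * minor X (del_nth j J))" (is "_ = _ + ?S") .
    have t1: "A ^ ?r / A ^ n * \<bar>x 0 * minor (X @ [?u]) J\<bar> \<le> \<epsilon> * \<psi>"
    proof -
      have "A ^ ?r / A ^ n * \<bar>x 0 * minor (X @ [?u]) J\<bar> = (\<bar>x 0\<bar> / A ^ n) * (A ^ ?r * \<bar>minor (X @ [?u]) J\<bar>)"
        by (simp add: abs_mult)
      also have "\<dots> \<le> \<epsilon> * \<psi>"
        using N1 A b2[OF J] \<epsilon>0 by (intro mult_mono) (auto simp: field_simps)
      finally show ?thesis .
    qed
    have t2: "A ^ ?r / A ^ n * \<bar>?S\<bar> \<le> (real ?r + 1) * (\<epsilon> * \<psi>)"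
    proof -
      have "A * \<bar>?S\<bar> \<le> (real ?r + 1) * (\<epsilon> * (\<psi> * A ^ Suc n / A ^ ?r))"
      proof (rule sumb[OF J])
        fix j assume "j < Suc ?r"
        from b1[OF del_nth_col_lists[OF J this]]
        show "\<bar>minor X (del_nth j J)\<bar> \<le> \<psi> * A ^ Suc n / A ^ ?r" using A by (simp add: field_simps)
      qed
      hence "A ^ ?r / A ^ Suc n * (A * \<bar>?S\<bar>) \<le> A ^ ?r / A ^ Suc n * ((real ?r + 1) * (\<epsilon> * (\<psi> * A ^ Suc n / A ^ ?r)))"
        using A by (intro mult_left_mono) auto
      thus ?thesis using A by (simp add: field_simps)
    qed
    have "A ^ length (X @ [x]) / A ^ Suc n * \<bar>minor (X @ [x]) J\<bar> = A ^ ?r / A ^ n * \<bar>x 0 * minor (X @ [?u]) J + ?S\<bar>"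
      using A mx by simp
    also have "\<dots> \<le> A ^ ?r / A ^ n * (\<bar>x 0 * minor (X @ [?u]) J\<bar> + \<bar>?S\<bar>)"
      using A by (intro mult_left_mono) auto
    also have "\<dots> \<le> \<epsilon> * \<psi> + (real ?r + 1) * (\<epsilon> * \<psi>)" using t1 t2 by (simp add: distrib_left)
    also have "\<dots> = (real ?r + 2) * \<psi> * \<epsilon>" by (simp add: algebra_simps)
    also have "\<dots> \<le> (real n + 2) * \<psi> * \<epsilon>" using X \<psi>0 \<epsilon>0 by (intro mult_right_mono) auto
    finally show "A ^ length (X @ [x]) / A ^ Suc n * \<bar>minor (X @ [x]) J\<bar> \<le> (real n + 2) * covol n A X y * \<epsilon>"
      by (simp add: \<psi>_def)
  next
    fix J assume "J \<in> col_lists n (Suc (length (X @ [x])))"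
    hence J: "J \<in> col_lists n (Suc (Suc ?r))" by simp
    hence lJ: "length J = Suc (length X + length [?u])" by (simp add: col_lists_def)
    have dup: "minor (X @ [?u] @ [?u]) J = 0"
      by (rule minor_dup_row[of ?r "Suc ?r"]) (auto simp: nth_append)
    have "minor (X @ [x] @ [?u]) J =
      (\<Sum>j<Suc (Suc ?r). (-1) ^ (?r + j) * (x 0 * y ^ (J ! j) + e (J ! j)) * minor (X @ [?u]) (del_nth j J))"
      using minor_expand_row[OF lJ, of x] by (simp add: e_def del: sum.lessThan_Suc)
    also have "\<dots> = x 0 * minor (X @ [?u] @ [?u]) J + (\<Sum>j<Suc (Suc ?r). (-1) ^ (?r + j) * e (J ! j) * minor (X @ [?u]) (del_nth j J))"
      using minor_expand_row[OF lJ, of ?u]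
      by (simp add: sum_distrib_left algebra_simps sum.distrib del: sum.lessThan_Suc)
    finally have mx: "minor (X @ [x] @ [?u]) J = (\<Sum>j<Suc (Suc ?r). (-1) ^ (?r + j) * e (J ! j) * minor (X @ [?u]) (del_nth j J))"
      (is "_ = ?S") using dup by simp
    have "A * \<bar>?S\<bar> \<le> (real (Suc ?r) + 1) * (\<epsilon> * (\<psi> / A ^ ?r))"
    proof (rule sumb[OF J])
      fix j assume "j < Suc (Suc ?r)"
      from b2[OF del_nth_col_lists[OF J this]]
      show "\<bar>minor (X @ [?u]) (del_nth j J)\<bar> \<le> \<psi> / A ^ ?r" using A by (simp add: field_simps)
    qed
    hence "A ^ ?r * (A * \<bar>?S\<bar>) \<le> A ^ ?r * ((real (Suc ?r) + 1) * (\<epsilon> * (\<psi> / A ^ ?r)))"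
      using A by (intro mult_left_mono) auto
    also have "\<dots> = (real ?r + 2) * \<psi> * \<epsilon>" using A by (simp add: field_simps)
    also have "\<dots> \<le> (real n + 2) * \<psi> * \<epsilon>" using X \<psi>0 \<epsilon>0 by (intro mult_right_mono) auto
    finally show "A ^ length (X @ [x]) * \<bar>minor ((X @ [x]) @ [?u]) J\<bar> \<le> (real n + 2) * covol n A X y * \<epsilon>"
      using mx by (simp add: \<psi>_def mult.assoc mult.commute[of A])
  qed
qed

lemma covol_Nil_le_1: "A \<ge> 1 \<Longrightarrow> y \<in> {0..1} \<Longrightarrow> covol n A [] y \<le> 1"
proof -
  assume A: "A \<ge> 1" and y: "y \<in> {0..1}"
  have "0 < A" using A by simp
  have m0: "minor [] J = 1" for J by (simp add: minor_def)
  have "minor ([] @ [\<lambda>j. y ^ j]) J = y ^ (J ! 0)" if "J \<in> col_lists n (Suc 0)" for J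
    using minor_snoc[of J "[]" "\<lambda>j. y ^ j"] that by (simp add: m0 col_lists_def)
  thus ?thesis unfolding covol_le_iff[OF \<open>0 < A\<close>] using A y one_le_power[OF A, of "Suc n"]
    by (auto simp: m0 divide_le_eq_1 power_le_one)
qed


text \<open>Comparable frames have different lengths and nested spans. Chains are therefore flags of
  subspaces, and \<open>length\<close> is injective on them, which bounds their size by n +
  1.\<close>

definition frame_comparable :: "nat \<Rightarrow> (nat \<Rightarrow> real) list \<Rightarrow> (nat \<Rightarrow> real) list \<Rightarrow> bool" where
  "frame_comparable n X Y \<longleftrightarrow> length X \<noteq> length Y \<and> (set X \<subseteq> rspan n Y \<or> set Y \<subseteq> rspan n X)"

definition prim_frames :: "nat \<Rightarrow> (nat \<Rightarrow> real) list set" where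
  "prim_frames n = {X. primitive_frame n X \<and> X \<noteq> []}"

lemma prim_frames_full_rank: "X \<in> prim_frames n \<Longrightarrow> full_rank n X"
  by (auto simp: prim_frames_def primitive_frame_def int_frame_def)

lemma frame_good_family:
  "good_family (Suc n) (remez_const n) (prim_frames n) (covol n A) (frame_comparable n)"
  unfolding good_family_def
proof (intro conjI allI ballI impI)
  show "symp (frame_comparable n)" by (auto simp: symp_def frame_comparable_def)
next
  fix F assume F: "chain_in (prim_frames n) (frame_comparable n) F"
  have "inj_on length F"
    using F by (auto simp: inj_on_def chain_in_def pairwise_def frame_comparable_def)
  moreover have "length ` F \<subseteq> {1..Suc n}"
    using F full_rank_length_le_Suc prim_frames_full_rank
    by (fastforce simp: chain_in_def prim_frames_def Suc_le_eq)
  ultimately show "card F \<le> Suc n"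
    using card_inj_on_le[of length F "{1..Suc n}"] by simp
next
  fix X show "continuous_on UNIV (covol n A X)"
    unfolding covol_def by (rule continuous_on_pmax[OF frame_polys_props(1,2)])
next
  fix X a b E \<delta> m y
  assume H: "a < b" "E \<in> lmeasurable" "E \<subseteq> {a..b}" "0 < \<delta>" "\<delta> * (b - a) \<le> measure lebesgue E"
    "\<forall>y\<in>E. covol n A X y \<le> m" "y \<in> {a..b}"
  show "covol n A X y \<le> remez_const n \<delta> * m"
    unfolding covol_def
    by (rule pmax_remez[OF frame_polys_props H(1-5) _ H(7)]) (use H(6) in \<open>auto simp: covol_def\<close>)
qed

lemma Ints_abs_ge_1: "x \<in> \<int> \<Longrightarrow> x \<noteq> 0 \<Longrightarrow> 1 \<le> \<bar>x::real\<bar>"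
  by (auto elim!: Ints_cases)

text \<open>A nonzero minor of an integer frame has modulus at least 1. For n + 1 rows its weight is
  1. Otherwise some column j lies outside J, and the polynomial of \<open>J @ [j]\<close> has the
  coefficient \<open>minor X J\<close> at y^j, so it reaches a fixed \<kappa> on the interval, and
  its weight is at least A.\<close>

lemma covol_large_somewhere:
  assumes ab: "0 \<le> a" "a < b" "b \<le> 1"
  shows "\<exists>A0\<ge>1. \<forall>A\<ge>A0. \<forall>X\<in>prim_frames n. \<exists>y\<in>{a..b}. 1 \<le> covol n A X y"
proof -
  obtain \<kappa> where \<kappa>: "\<kappa> > 0" "\<And>p::real poly. degree p \<le> n \<Longrightarrow> (\<exists>i. 1 \<le> \<bar>poly.coeff p i\<bar>) \<Longrightarrow> (\<exists>y\<in>{a..b}. \<kappa> \<le> \<bar>poly p y\<bar>)"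
    using poly_large_somewhere[OF ab, of n] by blast
  have "\<exists>y\<in>{a..b}. 1 \<le> covol n A X y" if A: "A \<ge> max 1 (1 / \<kappa>)" and X: "X \<in> prim_frames n" for A X
  proof -
    have A1: "A \<ge> 1" "A > 0" "A * \<kappa> \<ge> 1" using A \<kappa>(1) by (auto simp: field_simps)
    obtain J where J: "J \<in> col_lists n (length X)" "minor X J \<noteq> 0"
      using prim_frames_full_rank[OF X] by (auto simp: full_rank_def)
    have "minor X J \<in> \<int>"
      using X by (intro minor_Ints) (auto simp: prim_frames_def primitive_frame_def int_frame_def)
    hence mJ: "1 \<le> \<bar>minor X J\<bar>" using J(2) Ints_abs_ge_1 by blast
    have lX: "length X \<le> Suc n" "1 \<le> length X"
      using full_rank_length_le_Suc[OF prim_frames_full_rank[OF X]] X by (auto simp: prim_frames_def Suc_le_eq)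
    show ?thesis
    proof (cases "length X = Suc n")
      case True
      have "A ^ length X / A ^ Suc n * \<bar>minor X J\<bar> \<le> covol n A X a"
        using covol_bounds[OF A1(2), of n X a] J by blast
      hence "1 \<le> covol n A X a" using True mJ A1 by simp
      thus ?thesis using ab by (intro bexI[of _ a]) auto
    next
      case False
      have "card (set J) \<le> length X" using J(1) card_length[of J] by (simp add: col_lists_def)
      also have "\<dots> < card {..n}" using False lX by simp
      finally have "\<not> {..n} \<subseteq> set J" using card_mono[of "set J" "{..n}"] by auto
      then obtain j where j: "j \<le> n" "j \<notin> set J" by auto
      let ?J = "J @ [j]"
      have J': "?J \<in> col_lists n (Suc (length X))" using J j by (auto simp: col_lists_def)
      have lJ: "length J = length X" using J by (simp add: col_lists_def)
      have "poly.coeff (wedge_poly X ?J) j = (\<Sum>t<Suc (length X). if t = length X then minor X J else 0)"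
        unfolding wedge_poly_def coeff_sum
      proof (intro sum.cong refl)
        fix t assume "t \<in> {..<Suc (length X)}"
        moreover have "J ! t \<noteq> j" if "t < length X" using j(2) lJ that nth_mem by metis
        ultimately show "poly.coeff (Polynomial.monom ((-1) ^ (length X + t) * minor X (del_nth t ?J)) (?J ! t)) j
            = (if t = length X then minor X J else 0)"
          using lJ by (auto simp: nth_append del_nth_def less_Suc_eq)
      qed
      also have "\<dots> = minor X J" by simp
      finally have "\<exists>i. 1 \<le> \<bar>poly.coeff (wedge_poly X ?J) i\<bar>" using mJ by metis
      then obtain y where y: "y \<in> {a..b}" "\<kappa> \<le> \<bar>poly (wedge_poly X ?J) y\<bar>"
        using \<kappa>(2)[OF degree_wedge_poly[OF J']] by blast
      have "A ^ length X * \<bar>minor (X @ [\<lambda>j. y ^ j]) ?J\<bar> \<le> covol n A X y"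
        using covol_bounds[OF A1(2), of n X y] J' by blast
      moreover have "A * \<kappa> \<le> A ^ length X * \<bar>minor (X @ [\<lambda>j. y ^ j]) ?J\<bar>"
        using y(2) A1 \<kappa>(1) power_increasing[OF lX(2) A1(1)] lJ
        by (intro mult_mono) (auto simp: poly_wedge_poly)
      ultimately show ?thesis using y(1) A1(3) by (intro bexI[of _ y]) auto
    qed
  qed
  thus ?thesis by (intro exI[of _ "max 1 (1 / \<kappa>)"]) auto
qed

text \<open>Every nonzero integer vector has size at least \<epsilon> under the unimodular map at
  scale A, so the lattice stays in a compact part of the space of lattices. For \<epsilon> > 0 the
  index j = 0 contributes nothing to the second alternative, the error being 0 there.\<close>

definition badly_approx_at :: "nat \<Rightarrow> real \<Rightarrow> real \<Rightarrow> real set" where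
  "badly_approx_at n \<epsilon> A = {y. \<forall>xs::int list. length xs = Suc n \<longrightarrow> (\<exists>j\<le>n. xs ! j \<noteq> 0) \<longrightarrow>
     (\<epsilon> * A ^ n \<le> \<bar>real_of_int (xs ! 0)\<bar> \<or> (\<exists>j\<le>n. \<epsilon> \<le> A * \<bar>real_of_int (xs ! j) - real_of_int (xs ! 0) * y ^ j\<bar>))}"

lemma closed_badly_approx_at: "closed (badly_approx_at n \<epsilon> A)"
proof -
  have "badly_approx_at n \<epsilon> A = (\<Inter>xs\<in>{xs::int list. length xs = Suc n \<and> (\<exists>j\<le>n. xs ! j \<noteq> 0)
      \<and> \<not> \<epsilon> * A ^ n \<le> \<bar>real_of_int (xs ! 0)\<bar>}.
      (\<Union>j\<in>{..n}. {y. \<epsilon> \<le> A * \<bar>real_of_int (xs ! j) - real_of_int (xs ! 0) * y ^ j\<bar>}))"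
    unfolding badly_approx_at_def by auto
  also have "closed \<dots>"
    by (intro closed_INT ballI closed_UN closed_Collect_le continuous_intros) auto
  finally show ?thesis .
qed

text \<open>Let x be a short vector and X the longest member of the marking flag, or the empty
  frame, whose span misses x. Adding x multiplies the covolume by at most (n + 2) \<epsilon>, so
  \<open>X @ [x]\<close> has covolume at most half of min e \<rho>. But its span either is that of a
  flag member one dimension above X, of covolume at least e, or fits into the flag as a new member,
  and then marking gives at least \<rho>.\<close>

lemma marked_imp_badly_approx:
  assumes A: "A \<ge> 1" and y: "y \<in> {0..1}" and pos: "0 < e" "0 < \<rho>" "0 < M"
    and mk: "marked (prim_frames n) (covol n A) (frame_comparable n) e \<rho> M y"
  shows "y \<in> badly_approx_at n (min e \<rho> / (2 * (real n + 2) * max 1 M)) A"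
proof -
  define \<epsilon> where "\<epsilon> = min e \<rho> / (2 * (real n + 2) * max 1 M)"
  have \<epsilon>0: "\<epsilon> > 0" using pos by (simp add: \<epsilon>_def)
  obtain F where F: "chain_in (prim_frames n) (frame_comparable n) F"
     "\<And>X. X \<in> F \<Longrightarrow> e \<le> covol n A X y" "\<And>X. X \<in> F \<Longrightarrow> covol n A X y \<le> M"
     "\<And>X. X \<in> prim_frames n \<Longrightarrow> X \<notin> F \<Longrightarrow> (\<forall>Y\<in>F. frame_comparable n X Y) \<Longrightarrow> \<rho> \<le> covol n A X y"
    using mk unfolding marked_def by blast
  have FS: "finite F" "F \<subseteq> prim_frames n" using F(1) by (auto simp: chain_in_def)
  have "\<epsilon> * A ^ n \<le> \<bar>real_of_int (xs ! 0)\<bar> \<or> (\<exists>j\<le>n. \<epsilon> \<le> A * \<bar>real_of_int (xs ! j) - real_of_int (xs ! 0) * y ^ j\<bar>)"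
    if xs: "length xs = Suc n" "\<exists>j\<le>n. xs ! j \<noteq> 0" for xs :: "int list"
  proof (rule ccontr)
    assume neg: "\<not> ?thesis"
    have N: "\<bar>real_of_int (xs ! 0)\<bar> \<le> \<epsilon> * A ^ n"
        "\<And>j. j \<le> n \<Longrightarrow> A * \<bar>real_of_int (xs ! j) - real_of_int (xs ! 0) * y ^ j\<bar> \<le> \<epsilon>"
      using neg by (linarith, meson linear)
    define x where "x j = (if j \<le> n then real_of_int (xs ! j) else 0)" for j
    \<comment> \<open>The empty frame is added as the bottom of the flag. Its covolume is at most 1,
      which is the origin of max 1 M in the constant.\<close>
    define Q where "Q = {X \<in> insert [] F. x \<notin> rspan n X}"
    have "[] \<in> Q"
    proof -
      obtain j where "j \<le> n" "xs ! j \<noteq> 0" using xs(2) by auto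
      hence "x \<notin> rspan n []" by (auto simp: rspan_def x_def)
      thus ?thesis by (simp add: Q_def)
    qed
    moreover have "finite Q" using FS by (simp add: Q_def)
    ultimately have "Max (length ` Q) \<in> length ` Q" and mx: "\<And>Y. Y \<in> Q \<Longrightarrow> length Y \<le> Max (length ` Q)"
      by (auto intro!: Max_in)
    then obtain X where X: "X \<in> Q" "\<And>Y. Y \<in> Q \<Longrightarrow> length Y \<le> length X" by force
    have fX: "full_rank n X"
      using X(1) FS prim_frames_full_rank by (auto simp: Q_def full_rank_def minor_def col_lists_def)
    have xX: "x \<notin> rspan n X" using X(1) by (simp add: Q_def)
    let ?W = "X @ [x]"
    have fW: "full_rank n ?W" using not_in_rspan_imp_full_rank fX xX by blast
    have iX: "\<forall>z\<in>set X. \<forall>j. z j \<in> \<int>"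
      using X(1) FS by (auto simp: Q_def prim_frames_def primitive_frame_def int_frame_def)
    have iW: "int_frame n ?W" using fW iX by (auto simp: int_frame_def x_def)
    have lW: "length X \<le> n" using full_rank_length_le_Suc[OF fW] by simp
    have small: "set Y \<subseteq> rspan n X" if "Y \<in> F" "length Y \<le> length X" for Y
    proof (cases "Y = X")
      case True thus ?thesis using set_in_rspan by blast
    next
      case False
      have "X \<noteq> []" using that FS by (auto simp: prim_frames_def)
      hence "X \<in> F" using X(1) by (auto simp: Q_def)
      hence "frame_comparable n Y X" using F(1) that False by (auto simp: chain_in_def pairwise_def)
      hence "length Y < length X" "set Y \<subseteq> rspan n X \<or> set X \<subseteq> rspan n Y"
        using that by (auto simp: frame_comparable_def)
      thus ?thesis using full_rank_length_le[OF fX, of Y] by auto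
    qed
    have large: "set ?W \<subseteq> rspan n Y" if Y: "Y \<in> F" "length X < length Y" for Y
    proof -
      have "x \<in> rspan n Y" using X(2)[of Y] Y by (auto simp: Q_def)
      moreover have "set X \<subseteq> rspan n Y"
      proof (cases "X = []")
        case False
        hence "X \<in> F" using X(1) by (auto simp: Q_def)
        hence "frame_comparable n Y X" using F(1) Y by (auto simp: chain_in_def pairwise_def)
        thus ?thesis
          using full_rank_length_le[of n Y X] prim_frames_full_rank[of Y n] Y FS by (auto simp: frame_comparable_def)
      qed auto
      ultimately show ?thesis by auto
    qed
    have "min e \<rho> \<le> covol n A ?W y"
    proof (cases "\<exists>Y\<in>F. length Y = Suc (length X)")
      case True
      then obtain Y where Y: "Y \<in> F" "length Y = Suc (length X)" by auto
      have "primitive_frame n Y" using Y FS by (auto simp: prim_frames_def)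
      then obtain c where "1 \<le> \<bar>c\<bar>" "\<forall>J\<in>col_lists n (length Y). minor ?W J = c * minor Y J"
        using iW large[OF Y(1)] Y(2) unfolding primitive_frame_def by fastforce
      hence "covol n A Y y \<le> covol n A ?W y"
        using A Y(2) by (intro covol_proportional[of A ?W Y c]) auto
      thus ?thesis using F(2)[OF Y(1)] by simp
    next
      case False
      obtain W' c where W': "primitive_frame n W'" "length W' = Suc (length X)" "set W' \<subseteq> rspan n ?W" "set ?W \<subseteq> rspan n W'"
        "1 \<le> \<bar>c\<bar>" "\<forall>J\<in>col_lists n (Suc (length X)). minor ?W J = c * minor W' J"
        using exists_primitive_frame[OF iW] by auto
      have "\<rho> \<le> covol n A W' y"
      proof (rule F(4))
        show "W' \<in> prim_frames n" using W' by (auto simp: prim_frames_def)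
        show "W' \<notin> F" using False W'(2) by auto
        show "\<forall>Y\<in>F. frame_comparable n W' Y"
        proof
          fix Y assume Y: "Y \<in> F"
          have ne: "length W' \<noteq> length Y" using False Y W'(2) by auto
          show "frame_comparable n W' Y"
          proof (cases "length Y \<le> length X")
            case True
            have "set Y \<subseteq> rspan n X" by (rule small[OF Y True])
            moreover have "rspan n X \<subseteq> rspan n W'" using W'(4) by (intro rspan_mono) auto
            ultimately show ?thesis using ne by (auto simp: frame_comparable_def)
          next
            case False
            hence "rspan n ?W \<subseteq> rspan n Y" using large[OF Y] by (intro rspan_mono) auto
            thus ?thesis using ne W'(3) by (auto simp: frame_comparable_def)
          qed
        qed
      qed
      also have "\<dots> \<le> covol n A ?W y"
        using A W' by (intro covol_proportional[of A ?W W' c]) auto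
      finally show ?thesis by simp
    qed
    also have "\<dots> \<le> (real n + 2) * covol n A X y * \<epsilon>"
      by (rule covol_snoc_le) (use A lW N in \<open>auto simp: x_def\<close>)
    also have "\<dots> \<le> (real n + 2) * max 1 M * \<epsilon>"
    proof (intro mult_right_mono mult_left_mono)
      show "covol n A X y \<le> max 1 M"
        using covol_Nil_le_1[OF A y, of n] F(3)[of X] X(1) by (auto simp: Q_def)
    qed (use \<epsilon>0 in auto)
    also have "\<dots> = min e \<rho> / 2"
    proof -
      have cancel: "a * b * (m / (2 * a * b)) = m / 2" if "a > 0" "b > 0" for a b m :: real
        using that by (simp add: field_simps)
      show ?thesis unfolding \<epsilon>_def by (rule cancel) auto
    qed
    finally have "min e \<rho> \<le> min e \<rho> / 2" .
    moreover have "0 < min e \<rho>" using pos by simp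
    ultimately show False by linarith
  qed
  thus ?thesis unfolding badly_approx_at_def \<epsilon>_def[symmetric] by blast
qed

text \<open>Only the starting scale A0 depends on the interval; \<epsilon> and c are the same for
  all subintervals of [0, 1], as the Cantor construction requires at every level.\<close>

theorem curve_nondivergence:
  "\<exists>\<epsilon> c. 0 < \<epsilon> \<and> 0 < c \<and> (\<forall>a b. 0 \<le> a \<longrightarrow> a < b \<longrightarrow> b \<le> 1 \<longrightarrow>
     (\<exists>A0\<ge>1. \<forall>A\<ge>A0. c * (b - a) \<le> measure lebesgue (badly_approx_at n \<epsilon> A \<inter> {a..b})))"
proof -
  show ?thesis
  proof (rule nondivergence[where C = "remez_const n" and K = "Suc n" and ?'s = "(nat \<Rightarrow> real) list", THEN exE],
      erule remez_const_ge_1, elim exE)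
    fix e \<rho> M c
    assume H: "0 < e \<and> 0 < \<rho> \<and> 0 < M \<and> 0 < c \<and>
      (\<forall>(S :: (nat \<Rightarrow> real) list set) \<psi> R a b T.
       good_family (Suc n) (remez_const n) S \<psi> R \<longrightarrow> a < b \<longrightarrow> (\<forall>s\<in>S. \<exists>y\<in>{a..b}. 1 \<le> \<psi> s y) \<longrightarrow>
       T \<in> sets lebesgue \<longrightarrow> (\<forall>y\<in>{a..b}. marked S \<psi> R e \<rho> M y \<longrightarrow> y \<in> T)
       \<longrightarrow> c * (b - a) \<le> measure lebesgue (T \<inter> {a..b}))"
    hence pos: "0 < e" "0 < \<rho>" "0 < M" "0 < c" by auto
    let ?\<epsilon> = "min e \<rho> / (2 * (real n + 2) * max 1 M)"
    have "\<exists>A0\<ge>1. \<forall>A\<ge>A0. c * (b - a) \<le> measure lebesgue (badly_approx_at n ?\<epsilon> A \<inter> {a..b})"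
      if ab: "0 \<le> a" "a < b" "b \<le> 1" for a b
    proof -
      obtain A0 where A0: "A0 \<ge> 1" "\<And>A X. A \<ge> A0 \<Longrightarrow> X \<in> prim_frames n \<Longrightarrow> \<exists>y\<in>{a..b}. 1 \<le> covol n A X y"
        using covol_large_somewhere[OF ab, of n] by blast
      have "c * (b - a) \<le> measure lebesgue (badly_approx_at n ?\<epsilon> A \<inter> {a..b})" if A: "A \<ge> A0" for A
      proof (rule H[THEN conjunct2, THEN conjunct2, THEN conjunct2, THEN conjunct2, rule_format,
            of "prim_frames n" "covol n A" "frame_comparable n" a b])
        show "good_family (Suc n) (remez_const n) (prim_frames n) (covol n A) (frame_comparable n)"
          by (rule frame_good_family)
        show "badly_approx_at n ?\<epsilon> A \<in> sets lebesgue"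
          by (intro sets_completionI_sets) (simp add: borel_closed closed_badly_approx_at)
        show "y \<in> badly_approx_at n ?\<epsilon> A"
          if "y \<in> {a..b}" "marked (prim_frames n) (covol n A) (frame_comparable n) e \<rho> M y" for y
          by (rule marked_imp_badly_approx[OF _ _ pos(1-3) that(2)]) (use A A0(1) that(1) ab in auto)
      qed (use ab A0(2)[OF A] in auto)
      thus ?thesis using A0(1) by blast
    qed
    thus ?thesis using pos by (intro exI[of _ ?\<epsilon>] exI[of _ c]) auto
  qed
qed

subsection \<open>An effective Kronecker theorem\<close>

text \<open>Since y \<le> 2, the cubic Taylor term takes away at most two thirds of y.\<close>

lemma sin_lower_bound:
  assumes "0 \<le> y" "y \<le> pi / 2"
  shows "y / 3 \<le> sin y"
proof -
  have y2: "y \<le> 2" using assms pi_less_4 by simp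
  have "\<bar>sin y - (\<Sum>m<3. sin_coeff m * y ^ m)\<bar> \<le> inverse (fact 3) * \<bar>y\<bar> ^ 3"
    by (rule Maclaurin_sin_bound)
  moreover have "(\<Sum>m<3. sin_coeff m * y ^ m) = y"
    by (simp add: sin_coeff_def eval_nat_numeral)
  moreover have "inverse (fact 3) * \<bar>y\<bar> ^ 3 = y * (y * y) / 6"
    using assms by (simp add: eval_nat_numeral)
  ultimately have "y - y * (y * y) / 6 \<le> sin y" by linarith
  moreover have "y * (y * y) \<le> y * (2 * 2)"
    using assms y2 by (intro mult_left_mono mult_mono) auto
  ultimately show ?thesis by linarith
qed

definition cexp :: "real \<Rightarrow> complex" where "cexp t = cis (2 * pi * t)"

lemma cexp_add: "cexp (s + t) = cexp s * cexp t"
  by (simp add: cexp_def cis_mult algebra_simps)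

lemma norm_cexp [simp]: "norm (cexp t) = 1" by (simp add: cexp_def)

lemma cexp_0 [simp]: "cexp 0 = 1" by (simp add: cexp_def)

lemma cexp_of_int [simp]: "cexp (of_int m) = 1"
  unfolding cexp_def by (metis cis_multiple_2pi Ints_of_int mult.commute)

lemma cexp_power: "cexp t ^ k = cexp (real k * t)"
  by (induction k) (auto simp: cexp_add[symmetric] algebra_simps)

lemma cexp_sum: "finite I \<Longrightarrow> cexp (\<Sum>i\<in>I. f i) = (\<Prod>i\<in>I. cexp (f i))"
  by (induction I rule: finite_induct) (auto simp: cexp_add)

text \<open>With s the signed distance of t to the nearest integer, the norm is 2 |sin (pi s)|, at
  least 2 pi |s| / 3 and hence at least |s|.\<close>

lemma norm_cexp_diff_1:
  assumes d: "\<And>m::int. d \<le> \<bar>t - of_int m\<bar>"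
  shows "d \<le> norm (cexp t - 1)"
proof -
  define s where "s = t - of_int (round t)"
  have s: "\<bar>s\<bar> \<le> 1 / 2" using of_int_round_abs_le[of t] by (simp add: s_def abs_minus_commute)
  have ds: "d \<le> \<bar>s\<bar>" using d[of "round t"] by (simp add: s_def)
  have "cexp t = cexp s"
    using cexp_add[of s "of_int (round t)"] by (simp add: s_def)
  moreover have "cexp s - 1 = cis (pi * s) * (2 * \<i> * sin (pi * s))"
  proof -
    have "cexp s = cis (pi * s) * cis (pi * s)" by (simp add: cexp_def cis_mult algebra_simps)
    moreover have "1 = cis (pi * s) * cis (- (pi * s))" by (simp add: cis_mult)
    ultimately have "cexp s - 1 = cis (pi * s) * (cis (pi * s) - cis (- (pi * s)))"
      by (simp add: algebra_simps)
    also have "cis (pi * s) - cis (- (pi * s)) = 2 * \<i> * sin (pi * s)"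
      by (auto simp: complex_eq_iff)
    finally show ?thesis .
  qed
  ultimately have n: "norm (cexp t - 1) = 2 * \<bar>sin (pi * s)\<bar>" by (simp add: norm_mult)
  have "pi * \<bar>s\<bar> / 3 \<le> sin (pi * \<bar>s\<bar>)" using s by (intro sin_lower_bound) auto
  moreover have "sin (pi * \<bar>s\<bar>) \<le> \<bar>sin (pi * s)\<bar>" by (cases "s \<ge> 0") auto
  moreover have "3 / 2 * \<bar>s\<bar> \<le> pi * \<bar>s\<bar>" using pi_gt3 by (intro mult_right_mono) auto
  ultimately have "\<bar>s\<bar> \<le> 2 * \<bar>sin (pi * s)\<bar>" by linarith
  thus ?thesis using n ds by linarith
qed

lemma norm_geometric_average:
  assumes A: "A \<ge> 1" and d: "d > 0" "\<And>m::int. d \<le> \<bar>t - of_int m\<bar>"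
  shows "norm ((\<Sum>a<A. cexp t ^ a) / of_nat A) \<le> 2 / (real A * d)"
proof -
  let ?z = "cexp t"
  have z1: "d \<le> norm (?z - 1)" by (rule norm_cexp_diff_1[OF d(2)])
  hence "?z \<noteq> 1" using d(1) by auto
  hence "(\<Sum>a<A. ?z ^ a) = (?z ^ A - 1) / (?z - 1)" by (simp add: geometric_sum)
  hence "norm (\<Sum>a<A. ?z ^ a) = norm (?z ^ A - 1) / norm (?z - 1)" by (simp add: norm_divide)
  also have "\<dots> \<le> 2 / d"
  proof (intro frac_le)
    show "norm (?z ^ A - 1) \<le> 2" using norm_triangle_ineq4[of "?z ^ A" 1] by (simp add: norm_power)
  qed (use z1 d in auto)
  finally have "norm (\<Sum>a<A. ?z ^ a) / real A \<le> (2 / d) / real A" by (rule divide_right_mono) simp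
  thus ?thesis by (simp add: norm_divide mult.commute)
qed

lemma norm_average_le_1: "A \<ge> 1 \<Longrightarrow> norm ((\<Sum>a<A. cexp t ^ a) / of_nat A) \<le> 1"
proof -
  assume A: "A \<ge> 1"
  have "norm (\<Sum>a<A. cexp t ^ a) \<le> (\<Sum>a<A. 1::real)"
    by (rule sum_norm_le) (simp add: norm_power)
  thus ?thesis using A by (simp add: norm_divide divide_le_eq_1)
qed

text \<open>The weights are the k-fold convolution of the uniform distribution on {0..<A}. Their
  transform is the k-th power of an average of powers of z, so at z = \<open>cexp t\<close> it
  decays like (A d)^(-k) when t has distance d from the integers.\<close>

lemma averaging_kernel:
  assumes A: "A \<ge> 1"
  shows "\<exists>w::nat \<Rightarrow> real. (\<forall>j. w j \<ge> 0) \<and> (\<Sum>j\<le>k * A. w j) = 1 \<and>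
    (\<forall>z::complex. (\<Sum>j\<le>k * A. of_real (w j) * z ^ j) = ((\<Sum>a<A. z ^ a) / of_nat A) ^ k)"
proof -
  define q :: "real poly" where "q = (\<Sum>a<A. Polynomial.monom (1 / real A) a)"
  have cq: "poly.coeff q i = (if i < A then 1 / real A else 0)" for i
    unfolding q_def by (simp add: coeff_sum)
  have degq: "degree q \<le> A" by (rule degree_le) (simp add: cq)
  define w where "w j = poly.coeff (q ^ k) j" for j
  have nn: "poly.coeff (q ^ k) j \<ge> 0" for j
  proof (induction k arbitrary: j)
    case (Suc k)
    show ?case unfolding power_Suc coeff_mult
      by (intro sum_nonneg mult_nonneg_nonneg Suc) (auto simp: cq)
  qed auto
  have deg: "degree (q ^ k) \<le> k * A"
    using degree_power_le[of q k] degq by (metis dual_order.trans mult.commute mult_le_mono2)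
  \<comment> \<open>The complex copy of q is evaluated at z; nonnegativity of the weights is read
    off from the real one.\<close>
  define Q :: "complex poly" where "Q = (\<Sum>a<A. Polynomial.monom (1 / of_nat A) a)"
  have cQ: "poly.coeff Q i = of_real (poly.coeff q i)" for i
    unfolding Q_def q_def by (simp add: coeff_sum)
  have cQk: "poly.coeff (Q ^ k) j = of_real (poly.coeff (q ^ k) j)" for j
  proof (induction k arbitrary: j)
    case (Suc k)
    show ?case unfolding power_Suc coeff_mult by (simp add: cQ Suc)
  qed simp
  have ev: "(\<Sum>j\<le>k * A. of_real (w j) * z ^ j) = ((\<Sum>a<A. z ^ a) / of_nat A) ^ k" for z :: complex
  proof -
    have "poly (Q ^ k) z = (\<Sum>j\<le>degree (Q ^ k). poly.coeff (Q ^ k) j * z ^ j)" by (rule poly_altdef)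
    also have "\<dots> = (\<Sum>j\<le>k * A. poly.coeff (Q ^ k) j * z ^ j)"
    proof (rule sum.mono_neutral_left)
      have "degree (Q ^ k) \<le> k * A" using deg
        by (intro degree_le allI impI) (simp add: cQk coeff_eq_0)
      thus "{..degree (Q ^ k)} \<subseteq> {..k * A}" by auto
    qed (auto simp: coeff_eq_0)
    finally have "(\<Sum>j\<le>k * A. of_real (w j) * z ^ j) = poly Q z ^ k" by (simp add: w_def cQk)
    also have "poly Q z = (\<Sum>a<A. z ^ a) / of_nat A"
      unfolding Q_def by (simp add: poly_sum poly_monom sum_divide_distrib)
    finally show ?thesis .
  qed
  have "(\<Sum>j\<le>k * A. w j) = 1"
  proof -
    have "complex_of_real (\<Sum>j\<le>k * A. w j) = ((\<Sum>a<A. 1 ^ a) / of_nat A) ^ k"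
      using ev[of 1] by simp
    also have "\<dots> = complex_of_real 1" using A by simp
    finally show ?thesis by (simp only: of_real_eq_iff)
  qed
  thus ?thesis using nn ev by (intro exI[of _ w]) (auto simp: w_def)
qed

text \<open>A trigonometric polynomial with kernel coefficients f is averaged over the box of all j
  with product weights w. If every value kept distance B from the integers, the average S would be
  at most (2 / (M B))^k. Expanded by frequency, every x \<noteq> 0 meets an index i with x
  \<theta>_i at distance at least Y from the integers, so these frequencies together contribute at
  most (2 / (A Y))^k, and S is close to the constant coefficient, which is at least 1 / (k M +
  1).\<close>

lemma kronecker_effective:
  fixes \<theta> :: "nat \<Rightarrow> real" and A M k n :: nat
  assumes A: "A \<ge> 1" and M: "M \<ge> 1" and Y: "Y > 0" and B: "B > 0"
    and hyp: "\<And>x::int. x \<noteq> 0 \<Longrightarrow> \<bar>x\<bar> \<le> int (k * M) \<Longrightarrow> \<exists>i\<in>{1..n}. \<forall>m::int. Y \<le> \<bar>of_int x * \<theta> i - of_int m\<bar>"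
    and ineq: "(2 / (real A * Y)) ^ k + (2 / (real M * B)) ^ k < 1 / (real (k * M) + 1)"
  shows "\<exists>j::nat \<Rightarrow> nat. (\<forall>i\<in>{1..n}. j i \<le> k * A) \<and> (\<exists>m::int. \<bar>(\<Sum>i=1..n. real (j i) * \<theta> i) - \<beta> - of_int m\<bar> < B)"
proof (rule ccontr)
  assume neg: "\<not> ?thesis"
  obtain w where w: "\<And>j. w j \<ge> 0" "(\<Sum>j\<le>k * A. w j) = 1"
     "\<And>z::complex. (\<Sum>j\<le>k * A. of_real (w j) * z ^ j) = ((\<Sum>a<A. z ^ a) / of_nat A) ^ k"
    using averaging_kernel[OF A, of k] by blast
  obtain f where f: "\<And>j. f j \<ge> 0" "(\<Sum>j\<le>k * M. f j) = 1"
     "\<And>z::complex. (\<Sum>j\<le>k * M. of_real (f j) * z ^ j) = ((\<Sum>a<M. z ^ a) / of_nat M) ^ k"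
    using averaging_kernel[OF M, of k] by blast
  \<comment> \<open>Some coefficient is at least the average. Shifting all frequencies by m0 makes
    it the constant term.\<close>
  obtain m0 where m0: "m0 \<le> k * M" "1 / (real (k * M) + 1) \<le> f m0"
  proof (rule ccontr)
    assume "\<not> thesis"
    hence "f m < 1 / (real (k * M) + 1)" if "m \<le> k * M" for m using that \<open>\<And>m0. _ \<Longrightarrow> _ \<Longrightarrow> thesis\<close> by force
    hence "(\<Sum>j\<le>k * M. f j) < (\<Sum>j\<le>k * M. 1 / (real (k * M) + 1))"
      by (intro sum_strict_mono) auto
    also have "\<dots> = real (Suc (k * M)) * (1 / (real (k * M) + 1))" by (simp only: sum_constant card_atMost)
    also have "real (Suc (k * M)) = real (k * M) + 1" by simp
    also have "(real (k * M) + 1) * (1 / (real (k * M) + 1)) = 1"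
      using of_nat_0_le_iff[of "k * M", where ?'a = real] by (simp del: of_nat_mult)
    finally show False using f(2) by simp
  qed
  let ?I = "PiE {1..n} (\<lambda>_. {..k * A})"
  let ?L = "\<lambda>j. (\<Sum>i=1..n. real (j i) * \<theta> i) - \<beta>"
  let ?F = "\<lambda>t. (\<Sum>m\<le>k * M. of_real (f m) * cexp ((real m - real m0) * t))"
  define S where "S = (\<Sum>j\<in>?I. of_real (\<Prod>i=1..n. w (j i)) * ?F (?L j))"
  have Fb: "norm (?F t) \<le> (2 / (real M * B)) ^ k" if "\<And>m::int. B \<le> \<bar>t - of_int m\<bar>" for t
  proof -
    have "?F t = cexp (- real m0 * t) * (\<Sum>m\<le>k * M. of_real (f m) * cexp t ^ m)"
      unfolding sum_distrib_left
    proof (intro sum.cong refl)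
      fix m
      have "(real m - real m0) * t = - real m0 * t + real m * t" by (simp add: algebra_simps)
      hence "cexp ((real m - real m0) * t) = cexp (- real m0 * t) * cexp t ^ m"
        by (simp only: cexp_add cexp_power)
      thus "of_real (f m) * cexp ((real m - real m0) * t) = cexp (- real m0 * t) * (of_real (f m) * cexp t ^ m)"
        by simp
    qed
    hence "norm (?F t) = norm ((\<Sum>a<M. cexp t ^ a) / of_nat M) ^ k"
      by (simp only: f(3) norm_mult norm_cexp norm_power mult_1)
    also have "\<dots> \<le> (2 / (real M * B)) ^ k"
      by (intro power_mono norm_geometric_average M B that) auto
    finally show ?thesis .
  qed
  have "norm S \<le> (\<Sum>j\<in>?I. (\<Prod>i=1..n. w (j i)) * (2 / (real M * B)) ^ k)"
    unfolding S_def
  proof (rule sum_norm_le)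
    fix j assume j: "j \<in> ?I"
    have "B \<le> \<bar>?L j - of_int m\<bar>" for m :: int
    proof -
      have "\<forall>i\<in>{1..n}. j i \<le> k * A" using j by auto
      hence "\<not> \<bar>?L j - of_int m\<bar> < B" using neg by blast
      thus ?thesis by simp
    qed
    hence "norm (?F (?L j)) \<le> (2 / (real M * B)) ^ k" by (rule Fb)
    moreover have "0 \<le> (\<Prod>i=1..n. w (j i))" using w(1) by (intro prod_nonneg) auto
    ultimately show "norm (of_real (\<Prod>i=1..n. w (j i)) * ?F (?L j)) \<le> (\<Prod>i=1..n. w (j i)) * (2 / (real M * B)) ^ k"
      unfolding norm_mult norm_of_real by (intro mult_mono) auto
  qed
  also have "\<dots> = (\<Sum>j\<in>?I. \<Prod>i=1..n. w (j i)) * (2 / (real M * B)) ^ k" by (simp add: sum_distrib_right)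
  also have "(\<Sum>j\<in>?I. \<Prod>i=1..n. w (j i)) = (\<Prod>i=1..n. \<Sum>j\<le>k * A. w j)"
    by (rule prod_sum_PiE[symmetric]) auto
  also have "\<dots> = 1" by (simp add: w(2))
  finally have up: "norm S \<le> (2 / (real M * B)) ^ k" by simp
  define G where "G m = cexp (- (real m - real m0) * \<beta>) *
      (\<Prod>i=1..n. \<Sum>j\<le>k * A. of_real (w j) * cexp ((real m - real m0) * \<theta> i) ^ j)" for m
  have "S = (\<Sum>j\<in>?I. \<Sum>m\<le>k * M. of_real (f m) * (cexp (- (real m - real m0) * \<beta>) *
      (\<Prod>i=1..n. of_real (w (j i)) * cexp ((real m - real m0) * \<theta> i) ^ (j i))))"
    unfolding S_def sum_distrib_left
  proof (intro sum.cong refl)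
    fix j m
    have "(real m - real m0) * ?L j = - (real m - real m0) * \<beta> + (\<Sum>i=1..n. real (j i) * ((real m - real m0) * \<theta> i))"
      by (simp add: right_diff_distrib sum_distrib_left mult_ac)
    hence "cexp ((real m - real m0) * ?L j) = cexp (- (real m - real m0) * \<beta>) *
       (\<Prod>i=1..n. cexp ((real m - real m0) * \<theta> i) ^ (j i))"
      by (simp only: cexp_add cexp_sum[OF finite_atLeastAtMost] cexp_power)
    thus "of_real (\<Prod>i=1..n. w (j i)) * (of_real (f m) * cexp ((real m - real m0) * ?L j)) =
      of_real (f m) * (cexp (- (real m - real m0) * \<beta>) *
      (\<Prod>i=1..n. of_real (w (j i)) * cexp ((real m - real m0) * \<theta> i) ^ (j i)))"
      by (simp add: prod.distrib mult_ac)
  qed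
  also have "\<dots> = (\<Sum>m\<le>k * M. of_real (f m) * (cexp (- (real m - real m0) * \<beta>) *
      (\<Sum>j\<in>?I. \<Prod>i=1..n. of_real (w (j i)) * cexp ((real m - real m0) * \<theta> i) ^ (j i))))"
    by (subst sum.swap) (simp add: sum_distrib_left)
  also have "\<dots> = (\<Sum>m\<le>k * M. of_real (f m) * G m)"
    unfolding G_def by (subst prod_sum_PiE) auto
  finally have SG: "S = (\<Sum>m\<le>k * M. of_real (f m) * G m)" .
  have Gm0: "G m0 = 1"
    using w(2) unfolding G_def by (simp add: of_real_sum[symmetric] del: of_real_sum)
  have Gm: "norm (G m) \<le> (2 / (real A * Y)) ^ k" if m: "m \<le> k * M" "m \<noteq> m0" for m
  proof -
    define x where "x = int m - int m0"
    have xr: "real m - real m0 = of_int x" by (simp add: x_def)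
    have "int m \<le> int (k * M)" "int m0 \<le> int (k * M)" using m(1) m0(1) by (simp_all only: of_nat_le_iff)
    hence "x \<noteq> 0" "\<bar>x\<bar> \<le> int (k * M)" unfolding x_def using m(2) by linarith+
    from hyp[OF this] obtain i0 where i0: "i0 \<in> {1..n}" "\<And>p::int. Y \<le> \<bar>of_int x * \<theta> i0 - of_int p\<bar>"
      by blast
    let ?g = "\<lambda>i. norm (((\<Sum>a<A. cexp (of_int x * \<theta> i) ^ a) / of_nat A) ^ k)"
    have "norm (G m) = (\<Prod>i=1..n. ?g i)"
      unfolding G_def xr by (simp only: norm_mult norm_cexp prod_norm[symmetric] w(3) mult_1)
    also have "\<dots> = ?g i0 * (\<Prod>i\<in>{1..n} - {i0}. ?g i)" using i0(1) by (simp add: prod.remove)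
    also have "\<dots> \<le> (2 / (real A * Y)) ^ k * 1"
    proof (intro mult_mono)
      show "?g i0 \<le> (2 / (real A * Y)) ^ k" unfolding norm_power
        by (intro power_mono norm_geometric_average A Y i0(2)) auto
      show "(\<Prod>i\<in>{1..n} - {i0}. ?g i) \<le> 1"
        unfolding norm_power by (intro prod_le_1 conjI power_le_one norm_average_le_1 A) auto
    qed (use A Y in \<open>auto intro!: prod_nonneg\<close>)
    finally show ?thesis by simp
  qed
  have "S - of_real (f m0) = (\<Sum>m\<in>{..k * M} - {m0}. of_real (f m) * G m)"
    using m0(1) Gm0 by (simp add: SG sum.remove[of _ m0])
  hence "norm (S - of_real (f m0)) \<le> (\<Sum>m\<in>{..k * M} - {m0}. f m * (2 / (real A * Y)) ^ k)"
  proof (simp only:, intro sum_norm_le)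
    fix m assume "m \<in> {..k * M} - {m0}"
    thus "norm (of_real (f m) * G m) \<le> f m * (2 / (real A * Y)) ^ k"
      using Gm[of m] f(1)[of m] by (simp add: norm_mult mult_left_mono)
  qed
  also have "\<dots> \<le> (\<Sum>m\<le>k * M. f m * (2 / (real A * Y)) ^ k)"
    using f(1) A Y by (intro sum_mono2) auto
  also have "\<dots> = (2 / (real A * Y)) ^ k" by (simp add: sum_distrib_right[symmetric] f(2))
  finally have d: "norm (S - of_real (f m0)) \<le> (2 / (real A * Y)) ^ k" .
  have "f m0 = norm (complex_of_real (f m0))" using f(1) by simp
  also have "\<dots> \<le> norm S + norm (S - of_real (f m0))"
    by (metis norm_minus_commute norm_triangle_sub)
  finally show False using d up m0(2) ineq by linarith
qed

subsection \<open>Hausdorff dimension: lower bounds from Cantor sets\<close>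

definition touching :: "real set \<Rightarrow> real \<Rightarrow> real \<Rightarrow> real \<Rightarrow> real set" where
  "touching S r p q = {x \<in> S. cball x r \<inter> {p..q} \<noteq> {}}"

definition separated :: "real \<Rightarrow> real set \<Rightarrow> bool" where
  "separated d S \<longleftrightarrow> (\<forall>x\<in>S. \<forall>y\<in>S. x \<noteq> y \<longrightarrow> d \<le> \<bar>x - y\<bar>)"

lemma card_separated_le:
  assumes "finite S" "separated d S" "d > 0" "S \<subseteq> {p..q}" "p \<le> q"
  shows "real (card S) \<le> 1 + (q - p) / d"
proof -
  define f where "f x = nat \<lfloor>(x - p) / d\<rfloor>" for x
  have "inj_on f S"
  proof (rule inj_onI, rule ccontr)
    fix x y assume xy: "x \<in> S" "y \<in> S" "f x = f y" "x \<noteq> y"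
    have "0 \<le> (x - p) / d" "0 \<le> (y - p) / d" using xy assms by (auto intro!: divide_nonneg_pos)
    hence "\<lfloor>(x - p) / d\<rfloor> = \<lfloor>(y - p) / d\<rfloor>" using xy(3) by (simp add: f_def eq_nat_nat_iff)
    hence "\<bar>(x - p) / d - (y - p) / d\<bar> < 1" by linarith
    hence "\<bar>(x - y) / d\<bar> < 1" by (simp add: diff_divide_distrib)
    hence "\<bar>x - y\<bar> < d" using assms(3) by (simp add: abs_divide divide_less_eq)
    thus False using assms(2) xy unfolding separated_def by fastforce
  qed
  moreover have "f ` S \<subseteq> {..nat \<lfloor>(q - p) / d\<rfloor>}"
    using assms unfolding f_def by (auto intro!: nat_mono floor_mono divide_right_mono)
  ultimately have "card S \<le> Suc (nat \<lfloor>(q - p) / d\<rfloor>)"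
    using card_inj_on_le[of f S "{..nat \<lfloor>(q - p) / d\<rfloor>}"] by simp
  hence "real (card S) \<le> 1 + real (nat \<lfloor>(q - p) / d\<rfloor>)" by linarith
  also have "real (nat \<lfloor>(q - p) / d\<rfloor>) \<le> (q - p) / d"
    using assms by (simp add: of_nat_floor)
  finally show ?thesis by simp
qed

text \<open>Level k consists of disjoint balls of radius \<open>r k\<close> about the centres
  \<open>S k\<close>. Every centre has exactly \<open>M k\<close> children, so mass is a ratio of
  cardinalities and no measure has to be constructed; \<open>mass\<close> says that a ball of level
  k carries at most C (r k)^s. Children lie in the half ball so that their own balls stay inside the
  parent ball.\<close>

locale cantor_scheme =
  fixes d r :: "nat \<Rightarrow> real" and S :: "nat \<Rightarrow> real set" and ch :: "nat \<Rightarrow> real \<Rightarrow> real set"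
    and M :: "nat \<Rightarrow> nat" and c C s :: real
  assumes c: "c > 0" and C: "C > 0" and s: "0 < s" "s \<le> 1"
    and dpos: "d k > 0" and rpos: "r k > 0" and rd: "r k \<le> d k / 4"
    and fin: "finite (S k)" and S0: "\<exists>x. S 0 = {x}"
    and sep: "separated (d k) (S k)"
    and SSuc: "S (Suc k) = (\<Union>x\<in>S k. ch k x)"
    and chsub: "x \<in> S k \<Longrightarrow> ch k x \<subseteq> cball x (r k / 2)"
    and chcard: "x \<in> S k \<Longrightarrow> card (ch k x) = M k"
    and Mge: "c * r k / d (Suc k) \<le> real (M k)" "M k > 0"
    and rSuc: "r (Suc k) \<le> r k / 2" and dSuc: "d (Suc k) \<le> d k / 2"
    and mass: "1 \<le> C * real (card (S k)) * r k powr s"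
begin

lemma ch_disjoint:
  assumes "x \<in> S k" "y \<in> S k" "x \<noteq> y"
  shows "ch k x \<inter> ch k y = {}"
proof (rule ccontr)
  assume "\<not> ?thesis"
  then obtain z where "z \<in> ch k x" "z \<in> ch k y" by auto
  hence "z \<in> cball x (r k / 2)" "z \<in> cball y (r k / 2)" using chsub assms by blast+
  hence "dist x z \<le> r k / 2" "dist y z \<le> r k / 2" by auto
  hence "\<bar>x - y\<bar> \<le> r k" unfolding dist_real_def by linarith
  moreover have "d k \<le> \<bar>x - y\<bar>" using sep[of k] assms by (auto simp: separated_def)
  ultimately show False using rd[of k] dpos[of k] by linarith
qed

lemma fin_ch: "x \<in> S k \<Longrightarrow> finite (ch k x)"
  using chcard[of x k] Mge(2)[of k] card.infinite by fastforce

lemma card_S_Suc: "card (S (Suc k)) = card (S k) * M k"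
  unfolding SSuc using fin fin_ch ch_disjoint chcard by (subst card_UN_disjoint) auto

lemma card_S_pos: "card (S k) > 0"
proof (induction k)
  case 0 thus ?case using S0 by auto
next
  case (Suc k) thus ?case using Mge(2)[of k] by (simp add: card_S_Suc)
qed

lemma ball_child: "x \<in> S k \<Longrightarrow> y \<in> ch k x \<Longrightarrow> cball y (r (Suc k)) \<subseteq> cball x (r k)"
proof
  fix z assume "x \<in> S k" "y \<in> ch k x" "z \<in> cball y (r (Suc k))"
  hence "y \<in> cball x (r k / 2)" "dist y z \<le> r (Suc k)" using chsub[of x k] by auto
  hence "dist x y \<le> r k / 2" "dist y z \<le> r (Suc k)" by simp_all
  thus "z \<in> cball x (r k)" using rSuc[of k] dist_triangle[of x z y] by (auto simp: dist_commute)
qed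

lemma touching_Suc:
  "touching (S (Suc k)) (r (Suc k)) p q \<subseteq> (\<Union>x\<in>touching (S k) (r k) p q. ch k x)"
proof
  fix y assume y: "y \<in> touching (S (Suc k)) (r (Suc k)) p q"
  then obtain x where x: "x \<in> S k" "y \<in> ch k x" by (auto simp: touching_def SSuc)
  hence "x \<in> touching (S k) (r k) p q" using y ball_child[OF x] by (auto simp: touching_def)
  thus "y \<in> (\<Union>x\<in>touching (S k) (r k) p q. ch k x)" using x by auto
qed

lemma fin_touching: "finite (touching (S k) (r k) p q)" using fin by (simp add: touching_def)

lemma card_touching_Suc:
  "card (touching (S (Suc k)) (r (Suc k)) p q) \<le> card (touching (S k) (r k) p q) * M k"
proof -
  have "card (touching (S (Suc k)) (r (Suc k)) p q) \<le> card (\<Union>x\<in>touching (S k) (r k) p q. ch k x)"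
    using touching_Suc fin_touching fin_ch by (intro card_mono) (auto simp: touching_def)
  also have "\<dots> \<le> (\<Sum>x\<in>touching (S k) (r k) p q. card (ch k x))"
    using fin_touching by (rule card_UN_le)
  also have "\<dots> = card (touching (S k) (r k) p q) * M k"
    using chcard by (simp add: touching_def)
  finally show ?thesis .
qed

text \<open>The ratio is the mass of [p, q] under the uniform distribution on a level. It can only
  drop, since all balls have the same number of children.\<close>

lemma touching_ratio_antimono:
  assumes "k \<le> l"
  shows "real (card (touching (S l) (r l) p q)) / real (card (S l)) \<le> real (card (touching (S k) (r k) p q)) / real (card (S k))"
  using assms
proof (induction l rule: dec_induct)
  case (step l)
  have "real (card (touching (S (Suc l)) (r (Suc l)) p q)) / real (card (S (Suc l)))
      \<le> real (card (touching (S l) (r l) p q) * M l) / real (card (S l) * M l)"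
    unfolding card_S_Suc using card_touching_Suc[of l p q]
    by (intro divide_right_mono) (auto simp del: of_nat_mult)
  also have "\<dots> = real (card (touching (S l) (r l) p q)) / real (card (S l))" using Mge(2)[of l] by simp
  finally show ?case using step.IH by linarith
qed auto

lemma d_le: "d k \<le> d 0 / 2 ^ k"
proof (induction k)
  case (Suc k)
  show ?case using order_trans[OF dSuc[of k] divide_right_mono[OF Suc, of 2]] by simp
qed simp

text \<open>Take the first j with \<open>d (Suc j)\<close> at most 2 (q - p). The interval touches
  at most one ball of level j, and on the next level at most M j balls and at most 4 (q - p) / d
  (Suc j). The smaller of the two proportions is at most y^s with y = 4 (q - p) / (c r j), and
  \<open>mass\<close> converts (r j)^s into the number of balls.\<close>

lemma touching_bound:
  assumes pq: "p < q"
  shows "\<exists>j. real (card (touching (S (Suc j)) (r (Suc j)) p q)) / real (card (S (Suc j))) \<le> C * (4 / c) powr s * (q - p) powr s"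
proof -
  define u where "u = q - p"
  have u: "u > 0" using pq by (simp add: u_def)
  have "\<exists>j. d (Suc j) / 2 \<le> u"
  proof -
    obtain k where "d 0 / u < 2 ^ k" using real_arch_pow[of 2 "d 0 / u"] by auto
    hence "d 0 / 2 ^ k < u" using u by (simp add: field_simps)
    hence "d (Suc k) / 2 \<le> u" using d_le[of k] dSuc[of k] dpos[of k] by linarith
    thus ?thesis by blast
  qed
  then obtain j where j: "d (Suc j) / 2 \<le> u" "\<And>i. i < j \<Longrightarrow> \<not> d (Suc i) / 2 \<le> u"
    using exists_least_iff[of "\<lambda>j. d (Suc j) / 2 \<le> u"] by auto
  let ?T = "touching (S j) (r j) p q" and ?T' = "touching (S (Suc j)) (r (Suc j)) p q"
  have T1: "card ?T \<le> 1"
  proof (cases j)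
    case 0
    have "card ?T \<le> card (S 0)" using fin[of 0] 0 by (intro card_mono) (auto simp: touching_def)
    thus ?thesis using S0 by auto
  next
    case (Suc i)
    have ud: "u < d j / 2" using j(2)[of i] Suc by simp
    have "x = y" if xy: "x \<in> ?T" "y \<in> ?T" for x y
    proof (rule ccontr)
      assume "x \<noteq> y"
      hence "d j \<le> \<bar>x - y\<bar>" using sep[of j] xy by (auto simp: separated_def touching_def)
      moreover obtain x' y' where "dist x x' \<le> r j" "x' \<in> {p..q}" "dist y y' \<le> r j" "y' \<in> {p..q}"
        using xy by (fastforce simp: touching_def)
      hence "\<bar>x - y\<bar> \<le> 2 * r j + u" by (auto simp: dist_real_def u_def)
      ultimately show False using ud rd[of j] by linarith
    qed
    thus ?thesis by (metis One_nat_def card_le_Suc0_iff_eq fin_touching)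
  qed
  have a1: "card ?T' \<le> M j" using card_touching_Suc[of j p q] T1 mult_le_mono1[OF T1, of "M j"] by linarith
  have a2: "real (card ?T') \<le> 4 * u / d (Suc j)"
  proof -
    have "real (card ?T') \<le> 1 + ((q + r (Suc j)) - (p - r (Suc j))) / d (Suc j)"
    proof (rule card_separated_le)
      show "separated (d (Suc j)) ?T'" using sep[of "Suc j"] by (auto simp: separated_def touching_def)
      show "?T' \<subseteq> {p - r (Suc j)..q + r (Suc j)}"
        unfolding touching_def by (auto simp: dist_real_def)
    qed (use fin_touching dpos pq rpos[of "Suc j"] in auto)
    also have "\<dots> = 1 + u / d (Suc j) + 2 * r (Suc j) / d (Suc j)"
      by (simp add: u_def add_divide_distrib diff_divide_distrib)
    also have "2 * r (Suc j) / d (Suc j) \<le> 1 / 2" using rd[of "Suc j"] dpos[of "Suc j"] by (simp add: field_simps)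
    also have "1 + u / d (Suc j) + 1 / 2 \<le> 4 * u / d (Suc j)"
    proof -
      have "1 / 2 \<le> u / d (Suc j)" using j(1) dpos[of "Suc j"] by (simp add: field_simps)
      thus ?thesis by simp
    qed
    finally show ?thesis by simp
  qed
  define y where "y = 4 * u / (c * r j)"
  have y: "y > 0" using u c rpos[of j] by (simp add: y_def)
  have "real (card ?T') / real (M j) \<le> y powr s"
  proof (cases "y \<ge> 1")
    case True
    have "real (card ?T') / real (M j) \<le> 1" using a1 Mge(2)[of j] by (simp add: divide_le_eq_1)
    also have "1 \<le> y powr s" using True s by (simp add: ge_one_powr_ge_zero)
    finally show ?thesis .
  next
    case False
    have "real (card ?T') / real (M j) \<le> (4 * u / d (Suc j)) / (c * r j / d (Suc j))"
      using a2 Mge(1)[of j] c rpos[of j] dpos[of "Suc j"] u by (intro frac_le) auto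
    also have "\<dots> = y" using dpos[of "Suc j"] by (simp add: y_def)
    also have "y = y powr 1" using y by simp
    also have "\<dots> \<le> y powr s" using False y s by (intro powr_mono') auto
    finally show ?thesis .
  qed
  hence "real (card ?T') / real (card (S (Suc j))) \<le> y powr s / real (card (S j))"
    unfolding card_S_Suc using card_S_pos[of j] Mge(2)[of j] by (simp add: field_simps)
  also have "\<dots> \<le> y powr s * (C * r j powr s)"
  proof -
    have "1 / real (card (S j)) \<le> C * r j powr s" using mass[of j] card_S_pos[of j] by (simp add: field_simps)
    from mult_left_mono[OF this, of "y powr s"] show ?thesis by simp
  qed
  also have "\<dots> = C * (y * r j) powr s" using y rpos[of j] by (simp add: powr_mult)
  also have "y * r j = 4 / c * u" using rpos[of j] by (simp add: y_def)
  also have "(4 / c * u) powr s = (4 / c) powr s * u powr s" by (rule powr_mult)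
  finally have "real (card ?T') / real (card (S (Suc j))) \<le> C * (4 / c) powr s * (q - p) powr s"
    by (simp add: u_def mult.assoc)
  thus ?thesis by blast
qed

lemma touching_bound_eventually:
  assumes "p < q"
  shows "\<forall>\<^sub>F k in sequentially. real (card (touching (S k) (r k) p q)) \<le> C * (4 / c) powr s * (q - p) powr s * real (card (S k))"
proof -
  obtain j where j: "real (card (touching (S (Suc j)) (r (Suc j)) p q)) / real (card (S (Suc j))) \<le> C * (4 / c) powr s * (q - p) powr s"
    using touching_bound[OF assms] by blast
  have "real (card (touching (S k) (r k) p q)) \<le> C * (4 / c) powr s * (q - p) powr s * real (card (S k))" if "k \<ge> Suc j" for k
    using order_trans[OF touching_ratio_antimono[OF that, of p q] j] card_S_pos[of k] by (simp add: divide_le_eq)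
  thus ?thesis unfolding eventually_sequentially by blast
qed

definition level :: "nat \<Rightarrow> real set" where "level k = (\<Union>x\<in>S k. cball x (r k))"

lemma level_Suc: "level (Suc k) \<subseteq> level k"
  unfolding level_def SSuc using ball_child by fastforce

lemma level_antimono: "k \<le> l \<Longrightarrow> level l \<subseteq> level k"
  by (induction l rule: dec_induct) (use level_Suc in auto)

lemma compact_level: "compact (level k)"
  unfolding level_def using fin by (intro compact_UN) auto

text \<open>Mass distribution principle. By compactness finitely many of the intervals cover a whole
  level; at a deep enough level the estimates for all their masses hold at once, and these masses
  sum to at least 1.\<close>

lemma cover_bound:
  assumes V: "(\<Inter>k. level k) \<subseteq> (\<Union>i. {p i<..<q i})" and pq: "\<And>i::nat. p i < q i"
    and sm: "summable (\<lambda>i. (q i - p i) powr s)"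
  shows "1 \<le> C * (4 / c) powr s * (\<Sum>i. (q i - p i) powr s)"
proof -
  have "\<exists>k. level k \<subseteq> (\<Union>i. {p i<..<q i})"
  proof (rule ccontr)
    assume neg: "\<not> ?thesis"
    let ?F = "\<lambda>k. level k - (\<Union>i. {p i<..<q i})"
    have "(\<Inter>k. ?F k) \<noteq> {}"
    proof (rule compact_nest)
      show "compact (?F k)" for k using compact_level by (intro compact_diff open_UN) auto
      show "?F k \<noteq> {}" for k using neg by auto
      show "?F l \<subseteq> ?F k" if "k \<le> l" for k l using level_antimono[OF that] by auto
    qed
    thus False using V by auto
  qed
  then obtain k where k: "level k \<subseteq> (\<Union>i. {p i<..<q i})" by blast
  obtain D where D: "D \<subseteq> UNIV" "finite D" "level k \<subseteq> (\<Union>i\<in>D. {p i<..<q i})"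
    using compactE_image[OF compact_level[of k], of UNIV "\<lambda>i. {p i<..<q i}"] k by auto
  have "\<forall>\<^sub>F l in sequentially. \<forall>i\<in>D. real (card (touching (S l) (r l) (p i) (q i))) \<le> C * (4 / c) powr s * (q i - p i) powr s * real (card (S l))"
    using D(2) touching_bound_eventually[OF pq] by (intro eventually_ball_finite) auto
  hence "\<forall>\<^sub>F l in sequentially. (\<forall>i\<in>D. real (card (touching (S l) (r l) (p i) (q i))) \<le> C * (4 / c) powr s * (q i - p i) powr s * real (card (S l))) \<and> k \<le> l"
    using eventually_ge_at_top[of k] by eventually_elim auto
  then obtain l where l: "k \<le> l" "\<And>i. i \<in> D \<Longrightarrow> real (card (touching (S l) (r l) (p i) (q i))) \<le> C * (4 / c) powr s * (q i - p i) powr s * real (card (S l))"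
    using eventually_sequentially by auto
  have "S l \<subseteq> (\<Union>i\<in>D. touching (S l) (r l) (p i) (q i))"
  proof
    fix x assume x: "x \<in> S l"
    hence "x \<in> level l" using rpos[of l] by (auto simp: level_def intro!: bexI[of _ x])
    hence "x \<in> level k" using level_antimono[OF l(1)] by auto
    then obtain i where "i \<in> D" "x \<in> {p i<..<q i}" using D(3) by auto
    thus "x \<in> (\<Union>i\<in>D. touching (S l) (r l) (p i) (q i))"
      using x rpos[of l] by (intro UN_I[of i]) (auto simp: touching_def disjoint_iff intro!: exI[of _ x])
  qed
  hence "card (S l) \<le> card (\<Union>i\<in>D. touching (S l) (r l) (p i) (q i))"
    using D(2) fin_touching by (intro card_mono) auto
  also have "\<dots> \<le> (\<Sum>i\<in>D. card (touching (S l) (r l) (p i) (q i)))" using D(2) by (rule card_UN_le)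
  finally have "real (card (S l)) \<le> (\<Sum>i\<in>D. real (card (touching (S l) (r l) (p i) (q i))))"
    by (metis of_nat_le_iff of_nat_sum)
  also have "\<dots> \<le> (\<Sum>i\<in>D. C * (4 / c) powr s * (q i - p i) powr s * real (card (S l)))"
    by (intro sum_mono l(2))
  also have "\<dots> = C * (4 / c) powr s * (\<Sum>i\<in>D. (q i - p i) powr s) * real (card (S l))"
    by (simp add: sum_distrib_left sum_distrib_right)
  finally have "1 \<le> C * (4 / c) powr s * (\<Sum>i\<in>D. (q i - p i) powr s)"
    using card_S_pos[of l] by simp
  also have "\<dots> \<le> C * (4 / c) powr s * (\<Sum>i. (q i - p i) powr s)"
    using C sm D(2) by (intro mult_left_mono sum_le_suminf) auto
  finally show ?thesis .
qed

end


section \<open>Construction of a Cantor scheme inside a limsup set\<close>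

lemma powr_neg_eventually_le:
  assumes "g > 0" "\<epsilon> > 0"
  shows "\<forall>\<^sub>F t in sequentially. real t powr (- g) \<le> \<epsilon>"
proof -
  have "((\<lambda>t. real t powr (- g)) \<longlongrightarrow> 0) sequentially"
    using assms by (intro tendsto_neg_powr filterlim_real_sequentially) auto
  hence "\<forall>\<^sub>F t in sequentially. real t powr (- g) < \<epsilon>" using assms(2) by (rule order_tendstoD(2))
  thus ?thesis by eventually_elim simp
qed

text \<open>One level as a triple of separation, radius and centres, with the invariants that do not
  refer to the parent level, as dependent choice requires.\<close>

definition cantor_state :: "real \<Rightarrow> real \<Rightarrow> real \<Rightarrow> real \<Rightarrow> real \<times> real \<times> real set \<Rightarrow> bool" where
  "cantor_state a0 b0 C s = (\<lambda>(d, r, S). d > 0 \<and> r > 0 \<and> r \<le> d / 4 \<and> finite S \<and> S \<noteq> {} \<and> separated d S \<and>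
      (\<forall>x\<in>S. cball x r \<subseteq> {a0..b0}) \<and> 1 \<le> C * real (card S) * r powr s)"

definition cantor_step :: "(nat \<Rightarrow> real set) \<Rightarrow> real \<Rightarrow> nat \<Rightarrow> real \<times> real \<times> real set \<Rightarrow> real \<times> real \<times> real set
    \<Rightarrow> (real \<Rightarrow> real set) \<Rightarrow> nat \<Rightarrow> nat \<Rightarrow> bool" where
  "cantor_step G c k = (\<lambda>(d, r, S) (d', r', S') ch M t. k < t \<and> S' = (\<Union>x\<in>S. ch x) \<and>
      (\<forall>x\<in>S. ch x \<subseteq> cball x (r / 2) \<and> card (ch x) = M) \<and> c * r / d' \<le> real M \<and> M > 0 \<and>
      r' \<le> r / 2 \<and> d' \<le> d / 2 \<and> (\<forall>x\<in>S'. cball x r' \<subseteq> G t))"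

text \<open>One t is taken so large that it serves all of the finitely many centres, and the
  candidates near each of them are cut down to the same number M, the ceiling of c r t^g. The
  children of a single centre already secure the mass condition: M r'^s is at least c r t^(g - w s),
  and w s < g.\<close>

lemma cantor_step_exists:
  assumes c: "c > 0" and gw: "0 < g" "g < w" and s: "0 < s" "s < g / w" and C: "C \<ge> 1"
    and dense: "\<And>a b. a0 \<le> a \<Longrightarrow> a < b \<Longrightarrow> b \<le> b0 \<Longrightarrow> \<forall>\<^sub>F t in sequentially.
       \<exists>T. finite T \<and> T \<subseteq> {a..b} \<and> c * (b - a) * real t powr g \<le> real (card T) \<and>
          separated (real t powr (- g)) T \<and> (\<forall>x\<in>T. cball x (real t powr (- w)) \<subseteq> G t)"
    and st: "cantor_state a0 b0 C s \<sigma>"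
  shows "\<exists>\<sigma>' ch M t. cantor_state a0 b0 C s \<sigma>' \<and> cantor_step G c k \<sigma> \<sigma>' ch M t"
proof -
  obtain d r S where \<sigma>: "\<sigma> = (d, r, S)" by (cases \<sigma>) auto
  have st': "d > 0" "r > 0" "r \<le> d / 4" "finite S" "S \<noteq> {}" "separated d S"
      "\<And>x. x \<in> S \<Longrightarrow> cball x r \<subseteq> {a0..b0}" "1 \<le> C * real (card S) * r powr s"
    using st unfolding \<sigma> cantor_state_def by auto
  have gws: "0 < g - w * s" using s gw by (simp add: field_simps)
  have ev1: "\<forall>\<^sub>F t in sequentially. \<forall>x\<in>S.
       \<exists>T. finite T \<and> T \<subseteq> {x - r / 2..x + r / 2} \<and> c * r * real t powr g \<le> real (card T) \<and>
          separated (real t powr (- g)) T \<and> (\<forall>x\<in>T. cball x (real t powr (- w)) \<subseteq> G t)"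
  proof (intro eventually_ball_finite st'(4) ballI)
    fix x assume "x \<in> S"
    hence "{x - r .. x + r} \<subseteq> {a0..b0}" using st'(7) by (simp add: cball_eq_atLeastAtMost)
    hence "a0 \<le> x - r / 2" "x + r / 2 \<le> b0" using st'(2) by auto
    from dense[OF this(1) _ this(2)] st'(2)
    show "\<forall>\<^sub>F t in sequentially. \<exists>T. finite T \<and> T \<subseteq> {x - r / 2..x + r / 2} \<and> c * r * real t powr g \<le> real (card T) \<and>
          separated (real t powr (- g)) T \<and> (\<forall>x\<in>T. cball x (real t powr (- w)) \<subseteq> G t)" by simp
  qed
  have "\<forall>\<^sub>F t in sequentially. real t powr (- g) \<le> d / 2" using gw st' by (intro powr_neg_eventually_le) auto
  moreover have "\<forall>\<^sub>F t in sequentially. real t powr (- w) \<le> r / 2" using gw st' by (intro powr_neg_eventually_le) auto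
  moreover have "\<forall>\<^sub>F t in sequentially. real t powr (- (w - g)) \<le> 1 / 4" using gw by (intro powr_neg_eventually_le) auto
  moreover have "\<forall>\<^sub>F t in sequentially. real t powr (- (g - w * s)) \<le> c * r"
    using gws c st' by (intro powr_neg_eventually_le) auto
  moreover have "\<forall>\<^sub>F t in sequentially. max 1 k < t" by (rule eventually_gt_at_top)
  ultimately have "\<forall>\<^sub>F t in sequentially. max 1 k < t \<and> real t powr (- g) \<le> d / 2 \<and> real t powr (- w) \<le> r / 2 \<and>
      real t powr (- (w - g)) \<le> 1 / 4 \<and> real t powr (- (g - w * s)) \<le> c * r \<and> (\<forall>x\<in>S.
       \<exists>T. finite T \<and> T \<subseteq> {x - r / 2..x + r / 2} \<and> c * r * real t powr g \<le> real (card T) \<and>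
          separated (real t powr (- g)) T \<and> (\<forall>x\<in>T. cball x (real t powr (- w)) \<subseteq> G t))"
    using ev1 by eventually_elim auto
  from eventually_happens'[OF sequentially_bot this] obtain t where big: "max 1 k < t \<and> real t powr (- g) \<le> d / 2 \<and> real t powr (- w) \<le> r / 2 \<and>
      real t powr (- (w - g)) \<le> 1 / 4 \<and> real t powr (- (g - w * s)) \<le> c * r \<and> (\<forall>x\<in>S.
       \<exists>T. finite T \<and> T \<subseteq> {x - r / 2..x + r / 2} \<and> c * r * real t powr g \<le> real (card T) \<and>
          separated (real t powr (- g)) T \<and> (\<forall>x\<in>T. cball x (real t powr (- w)) \<subseteq> G t))"
    by (rule exE)
  note t = big[THEN conjunct1] big[THEN conjunct2, THEN conjunct1] big[THEN conjunct2, THEN conjunct2, THEN conjunct1]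
    big[THEN conjunct2, THEN conjunct2, THEN conjunct2, THEN conjunct1]
    big[THEN conjunct2, THEN conjunct2, THEN conjunct2, THEN conjunct2, THEN conjunct1]
  note T = big[THEN conjunct2, THEN conjunct2, THEN conjunct2, THEN conjunct2, THEN conjunct2]
  define M where "M = nat \<lceil>c * r * real t powr g\<rceil>"
  define d' where "d' = real t powr (- g)"
  define r' where "r' = real t powr (- w)"
  have t0: "real t > 0" using t(1) by simp
  have pos: "c * r * real t powr g > 0" using c st' t0 by simp
  have Mpos: "M > 0" using pos by (simp add: M_def)
  have Mge: "c * r * real t powr g \<le> real M" using pos unfolding M_def by linarith
  have "\<forall>x\<in>S. \<exists>T. T \<subseteq> {x - r / 2..x + r / 2} \<and> card T = M \<and>
          separated (real t powr (- g)) T \<and> (\<forall>x\<in>T. cball x (real t powr (- w)) \<subseteq> G t)"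
  proof
    fix x assume xS: "x \<in> S"
    from bspec[OF T xS] obtain W where W0: "finite W \<and> W \<subseteq> {x - r / 2..x + r / 2} \<and> c * r * real t powr g \<le> real (card W) \<and>
          separated (real t powr (- g)) W \<and> (\<forall>x\<in>W. cball x (real t powr (- w)) \<subseteq> G t)"
      by (rule exE)
    note W = W0[THEN conjunct1] W0[THEN conjunct2, THEN conjunct1] W0[THEN conjunct2, THEN conjunct2, THEN conjunct1]
      W0[THEN conjunct2, THEN conjunct2, THEN conjunct2, THEN conjunct1]
      W0[THEN conjunct2, THEN conjunct2, THEN conjunct2, THEN conjunct2]
    have "M \<le> card W" using W(3) unfolding M_def by (simp add: ceiling_le_iff nat_le_iff)
    then obtain T' where T': "T' \<subseteq> W" "card T' = M" by (rule obtain_subset_with_card_n)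
    have "T' \<subseteq> {x - r / 2..x + r / 2}" using T'(1) W(2) by (rule subset_trans)
    moreover have "separated (real t powr (- g)) T'" using T'(1) W(4) unfolding separated_def by blast
    moreover have "\<forall>x\<in>T'. cball x (real t powr (- w)) \<subseteq> G t" using T'(1) W(5) by blast
    ultimately show "\<exists>T. T \<subseteq> {x - r / 2..x + r / 2} \<and> card T = M \<and>
          separated (real t powr (- g)) T \<and> (\<forall>x\<in>T. cball x (real t powr (- w)) \<subseteq> G t)"
      using T'(2) by (intro exI[of _ T'] conjI)
  qed
  from bchoice[OF this] obtain ch where ch0: "\<forall>x\<in>S. ch x \<subseteq> {x - r / 2..x + r / 2} \<and> card (ch x) = M \<and>
          separated (real t powr (- g)) (ch x) \<and> (\<forall>x\<in>ch x. cball x (real t powr (- w)) \<subseteq> G t)"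
    by (rule exE)
  have ch: "\<And>x. x \<in> S \<Longrightarrow> ch x \<subseteq> {x - r / 2..x + r / 2}" "\<And>x. x \<in> S \<Longrightarrow> card (ch x) = M"
      "\<And>x. x \<in> S \<Longrightarrow> separated d' (ch x)" "\<And>x y. x \<in> S \<Longrightarrow> y \<in> ch x \<Longrightarrow> cball y r' \<subseteq> G t"
    using ch0 unfolding d'_def r'_def by blast+
  define S' where "S' = (\<Union>x\<in>S. ch x)"
  have finch: "finite (ch x)" if "x \<in> S" for x using ch(2)[OF that] Mpos card.infinite by fastforce
  have d'0: "d' > 0" and r'0: "r' > 0" using t0 by (auto simp: d'_def r'_def)
  have r'd': "r' \<le> d' / 4"
  proof -
    have "r' = d' * real t powr (- (w - g))" unfolding r'_def d'_def by (simp add: powr_add[symmetric])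
    also have "\<dots> \<le> d' * (1 / 4)" using t(4) d'0 by (intro mult_left_mono) auto
    finally show ?thesis by simp
  qed
  have sep': "separated d' S'"
    unfolding separated_def
  proof (intro ballI impI)
    fix x y assume xy: "x \<in> S'" "y \<in> S'" "x \<noteq> y"
    obtain u v where uv: "u \<in> S" "x \<in> ch u" "v \<in> S" "y \<in> ch v" using xy by (auto simp: S'_def)
    show "d' \<le> \<bar>x - y\<bar>"
    proof (cases "u = v")
      case True thus ?thesis using ch(3)[of u] uv xy by (auto simp: separated_def)
    next
      case False
      hence "d \<le> \<bar>u - v\<bar>" using st'(6) uv by (auto simp: separated_def)
      moreover have "x \<in> {u - r / 2..u + r / 2}" "y \<in> {v - r / 2..v + r / 2}" using ch(1) uv by blast+
      ultimately show ?thesis using st'(1,3) t(2) unfolding d'_def atLeastAtMost_iff by linarith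
    qed
  qed
  have cardS': "M \<le> card S'"
  proof -
    obtain x where "x \<in> S" using st'(5) by auto
    thus ?thesis using ch(2) finch st'(4) by (auto simp: S'_def intro!: card_mono)
  qed
  have "S' \<noteq> {}" using cardS' Mpos by auto
  moreover have "finite S'" using finch st'(4) by (auto simp: S'_def)
  moreover have "\<forall>x\<in>S'. cball x r' \<subseteq> {a0..b0}"
  proof
    fix x assume "x \<in> S'"
    then obtain u where u: "u \<in> S" "x \<in> ch u" by (auto simp: S'_def)
    hence "x \<in> {u - r / 2..u + r / 2}" using ch(1) by blast
    hence "cball x r' \<subseteq> cball u r" using t(3) unfolding r'_def[symmetric] by (auto simp: cball_eq_atLeastAtMost)
    thus "cball x r' \<subseteq> {a0..b0}" using st'(7)[OF u(1)] by blast
  qed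
  moreover have "1 \<le> C * real (card S') * r' powr s"
  proof -
    have "real t powr (- (g - w * s)) * (real t powr g * r' powr s) = 1"
      using t0 by (simp add: r'_def powr_powr powr_add[symmetric])
    hence "1 \<le> c * r * (real t powr g * r' powr s)"
      using mult_right_mono[OF t(5), of "real t powr g * r' powr s"] by simp
    also have "\<dots> = (c * r * real t powr g) * r' powr s" by simp
    also have "\<dots> \<le> real (card S') * r' powr s" using Mge cardS' by (intro mult_right_mono) auto
    also have "\<dots> \<le> C * (real (card S') * r' powr s)"
      using mult_right_mono[OF C, of "real (card S') * r' powr s"] by simp
    finally show ?thesis by (simp add: mult.assoc)
  qed
  ultimately have "cantor_state a0 b0 C s (d', r', S')"
    unfolding cantor_state_def using d'0 r'0 r'd' sep' by auto
  moreover have "cantor_step G c k \<sigma> (d', r', S') ch M t"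
    unfolding cantor_step_def \<sigma> split
  proof (intro conjI ballI)
    show "k < t" using t(1) by simp
    show "S' = (\<Union>x\<in>S. ch x)" by (rule S'_def)
    show "ch x \<subseteq> cball x (r / 2)" if "x \<in> S" for x using ch(1)[OF that] by (simp add: cball_eq_atLeastAtMost)
    show "card (ch x) = M" if "x \<in> S" for x by (rule ch(2)[OF that])
    show "c * r / d' \<le> real M" using Mge by (simp add: d'_def powr_minus divide_inverse)
    show "r' \<le> r / 2" "d' \<le> d / 2" using t(2,3) by (simp_all only: r'_def d'_def)
    show "cball x r' \<subseteq> G t" if "x \<in> S'" for x using ch(4) that by (auto simp only: S'_def)
  qed (rule Mpos)
  ultimately show ?thesis by blast
qed

text \<open>The hypothesis is local ubiquity: every interval contains a number of centres
  proportional to its length times t^g, at spacing t^(-g), whose balls of radius t^(-w) lie in G t.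
  A null s0-measure for some s0 < g / w would contradict the mass distribution principle for an s
  between s0 and g / w.\<close>

theorem hausdorff_dim_limsup_ge:
  fixes G :: "nat \<Rightarrow> real set"
  assumes c: "c > 0" and gw: "0 < g" "g < w" and ab: "a0 < b0"
    and dense: "\<And>a b. a0 \<le> a \<Longrightarrow> a < b \<Longrightarrow> b \<le> b0 \<Longrightarrow> \<forall>\<^sub>F t in sequentially.
       \<exists>T. finite T \<and> T \<subseteq> {a..b} \<and> c * (b - a) * real t powr g \<le> real (card T) \<and>
          separated (real t powr (- g)) T \<and> (\<forall>x\<in>T. cball x (real t powr (- w)) \<subseteq> G t)"
  shows "ereal (g / w) \<le> hausdorff_dim {x. \<exists>\<^sub>F t in sequentially. x \<in> G t}"
  unfolding hausdorff_dim_def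
proof (rule Inf_greatest)
  fix z assume "z \<in> ereal ` {s. 0 \<le> s \<and> hausdorff_measure s {x. \<exists>\<^sub>F t in sequentially. x \<in> G t} = 0}"
  then obtain s0 where s0: "z = ereal s0" "0 \<le> s0" "hausdorff_measure s0 {x. \<exists>\<^sub>F t in sequentially. x \<in> G t} = 0" by auto
  show "ereal (g / w) \<le> z"
  proof (rule ccontr)
    assume "\<not> ?thesis"
    hence lt: "s0 < g / w" using s0(1) by simp
    obtain s where s': "s0 < s" "s < g / w" using dense_order_class.dense[OF lt] by blast
    have s: "s0 < s" "s < g / w" "0 < s" using s' s0(2) by auto
    have s1: "s \<le> 1" using s(2) gw by (simp add: divide_less_eq_1_pos order.strict_trans[of s "g / w" 1] less_imp_le)
    define r0 where "r0 = (b0 - a0) / 2"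
    have r0: "r0 > 0" using ab by (simp add: r0_def)
    \<comment> \<open>Chosen so that the single ball of level 0 satisfies the mass
      condition.\<close>
    define C where "C = max 1 (r0 powr (- s))"
    have C1: "C \<ge> 1" by (simp add: C_def)
    have init: "cantor_state a0 b0 C s (4 * r0, r0, {(a0 + b0) / 2})"
    proof -
      have "1 = r0 powr (- s) * r0 powr s" using r0 by (simp add: powr_minus)
      also have "\<dots> \<le> C * r0 powr s" unfolding C_def by (intro mult_right_mono) auto
      finally show ?thesis unfolding cantor_state_def using r0
        by (auto simp: separated_def cball_eq_atLeastAtMost r0_def field_simps)
    qed
    have step: "\<exists>\<sigma>' ch M t. cantor_state a0 b0 C s \<sigma>' \<and> cantor_step G c k \<sigma> \<sigma>' ch M t"
      if "cantor_state a0 b0 C s \<sigma>" for \<sigma> k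
      by (rule cantor_step_exists[OF c gw s(3,2) C1 dense that])
    obtain \<sigma> where \<sigma>0: "\<sigma> 0 = (4 * r0, r0, {(a0 + b0) / 2})" and \<sigma>: "\<And>k. cantor_state a0 b0 C s (\<sigma> k)"
       "\<And>k. \<exists>ch M t. cantor_step G c k (\<sigma> k) (\<sigma> (Suc k)) ch M t"
    proof -
      have "\<exists>\<sigma>. \<forall>k. (cantor_state a0 b0 C s (\<sigma> k) \<and> (k = 0 \<longrightarrow> \<sigma> k = (4 * r0, r0, {(a0 + b0) / 2}))) \<and>
          (\<exists>ch M t. cantor_step G c k (\<sigma> k) (\<sigma> (Suc k)) ch M t)"
      proof (rule dependent_nat_choice)
        show "\<exists>\<sigma>. cantor_state a0 b0 C s \<sigma> \<and> (0 = (0::nat) \<longrightarrow> \<sigma> = (4 * r0, r0, {(a0 + b0) / 2}))"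
          using init by simp
      next
        fix \<sigma> and k :: nat assume "cantor_state a0 b0 C s \<sigma> \<and> (k = 0 \<longrightarrow> \<sigma> = (4 * r0, r0, {(a0 + b0) / 2}))"
        then obtain \<sigma>' ch M t where "cantor_state a0 b0 C s \<sigma>'" "cantor_step G c k \<sigma> \<sigma>' ch M t"
          using step[of \<sigma> k] by auto
        thus "\<exists>\<sigma>'. (cantor_state a0 b0 C s \<sigma>' \<and> (Suc k = 0 \<longrightarrow> \<sigma>' = (4 * r0, r0, {(a0 + b0) / 2}))) \<and>
            (\<exists>ch M t. cantor_step G c k \<sigma> \<sigma>' ch M t)"
          by (intro exI[of _ \<sigma>'] conjI impI) (blast | simp)+
      qed
      thus ?thesis using that by blast
    qed
    then obtain ch M t where cst: "\<And>k. cantor_step G c k (\<sigma> k) (\<sigma> (Suc k)) (ch k) (M k) (t k)" by metis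
    define d where "d k = fst (\<sigma> k)" for k
    define r where "r k = fst (snd (\<sigma> k))" for k
    define S where "S k = snd (snd (\<sigma> k))" for k
    have \<sigma>e: "\<sigma> k = (d k, r k, S k)" for k by (simp add: d_def r_def S_def)
    note st = \<sigma>(1)[unfolded \<sigma>e cantor_state_def split]
    note sp = cst[unfolded \<sigma>e cantor_step_def split]
    interpret cantor_scheme d r S ch M c C s
    proof
      have "S 0 = {(a0 + b0) / 2}" using \<sigma>0 by (simp add: S_def)
      thus "\<exists>x. S 0 = {x}" by blast
    qed (use c C1 s s1 st sp in auto)
    have sub: "(\<Inter>k. level k) \<subseteq> {x. \<exists>\<^sub>F t in sequentially. x \<in> G t}"
    proof
      fix x assume x: "x \<in> (\<Inter>k. level k)"
      have "x \<in> G (t k)" for k using x sp[of k] by (force simp: level_def)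
      moreover have "k < t k" for k using sp[of k] by auto
      ultimately have "\<exists>t\<ge>n. x \<in> G t" for n by (meson less_imp_le)
      thus "x \<in> {x. \<exists>\<^sub>F t in sequentially. x \<in> G t}"
        by (auto simp: frequently_sequentially)
    qed
    let ?A = "{x. \<exists>\<^sub>F t in sequentially. x \<in> G t}"
    define K where "K = C * (4 / c) powr s * 4 powr s"
    have K: "K > 0" using C1 c by (simp add: K_def)
    define \<eta> where "\<eta> = 1 / (4 * K)"
    have \<eta>: "\<eta> > 0" using K by (simp add: \<eta>_def)
    have "hausdorff_premeasure s0 1 ?A = 0"
    proof -
      have "hausdorff_premeasure s0 1 ?A \<le> hausdorff_measure s0 ?A"
        unfolding hausdorff_measure_def by (rule SUP_upper) auto
      thus ?thesis using s0(3) by simp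
    qed
    hence "hausdorff_premeasure s0 1 ?A < ennreal \<eta>" using \<eta> by simp
    then obtain U :: "nat \<Rightarrow> real set" where U: "?A \<subseteq> (\<Union>i. U i)" "\<And>i. bounded (U i)" "\<And>i. diameter (U i) \<le> 1"
       "(\<Sum>i. ennreal (diam_pow s0 (U i))) < ennreal \<eta>"
      unfolding hausdorff_premeasure_def INF_less_iff by auto
    define D where "D i = diameter (U i)" for i
    have D0: "D i \<ge> 0" for i unfolding D_def by (rule diameter_ge_0) (use U in auto)
    have Dp: "D i powr s \<le> diam_pow s0 (U i)" for i
    proof (cases "U i = {}")
      case True thus ?thesis by (simp add: D_def diam_pow_def)
    next
      case False
      show ?thesis
      proof (cases "s0 = 0")
        case True thus ?thesis using False D0[of i] U(3)[of i] s by (simp add: diam_pow_def D_def powr_le1)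
      next
        case ne: False
        show ?thesis
        proof (cases "D i = 0")
          case True thus ?thesis using False ne by (simp add: diam_pow_def D_def)
        next
          case f: False
          hence "D i powr s \<le> D i powr s0" using D0[of i] U(3)[of i] s' by (intro powr_mono') (auto simp: D_def)
          thus ?thesis using False ne by (simp add: diam_pow_def D_def)
        qed
      qed
    qed
    have dp0: "diam_pow s0 (U i) \<ge> 0" for i by (simp add: diam_pow_def)
    have fin': "(\<Sum>i. ennreal (diam_pow s0 (U i))) \<noteq> Orderings.top" using less_trans[OF U(4) ennreal_less_top] by simp
    have smU: "summable (\<lambda>i. diam_pow s0 (U i))" by (rule summable_suminf_not_top[OF dp0 fin'])
    have sumU: "(\<Sum>i. diam_pow s0 (U i)) < \<eta>"
      using U(4) suminf_ennreal2[OF dp0 smU] \<eta> by (simp add: ennreal_less_iff suminf_nonneg[OF smU dp0])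
    \<comment> \<open>Covering sets may have diameter 0 and need not be open, so each is enlarged by
      \<tau> i, at a total cost \<eta> in s-th powers. The contradiction is that the resulting bound
      K (\<eta> + \<eta>) is 1 / 2.\<close>
    define \<tau> where "\<tau> i = (\<eta> * (1/2) ^ Suc i) powr (1 / s)" for i :: nat
    have \<tau>: "\<tau> i > 0" "\<tau> i powr s = \<eta> * (1/2) ^ Suc i" for i
      using \<eta> s by (auto simp: \<tau>_def powr_powr)
    define x where "x i = (SOME y. y \<in> U i)" for i
    define v where "v i = 2 * max (D i) (\<tau> i)" for i
    have v: "v i > 0" for i using \<tau>(1)[of i] by (simp add: v_def less_max_iff_disj)
    have cov: "(\<Inter>k. level k) \<subseteq> (\<Union>i. {x i - v i<..<x i + v i})"
    proof
      fix y assume "y \<in> (\<Inter>k. level k)"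
      then obtain i where i: "y \<in> U i" using sub U(1) by blast
      hence "x i \<in> U i" unfolding x_def by (rule someI)
      hence "dist y (x i) \<le> D i" using i U(2) unfolding D_def by (intro diameter_bounded_bound) auto
      also have "D i < v i" using \<tau>(1)[of i] D0[of i] by (auto simp: v_def max_def)
      finally show "y \<in> (\<Union>i. {x i - v i<..<x i + v i})" by (intro UN_I[of i]) (auto simp: dist_real_def)
    qed
    have len: "(x i + v i - (x i - v i)) powr s \<le> 4 powr s * (diam_pow s0 (U i) + \<eta> * (1/2) ^ Suc i)" for i
    proof -
      have "(x i + v i - (x i - v i)) powr s = 4 powr s * max (D i) (\<tau> i) powr s"
        using \<tau>(1)[of i] by (simp add: v_def powr_mult[symmetric] D0)
      also have "max (D i) (\<tau> i) powr s \<le> D i powr s + \<tau> i powr s" by (auto simp: max_def)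
      also have "\<dots> \<le> diam_pow s0 (U i) + \<eta> * (1/2) ^ Suc i" using Dp[of i] \<tau>(2)[of i] by simp
      finally show ?thesis by (simp add: mult_left_mono)
    qed
    have geo: "(\<lambda>i. \<eta> * (1/2) ^ Suc i) sums \<eta>"
      using sums_mult[OF power_half_series, of \<eta>] by simp
    have smr: "summable (\<lambda>i. 4 powr s * (diam_pow s0 (U i) + \<eta> * (1/2) ^ Suc i))"
      by (rule summable_mult[OF summable_add[OF smU sums_summable[OF geo]]])
    have sml: "summable (\<lambda>i. (x i + v i - (x i - v i)) powr s)"
      by (rule summable_comparison_test[OF _ smr]) (use len in auto)
    have "1 \<le> C * (4 / c) powr s * (\<Sum>i. (x i + v i - (x i - v i)) powr s)"
      by (rule cover_bound[OF cov _ sml]) (use v in \<open>auto simp: less_diff_eq intro: add_strict_mono\<close>)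
    also have "\<dots> \<le> C * (4 / c) powr s * (\<Sum>i. 4 powr s * (diam_pow s0 (U i) + \<eta> * (1/2) ^ Suc i))"
      using C1 by (intro mult_left_mono suminf_le len sml smr) auto
    also have "(\<Sum>i. 4 powr s * (diam_pow s0 (U i) + \<eta> * (1/2) ^ Suc i)) = 4 powr s * ((\<Sum>i. diam_pow s0 (U i)) + \<eta>)"
    proof -
      have "(\<Sum>i. 4 powr s * (diam_pow s0 (U i) + \<eta> * (1/2) ^ Suc i)) = 4 powr s * (\<Sum>i. diam_pow s0 (U i) + \<eta> * (1/2) ^ Suc i)"
        by (rule suminf_mult[OF summable_add[OF smU sums_summable[OF geo]]])
      also have "(\<Sum>i. diam_pow s0 (U i) + \<eta> * (1/2) ^ Suc i) = (\<Sum>i. diam_pow s0 (U i)) + \<eta>"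
        using suminf_add[OF smU sums_summable[OF geo]] sums_unique[OF geo] by simp
      finally show ?thesis .
    qed
    also have "C * (4 / c) powr s * (4 powr s * ((\<Sum>i. diam_pow s0 (U i)) + \<eta>)) = K * ((\<Sum>i. diam_pow s0 (U i)) + \<eta>)"
      by (simp add: K_def)
    also have "\<dots> < K * (\<eta> + \<eta>)" using sumU K by (intro mult_strict_left_mono) auto
    also have "\<dots> = 1 / 2" using K by (simp add: \<eta>_def)
    finally show False by simp
  qed
qed

subsection \<open>Simultaneous approximation near roots of integer polynomials\<close>

lemma floor_div_eq_imp_close:
  fixes a b Y :: real
  assumes "\<lfloor>a / Y\<rfloor> = \<lfloor>b / Y\<rfloor>" "Y > 0"
  shows "\<bar>a - b\<bar> \<le> Y"
proof -
  have "\<bar>a / Y - b / Y\<bar> < 1" using assms(1) by linarith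
  hence "\<bar>a - b\<bar> / Y < 1" using assms(2) by (simp add: diff_divide_distrib[symmetric] abs_divide)
  thus ?thesis using assms(2) by (simp add: divide_less_eq)
qed

text \<open>Pigeonhole over the multiples x \<alpha>^i. The recurrence applied to integer parts,
  \<open>q x k\<close>, takes at most 4 H + 1 values because fractional parts lie in [0, 1); only
  the first n fractional parts are localised to precision Y. For two x with the same data the errors
  of the difference satisfy the recurrence exactly, and dominance of the leading coefficient carries
  the bound Y from the first n errors to all. Thus the other N + 1 - n coordinates each cost a
  factor of order H instead of 1 / Y.\<close>

lemma recurrence_approx:
  fixes a :: "nat \<Rightarrow> int" and H :: nat
  assumes nN: "n \<le> N" and dom: "(\<Sum>j<n. \<bar>a j\<bar>) \<le> a n" and an: "1 \<le> a n" "a n \<le> int H"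
    and root: "(\<Sum>j\<le>n. of_int (a j) * \<alpha> ^ j) = (0::real)" and Y: "Y > 0"
    and count: "(4 * real H + 1) ^ (N + 1 - n) * (1 / Y + 1) ^ n < real X"
  shows "\<exists>(x::int) y. 1 \<le> x \<and> x \<le> int X \<and> (\<forall>i\<le>N. \<bar>\<alpha> ^ i * of_int x - of_int (y i :: int)\<bar> \<le> Y)"
proof -
  define v where "v x i = \<lfloor>\<alpha> ^ i * real x\<rfloor>" for x i :: nat
  define e where "e x i = \<alpha> ^ i * real x - of_int (v x i)" for x i
  have e01: "0 \<le> e x i" "e x i < 1" for x i unfolding e_def v_def by linarith+
  define q where "q x k = (\<Sum>j\<le>n. a j * v x (k + j))" for x k
  have root': "(\<Sum>j\<le>n. of_int (a j) * \<alpha> ^ (k + j)) = 0" for k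
  proof -
    have "(\<Sum>j\<le>n. of_int (a j) * \<alpha> ^ (k + j)) = \<alpha> ^ k * (\<Sum>j\<le>n. of_int (a j) * \<alpha> ^ j)"
      by (simp add: power_add sum_distrib_left mult_ac)
    thus ?thesis by (simp add: root)
  qed
  have qe: "of_int (q x k) = - (\<Sum>j\<le>n. of_int (a j) * e x (k + j))" for x k
  proof -
    have "(\<Sum>j\<le>n. of_int (a j) * e x (k + j)) =
        (\<Sum>j\<le>n. (of_int (a j) * \<alpha> ^ (k + j)) * real x - of_int (a j * v x (k + j)))"
      by (intro sum.cong refl) (simp add: e_def algebra_simps)
    also have "\<dots> = (\<Sum>j\<le>n. of_int (a j) * \<alpha> ^ (k + j)) * real x - of_int (q x k)"
      by (simp only: sum_subtractf sum_distrib_right[symmetric] q_def of_int_sum)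
    finally have "(\<Sum>j\<le>n. of_int (a j) * e x (k + j)) = (\<Sum>j\<le>n. of_int (a j) * \<alpha> ^ (k + j)) * real x - of_int (q x k)" .
    thus ?thesis by (simp add: root')
  qed
  have suma: "(\<Sum>j\<le>n. \<bar>a j\<bar>) \<le> 2 * int H"
    using dom an by (simp add: lessThan_Suc_atMost[symmetric])
  have qb: "\<bar>q x k\<bar> \<le> 2 * int H" for x k
  proof -
    have "\<bar>of_int (q x k) :: real\<bar> \<le> (\<Sum>j\<le>n. \<bar>of_int (a j) * e x (k + j)\<bar>)"
      unfolding qe abs_minus_cancel by (rule sum_abs)
    also have "\<dots> \<le> (\<Sum>j\<le>n. \<bar>of_int (a j)\<bar>)"
      using e01 by (intro sum_mono) (simp add: abs_mult mult_left_le less_imp_le)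
    also have "\<dots> = of_int (\<Sum>j\<le>n. \<bar>a j\<bar>)" by simp
    also have "\<dots> \<le> of_int (2 * int H)" using suma by (simp only: of_int_le_iff)
    finally show ?thesis by (simp only: of_int_abs[symmetric] of_int_le_iff)
  qed
  define f where "f x = (\<lambda>k\<in>{..N - n}. q x k, \<lambda>i\<in>{..<n}. \<lfloor>e x i / Y\<rfloor>)" for x
  define T where "T = PiE {..N - n} (\<lambda>_. {- 2 * int H..2 * int H}) \<times> PiE {..<n} (\<lambda>_. {0..\<lfloor>1 / Y\<rfloor>})"
  have "finite T" unfolding T_def by (intro finite_cartesian_product finite_PiE) auto
  have fT: "f x \<in> T" for x
  proof -
    have "\<lfloor>e x i / Y\<rfloor> \<le> \<lfloor>1 / Y\<rfloor>" for i using e01[of x i] Y by (intro floor_mono divide_right_mono) auto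
    moreover have "- (2 * int H) \<le> q x k" "q x k \<le> 2 * int H" for k using qb[of x k] by auto
    ultimately show ?thesis unfolding f_def T_def using e01 Y by auto
  qed
  have cardT: "real (card T) \<le> (4 * real H + 1) ^ (N + 1 - n) * (1 / Y + 1) ^ n"
  proof -
    have "card T = (nat (4 * int H + 1)) ^ (N - n + 1) * (nat (\<lfloor>1 / Y\<rfloor> + 1)) ^ n"
      unfolding T_def by (simp add: card_cartesian_product card_PiE algebra_simps)
    also have "real \<dots> = real (nat (4 * int H + 1)) ^ (N + 1 - n) * real (nat (\<lfloor>1 / Y\<rfloor> + 1)) ^ n"
      using nN by (simp add: Suc_diff_le)
    also have "\<dots> \<le> (4 * real H + 1) ^ (N + 1 - n) * (1 / Y + 1) ^ n"
    proof (intro mult_mono power_mono)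
      have "0 \<le> \<lfloor>1 / Y\<rfloor>" using Y by simp
      hence "real (nat (\<lfloor>1 / Y\<rfloor> + 1)) = of_int \<lfloor>1 / Y\<rfloor> + 1" by simp
      thus "real (nat (\<lfloor>1 / Y\<rfloor> + 1)) \<le> 1 / Y + 1" by linarith
    qed (use Y in auto)
    finally show ?thesis .
  qed
  have "\<not> inj_on f {0..X}"
  proof
    assume "inj_on f {0..X}"
    hence "card {0..X} \<le> card T" using fT \<open>finite T\<close> by (intro card_inj_on_le[of f]) auto
    hence "real X + 1 \<le> real (card T)" by simp
    thus False using cardT count by linarith
  qed
  then obtain x1 x2 where x12: "x1 \<le> X" "x2 \<le> X" "x1 < x2" "f x1 = f x2"
    unfolding inj_on_def by (metis atLeastAtMost_iff linorder_neqE_nat)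
  define x where "x = int x2 - int x1"
  define y where "y i = v x2 i - v x1 i" for i
  define E where "E i = \<alpha> ^ i * of_int x - of_int (y i)" for i
  have Ee: "E i = e x2 i - e x1 i" for i by (simp add: E_def e_def x_def y_def algebra_simps)
  have f1: "q x1 k = q x2 k" if "k \<le> N - n" for k
  proof -
    have "fst (f x1) k = fst (f x2) k" using x12(4) by simp
    thus ?thesis using that by (simp add: f_def)
  qed
  have f2: "\<lfloor>e x1 i / Y\<rfloor> = \<lfloor>e x2 i / Y\<rfloor>" if "i < n" for i
  proof -
    have "snd (f x1) i = snd (f x2) i" using x12(4) by simp
    thus ?thesis using that by (simp add: f_def)
  qed
  have small: "\<bar>E i\<bar> \<le> Y" if "i < n" for i
    unfolding Ee using floor_div_eq_imp_close[OF f2[OF that, symmetric] Y] .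
  have rec: "(\<Sum>j\<le>n. of_int (a j) * E (k + j)) = 0" if "k \<le> N - n" for k
    using qe[of x1 k] qe[of x2 k] f1[OF that]
    by (simp add: Ee right_diff_distrib sum_subtractf)
  have "\<bar>E i\<bar> \<le> Y" if "i \<le> N" for i
    using that
  proof (induction i rule: less_induct)
    case (less i)
    show ?case
    proof (cases "i < n")
      case False
      define k where "k = i - n"
      have k: "k \<le> N - n" "i = k + n" using False less.prems by (auto simp: k_def)
      have "of_int (a n) * E i = - (\<Sum>j<n. of_int (a j) * E (k + j))"
        using rec[OF k(1)] by (simp add: lessThan_Suc_atMost[symmetric] k(2))
      hence "of_int (a n) * \<bar>E i\<bar> = \<bar>\<Sum>j<n. of_int (a j) * E (k + j)\<bar>"
        using an by (metis abs_minus_cancel abs_mult abs_of_nonneg of_int_0_le_iff order_trans zero_le_one)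
      also have "\<dots> \<le> (\<Sum>j<n. \<bar>of_int (a j) * E (k + j)\<bar>)" by (rule sum_abs)
      also have "\<dots> \<le> (\<Sum>j<n. \<bar>of_int (a j)\<bar> * Y)"
        using less.IH k less.prems by (intro sum_mono) (auto simp: abs_mult intro!: mult_left_mono)
      also have "\<dots> = of_int (\<Sum>j<n. \<bar>a j\<bar>) * Y" by (simp add: sum_distrib_right)
      also have "\<dots> \<le> of_int (a n) * Y" using dom Y by (intro mult_right_mono) (auto simp only: of_int_le_iff less_imp_le)
      finally show ?thesis using an by simp
    qed (rule small)
  qed
  moreover have "1 \<le> x" "x \<le> int X" using x12 by (auto simp: x_def)
  ultimately show ?thesis unfolding E_def by blast
qed

lemma dirichlet_simultaneous:
  assumes Y: "Y > 0" and count: "(1 / Y + 1) ^ N < real X"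
  shows "\<exists>(x::int) y. 1 \<le> x \<and> x \<le> int X \<and> (\<forall>i\<in>{1..N}. \<bar>\<theta> i * of_int x - of_int (y i :: int)\<bar> \<le> Y)"
proof -
  define v where "v x i = \<lfloor>\<theta> i * real x\<rfloor>" for x i :: nat
  define e where "e x i = \<theta> i * real x - of_int (v x i)" for x i
  have e01: "0 \<le> e x i" "e x i < 1" for x i unfolding e_def v_def by linarith+
  define f where "f x = (\<lambda>i\<in>{1..N}. \<lfloor>e x i / Y\<rfloor>)" for x
  define T where "T = PiE {1..N} (\<lambda>_. {0..\<lfloor>1 / Y\<rfloor>})"
  have "finite T" unfolding T_def by (intro finite_PiE) auto
  have fT: "f x \<in> T" for x
  proof -
    have "\<lfloor>e x i / Y\<rfloor> \<le> \<lfloor>1 / Y\<rfloor>" for i using e01[of x i] Y by (intro floor_mono divide_right_mono) auto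
    thus ?thesis unfolding f_def T_def using e01 Y by auto
  qed
  have cardT: "real (card T) \<le> (1 / Y + 1) ^ N"
  proof -
    have "card T = (nat (\<lfloor>1 / Y\<rfloor> + 1)) ^ N" unfolding T_def by (simp add: card_PiE)
    also have "real \<dots> = real (nat (\<lfloor>1 / Y\<rfloor> + 1)) ^ N" by simp
    also have "\<dots> \<le> (1 / Y + 1) ^ N"
    proof (intro power_mono)
      have "0 \<le> \<lfloor>1 / Y\<rfloor>" using Y by simp
      hence "real (nat (\<lfloor>1 / Y\<rfloor> + 1)) = of_int \<lfloor>1 / Y\<rfloor> + 1" by simp
      thus "real (nat (\<lfloor>1 / Y\<rfloor> + 1)) \<le> 1 / Y + 1" by linarith
    qed auto
    finally show ?thesis .
  qed
  have "\<not> inj_on f {0..X}"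
  proof
    assume "inj_on f {0..X}"
    hence "card {0..X} \<le> card T" using fT \<open>finite T\<close> by (intro card_inj_on_le[of f]) auto
    hence "real X + 1 \<le> real (card T)" by simp
    thus False using cardT count by linarith
  qed
  then obtain x1 x2 where x12: "x1 \<le> X" "x2 \<le> X" "x1 < x2" "f x1 = f x2"
    unfolding inj_on_def by (metis atLeastAtMost_iff linorder_neqE_nat)
  have "\<bar>\<theta> i * of_int (int x2 - int x1) - of_int (v x2 i - v x1 i)\<bar> \<le> Y" if "i \<in> {1..N}" for i
  proof -
    have "\<lfloor>e x2 i / Y\<rfloor> = \<lfloor>e x1 i / Y\<rfloor>"
    proof -
      have "f x2 i = f x1 i" using x12(4) by simp
      thus ?thesis using that by (simp add: f_def)
    qed
    from floor_div_eq_imp_close[OF this Y] show ?thesis by (simp add: e_def algebra_simps)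
  qed
  thus ?thesis using x12 by (intro exI[of _ "int x2 - int x1"] exI[of _ "\<lambda>i. v x2 i - v x1 i"]) auto
qed

subsection \<open>Monotonicity of the dimension\<close>

lemma hausdorff_measure_mono: "A \<subseteq> B \<Longrightarrow> hausdorff_measure s A \<le> hausdorff_measure s B"
  unfolding hausdorff_measure_def hausdorff_premeasure_def
  by (intro SUP_mono bexI[of _ "_"] INF_superset_mono) auto

lemma hausdorff_dim_mono: "A \<subseteq> B \<Longrightarrow> hausdorff_dim A \<le> hausdorff_dim B"
  unfolding hausdorff_dim_def
proof (intro Inf_superset_mono image_mono subsetI)
  fix s assume "A \<subseteq> B" "s \<in> {s. 0 \<le> s \<and> hausdorff_measure s B = 0}"
  thus "s \<in> {s. 0 \<le> s \<and> hausdorff_measure s A = 0}"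
    using hausdorff_measure_mono[of A B s] by simp
qed

lemma hausdorff_dim_nonneg: "0 \<le> hausdorff_dim A"
  unfolding hausdorff_dim_def by (intro Inf_greatest) auto

text \<open>The limsup theorem for a constant sequence of sets: equally spaced points give g = 1
  with any radius exponent w = 1 + \<delta>, and then \<delta> tends to 0.\<close>

lemma hausdorff_dim_interval: "1 \<le> hausdorff_dim {0..1::real}"
proof -
  have "ereal (1 / (1 + \<delta>)) \<le> hausdorff_dim {0..1::real}" if \<delta>: "\<delta> > 0" for \<delta>
  proof -
    have "ereal (1 / (1 + \<delta>)) \<le> hausdorff_dim {x. \<exists>\<^sub>F t in sequentially. x \<in> {0..1::real}}"
    proof (rule hausdorff_dim_limsup_ge[of "1/2" 1 "1 + \<delta>" "1/4" "1/2" "\<lambda>_. {0..1}"])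
      fix a b :: real assume ab: "1 / 4 \<le> a" "a < b" "b \<le> 1 / 2"
      have "\<forall>\<^sub>F t in sequentially. max 4 (4 / (b - a)) < real t"
        using filterlim_real_sequentially unfolding filterlim_at_top_dense by blast
      thus "\<forall>\<^sub>F t in sequentially. \<exists>T. finite T \<and> T \<subseteq> {a..b} \<and> 1 / 2 * (b - a) * real t powr 1 \<le> real (card T) \<and>
          separated (real t powr - 1) T \<and> (\<forall>x\<in>T. cball x (real t powr - (1 + \<delta>)) \<subseteq> {0..1})"
      proof eventually_elim
        case (elim t)
        have t: "real t > 4" using elim by simp
        have "4 / (b - a) < real t" using elim by simp
        hence t2: "(b - a) * real t > 4" using ab by (simp add: field_simps)
        note t = t t2
        define m where "m = nat \<lfloor>(b - a) * real t\<rfloor>"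
        have mle: "real m \<le> (b - a) * real t" and mge: "(b - a) * real t - 1 \<le> real m"
          using t unfolding m_def by linarith+
        define T where "T = (\<lambda>i. a + real i / real t) ` {..<m}"
        have inj: "inj_on (\<lambda>i. a + real i / real t) {..<m}" using t by (auto simp: inj_on_def)
        have "finite T" by (simp add: T_def)
        moreover have "T \<subseteq> {a..b}"
        proof
          fix x assume "x \<in> T"
          then obtain i where i: "i < m" "x = a + real i / real t" by (auto simp: T_def)
          have "real i \<le> (b - a) * real t" using i(1) mle by linarith
          hence "real i / real t \<le> b - a" using t by (simp add: divide_le_eq)
          moreover have "0 \<le> real i / real t" by simp
          ultimately show "x \<in> {a..b}" unfolding i(2) by auto
        qed
        moreover have "1 / 2 * (b - a) * real t powr 1 \<le> real (card T)"
          using mge t inj by (simp add: T_def card_image)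
        moreover have "separated (real t powr - 1) T"
          unfolding separated_def
        proof (intro ballI impI)
          fix x y assume "x \<in> T" "y \<in> T" "x \<noteq> y"
          then obtain i j where ij: "x = a + real i / real t" "y = a + real j / real t" "i \<noteq> j" by (auto simp: T_def)
          have "1 \<le> \<bar>real i - real j\<bar>" using ij(3) by linarith
          hence "1 / real t \<le> \<bar>real i - real j\<bar> / real t" by (rule divide_right_mono) simp
          also have "\<dots> = \<bar>x - y\<bar>" by (simp add: ij diff_divide_distrib[symmetric] abs_divide)
          finally show "real t powr - 1 \<le> \<bar>x - y\<bar>" using t by (simp add: powr_minus divide_inverse)
        qed
        moreover have "cball x (real t powr - (1 + \<delta>)) \<subseteq> {0..1}" if "x \<in> T" for x
        proof -
          have "real t powr - (1 + \<delta>) \<le> real t powr - 1" using t \<delta> by (intro powr_mono) auto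
          also have "\<dots> \<le> 1 / 4" using t by (simp add: powr_minus field_simps)
          finally have "real t powr - (1 + \<delta>) \<le> 1 / 4" .
          moreover have "x \<in> {1/4..1/2}" using \<open>T \<subseteq> {a..b}\<close> that ab by force
          ultimately show ?thesis by (auto simp: cball_eq_atLeastAtMost)
        qed
        ultimately show ?case by blast
      qed
    qed (use \<delta> in auto)
    also have "\<dots> \<le> hausdorff_dim {0..1::real}" by (intro hausdorff_dim_mono) auto
    finally show ?thesis .
  qed
  note H = this
  have "ereal 1 \<le> hausdorff_dim {0..1::real}"
  proof (rule tendsto_upperbound)
    show "((\<lambda>\<delta>. ereal (1 / (1 + \<delta>))) \<longlongrightarrow> ereal 1) (at_right 0)"
      by (auto intro!: tendsto_eq_intros)
    show "\<forall>\<^sub>F \<delta> in at_right 0. ereal (1 / (1 + \<delta>)) \<le> hausdorff_dim {0..1::real}"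
      using eventually_at_right_less[of "0::real"] by eventually_elim (rule H)
  qed auto
  thus ?thesis by (simp add: one_ereal_def)
qed

text \<open>Dirichlet's theorem gives every real number an exponent of at least 1 / N. This settles
  L = 1, where the lower bound has no loss.\<close>

lemma h_dim_1: "N \<ge> 1 \<Longrightarrow> 1 \<le> h_dim N (1 / real N)"
proof -
  assume N: "N \<ge> 1"
  have "ereal (1 / real N) \<le> approx_exponent N \<zeta>" for \<zeta>
  proof (rule dense_le)
    fix z assume z: "z < ereal (1 / real N)"
    show "z \<le> approx_exponent N \<zeta>"
    proof (cases z)
      case (real l)
    have Nl: "real N * l < 1" using N z real by (simp add: field_simps)
    have "\<forall>\<^sub>F X in at_top. \<exists>(x::int) (y::nat \<Rightarrow> int). 1 \<le> \<bar>x\<bar> \<and> real_of_int \<bar>x\<bar> \<le> X \<and>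
       (MAX i\<in>{1..N}. \<bar>\<zeta> ^ i * real_of_int x - real_of_int (y i)\<bar>) \<le> X powr (- l)"
    proof -
      have "((\<lambda>X. (X powr l + 1) ^ N / (X - 1)) \<longlongrightarrow> 0) at_top"
      proof (rule tendsto_sandwich[OF _ _ tendsto_const])
        \<comment> \<open>The exponent l may be negative; with m = max l 0 the summand 1 in (X^l +
          1) is absorbed into X^m.\<close>
        define m where "m = max l 0"
        have Nm: "real N * m < 1" using Nl by (auto simp: m_def max_def)
        show "\<forall>\<^sub>F X in at_top. (X powr l + 1) ^ N / (X - 1) \<le> 2 ^ Suc N * X powr (real N * m - 1)"
          using eventually_ge_at_top[of 2]
        proof eventually_elim
          case (elim X)
          have "X powr l \<le> X powr m" "1 \<le> X powr m" using elim by (auto simp: m_def ge_one_powr_ge_zero intro: powr_mono)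
          hence "(X powr l + 1) ^ N \<le> (2 * X powr m) ^ N" by (intro power_mono) auto
          also have "\<dots> = 2 ^ N * X powr (real N * m)" using elim by (simp add: power_mult_distrib powr_power mult.commute)
          finally have "(X powr l + 1) ^ N / (X - 1) \<le> 2 ^ N * X powr (real N * m) / (X / 2)"
            using elim by (intro frac_le) auto
          also have "\<dots> = 2 ^ Suc N * X powr (real N * m - 1)" using elim by (simp add: powr_diff)
          finally show ?case .
        qed
        show "((\<lambda>X. 2 ^ Suc N * X powr (real N * m - 1)) \<longlongrightarrow> 0) at_top"
          using Nm by (intro tendsto_mult_right_zero tendsto_neg_powr filterlim_ident) auto
        show "\<forall>\<^sub>F X in at_top. 0 \<le> (X powr l + 1) ^ N / (X - 1)"
          using eventually_ge_at_top[of 2] by eventually_elim auto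
      qed
      hence "\<forall>\<^sub>F X in at_top. (X powr l + 1) ^ N / (X - 1) < 1" by (rule order_tendstoD(2)) simp
      thus ?thesis using eventually_ge_at_top[of 2]
      proof eventually_elim
        case (elim X)
        have "(1 / (X powr (- l)) + 1) ^ N < real (nat \<lfloor>X\<rfloor>)"
          using elim by (simp add: powr_minus field_simps) linarith
        then obtain x :: int and y where xy: "1 \<le> x" "x \<le> int (nat \<lfloor>X\<rfloor>)"
           "\<forall>i\<in>{1..N}. \<bar>\<zeta> ^ i * of_int x - of_int (y i :: int)\<bar> \<le> X powr (- l)"
          using dirichlet_simultaneous[of "X powr (- l)" N "nat \<lfloor>X\<rfloor>" "\<lambda>i. \<zeta> ^ i"] elim by auto
        have "(MAX i\<in>{1..N}. \<bar>\<zeta> ^ i * real_of_int x - real_of_int (y i)\<bar>) \<le> X powr (- l)"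
          using xy(3) N by (subst Max_le_iff) auto
        moreover have "real_of_int \<bar>x\<bar> \<le> X" using xy(1,2) elim by linarith
        ultimately show ?case using xy(1) by (intro exI[of _ x] exI[of _ y]) auto
      qed
    qed
    hence "\<exists>\<^sub>F X in at_top. \<exists>(x::int) (y::nat \<Rightarrow> int). 1 \<le> \<bar>x\<bar> \<and> real_of_int \<bar>x\<bar> \<le> X \<and>
       (MAX i\<in>{1..N}. \<bar>\<zeta> ^ i * real_of_int x - real_of_int (y i)\<bar>) \<le> X powr (- l)"
      by (rule eventually_frequently[rotated]) simp
    hence "ereal l \<le> approx_exponent N \<zeta>" unfolding approx_exponent_def by (intro Sup_upper) auto
    thus ?thesis using real by simp
    qed (use z in auto)
  qed
  hence "{0..1} \<subseteq> {\<zeta> :: real. approx_exponent N \<zeta> \<ge> ereal (1 / real N)}" by auto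
  thus ?thesis unfolding h_dim_def using hausdorff_dim_interval hausdorff_dim_mono order_trans by blast
qed

subsection \<open>Well-distributed algebraic numbers\<close>

lemma power_diff_ge:
  fixes u v :: real
  assumes "0 \<le> u" "u \<le> v" "n \<ge> 1"
  shows "(v - u) * u ^ (n - 1) \<le> v ^ n - u ^ n"
proof -
  obtain m where n: "n = Suc m" using assms(3) by (cases n) auto
  have "(v - u) * u ^ m \<le> v * v ^ m - u * u ^ m"
    using mult_left_mono[OF power_mono[OF assms(2,1), of m], of v] assms by (simp add: algebra_simps)
  thus ?thesis by (simp add: n)
qed

text \<open>To the right of 1/8 all non-constant terms are nondecreasing and the leading one
  contributes slope at least K (1/8)^(n - 1), so a value of modulus at most B at \<zeta> forces a
  zero within \<rho>.\<close>

lemma root_near: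
  fixes a :: "nat \<Rightarrow> int" and \<zeta> K B \<rho> :: real
  assumes n: "n \<ge> 1" and nn: "\<And>i. 1 \<le> i \<Longrightarrow> i \<le> n \<Longrightarrow> 0 \<le> a i" and K: "0 \<le> K" "K \<le> of_int (a n)"
    and \<zeta>: "\<zeta> \<in> {1/4..1/2}" and f: "\<bar>\<Sum>j\<le>n. of_int (a j) * \<zeta> ^ j\<bar> \<le> B"
    and \<rho>: "0 \<le> \<rho>" "\<rho> \<le> 1/8" "B \<le> K * \<rho> * (1/8) ^ (n - 1)"
  shows "\<exists>\<alpha>. \<bar>\<alpha> - \<zeta>\<bar> \<le> \<rho> \<and> (\<Sum>j\<le>n. of_int (a j) * \<alpha> ^ j) = (0::real)"
proof -
  define F where "F z = (\<Sum>j\<le>n. of_int (a j) * z ^ j)" for z :: real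
  have mono: "K * (v - u) * (1/8) ^ (n - 1) \<le> F v - F u" if uv: "1/8 \<le> u" "u \<le> v" for u v
  proof -
    have "K * (v - u) * (1/8) ^ (n - 1) \<le> of_int (a n) * (v - u) * u ^ (n - 1)"
      using K uv by (intro mult_mono power_mono) auto
    also have "\<dots> \<le> of_int (a n) * (v ^ n - u ^ n)"
      using power_diff_ge[of u v n] uv n nn[of n] by (simp add: mult.assoc mult_left_mono)
    also have "\<dots> \<le> (\<Sum>j\<le>n. of_int (a j) * (v ^ j - u ^ j))"
    proof (rule member_le_sum)
      fix j assume "j \<in> {..n} - {n}"
      thus "0 \<le> of_int (a j) * (v ^ j - u ^ j)"
        using nn[of j] uv power_mono[of u v j] by (cases "j = 0") auto
    qed auto
    also have "\<dots> = F v - F u" by (simp add: F_def right_diff_distrib sum_subtractf)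
    finally show ?thesis .
  qed
  have F\<zeta>: "\<bar>F \<zeta>\<bar> \<le> B" using f by (simp add: F_def)
  have "F (\<zeta> - \<rho>) \<le> 0" "0 \<le> F (\<zeta> + \<rho>)"
    using mono[of "\<zeta> - \<rho>" \<zeta>] mono[of \<zeta> "\<zeta> + \<rho>"] \<zeta> \<rho> F\<zeta> by auto
  moreover have "\<forall>x. \<zeta> - \<rho> \<le> x \<and> x \<le> \<zeta> + \<rho> \<longrightarrow> isCont F x"
    unfolding F_def by (auto intro!: continuous_intros)
  ultimately obtain \<alpha> where "\<zeta> - \<rho> \<le> \<alpha>" "\<alpha> \<le> \<zeta> + \<rho>" "F \<alpha> = 0"
    using IVT[of F "\<zeta> - \<rho>" 0 "\<zeta> + \<rho>"] \<rho>(1) by auto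
  thus ?thesis by (intro exI[of _ \<alpha>]) (auto simp: F_def)
qed

lemma badly_approx_imp_kronecker_hyp:
  assumes y: "y \<in> badly_approx_at n \<epsilon> A" and A: "A > 0" and \<epsilon>: "\<epsilon> > 0"
    and x: "x \<noteq> 0" "real_of_int \<bar>x\<bar> < \<epsilon> * A ^ n"
  shows "\<exists>i\<in>{1..n}. \<forall>m::int. \<epsilon> / A \<le> \<bar>of_int x * y ^ i - of_int m\<bar>"
proof -
  \<comment> \<open>For the given x, the vector of nearest integers has the smallest errors, so bad
    approximability of y is applied to it.\<close>
  define xs where "xs = map (\<lambda>j. if j = 0 then x else round (of_int x * y ^ j)) [0..<Suc n]"
  have l: "length xs = Suc n" by (simp add: xs_def)
  have nth: "xs ! j = (if j = 0 then x else round (of_int x * y ^ j))" if "j \<le> n" for j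
    using that by (simp add: xs_def del: upt_Suc)
  have x0: "xs ! 0 = x" using nth[of 0] by simp
  have "\<exists>j\<le>n. xs ! j \<noteq> 0" using x0 x(1) by (intro exI[of _ 0]) auto
  hence "\<epsilon> * A ^ n \<le> \<bar>real_of_int (xs ! 0)\<bar> \<or> (\<exists>j\<le>n. \<epsilon> \<le> A * \<bar>real_of_int (xs ! j) - real_of_int (xs ! 0) * y ^ j\<bar>)"
    using y l unfolding badly_approx_at_def by blast
  then obtain j where j: "j \<le> n" "\<epsilon> \<le> A * \<bar>real_of_int (xs ! j) - of_int x * y ^ j\<bar>"
    using x x0 by auto
  have j0: "j \<noteq> 0" using j \<epsilon> x0 by (intro notI) auto
  have "\<epsilon> / A \<le> \<bar>of_int x * y ^ j - of_int m\<bar>" for m :: int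
  proof -
    have "\<epsilon> / A \<le> \<bar>of_int (round (of_int x * y ^ j)) - of_int x * y ^ j\<bar>"
      using j j0 nth[of j] A by (simp add: divide_le_eq mult.commute)
    also have "\<dots> \<le> \<bar>of_int x * y ^ j - of_int m\<bar>"
      using round_diff_minimal[of "of_int x * y ^ j" m] by (simp add: abs_minus_commute)
    finally show ?thesis .
  qed
  thus ?thesis using j j0 by (intro bexI[of _ j]) auto
qed

text \<open>Kronecker's theorem for \<theta>_i = \<zeta>^i with coefficients up to about t^(1 +
  \<eta>) makes the value at \<zeta> smaller than B = t^(\<eta> - n). An amount K of the same order
  t^(1 + \<eta>) is put on the leading coefficient beforehand: it makes that coefficient dominant
  and the derivative large, so the root lies within about B / K, that is t^(-n - 1).\<close>

lemma algebraic_numbers_dense: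
  assumes n: "n \<ge> 1" and \<epsilon>: "\<epsilon> > 0" and \<eta>: "\<eta> > 0" "\<eta> \<le> 1"
  shows "\<exists>C>0. \<forall>\<^sub>F t in sequentially. \<forall>\<zeta>\<in>{1/4..1/2} \<inter> badly_approx_at n \<epsilon> (real t).
     \<exists>(a :: nat \<Rightarrow> int) \<alpha>. (\<Sum>j<n. \<bar>a j\<bar>) \<le> a n \<and> 1 \<le> a n \<and> of_int (a n) \<le> C * real t powr (1 + \<eta>) \<and>
        (\<Sum>j\<le>n. of_int (a j) * \<alpha> ^ j) = (0::real) \<and> \<bar>\<alpha> - \<zeta>\<bar> \<le> 8 ^ n / real t ^ (n + 1)"
proof -
  \<comment> \<open>The k-th powers in the Kronecker condition gain t^(-\<eta> k). With \<eta> k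
    \<ge> n + 1 this beats the number of frequencies, which is of order t^n.\<close>
  define k where "k = nat \<lceil>(real n + 1) / \<eta>\<rceil> + 1"
  have k: "k \<ge> 1" "real n + 1 \<le> real k * \<eta>"
  proof -
    have "(real n + 1) / \<eta> \<le> real k" unfolding k_def by linarith
    thus "real n + 1 \<le> real k * \<eta>" using \<eta> by (simp add: field_simps)
  qed (simp add: k_def)
  define D where "D = 2 * (8 * real k / \<epsilon>) ^ k * (\<epsilon> / 2 + 1)"
  define C where "C = 18 * real n * real k"
  have C: "C > 0" using n k by (simp add: C_def)
  have "\<forall>\<^sub>F t in sequentially. max (max D (8 ^ (n + 1))) (max (4 * real k / \<epsilon>) 2) < real t"
    using filterlim_real_sequentially unfolding filterlim_at_top_dense by blast
  hence "\<forall>\<^sub>F t in sequentially. \<forall>\<zeta>\<in>{1/4..1/2} \<inter> badly_approx_at n \<epsilon> (real t).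
     \<exists>(a :: nat \<Rightarrow> int) \<alpha>. (\<Sum>j<n. \<bar>a j\<bar>) \<le> a n \<and> 1 \<le> a n \<and> of_int (a n) \<le> C * real t powr (1 + \<eta>) \<and>
        (\<Sum>j\<le>n. of_int (a j) * \<alpha> ^ j) = (0::real) \<and> \<bar>\<alpha> - \<zeta>\<bar> \<le> 8 ^ n / real t ^ (n + 1)"
  proof eventually_elim
    case (elim t)
    define \<tau> where "\<tau> = real t"
    have \<tau>: "D < \<tau>" "8 ^ (n + 1) < \<tau>" "4 * real k / \<epsilon> < \<tau>" "2 < \<tau>" using elim by (auto simp: \<tau>_def)
    have \<tau>n: "\<tau> \<le> \<tau> ^ n" using \<tau>(4) n power_increasing[of 1 n \<tau>] by simp
    define P where "P = nat \<lceil>\<tau> powr (1 + \<eta>)\<rceil>"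
    have P1: "1 \<le> \<tau> powr (1 + \<eta>)" using \<tau>(4) \<eta> by (intro ge_one_powr_ge_zero) auto
    have Pge: "\<tau> powr (1 + \<eta>) \<le> real P" and Ple: "real P \<le> 2 * \<tau> powr (1 + \<eta>)"
      using P1 unfolding P_def by linarith+
    have Ppos: "P \<ge> 1" using P1 Pge by linarith
    \<comment> \<open>The size of M keeps all frequencies up to k M below \<epsilon> t^n, the range
      in which \<zeta> is known to be badly approximable.\<close>
    define z where "z = \<epsilon> * \<tau> ^ n / (2 * real k)"
    have z2: "z \<ge> 2"
    proof -
      have "4 * real k / \<epsilon> \<le> \<tau> ^ n" using \<tau>(3) \<tau>n by linarith
      thus ?thesis using \<epsilon> k by (simp add: z_def field_simps)
    qed
    define M where "M = nat \<lfloor>z\<rfloor>"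
    have Mle: "real M \<le> z" and Mge: "z / 2 \<le> real M" using z2 unfolding M_def by linarith+
    have M1: "M \<ge> 1" using Mge z2 by linarith
    define B where "B = \<tau> powr \<eta> / \<tau> ^ n"
    have B: "B > 0" using \<tau>(4) by (simp add: B_def)
    \<comment> \<open>The factor 8 n leaves room for dominance: the constant term is at most k P + K
      / 2 + 1 because \<zeta> \<le> 1/2, and the coefficients strictly between add at most K / 8 - k
      P.\<close>
    define K where "K = 8 * n * k * P"
    have kM: "real (k * M) \<le> \<epsilon> * \<tau> ^ n / 2"
    proof -
      have "real (k * M) \<le> real k * z" using Mle by (simp add: mult_left_mono)
      also have "\<dots> = \<epsilon> * \<tau> ^ n / 2" using k by (simp add: z_def)
      finally show ?thesis .
    qed
    have t\<eta>: "(\<tau> powr (-\<eta>)) ^ k \<le> 1 / \<tau> ^ (n + 1)"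
    proof -
      have "(\<tau> powr (-\<eta>)) ^ k = \<tau> powr (- (real k * \<eta>))" using \<tau>(4) by (simp add: powr_power mult.commute)
      also have "\<dots> \<le> \<tau> powr (- (real n + 1))" using k \<tau>(4) by (intro powr_mono) auto
      also have "\<dots> = inverse (\<tau> powr real (n + 1))" by (subst powr_minus[symmetric]) (simp add: algebra_simps)
      also have "\<tau> powr real (n + 1) = \<tau> ^ (n + 1)" using \<tau>(4) by (intro powr_realpow) simp
      also have "inverse (\<tau> ^ (n + 1)) = 1 / \<tau> ^ (n + 1)" by (simp add: divide_inverse)
      finally show ?thesis .
    qed
    have k8: "2 / \<epsilon> \<le> 8 * real k / \<epsilon>" using k \<epsilon> by (intro divide_right_mono) auto
    have i1: "(2 / (real P * (\<epsilon> / \<tau>))) ^ k \<le> (8 * real k / \<epsilon>) ^ k * (1 / \<tau> ^ (n + 1))"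
    proof -
      have "\<epsilon> * \<tau> powr \<eta> \<le> real P * (\<epsilon> / \<tau>)"
      proof -
        have "\<epsilon> * \<tau> powr \<eta> = \<tau> powr (1 + \<eta>) * (\<epsilon> / \<tau>)" using \<tau>(4) by (simp add: powr_add)
        also have "\<dots> \<le> real P * (\<epsilon> / \<tau>)" using Pge \<epsilon> \<tau>(4) by (intro mult_right_mono) auto
        finally show ?thesis .
      qed
      hence "2 / (real P * (\<epsilon> / \<tau>)) \<le> 2 / (\<epsilon> * \<tau> powr \<eta>)" using \<epsilon> \<tau>(4) Ppos by (intro frac_le) auto
      also have "\<dots> = 2 / \<epsilon> * \<tau> powr (-\<eta>)" by (simp add: powr_minus field_simps)
      also have "\<dots> \<le> 8 * real k / \<epsilon> * \<tau> powr (-\<eta>)" using k8 by (intro mult_right_mono) auto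
      finally have "(2 / (real P * (\<epsilon> / \<tau>))) ^ k \<le> (8 * real k / \<epsilon> * \<tau> powr (-\<eta>)) ^ k"
        using \<epsilon> \<tau>(4) by (intro power_mono) auto
      also have "\<dots> = (8 * real k / \<epsilon>) ^ k * (\<tau> powr (-\<eta>)) ^ k" by (rule power_mult_distrib)
      also have "\<dots> \<le> (8 * real k / \<epsilon>) ^ k * (1 / \<tau> ^ (n + 1))" using t\<eta> \<epsilon> by (intro mult_left_mono) auto
      finally show ?thesis .
    qed
    have i2: "(2 / (real M * B)) ^ k \<le> (8 * real k / \<epsilon>) ^ k * (1 / \<tau> ^ (n + 1))"
    proof -
      have "\<epsilon> * \<tau> powr \<eta> / (4 * real k) \<le> real M * B"
      proof -
        have "\<epsilon> * \<tau> powr \<eta> / (4 * real k) = z / 2 * B" using \<tau>(4) by (simp add: z_def B_def)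
        also have "\<dots> \<le> real M * B" using Mge B by (intro mult_right_mono) auto
        finally show ?thesis .
      qed
      hence "2 / (real M * B) \<le> 2 / (\<epsilon> * \<tau> powr \<eta> / (4 * real k))" using \<epsilon> \<tau>(4) M1 B k by (intro frac_le) auto
      also have "\<dots> = 8 * real k / \<epsilon> * \<tau> powr (-\<eta>)" by (simp add: powr_minus field_simps)
      finally have "(2 / (real M * B)) ^ k \<le> (8 * real k / \<epsilon> * \<tau> powr (-\<eta>)) ^ k"
        using B by (intro power_mono) auto
      also have "\<dots> = (8 * real k / \<epsilon>) ^ k * (\<tau> powr (-\<eta>)) ^ k" by (rule power_mult_distrib)
      also have "\<dots> \<le> (8 * real k / \<epsilon>) ^ k * (1 / \<tau> ^ (n + 1))" using t\<eta> \<epsilon> by (intro mult_left_mono) auto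
      finally show ?thesis .
    qed
    have ineq: "(2 / (real P * (\<epsilon> / \<tau>))) ^ k + (2 / (real M * B)) ^ k < 1 / (real (k * M) + 1)"
    proof -
      have "(2 / (real P * (\<epsilon> / \<tau>))) ^ k + (2 / (real M * B)) ^ k \<le> 2 * (8 * real k / \<epsilon>) ^ k * (1 / \<tau> ^ (n + 1))"
        using i1 i2 by simp
      also have "\<dots> < 1 / ((\<epsilon> / 2 + 1) * \<tau> ^ n)"
      proof -
        have gen: "E * (1 / (w * p)) < 1 / (q * p)" if "E * q < w" "q > 0" "p > 0" "w > 0" for E q p w :: real
          using that by (simp add: field_simps)
        show ?thesis using gen[of "2 * (8 * real k / \<epsilon>) ^ k" "\<epsilon> / 2 + 1" \<tau> "\<tau> ^ n"] \<tau>(1,4) \<epsilon>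
          unfolding D_def by simp
      qed
      also have "\<dots> \<le> 1 / (real (k * M) + 1)"
      proof (intro divide_left_mono)
        have "real (k * M) + 1 \<le> \<epsilon> * \<tau> ^ n / 2 + \<tau> ^ n" using kM \<tau>n \<tau>(4) by linarith
        thus "real (k * M) + 1 \<le> (\<epsilon> / 2 + 1) * \<tau> ^ n" by (simp add: algebra_simps)
        show "0 < (\<epsilon> / 2 + 1) * \<tau> ^ n * (real (k * M) + 1)" using \<epsilon> \<tau>(4)
          by (intro mult_pos_pos add_nonneg_pos) auto
      qed simp
      finally show ?thesis .
    qed
    show ?case
    proof
      fix \<zeta> assume "\<zeta> \<in> {1/4..1/2} \<inter> badly_approx_at n \<epsilon> (real t)"
      hence \<zeta>: "\<zeta> \<in> {1/4..1/2}" and bad: "\<zeta> \<in> badly_approx_at n \<epsilon> \<tau>" by (auto simp: \<tau>_def)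
      have hyp: "\<exists>i\<in>{1..n}. \<forall>m::int. \<epsilon> / \<tau> \<le> \<bar>of_int x * \<zeta> ^ i - of_int m\<bar>"
        if "x \<noteq> 0" "\<bar>x\<bar> \<le> int (k * M)" for x
      proof (rule badly_approx_imp_kronecker_hyp[OF bad _ \<epsilon> that(1)])
        have "real_of_int \<bar>x\<bar> \<le> real (k * M)" using that(2) by linarith
        also have "\<dots> < \<epsilon> * \<tau> ^ n"
        proof -
          have "0 < \<epsilon> * \<tau> ^ n" using \<epsilon> \<tau>(4) by (intro mult_pos_pos) auto
          thus ?thesis using kM by linarith
        qed
        finally show "real_of_int \<bar>x\<bar> < \<epsilon> * \<tau> ^ n" .
      qed (use \<tau> in simp)
      have Ypos: "\<epsilon> / \<tau> > 0" using \<epsilon> \<tau>(4) by simp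
      obtain j m where j: "\<forall>i\<in>{1..n}. j i \<le> k * P"
        and m: "\<bar>(\<Sum>i=1..n. real (j i) * \<zeta> ^ i) - (- (real K * \<zeta> ^ n)) - of_int m\<bar> < B"
        using kronecker_effective[OF Ppos M1 Ypos B hyp ineq, of "- (real K * \<zeta> ^ n)"] by blast
      \<comment> \<open>The target - K \<zeta>^n accounts for the amount K, which now joins the
        leading coefficient; the integer m that is nearly attained becomes the constant
        term.\<close>
      define a where "a i = (if i = 0 then - m else if i = n then int (j n + K) else int (j i))" for i
      have sumF: "(\<Sum>i\<le>n. of_int (a i) * x ^ i) = (\<Sum>i=1..n. real (j i) * x ^ i) + real K * x ^ n - of_int m" for x :: real
      proof -
        have "(\<Sum>i\<le>n. of_int (a i) * x ^ i) = of_int (a 0) + (\<Sum>i=1..n. of_int (a i) * x ^ i)"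
          by (simp add: sum.atMost_shift sum.atLeast1_atMost_eq lessThan_Suc_atMost del: sum.atMost_Suc)
        also have "(\<Sum>i=1..n. of_int (a i) * x ^ i) = (\<Sum>i=1..n. real (j i) * x ^ i + (if i = n then real K * x ^ n else 0))"
          by (intro sum.cong refl) (auto simp: a_def algebra_simps)
        also have "\<dots> = (\<Sum>i=1..n. real (j i) * x ^ i) + real K * x ^ n"
          using n by (simp add: sum.distrib)
        finally show ?thesis by (simp add: a_def)
      qed
      have Kn: "real K = 8 * real n * (real k * real P)" by (simp add: K_def)
      have kP1: "1 \<le> real k * real P" using k Ppos by (metis mult_le_mono nat_mult_1 of_nat_1 of_nat_le_iff of_nat_mult)
      have jle: "real (j i) \<le> real k * real P" if "i \<in> {1..n}" for i
        using j that by (metis of_nat_le_iff of_nat_mult)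
      have mb: "\<bar>of_int m :: real\<bar> \<le> real k * real P + real K / 2 + 1"
      proof -
        have z01: "0 \<le> \<zeta>" "\<zeta> \<le> 1/2" using \<zeta> by auto
        have "(\<Sum>i=1..n. real (j i) * \<zeta> ^ i) \<le> (\<Sum>i=1..n. real k * real P * (1/2) ^ i)"
          using jle z01 by (intro sum_mono mult_mono power_mono) auto
        also have "\<dots> = real k * real P * (\<Sum>i=1..n. (1/2) ^ i)" by (simp add: sum_distrib_left)
        also have "(\<Sum>i=1..n. (1/2::real) ^ i) = 1 - (1/2) ^ n"
          by (induction n) (auto simp: field_simps)
        also have "real k * real P * (1 - (1/2) ^ n) \<le> real k * real P * 1" by (intro mult_left_mono) auto
        finally have "(\<Sum>i=1..n. real (j i) * \<zeta> ^ i) \<le> real k * real P" by simp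
        moreover have "0 \<le> (\<Sum>i=1..n. real (j i) * \<zeta> ^ i)" using z01 by (intro sum_nonneg) auto
        moreover have "real K * \<zeta> ^ n \<le> real K * (1/2)"
        proof (intro mult_left_mono)
          have "\<zeta> ^ n \<le> \<zeta> ^ 1" using n z01 by (intro power_decreasing) auto
          thus "\<zeta> ^ n \<le> 1/2" using z01 by simp
        qed simp
        moreover have "0 \<le> real K * \<zeta> ^ n" using z01 by simp
        moreover have "B \<le> 1"
        proof -
          have "\<tau> powr \<eta> \<le> \<tau> powr 1" using \<tau>(4) \<eta> by (intro powr_mono) auto
          hence "\<tau> powr \<eta> \<le> \<tau> ^ n" using \<tau>n \<tau>(4) by simp
          thus ?thesis using \<tau>(4) by (simp add: B_def divide_le_eq)
        qed
        ultimately show ?thesis using m by linarith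
      qed
      have KP: "real n * (real k * real P) = real K / 8" by (simp add: Kn)
      have K8: "1 \<le> real K / 8"
        using kP1 n mult_mono[of 1 "real n" 1 "real k * real P"] unfolding KP[symmetric] by simp
      have dom: "(\<Sum>i<n. \<bar>a i\<bar>) \<le> a n"
      proof -
        have "{..<n} = insert 0 {1..<n}" using n by auto
        hence "(\<Sum>i<n. \<bar>a i\<bar>) = \<bar>a 0\<bar> + (\<Sum>i\<in>{1..<n}. \<bar>a i\<bar>)" by simp
        hence "real_of_int (\<Sum>i<n. \<bar>a i\<bar>) = \<bar>of_int m\<bar> + (\<Sum>i\<in>{1..<n}. real (j i))"
          by (simp add: a_def)
        also have "(\<Sum>i\<in>{1..<n}. real (j i)) \<le> (\<Sum>i\<in>{1..<n}. real k * real P)"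
          by (intro sum_mono jle) auto
        also have "\<dots> = real (n - 1) * (real k * real P)" by simp
        also have "\<dots> = real K / 8 - real k * real P" using n KP by (simp add: of_nat_diff algebra_simps)
        finally have "real_of_int (\<Sum>i<n. \<bar>a i\<bar>) \<le> real K" using mb K8 by linarith
        also have "\<dots> \<le> real_of_int (a n)" using n by (simp add: a_def)
        finally show ?thesis by (simp only: of_int_le_iff)
      qed
      have anK: "real K \<le> of_int (a n)" using n by (simp add: a_def)
      have an1: "1 \<le> a n" using anK K8 by linarith
      have anC: "of_int (a n) \<le> C * real t powr (1 + \<eta>)"
      proof -
        have "of_int (a n) = real (j n) + real K" using n by (simp add: a_def)
        also have "\<dots> \<le> real k * real P + 8 * real n * (real k * real P)" using jle[of n] n Kn by simp
        also have "\<dots> \<le> real n * (real k * real P) + 8 * real n * (real k * real P)"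
        proof (intro add_right_mono)
          have "1 * (real k * real P) \<le> real n * (real k * real P)" using n by (intro mult_right_mono) auto
          thus "real k * real P \<le> real n * (real k * real P)" by simp
        qed
        also have "\<dots> = 9 * real n * real k * real P" by simp
        also have "\<dots> \<le> 9 * real n * real k * (2 * \<tau> powr (1 + \<eta>))" using Ple by (intro mult_left_mono) auto
        finally show ?thesis by (simp add: C_def \<tau>_def)
      qed
      have nonneg: "0 \<le> a i" if "1 \<le> i" for i using that by (auto simp: a_def)
      have F: "\<bar>\<Sum>i\<le>n. of_int (a i) * \<zeta> ^ i\<bar> \<le> B" using m unfolding sumF by simp
      define \<rho> where "\<rho> = 8 ^ n / \<tau> ^ (n + 1)"
      have "\<rho> \<le> 1/8"
      proof -
        have "\<tau> ^ 1 \<le> \<tau> ^ (n + 1)" using \<tau>(4) by (intro power_increasing) auto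
        hence "8 ^ (n + 1) \<le> \<tau> ^ (n + 1)" using \<tau>(2) by simp
        thus ?thesis using \<tau>(4) by (simp add: \<rho>_def field_simps)
      qed
      moreover have "B \<le> real K * \<rho> * (1/8) ^ (n - 1)"
      proof -
        have e8: "(8::real) ^ n * (1/8) ^ (n - 1) = 8"
          using n by (cases n) (auto simp: power_mult_distrib[symmetric] mult_ac)
        have "\<tau> powr (1 + \<eta>) \<le> real K"
          using Pge n k(1) mult_mono[of 1 "8 * real n * real k" "\<tau> powr (1 + \<eta>)" "real P"] mult_mono[of 1 "8 * real n" 1 "real k"]
          by (simp add: K_def)
        hence "\<tau> powr (1 + \<eta>) * (8 / \<tau> ^ (n + 1)) \<le> real K * (8 / \<tau> ^ (n + 1))"
          using \<tau>(4) by (intro mult_right_mono) auto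
        also have "\<dots> = real K * \<rho> * (1/8) ^ (n - 1)" using e8 by (simp add: \<rho>_def mult_ac)
        finally have "\<tau> powr (1 + \<eta>) * (8 / \<tau> ^ (n + 1)) \<le> real K * \<rho> * (1/8) ^ (n - 1)" .
        moreover have "B \<le> \<tau> powr (1 + \<eta>) * (8 / \<tau> ^ (n + 1))"
          using \<tau>(4) by (simp add: B_def powr_add field_simps)
        ultimately show ?thesis by linarith
      qed
      moreover have "0 \<le> \<rho>" using \<tau>(4) by (simp add: \<rho>_def)
      ultimately obtain \<alpha> where "\<bar>\<alpha> - \<zeta>\<bar> \<le> \<rho>" "(\<Sum>j\<le>n. of_int (a j) * \<alpha> ^ j) = (0::real)"
        using root_near[OF n nonneg _ anK \<zeta> F, of \<rho>] by auto
      thus "\<exists>(a :: nat \<Rightarrow> int) \<alpha>. (\<Sum>j<n. \<bar>a j\<bar>) \<le> a n \<and> 1 \<le> a n \<and> of_int (a n) \<le> C * real t powr (1 + \<eta>) \<and>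
        (\<Sum>j\<le>n. of_int (a j) * \<alpha> ^ j) = (0::real) \<and> \<bar>\<alpha> - \<zeta>\<bar> \<le> 8 ^ n / real t ^ (n + 1)"
        using dom an1 anC unfolding \<rho>_def \<tau>_def by blast
    qed
  qed
  thus ?thesis using C by blast
qed

lemma separated_subset_of_measure:
  fixes E :: "real set"
  assumes E: "E \<in> lmeasurable" and s: "s > 0" and m: "measure lebesgue E > 0"
  shows "\<exists>T. finite T \<and> T \<subseteq> E \<and> separated s T \<and> measure lebesgue E / (2 * s) \<le> real (card T)"
proof -
  define q where "q = measure lebesgue E / (2 * s)"
  have q: "q > 0" using m s by (simp add: q_def)
  define k where "k = nat (\<lceil>q\<rceil> - 1)"
  have c1: "\<lceil>q\<rceil> \<ge> 1" using q by simp
  hence kq: "real k < q" "q \<le> real k + 1" unfolding k_def by linarith+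
  have "2 * s * real k < measure lebesgue E" using kq(1) s by (simp add: q_def field_simps)
  then obtain x where x: "\<forall>i\<le>k. x i \<in> E" "\<forall>i j. i < j \<longrightarrow> j \<le> k \<longrightarrow> s \<le> \<bar>x i - x j\<bar>"
    using separated_points_in_set[OF E s] by blast
  have sep: "s \<le> \<bar>x i - x j\<bar>" if "i \<noteq> j" "i \<le> k" "j \<le> k" for i j
    using x(2) that by (metis abs_minus_commute linorder_neqE_nat)
  have "inj_on x {..k}"
    using sep s by (auto simp: inj_on_def) (metis abs_zero diff_self not_less)
  hence "card (x ` {..k}) = k + 1" by (simp add: card_image)
  moreover have "separated s (x ` {..k})"
    unfolding separated_def
  proof (intro ballI impI)
    fix u v assume "u \<in> x ` {..k}" "v \<in> x ` {..k}" "u \<noteq> v"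
    then obtain i j where "u = x i" "v = x j" "i \<le> k" "j \<le> k" "i \<noteq> j" by auto
    thus "s \<le> \<bar>u - v\<bar>" using sep by simp
  qed
  moreover have "x ` {..k} \<subseteq> E" using x(1) by auto
  ultimately show ?thesis using kq(2) unfolding q_def[symmetric]
    by (intro exI[of _ "x ` {..k}"]) auto
qed

section \<open>From well-distributed roots to a lower bound for the dimension\<close>

definition approximable_set :: "nat \<Rightarrow> real \<Rightarrow> real \<Rightarrow> real set" where
  "approximable_set N l X = {\<zeta>. \<exists>(x :: int) (y :: nat \<Rightarrow> int). 1 \<le> \<bar>x\<bar> \<and> real_of_int \<bar>x\<bar> \<le> X \<and>
          (MAX i\<in>{1..N}. \<bar>\<zeta> ^ i * real_of_int x - real_of_int (y i)\<bar>) \<le> X powr (- l)}"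

lemma approx_exponent_ge:
  assumes "\<exists>\<^sub>F X in at_top. \<zeta> \<in> approximable_set N l X"
  shows "ereal l \<le> approx_exponent N \<zeta>"
  unfolding approx_exponent_def using assms unfolding approximable_set_def by (intro Sup_upper) auto

text \<open>With H of order t^(1 + \<eta>), X = t^xx and Y = X^(-l) / 2, the pigeonhole condition
  H^(N + 1 - n) Y^(-n) < X becomes the equation for xx, with \<eta> to spare for constants. Moving
  from \<alpha> to \<zeta> within t^(-w) changes the products \<zeta>^i x by at most N t^(xx - w) =
  N t^(-\<eta>) X^(-l), which fits into the other half of the allowed error.\<close>

lemma approx_near_root:
  assumes nN: "1 \<le> n" "n \<le> N" and l: "0 < l" "real n * l < 1" and \<eta>: "\<eta> > 0" and C: "C > 0"
    and xx: "xx = ((1 + \<eta>) * real (N + 1 - n) + \<eta>) / (1 - real n * l)"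
    and w: "w = xx * (1 + l) + \<eta>"
  shows "\<forall>\<^sub>F t in sequentially. \<forall>(a :: nat \<Rightarrow> int) \<alpha>. \<alpha> \<in> {1/4..1/2} \<longrightarrow> (\<Sum>j<n. \<bar>a j\<bar>) \<le> a n \<longrightarrow> 1 \<le> a n \<longrightarrow>
      of_int (a n) \<le> C * real t powr (1 + \<eta>) \<longrightarrow> (\<Sum>j\<le>n. of_int (a j) * \<alpha> ^ j) = (0::real) \<longrightarrow>
      cball \<alpha> (real t powr (- w)) \<subseteq> approximable_set N l (real t powr xx)"
proof -
  define Q where "Q = (4 * C + 1) ^ (N + 1 - n) * 3 ^ n"
  have Q: "Q > 0" using C by (simp add: Q_def)
  have xpos: "xx > 0" unfolding xx using \<eta> l nN by (intro divide_pos_pos add_nonneg_pos mult_nonneg_nonneg) auto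
  have wpos: "w > 0" unfolding w using xpos l \<eta> by (intro add_nonneg_pos mult_nonneg_nonneg) auto
  have xeq: "(1 + \<eta>) * real (N + 1 - n) + real n * (l * xx) = xx - \<eta>"
  proof -
    have "xx * (1 - real n * l) = (1 + \<eta>) * real (N + 1 - n) + \<eta>" unfolding xx using l by simp
    thus ?thesis by (simp add: algebra_simps)
  qed
  have e1: "\<forall>\<^sub>F t in sequentially. real t powr (- \<eta>) \<le> 1 / (4 * Q)"
    using \<eta> Q by (intro powr_neg_eventually_le) auto
  have e2: "\<forall>\<^sub>F t in sequentially. real t powr (- \<eta>) \<le> 1 / (2 * (real N + 1))"
    using \<eta> by (intro powr_neg_eventually_le) auto
  have e3: "\<forall>\<^sub>F t in sequentially. real t powr (- w) \<le> 1 / 4" using wpos by (intro powr_neg_eventually_le) auto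
  have e4: "\<forall>\<^sub>F t in sequentially. real t powr (- xx) \<le> 1 / 4" using xpos by (intro powr_neg_eventually_le) auto
  have e5: "\<forall>\<^sub>F t in sequentially. (1::nat) \<le> t" by (rule eventually_ge_at_top)
  show ?thesis using e1 e2 e3 e4 e5
  proof eventually_elim
    case (elim t)
    define \<tau> where "\<tau> = real t"
    have \<tau>1: "\<tau> \<ge> 1" using elim(5) by (simp add: \<tau>_def)
    note el = elim(1-4)[folded \<tau>_def]
    define Y where "Y = \<tau> powr (- (l * xx)) / 2"
    have Y: "Y > 0" using \<tau>1 by (simp add: Y_def)
    define X where "X = nat \<lfloor>\<tau> powr xx\<rfloor>"
    have xxge: "\<tau> powr xx \<ge> 4" using el(4) \<tau>1 by (simp add: powr_minus field_simps)
    have Xle: "real X \<le> \<tau> powr xx" and Xge: "\<tau> powr xx / 2 < real X" using xxge unfolding X_def by linarith+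
    show ?case
    proof (intro allI impI)
      fix a :: "nat \<Rightarrow> int" and \<alpha> :: real
      assume \<alpha>: "\<alpha> \<in> {1/4..1/2}" and dom: "(\<Sum>j<n. \<bar>a j\<bar>) \<le> a n" and a1: "1 \<le> a n"
        and aC: "of_int (a n) \<le> C * real t powr (1 + \<eta>)" and root: "(\<Sum>j\<le>n. of_int (a j) * \<alpha> ^ j) = (0::real)"
      define H where "H = nat (a n)"
      have Hr: "real H \<le> C * \<tau> powr (1 + \<eta>)" using aC a1 by (simp add: H_def \<tau>_def)
      have p1: "1 \<le> \<tau> powr (1 + \<eta>)" "1 \<le> \<tau> powr (l * xx)" using \<tau>1 \<eta> l xpos by (auto intro!: ge_one_powr_ge_zero)
      have count: "(4 * real H + 1) ^ (N + 1 - n) * (1 / Y + 1) ^ n < real X"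
      proof -
        have "4 * real H + 1 \<le> (4 * C + 1) * \<tau> powr (1 + \<eta>)" using Hr p1 by (simp add: algebra_simps)
        moreover have "1 / Y + 1 \<le> 3 * \<tau> powr (l * xx)"
          using p1 \<tau>1 by (simp add: Y_def powr_minus field_simps)
        ultimately have "(4 * real H + 1) ^ (N + 1 - n) * (1 / Y + 1) ^ n \<le>
            ((4 * C + 1) * \<tau> powr (1 + \<eta>)) ^ (N + 1 - n) * (3 * \<tau> powr (l * xx)) ^ n"
          using C Y by (intro mult_mono power_mono) auto
        also have "\<dots> = Q * (\<tau> powr ((1 + \<eta>) * real (N + 1 - n)) * \<tau> powr (real n * (l * xx)))"
          using \<tau>1 by (simp add: Q_def power_mult_distrib powr_power mult_ac)
        also have "\<tau> powr ((1 + \<eta>) * real (N + 1 - n)) * \<tau> powr (real n * (l * xx)) = \<tau> powr (xx - \<eta>)"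
          unfolding powr_add[symmetric] xeq ..
        also have "\<tau> powr (xx - \<eta>) = \<tau> powr xx * \<tau> powr (- \<eta>)" by (simp add: powr_add[symmetric])
        also have "Q * (\<tau> powr xx * \<tau> powr (- \<eta>)) \<le> Q * (\<tau> powr xx * (1 / (4 * Q)))"
          using el(1) Q by (intro mult_left_mono) auto
        also have "\<dots> = \<tau> powr xx / 4" using Q by simp
        also have "\<dots> < real X" using Xge xxge by linarith
        finally show ?thesis .
      qed
      have an: "a n \<le> int H" by (simp add: H_def)
      obtain x :: int and y where xy: "1 \<le> x" "x \<le> int X" "\<And>i. i \<le> N \<Longrightarrow> \<bar>\<alpha> ^ i * of_int x - of_int (y i :: int)\<bar> \<le> Y"
        using recurrence_approx[OF nN(2) dom a1 an root Y count] by blast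
      show "cball \<alpha> (real t powr (- w)) \<subseteq> approximable_set N l (real t powr xx)"
      proof
        fix \<zeta> assume "\<zeta> \<in> cball \<alpha> (real t powr (- w))"
        hence d: "\<bar>\<zeta> - \<alpha>\<bar> \<le> \<tau> powr (- w)" by (simp add: dist_real_def \<tau>_def abs_minus_commute)
        hence \<zeta>1: "\<bar>\<zeta>\<bar> \<le> 1" using \<alpha> el(3) by auto
        have xr: "of_int x \<le> \<tau> powr xx" "(0::real) \<le> of_int x" using xy(1,2) Xle by linarith+
        have "\<bar>\<zeta> ^ i * of_int x - of_int (y i)\<bar> \<le> \<tau> powr (- (l * xx))" if i: "i \<in> {1..N}" for i
        proof -
          have "\<bar>\<zeta> ^ i - \<alpha> ^ i\<bar> \<le> real i * \<bar>\<zeta> - \<alpha>\<bar>"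
            using norm_power_diff[of \<zeta> \<alpha> i] \<zeta>1 \<alpha> by simp
          also have "\<dots> \<le> real N * \<tau> powr (- w)" using i d by (intro mult_mono) auto
          finally have "\<bar>\<zeta> ^ i - \<alpha> ^ i\<bar> * of_int x \<le> (real N * \<tau> powr (- w)) * \<tau> powr xx"
            using xr by (intro mult_mono) auto
          also have "\<dots> = real N * (\<tau> powr (- \<eta>) * \<tau> powr (- (l * xx)))"
            unfolding mult.assoc powr_add[symmetric] w by (simp add: algebra_simps)
          also have "\<dots> \<le> real N * (1 / (2 * (real N + 1)) * \<tau> powr (- (l * xx)))"
            using el(2) by (intro mult_left_mono mult_right_mono) auto
          also have "\<dots> = (real N / (real N + 1)) * (\<tau> powr (- (l * xx)) / 2)" by simp
          also have "\<dots> \<le> 1 * (\<tau> powr (- (l * xx)) / 2)" by (intro mult_right_mono) auto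
          finally have "\<bar>\<zeta> ^ i - \<alpha> ^ i\<bar> * of_int x \<le> \<tau> powr (- (l * xx)) / 2" by simp
          moreover have "\<bar>\<zeta> ^ i - \<alpha> ^ i\<bar> * of_int x = \<bar>(\<zeta> ^ i - \<alpha> ^ i) * of_int x\<bar>" using xr by (simp add: abs_mult)
          moreover have "\<bar>\<alpha> ^ i * of_int x - of_int (y i)\<bar> \<le> \<tau> powr (- (l * xx)) / 2" using xy(3)[of i] i by (simp add: Y_def)
          moreover have "\<zeta> ^ i * of_int x - of_int (y i) = (\<zeta> ^ i - \<alpha> ^ i) * of_int x + (\<alpha> ^ i * of_int x - of_int (y i))"
            by (simp add: algebra_simps)
          ultimately show ?thesis by linarith
        qed
        moreover have "(real t powr xx) powr (- l) = \<tau> powr (- (l * xx))" by (simp add: powr_powr \<tau>_def mult.commute)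
        ultimately have "(MAX i\<in>{1..N}. \<bar>\<zeta> ^ i * real_of_int x - real_of_int (y i)\<bar>) \<le> (real t powr xx) powr (- l)"
          using nN by (subst Max_le_iff) auto
        thus "\<zeta> \<in> approximable_set N l (real t powr xx)"
          unfolding approximable_set_def using xy(1) xr by (intro CollectI exI[of _ x] exI[of _ y]) (auto simp: \<tau>_def)
      qed
    qed
  qed
qed

text \<open>Among the badly approximable points of an interval choose 3 d separated ones, d = t^(-g)
  with g = n + 1 - \<eta>. Each has a root within d, so the roots are still d separated and as many
  as the points. The inequality g < w required by the limsup theorem comes from N l \<ge> 1.\<close>

lemma h_dim_ge_aux:
  assumes nN: "1 \<le> n" "n + 1 \<le> N" and l: "1 \<le> real N * l" "real n * l < 1" and \<eta>: "\<eta> > 0" "\<eta> \<le> 1"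
    and xx: "xx = ((1 + \<eta>) * real (N + 1 - n) + \<eta>) / (1 - real n * l)"
  shows "ereal ((real n + 1 - \<eta>) / (xx * (1 + l) + \<eta>)) \<le> h_dim N l"
proof -
  have l0: "l > 0"
  proof (rule ccontr)
    assume "\<not> l > 0"
    hence "real N * l \<le> 0" by (intro mult_nonneg_nonpos) auto
    thus False using l by simp
  qed
  define w where "w = xx * (1 + l) + \<eta>"
  define g where "g = real n + 1 - \<eta>"
  have g0: "g > 0" using nN \<eta> by (simp add: g_def)
  have gw: "g < w"
  proof -
    have "(real n + 1) * (1 - real n * l) \<le> real (N + 1 - n)"
    proof -
      have "1 - real n * l \<le> 1 - real n * (1 / real N)"
        using l(1) nN by (intro diff_left_mono mult_left_mono) (auto simp: field_simps)
      hence "(real n + 1) * (1 - real n * l) \<le> (real n + 1) * (1 - real n / real N)" by (intro mult_left_mono) auto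
      also have "\<dots> = (real n + 1) / real N * (real N - real n)" using nN by (simp add: field_simps)
      also have "\<dots> \<le> 1 * (real N - real n)" using nN by (intro mult_right_mono) (auto simp: field_simps)
      finally show ?thesis using nN by (simp add: of_nat_diff)
    qed
    also have "\<dots> \<le> (1 + \<eta>) * real (N + 1 - n) + \<eta>" using \<eta> by (simp add: algebra_simps)
    finally have "real n + 1 \<le> xx" unfolding xx using l(2) by (simp add: pos_le_divide_eq)
    moreover have "xx * 1 \<le> xx * (1 + l)" using l0 calculation by (intro mult_left_mono) auto
    ultimately show ?thesis using \<eta> unfolding g_def w_def by linarith
  qed
  have xpos: "xx > 0" unfolding xx using \<eta> l nN by (intro divide_pos_pos add_nonneg_pos mult_nonneg_nonneg) auto
  obtain \<epsilon> c where \<epsilon>c: "0 < \<epsilon>" "0 < c" and nd: "\<And>a b. 0 \<le> a \<Longrightarrow> a < b \<Longrightarrow> b \<le> 1 \<Longrightarrow>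
     (\<exists>A0\<ge>1. \<forall>A\<ge>A0. c * (b - a) \<le> measure lebesgue (badly_approx_at n \<epsilon> A \<inter> {a..b}))"
    using curve_nondivergence[of n] by blast
  obtain C where C: "C > 0" and alg: "\<forall>\<^sub>F t in sequentially. \<forall>\<zeta>\<in>{1/4..1/2} \<inter> badly_approx_at n \<epsilon> (real t).
     \<exists>(a :: nat \<Rightarrow> int) \<alpha>. (\<Sum>j<n. \<bar>a j\<bar>) \<le> a n \<and> 1 \<le> a n \<and> of_int (a n) \<le> C * real t powr (1 + \<eta>) \<and>
        (\<Sum>j\<le>n. of_int (a j) * \<alpha> ^ j) = (0::real) \<and> \<bar>\<alpha> - \<zeta>\<bar> \<le> 8 ^ n / real t ^ (n + 1)"
    using algebraic_numbers_dense[OF nN(1) \<epsilon>c(1) \<eta>] by (elim exE conjE) (rule that)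
  have nN': "n \<le> N" using nN by simp
  note near = approx_near_root[OF nN(1) nN' l0 l(2) \<eta>(1) C xx w_def]
  have "ereal (g / w) \<le> hausdorff_dim {x. \<exists>\<^sub>F t in sequentially. x \<in> approximable_set N l (real t powr xx)}"
  proof (rule hausdorff_dim_limsup_ge[of "c / 12" g w "1/4" "1/2"])
    fix a b :: real assume ab: "1/4 \<le> a" "a < b" "b \<le> 1/2"
    \<comment> \<open>A quarter is cut off on each side so that roots within d of the chosen points
      stay in [a, b]. The constant c / 12 is c / 2, from the halved length, over 6, from the spacing
      3 d.\<close>
    define a' where "a' = a + (b - a) / 4"
    define b' where "b' = b - (b - a) / 4"
    have ab': "0 \<le> a'" "a' < b'" "b' \<le> 1" "b' - a' = (b - a) / 2" "a < a'" "b' < b"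
      using ab unfolding a'_def b'_def by (auto simp: field_simps)
    obtain A0 where A0: "\<And>A. A \<ge> A0 \<Longrightarrow> c * (b' - a') \<le> measure lebesgue (badly_approx_at n \<epsilon> A \<inter> {a'..b'})"
      using nd[OF ab'(1-3)] by blast
    have f1: "\<forall>\<^sub>F t in sequentially. A0 \<le> real t"
      using filterlim_real_sequentially unfolding filterlim_at_top by blast
    have f2: "\<forall>\<^sub>F t in sequentially. real t powr (- \<eta>) \<le> 1 / 8 ^ n" using \<eta> by (intro powr_neg_eventually_le) auto
    have f3: "\<forall>\<^sub>F t in sequentially. real t powr (- g) \<le> (b - a) / 4" using g0 ab by (intro powr_neg_eventually_le) auto
    have f4: "\<forall>\<^sub>F t in sequentially. (1::nat) \<le> t" by (rule eventually_ge_at_top)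
    show "\<forall>\<^sub>F t in sequentially. \<exists>T. finite T \<and> T \<subseteq> {a..b} \<and> c / 12 * (b - a) * real t powr g \<le> real (card T) \<and>
          separated (real t powr - g) T \<and> (\<forall>x\<in>T. cball x (real t powr - w) \<subseteq> approximable_set N l (real t powr xx))"
      using alg near f1 f2 f3 f4
    proof eventually_elim
      case (elim t)
      define d where "d = real t powr (- g)"
      have t1: "real t \<ge> 1" using elim(6) by simp
      have d0: "d > 0" using t1 by (simp add: d_def)
      define E where "E = badly_approx_at n \<epsilon> (real t) \<inter> {a'..b'}"
      have mE: "c * (b - a) / 2 \<le> measure lebesgue E" using A0[OF elim(3)] ab'(4) by (simp add: E_def)
      have mpos: "measure lebesgue E > 0" using mE \<epsilon>c(2) ab mult_pos_pos[of c "b - a"] by linarith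
      have "closed E" unfolding E_def using closed_badly_approx_at by auto
      hence "compact E" unfolding E_def by (auto simp: compact_eq_bounded_closed intro: bounded_subset[of "{a'..b'}"])
      hence Em: "E \<in> lmeasurable" by (rule lmeasurable_compact)
      obtain T0 where T0: "finite T0" "T0 \<subseteq> E" "separated (3 * d) T0" "measure lebesgue E / (2 * (3 * d)) \<le> real (card T0)"
        using separated_subset_of_measure[OF Em _ mpos, of "3 * d"] d0 by auto
      have rho: "8 ^ n / real t ^ (n + 1) \<le> d"
      proof -
        have "8 ^ n * real t powr (- \<eta>) \<le> 1" using elim(4) by (simp add: field_simps)
        hence "(8 ^ n * real t powr (- \<eta>)) * d \<le> 1 * d" using d0 by (intro mult_right_mono) auto
        moreover have "(8 ^ n * real t powr (- \<eta>)) * d = 8 ^ n * real t powr (- real (n + 1))"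
          unfolding d_def g_def mult.assoc powr_add[symmetric] by (simp add: algebra_simps)
        moreover have "real t powr (- real (n + 1)) = 1 / real t ^ (n + 1)"
          using t1 powr_realpow[of "real t" "n + 1"] by (simp only: powr_minus divide_inverse)
        ultimately show ?thesis by simp
      qed
      have "\<forall>\<zeta>\<in>T0. \<exists>\<alpha>. \<bar>\<alpha> - \<zeta>\<bar> \<le> d \<and> cball \<alpha> (real t powr (- w)) \<subseteq> approximable_set N l (real t powr xx)"
      proof
        fix \<zeta> assume z: "\<zeta> \<in> T0"
        hence zE: "\<zeta> \<in> badly_approx_at n \<epsilon> (real t)" "\<zeta> \<in> {a'..b'}" using T0(2) by (auto simp: E_def)
        hence "\<zeta> \<in> {1/4..1/2} \<inter> badly_approx_at n \<epsilon> (real t)" using ab ab' by auto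
        from bspec[OF elim(1) this] obtain a1 :: "nat \<Rightarrow> int" and \<alpha> where *: "(\<Sum>j<n. \<bar>a1 j\<bar>) \<le> a1 n" "1 \<le> a1 n"
          "of_int (a1 n) \<le> C * real t powr (1 + \<eta>)" "(\<Sum>j\<le>n. of_int (a1 j) * \<alpha> ^ j) = (0::real)" "\<bar>\<alpha> - \<zeta>\<bar> \<le> 8 ^ n / real t ^ (n + 1)"
          by (elim exE conjE)
        have da: "\<bar>\<alpha> - \<zeta>\<bar> \<le> d" using *(5) rho by linarith
        have "a' \<le> \<zeta>" "\<zeta> \<le> b'" using zE(2) by auto
        hence "a \<le> \<alpha>" "\<alpha> \<le> b" using da elim(5) unfolding d_def[symmetric] a'_def b'_def by linarith+
        hence "\<alpha> \<in> {1/4..1/2}" using ab by auto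
        hence "cball \<alpha> (real t powr (- w)) \<subseteq> approximable_set N l (real t powr xx)"
          using elim(2) *(1-4) by blast
        thus "\<exists>\<alpha>. \<bar>\<alpha> - \<zeta>\<bar> \<le> d \<and> cball \<alpha> (real t powr (- w)) \<subseteq> approximable_set N l (real t powr xx)" using da by blast
      qed
      from bchoice[OF this] obtain \<alpha> where \<alpha>0: "\<forall>\<zeta>\<in>T0. \<bar>\<alpha> \<zeta> - \<zeta>\<bar> \<le> d \<and> cball (\<alpha> \<zeta>) (real t powr (- w)) \<subseteq> approximable_set N l (real t powr xx)"
        by (rule exE)
      have \<alpha>: "\<bar>\<alpha> \<zeta> - \<zeta>\<bar> \<le> d" "cball (\<alpha> \<zeta>) (real t powr (- w)) \<subseteq> approximable_set N l (real t powr xx)" if "\<zeta> \<in> T0" for \<zeta>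
        using \<alpha>0 that by auto
      have sep: "d \<le> \<bar>\<alpha> x - \<alpha> y\<bar>" if "x \<in> T0" "y \<in> T0" "x \<noteq> y" for x y
      proof -
        have "3 * d \<le> \<bar>x - y\<bar>" using T0(3) that by (auto simp: separated_def)
        thus ?thesis using \<alpha>(1)[OF that(1)] \<alpha>(1)[OF that(2)] by linarith
      qed
      have "inj_on \<alpha> T0"
      proof (rule inj_onI, rule ccontr)
        fix x y assume "x \<in> T0" "y \<in> T0" "\<alpha> x = \<alpha> y" "x \<noteq> y"
        thus False using sep[of x y] d0 by simp
      qed
      hence cardT: "card (\<alpha> ` T0) = card T0" by (rule card_image)
      have "c / 12 * (b - a) * real t powr g \<le> real (card (\<alpha> ` T0))"
      proof -
        have "c / 12 * (b - a) * real t powr g = (c * (b - a) / 2) / (2 * (3 * d))"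
        proof -
          have dg: "real t powr g = 1 / d" unfolding d_def by (simp add: powr_minus_divide)
          show ?thesis unfolding dg by simp
        qed
        also have "\<dots> \<le> measure lebesgue E / (2 * (3 * d))" using mE d0 by (intro divide_right_mono) auto
        also have "\<dots> \<le> real (card (\<alpha> ` T0))" using T0(4) cardT by simp
        finally show ?thesis .
      qed
      moreover have "\<alpha> ` T0 \<subseteq> {a..b}"
      proof
        fix x assume "x \<in> \<alpha> ` T0"
        then obtain z where z: "z \<in> T0" "x = \<alpha> z" by auto
        have "z \<in> {a'..b'}" using z(1) T0(2) by (auto simp: E_def)
        hence "a' \<le> z" "z \<le> b'" by auto
        hence "a \<le> x" "x \<le> b" using \<alpha>(1)[OF z(1)] elim(5) z(2) unfolding d_def[symmetric] a'_def b'_def by linarith+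
        thus "x \<in> {a..b}" by simp
      qed
      moreover have "separated d (\<alpha> ` T0)" using sep by (auto simp: separated_def)
      moreover have "\<forall>x\<in>\<alpha> ` T0. cball x (real t powr - w) \<subseteq> approximable_set N l (real t powr xx)" using \<alpha>(2) by auto
      ultimately show ?case using T0(1) unfolding d_def by (intro exI[of _ "\<alpha> ` T0"] conjI) auto
    qed
  qed (use \<epsilon>c g0 gw in auto)
  also have "\<dots> \<le> h_dim N l"
    unfolding h_dim_def
  proof (rule hausdorff_dim_mono, rule subsetI)
    fix \<zeta> assume "\<zeta> \<in> {x. \<exists>\<^sub>F t in sequentially. x \<in> approximable_set N l (real t powr xx)}"
    hence fr: "\<exists>\<^sub>F t in sequentially. \<zeta> \<in> approximable_set N l (real t powr xx)" by simp
    have lim: "filterlim (\<lambda>t. real t powr xx) at_top sequentially"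
      by (rule filterlim_compose[OF real_powr_at_top[OF xpos] filterlim_real_sequentially])
    have "\<exists>\<^sub>F X in at_top. \<zeta> \<in> approximable_set N l X"
    proof (rule ccontr)
      assume "\<not> ?thesis"
      hence "\<forall>\<^sub>F X in at_top. \<zeta> \<notin> approximable_set N l X" by (simp add: not_frequently)
      hence "\<forall>\<^sub>F t in sequentially. \<zeta> \<notin> approximable_set N l (real t powr xx)"
        using lim by (rule eventually_compose_filterlim)
      thus False using fr by (simp add: frequently_def)
    qed
    thus "\<zeta> \<in> {\<zeta>. ereal l \<le> approx_exponent N \<zeta>}" using approx_exponent_ge by auto
  qed
  finally show ?thesis by (simp add: g_def w_def)
qed

text \<open>The loss \<eta> of the auxiliary bound is removed by a limit from the right.\<close>

theorem h_dim_ge: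
  assumes nN: "1 \<le> n" "n + 1 \<le> N" and l: "1 \<le> real N * l" "real n * l < 1"
  shows "ereal ((real n + 1) * (1 - real n * l) / ((real (N + 1 - n)) * (1 + l))) \<le> h_dim N l"
proof -
  define F where "F \<eta> = (real n + 1 - \<eta>) / (((1 + \<eta>) * real (N + 1 - n) + \<eta>) / (1 - real n * l) * (1 + l) + \<eta>)" for \<eta>
  have l0: "l > 0"
  proof (rule ccontr)
    assume "\<not> l > 0"
    hence "real N * l \<le> 0" by (intro mult_nonneg_nonpos) auto
    thus False using l by simp
  qed
  have pos: "real (N + 1 - n) / (1 - real n * l) * (1 + l) > 0" using l l0 nN by (intro mult_pos_pos divide_pos_pos) auto
  have "(F \<longlongrightarrow> (real n + 1 - 0) / (((1 + 0) * real (N + 1 - n) + 0) / (1 - real n * l) * (1 + l) + 0)) (at_right 0)"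
    unfolding F_def using l pos by (intro tendsto_intros) auto
  moreover have "(real n + 1 - 0) / (((1 + 0) * real (N + 1 - n) + 0) / (1 - real n * l) * (1 + l) + 0)
      = (real n + 1) * (1 - real n * l) / ((real (N + 1 - n)) * (1 + l))" by simp
  ultimately have lim: "((\<lambda>\<eta>. ereal (F \<eta>)) \<longlongrightarrow> ereal ((real n + 1) * (1 - real n * l) / ((real (N + 1 - n)) * (1 + l)))) (at_right 0)"
    by (metis tendsto_ereal)
  show ?thesis
  proof (rule tendsto_upperbound[OF lim])
    have "\<forall>\<^sub>F \<eta> in at_right (0::real). \<eta> < 1" 
    proof -
      have "(0::real) < 1" by simp
      from eventually_at_right_real[OF this] show ?thesis by eventually_elim simp
    qed
    thus "\<forall>\<^sub>F \<eta> in at_right 0. ereal (F \<eta>) \<le> h_dim N l"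
      using eventually_at_right_less[of "0::real"]
    proof eventually_elim
      case (elim \<eta>)
      show ?case unfolding F_def by (rule h_dim_ge_aux[OF nN l]) (use elim in auto)
    qed
  qed simp
qed

subsection \<open>Annihilating polynomials of a good approximation\<close>

text \<open>The linear functional sending T^i to x i for i up to N. Coefficients beyond N are cut
  off, so degrees have to be watched in every product.\<close>

definition pair_poly :: "nat \<Rightarrow> (nat \<Rightarrow> int) \<Rightarrow> 'a :: comm_ring_1 poly \<Rightarrow> 'a" where
  "pair_poly N x P = (\<Sum>i\<le>N. poly.coeff P i * of_int (x i))"

lemma pair_poly_add: "pair_poly N x (P + Q) = pair_poly N x P + pair_poly N x Q"
  by (simp add: pair_poly_def sum.distrib algebra_simps)

lemma pair_poly_diff: "pair_poly N x (P - Q) = pair_poly N x P - pair_poly N x Q"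
  by (simp add: pair_poly_def sum_subtractf algebra_simps)

lemma pair_poly_smult: "pair_poly N x (Polynomial.smult c P) = c * pair_poly N x P"
  by (simp add: pair_poly_def sum_distrib_left mult.assoc)

lemma pair_poly_sum: "pair_poly N x (\<Sum>i\<in>I. f i) = (\<Sum>i\<in>I. pair_poly N x (f i))"
  by (induction I rule: infinite_finite_induct) (auto simp: pair_poly_add, auto simp: pair_poly_def)

lemma pair_poly_shift_mult:
  "pair_poly N x (P * U) = (\<Sum>i\<le>degree U. poly.coeff U i * pair_poly N x (P * Polynomial.monom 1 i))"
proof -
  have "P * U = P * (\<Sum>i\<le>degree U. Polynomial.monom (poly.coeff U i) i)"
    by (simp add: poly_as_sum_of_monoms)
  also have "\<dots> = (\<Sum>i\<le>degree U. Polynomial.smult (poly.coeff U i) (P * Polynomial.monom 1 i))"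
    by (simp add: sum_distrib_left smult_monom mult_smult_right[symmetric] del: mult_smult_right)
  finally show ?thesis by (simp add: pair_poly_sum pair_poly_smult)
qed

text \<open>P is a characteristic polynomial of x 0, ..., x N: the linear recurrence with these
  coefficients holds wherever all its terms are in range.\<close>

definition kills :: "nat \<Rightarrow> (nat \<Rightarrow> int) \<Rightarrow> 'a :: comm_ring_1 poly \<Rightarrow> bool" where
  "kills N x P \<longleftrightarrow> (\<forall>i. degree P + i \<le> N \<longrightarrow> pair_poly N x (P * Polynomial.monom 1 i) = 0)"

lemma kills_mult:
  fixes P U :: "'a :: idom poly"
  assumes "kills N x P" "P \<noteq> 0" "degree (P * U) \<le> N"
  shows "pair_poly N x (P * U) = 0"
proof (cases "U = 0")
  case False
  hence "degree P + degree U \<le> N" using assms by (simp add: degree_mult_eq)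
  thus ?thesis using assms(1) by (subst pair_poly_shift_mult, intro sum.neutral) (auto simp: kills_def)
qed (simp add: pair_poly_def)

text \<open>The gcd of D and R kills x as well, so by minimality it has the degree of D. Indeed the
  gcd times T^i is D U + R V with V reduced modulo D: the shifts of R that occur are below deg D and
  vanish by hypothesis, and since deg (R V) \<le> N, what remains is a multiple of D of degree at
  most N.\<close>

lemma minimal_killer_dvd:
  fixes D R :: "rat poly"
  assumes D: "D \<noteq> 0" "kills N x D" "1 \<le> degree D" "degree D \<le> N"
    and min: "\<And>P :: rat poly. P \<noteq> 0 \<Longrightarrow> degree P \<le> N \<Longrightarrow> kills N x P \<Longrightarrow> degree D \<le> degree P"
    and R: "degree R \<le> N + 1 - degree D" "\<And>i. i < degree D \<Longrightarrow> pair_poly N x (R * Polynomial.monom 1 i) = 0"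
  shows "D dvd R"
proof -
  define G where "G = gcd D R"
  define a where "a = fst (bezout_coefficients D R)"
  define b where "b = snd (bezout_coefficients D R)"
  have bz: "G = a * D + b * R" unfolding G_def a_def b_def by (rule bezout_coefficients_fst_snd[symmetric])
  have G0: "G \<noteq> 0" using D(1) by (simp add: G_def)
  have GD: "G dvd D" by (simp add: G_def)
  have dG: "degree G \<le> degree D" by (rule dvd_imp_degree_le[OF GD D(1)])
  have "kills N x G"
    unfolding kills_def
  proof (intro allI impI)
    fix i assume i: "degree G + i \<le> N"
    let ?m = "Polynomial.monom (1::rat) i"
    define V where "V = (b * ?m) mod D"
    define U where "U = a * ?m + R * ((b * ?m) div D)"
    have eq: "G * ?m = D * U + R * V"
    proof -
      have "G * ?m = D * (a * ?m) + R * (b * ?m)" unfolding bz by (simp add: algebra_simps)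
      also have "b * ?m = (b * ?m) div D * D + V" unfolding V_def by simp
      finally show ?thesis unfolding U_def by (simp add: algebra_simps)
    qed
    have V: "V = 0 \<or> degree V < degree D" unfolding V_def using D(1) degree_mod_less by blast
    have RV: "pair_poly N x (R * V) = 0"
    proof (cases "V = 0")
      case False
      thus ?thesis using V R(2) by (subst pair_poly_shift_mult, intro sum.neutral) auto
    qed (simp add: pair_poly_def)
    have dRV: "degree (R * V) \<le> N"
    proof (cases "V = 0")
      case False
      have "degree (R * V) \<le> degree R + degree V" by (rule degree_mult_le)
      thus ?thesis using V False R(1) D(3,4) by linarith
    qed simp
    have "D * U = G * ?m - R * V" using eq by simp
    moreover have "degree (G * ?m) \<le> N"
      using degree_mult_le[of G ?m] i degree_monom_le[of "1::rat" i] by linarith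
    ultimately have "degree (D * U) \<le> N" using dRV by (metis degree_diff_le)
    hence "pair_poly N x (D * U) = 0" by (rule kills_mult[OF D(2,1)])
    thus "pair_poly N x (G * ?m) = 0" by (simp add: eq pair_poly_add RV)
  qed
  hence "degree D \<le> degree G" using min[OF G0] dG D(4) by auto
  obtain e where e: "D = G * e" using GD by auto
  have "degree e = 0" using e D(1) \<open>degree D \<le> degree G\<close> degree_mult_eq[of G e] by auto
  then obtain c where "e = [:c:]" using degree_eq_zeroE by blast
  hence Dc: "D = Polynomial.smult c G" "c \<noteq> 0" using e D(1) by auto
  hence "D dvd G" by (simp add: smult_dvd_iff)
  thus ?thesis unfolding G_def using gcd_dvd2 dvd_trans by blast
qed

text \<open>Gauss's lemma: comparing contents clears the denominator of the rational
  quotient.\<close>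

lemma content_1_dvd_of_int:
  fixes D R :: "int poly"
  assumes c: "content D = 1" and dv: "(of_int_poly D :: rat poly) dvd of_int_poly R"
  shows "D dvd R"
proof (cases "R = 0")
  case False
  from dv obtain g :: "rat poly" where g: "of_int_poly R = of_int_poly D * g" by (auto elim: dvdE)
  have g0: "g \<noteq> 0" using g False by auto
  obtain r gi where rg: "rat_to_normalized_int_poly g = (r, gi)" by (cases "rat_to_normalized_int_poly g") auto
  have gr: "g = Polynomial.smult r (of_int_poly gi)" and cgi: "content gi = 1"
    using rat_to_normalized_int_poly(1)[OF rg] rat_to_normalized_int_poly(3)[OF rg g0] by auto
  obtain p q where pq: "quotient_of r = (p, q)" by (cases "quotient_of r") auto
  have q0: "q > 0" and r: "r = of_int p / of_int q"
    using quotient_of_denom_pos[OF pq] quotient_of_div[OF pq] by auto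
  have "(of_int_poly (Polynomial.smult q R) :: rat poly) = of_int_poly (Polynomial.smult p (D * gi))"
    using q0 by (simp add: g gr r hom_distribs)
  hence eq: "Polynomial.smult q R = Polynomial.smult p (D * gi)" by (simp only: of_int_poly_hom.eq_iff)
  hence "content (Polynomial.smult q R) = content (Polynomial.smult p (D * gi))" by simp
  hence "q * content R = \<bar>p\<bar>" using q0 c cgi by (simp add: content_mult abs_mult)
  hence "q dvd p" by (metis dvd_abs_iff dvd_triv_left)
  then obtain s where "p = q * s" by auto
  hence "Polynomial.smult q R = Polynomial.smult q (D * Polynomial.smult s gi)" using eq by simp
  hence "R = D * Polynomial.smult s gi" using q0 by (metis less_irrefl smult_cancel)
  thus ?thesis by (metis dvd_triv_left)
qed auto

section \<open>Mahler measure and counting of integer polynomials\<close>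

lemma mahler_mult: "mahler_measure (p * q) = mahler_measure p * mahler_measure q"
  unfolding mahler_measure_def by (simp add: hom_distribs measure_eq_prod)

lemma mahler_le_sum:
  assumes "degree p \<le> k" "\<And>i. \<bar>poly.coeff p i\<bar> \<le> B"
  shows "mahler_measure p \<le> (real k + 1) * of_int B"
proof -
  have B0: "0 \<le> B" using assms(2)[of 0] by linarith
  have "(\<Sum>a\<leftarrow>coeffs p. a * a) \<le> (\<Sum>a\<leftarrow>coeffs p. B * B)"
  proof (intro sum_list_mono)
    fix a assume "a \<in> set (coeffs p)"
    then obtain i where "a = poly.coeff p i" by (metis coeffs_nth in_set_conv_nth length_coeffs_degree less_Suc_eq_le length_coeffs coeffs_eq_Nil list.size(3) not_less_zero)
    hence "\<bar>a\<bar> \<le> B" using assms(2) by simp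
    hence "\<bar>a\<bar> * \<bar>a\<bar> \<le> B * B" by (intro mult_mono) auto
    thus "a * a \<le> B * B" by simp
  qed
  also have "\<dots> = int (length (coeffs p)) * (B * B)" by (simp add: sum_list_triv)
  also have "\<dots> \<le> int (k + 1) * (B * B)"
    using assms(1) B0 by (intro mult_right_mono) (auto simp: length_coeffs_degree coeffs_def)
  also have "\<dots> \<le> int (k + 1) * int (k + 1) * (B * B)" using B0 by (intro mult_right_mono) auto
  finally have "real_of_int (\<Sum>a\<leftarrow>coeffs p. a * a) \<le> of_int (int (k + 1) * int (k + 1) * (B * B))"
    by (simp only: of_int_le_iff)
  also have "\<dots> = ((real k + 1) * of_int B)\<^sup>2" by (simp add: power2_eq_square mult_ac add.commute)
  finally have "sqrt (real_of_int (\<Sum>a\<leftarrow>coeffs p. a * a)) \<le> (real k + 1) * of_int B"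
    using B0 by (intro real_le_lsqrt) (auto intro!: sum_list_nonneg)
  thus ?thesis using Landau_inequality_mahler_measure[of p] by linarith
qed

lemma coeff_le_mahler:
  assumes "degree p \<le> k"
  shows "\<bar>real_of_int (poly.coeff p i)\<bar> \<le> 2 ^ k * mahler_measure p"
proof -
  have "real_of_int \<bar>poly.coeff p i\<bar> \<le> real (degree p choose i) * mahler_measure p" by (rule Mignotte_bound)
  also have "\<dots> \<le> 2 ^ k * mahler_measure p"
  proof (intro mult_right_mono mahler_measure_ge_0)
    have "degree p choose i \<le> 2 ^ degree p" by (rule binomial_le_pow2)
    also have "\<dots> \<le> 2 ^ k" using assms by (intro power_increasing) auto
    finally have "real (degree p choose i) \<le> real (2 ^ k)" by (simp only: of_nat_le_iff)
    thus "real (degree p choose i) \<le> 2 ^ k" by simp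
  qed
  finally show ?thesis by simp
qed

lemma pigeonhole_fiber:
  assumes "finite A" "finite T" "f ` A \<subseteq> T" "A \<noteq> {}"
  shows "\<exists>v\<in>T. card A \<le> card T * card {a\<in>A. f a = v}"
proof (rule ccontr)
  assume "\<not> ?thesis"
  hence lt: "card T * card {a\<in>A. f a = v} < card A" if "v \<in> T" for v using that by (auto simp: not_le)
  have T0: "T \<noteq> {}" using assms by auto
  have "A = (\<Union>v\<in>T. {a\<in>A. f a = v})" using assms(3) by auto
  hence "card A \<le> (\<Sum>v\<in>T. card {a\<in>A. f a = v})" using card_UN_le[OF assms(2), of "\<lambda>v. {a\<in>A. f a = v}"] by simp
  hence "card T * card A \<le> (\<Sum>v\<in>T. card T * card {a\<in>A. f a = v})" by (simp add: sum_distrib_left[symmetric])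
  also have "\<dots> < (\<Sum>v\<in>T. card A)" using lt assms(2) T0 by (intro sum_strict_mono) auto
  finally show False by simp
qed

definition box_poly :: "nat \<Rightarrow> (nat \<Rightarrow> nat) \<Rightarrow> int poly" where
  "box_poly k f = (\<Sum>i\<le>k. Polynomial.monom (int (f i)) i)"

lemma coeff_box_poly: "poly.coeff (box_poly k f) i = (if i \<le> k then int (f i) else 0)"
  unfolding box_poly_def by (simp add: coeff_sum)

lemma degree_box_poly: "degree (box_poly k f) \<le> k"
  by (rule degree_le) (simp add: coeff_box_poly)

lemma box_poly_inj: "inj_on (box_poly k) (PiE {..k} (\<lambda>_. {..B}))"
proof (rule inj_onI)
  fix f g assume f: "f \<in> PiE {..k} (\<lambda>_. {..B})" and g: "g \<in> PiE {..k} (\<lambda>_. {..B})" and eq: "box_poly k f = box_poly k g"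
  have "f i = g i" for i
  proof (cases "i \<le> k")
    case True
    thus ?thesis using arg_cong[OF eq, of "\<lambda>p. poly.coeff p i"] by (simp add: coeff_box_poly)
  next
    case False
    thus ?thesis using f g by (auto simp: PiE_def extensional_def)
  qed
  thus "f = g" by blast
qed

text \<open>Pigeonhole on the values of the pairing over polynomials with coefficients in {0..B}.
  Subtracting one member of a large fibre from all of it makes the values 0 and leaves coefficients
  of modulus at most B.\<close>

lemma many_killers:
  fixes x :: "nat \<Rightarrow> int" and W :: nat
  assumes kN: "k \<le> N" and W: "\<And>i. i \<le> N \<Longrightarrow> \<bar>x i\<bar> \<le> int W"
  shows "\<exists>S :: int poly set. finite S \<and> 0 \<in> S \<and> (\<forall>R\<in>S. degree R \<le> k \<and> (\<forall>i. \<bar>poly.coeff R i\<bar> \<le> int B) \<and> pair_poly N x R = 0) \<and>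
     (B + 1) ^ (k + 1) \<le> (2 * ((N + 1) * B * W) + 1) * card S"
proof -
  let ?A = "PiE {..k} (\<lambda>_::nat. {..B})"
  let ?V = "int ((N + 1) * B * W)"
  have finA: "finite ?A" by (intro finite_PiE) auto
  have ne: "?A \<noteq> {}" by (simp add: PiE_eq_empty_iff)
  have b: "pair_poly N x (box_poly k f) \<in> {- ?V..?V}" if "f \<in> ?A" for f
  proof -
    have "\<bar>pair_poly N x (box_poly k f)\<bar> \<le> (\<Sum>i\<le>N. \<bar>poly.coeff (box_poly k f) i * of_int (x i)\<bar>)"
      unfolding pair_poly_def by (rule sum_abs)
    also have "\<dots> \<le> (\<Sum>i\<le>N. int B * int W)"
    proof (intro sum_mono)
      fix i assume "i \<in> {..N}"
      moreover have "\<bar>poly.coeff (box_poly k f) i\<bar> \<le> int B" using that by (auto simp: coeff_box_poly)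
      ultimately show "\<bar>poly.coeff (box_poly k f) i * of_int (x i)\<bar> \<le> int B * int W"
        using W[of i] unfolding abs_mult by (intro mult_mono) auto
    qed
    also have "\<dots> = ?V" by (simp add: algebra_simps)
    finally show ?thesis by auto
  qed
  have sub: "(\<lambda>f. pair_poly N x (box_poly k f)) ` ?A \<subseteq> {- ?V..?V}" using b by blast
  have "finite {- ?V..?V}" by simp
  from pigeonhole_fiber[OF finA this sub ne] obtain v
    where v: "card ?A \<le> card {- ?V..?V} * card {f\<in>?A. pair_poly N x (box_poly k f) = v}" by (rule bexE)
  let ?F = "{f\<in>?A. pair_poly N x (box_poly k f) = v}"
  have cA: "card ?A = (B + 1) ^ (k + 1)" by (simp add: card_PiE)
  have cV: "card {- ?V..?V} = 2 * ((N + 1) * B * W) + 1" by (simp del: of_nat_mult)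
  have "?F \<noteq> {}"
  proof
    assume e: "?F = {}"
    have "card ?A \<le> 0" using v by (simp only: e card.empty mult_0_right)
    thus False using cA by simp
  qed
  then obtain f0 where f0: "f0 \<in> ?F" by blast
  define S where "S = (\<lambda>f. box_poly k f - box_poly k f0) ` ?F"
  have "finite S" using finA by (simp add: S_def)
  moreover have "0 \<in> S" using f0 by (auto simp: S_def intro!: image_eqI[of _ _ f0])
  moreover have "degree R \<le> k \<and> (\<forall>i. \<bar>poly.coeff R i\<bar> \<le> int B) \<and> pair_poly N x R = 0" if RS: "R \<in> S" for R
  proof -
    obtain f where f: "f \<in> ?F" "R = box_poly k f - box_poly k f0" using RS by (auto simp: S_def)
    have "f i \<le> B" "f0 i \<le> B" if "i \<le> k" for i using f(1) f0 that by auto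
    hence bd: "i \<le> k \<Longrightarrow> f i \<le> B \<and> f0 i \<le> B" for i by blast
    have "\<bar>poly.coeff R i\<bar> \<le> int B" for i
      unfolding f(2) using bd[of i] by (cases "i \<le> k") (auto simp: coeff_box_poly abs_le_iff)
    thus ?thesis unfolding f(2) using f(1) f0 degree_box_poly[of k] by (auto simp: pair_poly_diff intro!: degree_diff_le)
  qed
  moreover have "card S = card ?F"
    unfolding S_def by (intro card_image inj_onI) (use box_poly_inj[of k B] in \<open>auto dest: inj_onD\<close>)
  ultimately show ?thesis using v cA cV by (intro exI[of _ S]) auto
qed

lemma pair_poly_of_int: "pair_poly N x (of_int_poly P :: rat poly) = of_int (pair_poly N x P)"
  by (simp add: pair_poly_def)

lemma kills_of_int: "kills N x (of_int_poly P :: rat poly) \<longleftrightarrow> kills N x P"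
proof -
  have "pair_poly N x (of_int_poly P * Polynomial.monom 1 i :: rat poly) = of_int (pair_poly N x (P * Polynomial.monom 1 i))" for i
  proof -
    have "(of_int_poly P * Polynomial.monom 1 i :: rat poly) = of_int_poly (P * Polynomial.monom 1 i)"
      by (simp add: hom_distribs)
    thus ?thesis by (simp only: pair_poly_of_int)
  qed
  thus ?thesis by (simp add: kills_def)
qed

lemma kills_smult:
  fixes P :: "'a :: idom poly"
  assumes "c \<noteq> 0"
  shows "kills N x (Polynomial.smult c P) \<longleftrightarrow> kills N x P"
  using assms by (simp add: kills_def pair_poly_smult)

lemma coeff_mult_monom1: "poly.coeff (R * Polynomial.monom 1 i) j = (if i \<le> j then poly.coeff R (j - i) else (0::int))"
  by (simp add: coeff_monom_mult mult.commute[of R])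

text \<open>As x (i + j) is close to \<zeta>^i x j, the pairing with R T^i is close to \<zeta>^i
  times the pairing with R, that is, to 0. Being an integer of modulus below 1, it vanishes: one
  linear condition implies all the shifted ones.\<close>

lemma small_poly_kills:
  fixes R :: "int poly" and x :: "nat \<Rightarrow> int" and \<zeta> :: real
  assumes z: "\<bar>\<zeta>\<bar> \<le> m" "1 \<le> m" and Y: "\<And>i. i \<le> N \<Longrightarrow> \<bar>\<zeta> ^ i * of_int (x 0) - of_int (x i)\<bar> \<le> Y"
    and R: "\<And>i. \<bar>poly.coeff R i\<bar> \<le> int B" "pair_poly N x R = 0"
    and small: "(real N + 1) * real B * (1 + m ^ N) * Y < 1"
  shows "kills N x R"
  unfolding kills_def
proof (intro allI impI)
  fix i assume i: "degree R + i \<le> N"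
  define d where "d = degree R"
  have Y0: "Y \<ge> 0" using Y[of 0] by simp
  have p1: "pair_poly N x (R * Polynomial.monom 1 i) = (\<Sum>j\<le>d. poly.coeff R j * x (i + j))"
  proof -
    have "pair_poly N x (R * Polynomial.monom 1 i) = (\<Sum>j\<le>N. (if i \<le> j then poly.coeff R (j - i) else 0) * x j)"
      unfolding pair_poly_def by (intro sum.cong refl) (simp add: coeff_mult_monom1)
    also have "\<dots> = (\<Sum>j\<in>{i..i + d}. poly.coeff R (j - i) * x j)"
      using i by (intro sum.mono_neutral_cong_right) (auto simp: d_def coeff_eq_0)
    also have "\<dots> = (\<Sum>j\<in>{0..d}. poly.coeff R j * x (i + j))"
      by (rule sum.reindex_bij_witness[of _ "\<lambda>j. i + j" "\<lambda>j. j - i"]) auto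
    finally show ?thesis by (simp add: atLeast0AtMost)
  qed
  have p0: "(\<Sum>j\<le>d. poly.coeff R j * x j) = 0"
  proof -
    have "pair_poly N x R = (\<Sum>j\<le>d. poly.coeff R j * x j)"
      unfolding pair_poly_def using i by (intro sum.mono_neutral_cong_right) (auto simp: d_def coeff_eq_0)
    thus ?thesis using R(2) by simp
  qed
  have e: "\<bar>of_int (x (i + j)) - \<zeta> ^ i * of_int (x j)\<bar> \<le> (1 + m ^ N) * Y" if j: "j \<le> d" for j
  proof -
    define P Q where "P = \<zeta> ^ i * (\<zeta> ^ j * of_int (x 0) - of_int (x j))"
      and "Q = \<zeta> ^ (i + j) * of_int (x 0) - of_int (x (i + j))"
    have "\<bar>P\<bar> \<le> m ^ N * Y"
    proof -
      have "\<bar>\<zeta>\<bar> ^ i \<le> m ^ i" using z by (intro power_mono) auto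
      also have "\<dots> \<le> m ^ N" using z i by (intro power_increasing) auto
      finally show ?thesis unfolding P_def using Y[of j] j i z by (auto simp: abs_mult power_abs d_def intro!: mult_mono)
    qed
    moreover have "\<bar>Q\<bar> \<le> Y" unfolding Q_def using Y[of "i + j"] i j by (simp add: d_def)
    moreover have "of_int (x (i + j)) - \<zeta> ^ i * of_int (x j) = P - Q"
      by (simp add: P_def Q_def algebra_simps power_add)
    moreover have "(1 + m ^ N) * Y = Y + m ^ N * Y" by (simp add: algebra_simps)
    ultimately show ?thesis by linarith
  qed
  have "of_int (pair_poly N x (R * Polynomial.monom 1 i)) = (\<Sum>j\<le>d. of_int (poly.coeff R j) * (of_int (x (i + j)) - \<zeta> ^ i * of_int (x j)))"
  proof -
    have "(\<Sum>j\<le>d. of_int (poly.coeff R j) * (of_int (x (i + j)) - \<zeta> ^ i * of_int (x j))) =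
       (\<Sum>j\<le>d. of_int (poly.coeff R j * x (i + j)) - \<zeta> ^ i * of_int (poly.coeff R j * x j))"
      by (intro sum.cong refl) (simp add: algebra_simps)
    also have "\<dots> = of_int (\<Sum>j\<le>d. poly.coeff R j * x (i + j)) - \<zeta> ^ i * of_int (\<Sum>j\<le>d. poly.coeff R j * x j)"
      by (simp only: sum_subtractf sum_distrib_left[symmetric] of_int_sum)
    finally show ?thesis using p0 p1 by simp
  qed
  hence "\<bar>real_of_int (pair_poly N x (R * Polynomial.monom 1 i))\<bar> \<le>
      (\<Sum>j\<le>d. \<bar>of_int (poly.coeff R j) * (of_int (x (i + j)) - \<zeta> ^ i * of_int (x j))\<bar>)"
    by (simp only: sum_abs)
  also have "\<dots> \<le> (\<Sum>j\<le>d. real B * ((1 + m ^ N) * Y))"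
  proof (intro sum_mono)
    fix j assume "j \<in> {..d}"
    moreover have "\<bar>real_of_int (poly.coeff R j)\<bar> \<le> real B" using R(1)[of j] by linarith
    ultimately show "\<bar>of_int (poly.coeff R j) * (of_int (x (i + j)) - \<zeta> ^ i * of_int (x j))\<bar> \<le> real B * ((1 + m ^ N) * Y)"
      unfolding abs_mult using e[of j] by (intro mult_mono) auto
  qed
  also have "\<dots> = (real d + 1) * (real B * ((1 + m ^ N) * Y))" by (simp add: algebra_simps)
  also have "\<dots> \<le> (real N + 1) * (real B * ((1 + m ^ N) * Y))"
    using i Y0 z by (intro mult_right_mono) (auto simp: d_def)
  also have "\<dots> < 1" using small by (simp add: mult.assoc)
  finally show "pair_poly N x (R * Polynomial.monom 1 i) = 0" by linarith
qed

lemma card_polys_le: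
  assumes "finite S" "\<And>p. p \<in> S \<Longrightarrow> degree p \<le> k \<and> (\<forall>i. \<bar>poly.coeff p i\<bar> \<le> int b)"
  shows "card (S :: int poly set) \<le> (2 * b + 1) ^ (k + 1)"
proof -
  let ?g = "\<lambda>p. restrict (poly.coeff p) {..k}"
  have "inj_on ?g S"
  proof (rule inj_onI)
    fix p q assume pq: "p \<in> S" "q \<in> S" "?g p = ?g q"
    show "p = q"
    proof (rule poly_eqI)
      fix i show "poly.coeff p i = poly.coeff q i"
      proof (cases "i \<le> k")
        case True
        thus ?thesis using fun_cong[OF pq(3), of i] by simp
      next
        case False
        thus ?thesis using assms(2)[OF pq(1)] assms(2)[OF pq(2)] by (simp add: coeff_eq_0)
      qed
    qed
  qed
  moreover have "?g ` S \<subseteq> PiE {..k} (\<lambda>_. {- int b..int b})"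
  proof (rule image_subsetI)
    fix p assume "p \<in> S"
    hence "\<bar>poly.coeff p i\<bar> \<le> int b" for i using assms(2) by blast
    hence "- int b \<le> poly.coeff p i \<and> poly.coeff p i \<le> int b" for i by (simp add: abs_le_iff minus_le_iff)
    thus "?g p \<in> PiE {..k} (\<lambda>_. {- int b..int b})" by auto
  qed
  ultimately have "card S \<le> card (PiE {..k} (\<lambda>_. {- int b..int b}))"
    by (intro card_inj_on_le[of ?g]) (auto intro!: finite_PiE)
  also have "\<dots> = (2 * b + 1) ^ (k + 1)"
  proof -
    have "nat (int b - - int b + 1) = 2 * b + 1" by simp
    thus ?thesis by (simp add: card_PiE)
  qed
  finally show ?thesis .
qed

text \<open>Every small annihilator of degree at most \<open>N + 1 - n\<close> is a multiple of the minimal one, \<open>D\<close> of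
  degree \<open>n\<close>; comparing the number of such annihilators with the number of multiples bounds the height of \<open>D\<close>.\<close>

lemma exists_small_killer:
  fixes x :: "nat \<Rightarrow> int" and \<zeta> m Y :: real
  assumes z: "\<bar>\<zeta>\<bar> \<le> m" "1 \<le> m" and Y: "\<And>i. i \<le> N \<Longrightarrow> \<bar>\<zeta> ^ i * of_int (x 0) - of_int (x i)\<bar> \<le> Y"
    and x0: "x 0 \<noteq> 0" and k0: "1 \<le> k0" "2 * k0 \<le> N + 1"
    and small: "(real N + 1) * real B * (1 + m ^ N) * Y < 1" and B: "1 \<le> B"
    and W: "\<And>i. i \<le> N \<Longrightarrow> \<bar>x i\<bar> \<le> int W"
    and big: "real (2 * ((N + 1) * B * W) + 1) < real B ^ (k0 + 1)"
  shows "\<exists>(D :: int poly) n. D \<noteq> 0 \<and> degree D = n \<and> 1 \<le> n \<and> n \<le> k0 \<and> pair_poly N x D = 0 \<and>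
     mahler_measure D ^ (N + 2 - 2 * n) * real B ^ n \<le>
       real (2 * ((N + 1) * B * W) + 1) * (3 * 2 ^ N * (real N + 1)) ^ (N + 2 - 2 * n)"
proof -
  define Kp where "Kp P \<longleftrightarrow> (P :: rat poly) \<noteq> 0 \<and> degree P \<le> N \<and> kills N x P" for P
  have k0N: "k0 \<le> N" using k0 by linarith
  obtain S0 :: "int poly set" where S0: "finite S0" "0 \<in> S0" "\<forall>R\<in>S0. degree R \<le> k0 \<and> (\<forall>i. \<bar>poly.coeff R i\<bar> \<le> int B) \<and> pair_poly N x R = 0"
     "(B + 1) ^ (k0 + 1) \<le> (2 * ((N + 1) * B * W) + 1) * card S0"
    by (rule exE[OF many_killers[where B = B and N = N and x = x, OF k0N W]], assumption, (elim conjE)+, rule that)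
  have "\<exists>R\<in>S0. R \<noteq> 0"
  proof (rule ccontr)
    assume "\<not> ?thesis"
    hence "S0 \<subseteq> {0}" by auto
    hence "card S0 \<le> 1" using card_mono[of "{0 :: int poly}" S0] by simp
    hence "(2 * ((N + 1) * B * W) + 1) * card S0 \<le> (2 * ((N + 1) * B * W) + 1) * 1" by (rule mult_le_mono2)
    hence "(B + 1) ^ (k0 + 1) \<le> 2 * ((N + 1) * B * W) + 1" using le_trans[OF S0(4)] by (simp only: mult_1_right)
    hence "real ((B + 1) ^ (k0 + 1)) \<le> real (2 * ((N + 1) * B * W) + 1)" by (simp only: of_nat_le_iff)
    moreover have "real B ^ (k0 + 1) \<le> real ((B + 1) ^ (k0 + 1))" unfolding semiring_1_class.of_nat_power by (intro power_mono) auto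
    ultimately show False using big by linarith
  qed
  then obtain R0 where R0: "R0 \<in> S0" "R0 \<noteq> 0" by blast
  have "kills N x R0" using bspec[OF S0(3) R0(1)] by (intro small_poly_kills[OF z Y _ _ small]) auto
  hence KR0: "Kp (of_int_poly R0)" using R0(2) bspec[OF S0(3) R0(1)] k0N by (auto simp: Kp_def kills_of_int)
  obtain P0 where P0: "Kp P0" "\<And>P. Kp P \<Longrightarrow> degree P0 \<le> degree P"
    using ex_has_least_nat[of Kp, OF KR0, of degree] by auto
  obtain r D where rD: "rat_to_normalized_int_poly P0 = (r, D)" by (cases "rat_to_normalized_int_poly P0") auto
  have P0': "P0 \<noteq> 0" using P0(1) by (simp add: Kp_def)
  have PD: "P0 = Polynomial.smult r (of_int_poly D)" and cD: "content D = 1" and degD: "degree D = degree P0" and rpos: "r > 0"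
    using rat_to_normalized_int_poly(1)[OF rD] rat_to_normalized_int_poly(3)[OF rD P0'] rat_to_normalized_int_poly(4)[OF rD]
      rat_to_normalized_int_poly(2)[OF rD] by auto
  define n where "n = degree D"
  have D0: "D \<noteq> 0" using cD by auto
  have kD: "kills N x (of_int_poly D :: rat poly)" using P0(1) PD rpos by (simp add: Kp_def kills_smult)
  have nk0: "n \<le> k0" using P0(2)[OF KR0] bspec[OF S0(3) R0(1)] degD by (simp add: n_def)
  have n1: "1 \<le> n"
  proof (rule ccontr)
    assume "\<not> 1 \<le> n"
    hence "degree D = 0" by (simp add: n_def)
    then obtain c where c: "D = [:c:]" using degree_eq_zeroE by blast
    have c0: "c \<noteq> 0" using c D0 by simp
    have "kills N x D" using kD kills_of_int by blast
    hence "degree D + 0 \<le> N \<longrightarrow> pair_poly N x (D * Polynomial.monom 1 0) = 0" unfolding kills_def by (rule spec)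
    hence "pair_poly N x D = 0" using \<open>degree D = 0\<close> by simp
    moreover have "pair_poly N x D = (\<Sum>i\<le>N. if i = 0 then c * x 0 else 0)"
      unfolding pair_poly_def c by (intro sum.cong refl) (auto simp: coeff_pCons split: nat.splits)
    ultimately show False using c0 x0 by simp
  qed
  have dN: "degree (of_int_poly D :: rat poly) = n" by (simp add: n_def)
  \<comment> \<open>The largest degree up to which \<open>minimal_killer_dvd\<close> forces
    annihilators to be multiples of D.\<close>
  define k where "k = N + 1 - n"
  have kN: "k \<le> N" "k0 \<le> k" using n1 nk0 k0 by (auto simp: k_def)
  obtain S :: "int poly set" where S: "finite S" "0 \<in> S" "\<forall>R\<in>S. degree R \<le> k \<and> (\<forall>i. \<bar>poly.coeff R i\<bar> \<le> int B) \<and> pair_poly N x R = 0"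
     "(B + 1) ^ (k + 1) \<le> (2 * ((N + 1) * B * W) + 1) * card S"
    by (rule exE[OF many_killers[where B = B and N = N and x = x, OF kN(1) W]], assumption, (elim conjE)+, rule that)
  have dvd: "D dvd R" if RS: "R \<in> S" for R
  proof (rule content_1_dvd_of_int[OF cD], rule minimal_killer_dvd[of _ N x])
    have kR: "kills N x R" using bspec[OF S(3) RS] by (intro small_poly_kills[OF z Y _ _ small]) auto
    show "degree (of_int_poly R :: rat poly) \<le> N + 1 - degree (of_int_poly D :: rat poly)"
      using bspec[OF S(3) RS] by (simp add: k_def n_def)
    show "pair_poly N x (of_int_poly R * Polynomial.monom 1 i :: rat poly) = 0"
      if "i < degree (of_int_poly D :: rat poly)" for i
    proof -
      have "degree R + i \<le> N" using that bspec[OF S(3) RS] n1 nk0 k0N unfolding dN by (auto simp: k_def)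
      thus ?thesis using kR unfolding kills_of_int[symmetric] by (simp add: kills_def)
    qed
  qed (use D0 kD dN n1 nk0 k0N P0(2) degD in \<open>auto simp: Kp_def n_def\<close>)
  define MD where "MD = mahler_measure D"
  have MD1: "MD \<ge> 1" unfolding MD_def by (rule mahler_measure_poly_ge_1[OF D0])
  \<comment> \<open>The quotient of a multiple R by D has Mahler measure M(R) / MD, and coefficients
    are at most 2^N times the Mahler measure, so bb bounds the coefficients of every
    quotient.\<close>
  define bb where "bb = 2 ^ N * (real N + 1) * real B / MD"
  define b where "b = nat \<lfloor>bb\<rfloor>"
  have bb0: "bb \<ge> 0" using MD1 by (simp add: bb_def)
  define q where "q R = (SOME s. R = D * s)" for R
  have q: "R = D * q R" if "R \<in> S" for R
    using someI_ex[of "\<lambda>s. R = D * s"] dvd[OF that] unfolding q_def by (auto elim: dvdE)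
  have qb: "degree (q R) \<le> k - n \<and> (\<forall>i. \<bar>poly.coeff (q R) i\<bar> \<le> int b)" if RS: "R \<in> S" for R
  proof (cases "q R = 0")
    case False
    have "degree R = n + degree (q R)" using q[OF RS] False D0 by (metis degree_mult_eq n_def)
    hence d: "degree (q R) \<le> k - n" using bspec[OF S(3) RS] by linarith
    have "mahler_measure R = MD * mahler_measure (q R)" using q[OF RS] mahler_mult by (metis MD_def)
    moreover have "mahler_measure R \<le> (real N + 1) * of_int (int B)"
      using bspec[OF S(3) RS] kN by (intro mahler_le_sum) auto
    ultimately have "MD * mahler_measure (q R) \<le> (real N + 1) * real B" by simp
    hence mq: "mahler_measure (q R) \<le> (real N + 1) * real B / MD" using MD1 by (simp add: field_simps)
    have "\<bar>poly.coeff (q R) i\<bar> \<le> int b" for i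
    proof -
      have "\<bar>real_of_int (poly.coeff (q R) i)\<bar> \<le> 2 ^ N * mahler_measure (q R)"
        by (rule coeff_le_mahler) (use d kN in linarith)
      also have "\<dots> \<le> 2 ^ N * ((real N + 1) * real B / MD)" by (intro mult_left_mono mq) auto
      also have "\<dots> = bb" by (simp add: bb_def)
      finally show ?thesis unfolding b_def using bb0 by linarith
    qed
    thus ?thesis using d by blast
  qed auto
  have "card S = card (q ` S)" using q by (intro card_image[symmetric] inj_onI) metis
  also have "\<dots> \<le> (2 * b + 1) ^ (k - n + 1)" using S(1) qb by (intro card_polys_le) auto
  finally have cS: "card S \<le> (2 * b + 1) ^ (k - n + 1)" .
  let ?V = "2 * ((N + 1) * B * W) + 1"
  have main: "real B ^ (k + 1) \<le> real ?V * real (2 * b + 1) ^ (k - n + 1)"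
  proof -
    have "(B + 1) ^ (k + 1) \<le> ?V * (2 * b + 1) ^ (k - n + 1)" by (rule le_trans[OF S(4) mult_le_mono2[OF cS]])
    hence "real ((B + 1) ^ (k + 1)) \<le> real (?V * (2 * b + 1) ^ (k - n + 1))" by (simp only: of_nat_le_iff)
    moreover have "real B ^ (k + 1) \<le> real ((B + 1) ^ (k + 1))" unfolding semiring_1_class.of_nat_power by (intro power_mono) auto
    ultimately show ?thesis by (simp only: of_nat_mult semiring_1_class.of_nat_power)
  qed
  \<comment> \<open>With b = 0 the only possible multiple is R = 0, and the count contradicts
    \<open>big\<close>. Once b is at least 1, 2 b + 1 is at most 3 bb.\<close>
  have b1: "b \<ge> 1"
  proof (rule ccontr)
    assume "\<not> b \<ge> 1"
    hence b0: "b = 0" by simp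
    have "real B ^ (k + 1) \<le> real ?V" using main unfolding b0 by (simp only: mult_0_right add_0 of_nat_1 power_one mult_1_right)
    moreover have "real B ^ (k0 + 1) \<le> real B ^ (k + 1)" using B kN by (intro power_increasing) auto
    ultimately show False using big by linarith
  qed
  have "real (2 * b + 1) \<le> 3 * bb"
  proof -
    have "real b \<le> bb" using bb0 by (simp add: b_def)
    thus ?thesis using b1 by simp
  qed
  hence "real B ^ (k + 1) \<le> real ?V * (3 * bb) ^ (k - n + 1)"
    using main by (meson mult_left_mono order_trans of_nat_0_le_iff power_mono)
  also have "(3 * bb) ^ (k - n + 1) = (3 * 2 ^ N * (real N + 1)) ^ (k - n + 1) * real B ^ (k - n + 1) / MD ^ (k - n + 1)"
    unfolding bb_def by (simp add: power_divide power_mult_distrib mult_ac)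
  finally have fin: "MD ^ (k - n + 1) * real B ^ (k + 1) \<le> real ?V * (3 * 2 ^ N * (real N + 1)) ^ (k - n + 1) * real B ^ (k - n + 1)"
    using MD1 by (simp add: field_simps)
  have "n + (k - n + 1) = k + 1" using nk0 k0 by (simp add: k_def)
  hence e: "real B ^ (k + 1) = real B ^ n * real B ^ (k - n + 1)" by (simp only: power_add[symmetric])
  have "(MD ^ (k - n + 1) * real B ^ n) * real B ^ (k - n + 1) \<le>
      (real ?V * (3 * 2 ^ N * (real N + 1)) ^ (k - n + 1)) * real B ^ (k - n + 1)"
    using fin unfolding e by (simp only: mult.assoc)
  moreover have "0 < real B ^ (k - n + 1)" using B by simp
  ultimately have "MD ^ (k - n + 1) * real B ^ n \<le> real ?V * (3 * 2 ^ N * (real N + 1)) ^ (k - n + 1)"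
    by (simp only: mult_le_cancel_right_pos)
  hence "MD ^ (N + 2 - 2 * n) * real B ^ n \<le> real ?V * (3 * 2 ^ N * (real N + 1)) ^ (N + 2 - 2 * n)"
  proof -
    assume *: "MD ^ (k - n + 1) * real B ^ n \<le> real ?V * (3 * 2 ^ N * (real N + 1)) ^ (k - n + 1)"
    have "k - n + 1 = N + 2 - 2 * n" using nk0 k0 by (simp add: k_def)
    thus ?thesis using * by (simp only:)
  qed
  moreover have "pair_poly N x D = 0"
  proof -
    have "kills N x D" using kD kills_of_int by blast
    hence "degree D + 0 \<le> N \<longrightarrow> pair_poly N x (D * Polynomial.monom 1 0) = 0" unfolding kills_def by (rule spec)
    thus ?thesis using nk0 k0N by (simp add: n_def)
  qed
  ultimately show ?thesis using D0 n1 nk0 unfolding n_def MD_def by (intro exI[of _ D] exI[of _ "degree D"]) simp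
qed

section \<open>Small values of integer polynomials at the approximated number\<close>

lemma powr_ge_of_ge:
  fixes K a X :: real
  assumes "K > 0" "a > 0" "X \<ge> K powr (1 / a)"
  shows "K \<le> X powr a"
proof -
  have "K = (K powr (1 / a)) powr a" using assms by (simp add: powr_powr)
  also have "\<dots> \<le> X powr a" using assms by (intro powr_mono2) auto
  finally show ?thesis .
qed

lemma killer_value_le:
  assumes p: "pair_poly N x D = 0" "degree D \<le> N" and x0: "x 0 \<noteq> 0"
    and Y: "\<And>i. i \<le> N \<Longrightarrow> \<bar>\<zeta> ^ i * of_int (x 0) - of_int (x i)\<bar> \<le> Y"
  shows "\<bar>poly (of_int_poly D) \<zeta>\<bar> * \<bar>of_int (x 0)\<bar> \<le> (real N + 1) * 2 ^ N * mahler_measure D * Y"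
proof -
  have Y0: "Y \<ge> 0" using Y[of 0] by simp
  have "poly (of_int_poly D) \<zeta> = (\<Sum>i\<le>N. of_int (poly.coeff D i) * \<zeta> ^ i)"
  proof -
    have "poly (of_int_poly D) \<zeta> = (\<Sum>i\<le>degree D. of_int (poly.coeff D i) * \<zeta> ^ i)"
      by (simp add: poly_altdef)
    also have "\<dots> = (\<Sum>i\<le>N. of_int (poly.coeff D i) * \<zeta> ^ i)"
      using p(2) by (intro sum.mono_neutral_left) (auto simp: coeff_eq_0)
    finally show ?thesis .
  qed
  hence "poly (of_int_poly D) \<zeta> * of_int (x 0) = (\<Sum>i\<le>N. of_int (poly.coeff D i) * (\<zeta> ^ i * of_int (x 0)))"
    by (simp add: sum_distrib_right mult.assoc)
  also have "\<dots> = (\<Sum>i\<le>N. of_int (poly.coeff D i) * (\<zeta> ^ i * of_int (x 0) - of_int (x i))) + of_int (pair_poly N x D)"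
    by (simp add: pair_poly_def right_diff_distrib sum_subtractf)
  finally have "\<bar>poly (of_int_poly D) \<zeta> * of_int (x 0)\<bar> \<le> (\<Sum>i\<le>N. \<bar>of_int (poly.coeff D i) * (\<zeta> ^ i * of_int (x 0) - of_int (x i))\<bar>)"
    using p(1) by simp
  also have "\<dots> \<le> (\<Sum>i\<le>N. 2 ^ N * mahler_measure D * Y)"
  proof (rule sum_mono)
    fix i assume "i \<in> {..N}"
    thus "\<bar>of_int (poly.coeff D i) * (\<zeta> ^ i * of_int (x 0) - of_int (x i))\<bar> \<le> 2 ^ N * mahler_measure D * Y"
      unfolding abs_mult using Y[of i] coeff_le_mahler[OF p(2), of i] by (intro mult_mono) auto
  qed
  also have "\<dots> = (real N + 1) * 2 ^ N * mahler_measure D * Y" by (simp add: algebra_simps)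
  finally show ?thesis by (simp add: abs_mult)
qed

text \<open>Because N e \<le> p, the root taken in \<mu>^p \<le> C X^e leaves X with exponent at
  most 1 / N; the lower bound e0 keeps the constant independent of e, which varies with the
  degree.\<close>

lemma height_bound_of_power:
  fixes \<mu> C X e :: real
  assumes mu: "1 \<le> \<mu>" "1 \<le> X" "1 \<le> C" "\<mu> ^ p \<le> C * X powr e" and e: "0 < e0" "e0 \<le> e" "N * e \<le> real p" and N: "N > 0"
  shows "\<mu> \<le> (C powr (1 / e0) * X) powr (1 / N)"
proof -
  have e': "e > 0" using e by linarith
  have "\<mu> powr (N * e) \<le> \<mu> powr real p" using mu e by (intro powr_mono) auto
  also have "\<dots> = \<mu> ^ p" using mu by (simp add: powr_realpow)
  also note mu(4)
  finally have "(\<mu> powr (N * e)) powr (1 / (N * e)) \<le> (C * X powr e) powr (1 / (N * e))"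
    using e' N by (intro powr_mono2) auto
  moreover have "(\<mu> powr (N * e)) powr (1 / (N * e)) = \<mu>" using e' N mu by (simp add: powr_powr)
  moreover have "(C * X powr e) powr (1 / (N * e)) = (C powr (1 / e) * X) powr (1 / N)"
    using e' N mu by (simp add: powr_mult powr_powr mult.commute)
  moreover have "(C powr (1 / e) * X) powr (1 / N) \<le> (C powr (1 / e0) * X) powr (1 / N)"
    using e e' N mu by (intro powr_mono2 mult_right_mono powr_mono divide_left_mono) auto
  ultimately show ?thesis by linarith
qed

text \<open>With X = |x 0| one may take B of order X^l, and \<open>exists_small_killer\<close>
  bounds the Mahler measure \<mu> by \<mu>^(N + 2 - 2 n) = O(X^(1 - (n - 1) l)). Since N l \<ge> 2,
  N (1 - (n - 1) l) is at most N + 2 - 2 n, hence \<mu> = O(X^(1 / N)). The value at \<zeta> is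
  O(\<mu> X^(-1 - l)), and (1 + w) / N < 1 + l leaves a negative power of X. It is written as a
  power with exponent deg D so that it can be divided among factors.\<close>

lemma killer_of_approximation:
  fixes l m w :: real
  assumes k0: "1 \<le> k0" "2 * k0 \<le> N + 1" and l: "l > 0" "(real k0 - 1) * l < 1" "1 < real k0 * l" "2 \<le> real N * l"
    and m: "1 \<le> m" and w: "0 \<le> w" "w < real N * (1 + l) - 1"
  shows "\<exists>\<eta>>0. \<exists>X0\<ge>1. \<forall>\<zeta> (x :: nat \<Rightarrow> int). \<bar>\<zeta>\<bar> \<le> m \<longrightarrow> X0 \<le> \<bar>real_of_int (x 0)\<bar> \<longrightarrow>
     (\<forall>i\<le>N. \<bar>\<zeta> ^ i * real_of_int (x 0) - real_of_int (x i)\<bar> \<le> \<bar>real_of_int (x 0)\<bar> powr - l) \<longrightarrow>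
     (\<exists>D :: int poly. D \<noteq> 0 \<and> 1 \<le> degree D \<and> degree D \<le> k0 \<and>
        \<bar>poly (of_int_poly D) \<zeta>\<bar> * mahler_measure D powr w \<le> (\<bar>real_of_int (x 0)\<bar> powr - \<eta>) ^ degree D)"
proof -
  have N1: "N \<ge> 1" using k0 by linarith
  define M1 where "M1 = m ^ N"
  have M1: "M1 \<ge> 1" unfolding M1_def using m by (rule one_le_power)
  \<comment> \<open>For B \<le> c0 X^l this makes the quantity (N + 1) B (1 + m^N) X^(-l) of
    \<open>small_poly_kills\<close> at most 1/2.\<close>
  define c0 where "c0 = 1 / (2 * (real N + 1) * (1 + M1))"
  define c where "c = c0 / 2"
  have c0: "c0 > 0" using M1 unfolding c0_def by (intro divide_pos_pos mult_pos_pos) auto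
  have "1 \<le> 2 * (real N + 1) * (1 + M1)"
  proof -
    have "1 * 1 \<le> (2 * (real N + 1)) * (1 + M1)" using M1 by (intro mult_mono) auto
    thus ?thesis by simp
  qed
  hence c01: "c0 \<le> 1" unfolding c0_def by (simp add: divide_le_eq_1)
  have c: "c > 0" "c \<le> 1" using c0 c01 by (auto simp: c_def)
  define C2 where "C2 = 2 * (real N + 1) * (M1 + 2) + 1"
  have C2: "C2 \<ge> 1" using M1 by (simp add: C2_def)
  define KK where "KK = 3 * 2 ^ N * (real N + 1)"
  have KK: "KK \<ge> 1"
  proof -
    have "1 * 1 \<le> (3 * 2 ^ N) * (real N + 1)"
    proof (intro mult_mono)
      have "(1::real) \<le> 2 ^ N" by (rule one_le_power) simp
      thus "1 \<le> 3 * (2::real) ^ N" by linarith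
    qed auto
    thus ?thesis by (simp add: KK_def)
  qed
  define C4 where "C4 = C2 * KK ^ N / c ^ k0"
  have C4: "C4 \<ge> 1"
  proof -
    have "c ^ k0 \<le> 1 * 1" using c by (simp add: power_le_one)
    also have "\<dots> \<le> C2 * KK ^ N" using C2 one_le_power[OF KK, of N] by (intro mult_mono) auto
    finally show ?thesis using c by (simp add: C4_def pos_le_divide_eq)
  qed
  define e0 where "e0 = 1 - (real k0 - 1) * l"
  have e0: "e0 > 0" using l by (simp add: e0_def)
  define C5 where "C5 = C4 powr (1 / e0)"
  have C5: "C5 > 0" using C4 by (simp add: C5_def)
  define a where "a = (1 + w) / real N"
  have aw: "a < 1 + l" using w N1 by (simp add: a_def field_simps)
  have a0: "a \<ge> 0" using w by (simp add: a_def)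
  \<comment> \<open>The spare exponent 1 + l - a equals 2 k0 \<eta>: one half absorbs the constant
    C6, the other provides \<eta> for each of up to k0 degrees.\<close>
  define \<eta> where "\<eta> = (1 + l - a) / (2 * real k0)"
  have eta: "\<eta> > 0" using aw k0 by (simp add: \<eta>_def)
  have eta2: "2 * real k0 * \<eta> = 1 + l - a" using k0 by (simp add: \<eta>_def)
  define C6 where "C6 = (real N + 1) * 2 ^ N * C5 powr a"
  have C6: "C6 > 0" using C5 by (simp add: C6_def)
  define X0 where "X0 = Max {1, (2 / c0) powr (1 / l), (2 * C2 / c ^ k0) powr (1 / (real k0 * l - 1)), C6 powr (1 / (real k0 * \<eta>))}"
  have X0: "1 \<le> X0" "(2 / c0) powr (1 / l) \<le> X0" "(2 * C2 / c ^ k0) powr (1 / (real k0 * l - 1)) \<le> X0"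
     "C6 powr (1 / (real k0 * \<eta>)) \<le> X0" by (auto simp: X0_def)
  show ?thesis
  proof (rule exI[of _ \<eta>], rule conjI[OF eta], rule exI[of _ X0], rule conjI[OF X0(1)], intro allI impI)
    fix \<zeta> :: real and x :: "nat \<Rightarrow> int"
    assume z: "\<bar>\<zeta>\<bar> \<le> m" and xX: "X0 \<le> \<bar>real_of_int (x 0)\<bar>"
      and ap: "\<forall>i\<le>N. \<bar>\<zeta> ^ i * real_of_int (x 0) - real_of_int (x i)\<bar> \<le> \<bar>real_of_int (x 0)\<bar> powr - l"
    define X where "X = \<bar>real_of_int (x 0)\<bar>"
    have X: "X \<ge> 1" "X0 \<le> X" using xX X0(1) by (auto simp: X_def)
    have x0: "x 0 \<noteq> 0" using X by (auto simp: X_def)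
    define Y where "Y = X powr - l"
    have Y: "0 < Y" "Y \<le> 1" using X l powr_mono[of "-l" 0 X] by (auto simp: Y_def)
    have ap': "\<bar>\<zeta> ^ i * real_of_int (x 0) - real_of_int (x i)\<bar> \<le> Y" if "i \<le> N" for i
      using ap that by (simp add: Y_def X_def)
    have g1: "2 / c0 \<le> X powr l" using X X0 c0 l by (intro powr_ge_of_ge) auto
    have g2: "2 * C2 / c ^ k0 \<le> X powr (real k0 * l - 1)" using X X0 c C2 l by (intro powr_ge_of_ge) auto
    have g3: "C6 \<le> X powr (real k0 * \<eta>)" using X X0 C6 eta k0 by (intro powr_ge_of_ge) auto
    define B where "B = nat \<lfloor>c0 * X powr l\<rfloor>"
    have t2: "2 \<le> c0 * X powr l" using g1 c0 by (simp add: pos_divide_le_eq mult.commute)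
    have Bu: "real B \<le> c0 * X powr l" using t2 by (simp add: B_def)
    have Bl: "c * X powr l \<le> real B" using t2 unfolding B_def c_def by linarith
    have B1: "1 \<le> B" using t2 Bl by (simp add: c_def)
    define W where "W = nat \<lceil>M1 * X + 1\<rceil>"
    have Wu: "real W \<le> (M1 + 2) * X"
    proof -
      have "0 \<le> M1 * X" using X M1 by simp
      hence "real W \<le> M1 * X + 2" unfolding W_def by linarith
      also have "\<dots> \<le> M1 * X + 2 * X" using X by linarith
      finally show ?thesis by (simp add: algebra_simps)
    qed
    have xW: "\<bar>x i\<bar> \<le> int W" if i: "i \<le> N" for i
    proof -
      have "\<bar>\<zeta> ^ i * real_of_int (x 0)\<bar> \<le> M1 * X"
      proof -
        have "\<bar>\<zeta>\<bar> ^ i \<le> m ^ i" using z by (intro power_mono) auto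
        also have "\<dots> \<le> M1" unfolding M1_def using m i by (intro power_increasing) auto
        finally show ?thesis using X by (simp add: abs_mult power_abs X_def mult_right_mono)
      qed
      hence "\<bar>real_of_int (x i)\<bar> \<le> M1 * X + 1" using ap'[OF i] Y by linarith
      hence "real_of_int \<bar>x i\<bar> \<le> real W" unfolding W_def by linarith
      thus ?thesis by linarith
    qed
    have small: "(real N + 1) * real B * (1 + m ^ N) * Y < 1"
    proof -
      have "(real N + 1) * real B * (1 + m ^ N) * Y \<le> (real N + 1) * (c0 * X powr l) * (1 + M1) * Y"
        unfolding M1_def[symmetric] using Bu M1 Y by (intro mult_right_mono mult_left_mono) auto
      also have "\<dots> = (real N + 1) * c0 * (1 + M1) * (X powr l * X powr - l)" by (simp add: Y_def mult_ac)
      also have "X powr l * X powr - l = 1" using X by (simp add: powr_minus)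
      also have "(real N + 1) * c0 * (1 + M1) * 1 = 1 / 2" using M1 by (simp add: c0_def)
      finally show ?thesis by linarith
    qed
    define V where "V = real (2 * ((N + 1) * B * W) + 1)"
    have Vu: "V \<le> C2 * (real B * X)"
    proof -
      have "V = 2 * (real N + 1) * real B * real W + 1" by (simp add: V_def algebra_simps)
      also have "\<dots> \<le> 2 * (real N + 1) * real B * ((M1 + 2) * X) + 1" by (intro add_right_mono mult_left_mono Wu) auto
      also have "1 * 1 \<le> real B * X" using B1 X by (intro mult_mono) auto
      hence "2 * (real N + 1) * real B * ((M1 + 2) * X) + 1 \<le> 2 * (real N + 1) * real B * ((M1 + 2) * X) + real B * X" by linarith
      also have "\<dots> = C2 * (real B * X)" by (simp add: C2_def algebra_simps)
      finally show ?thesis .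
    qed
    have cB: "c ^ j * X powr (real j * l) \<le> real B ^ j" for j
    proof -
      have "(c * X powr l) ^ j \<le> real B ^ j" using c X by (intro power_mono Bl) auto
      moreover have "(X powr l) ^ j = X powr (real j * l)" using X by (simp add: powr_powr powr_realpow[symmetric] mult.commute)
      ultimately show ?thesis by (simp add: power_mult_distrib)
    qed
    have big: "real (2 * ((N + 1) * B * W) + 1) < real B ^ (k0 + 1)"
    proof -
      have "2 * C2 * X \<le> (c ^ k0 * X powr (real k0 * l - 1)) * X"
        using g2 c X by (intro mult_right_mono) (auto simp: pos_divide_le_eq mult.commute)
      also have "\<dots> = c ^ k0 * X powr (real k0 * l)" using X by (simp add: powr_diff)
      also note cB
      finally have "2 * C2 * X \<le> real B ^ k0" .
      moreover have "0 < C2 * X" using C2 X by simp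
      ultimately have "C2 * X < real B ^ k0" by linarith
      hence "real B * (C2 * X) < real B * real B ^ k0" using B1 by (intro mult_strict_left_mono) auto
      thus ?thesis using Vu unfolding V_def[symmetric] by (simp add: mult_ac)
    qed
    have ex: "\<exists>(D :: int poly) n. D \<noteq> 0 \<and> degree D = n \<and> 1 \<le> n \<and> n \<le> k0 \<and> pair_poly N x D = 0 \<and>
     mahler_measure D ^ (N + 2 - 2 * n) * real B ^ n \<le> V * KK ^ (N + 2 - 2 * n)"
      unfolding V_def KK_def
      by (rule exists_small_killer[OF z m ap' x0 k0 small B1 xW big]) (auto simp only:)
    obtain D :: "int poly" and n where D: "D \<noteq> 0" "degree D = n" "1 \<le> n" "n \<le> k0" "pair_poly N x D = 0"
       "mahler_measure D ^ (N + 2 - 2 * n) * real B ^ n \<le> V * KK ^ (N + 2 - 2 * n)"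
      by (rule exE[OF ex], erule exE, (elim conjE)+, rule that)
    define \<mu> where "\<mu> = mahler_measure D"
    have mu: "\<mu> \<ge> 1" unfolding \<mu>_def by (rule mahler_measure_poly_ge_1[OF D(1)])
    define p where "p = N + 2 - 2 * n"
    obtain n' where n': "n = Suc n'" using D(3) by (cases n) auto
    have pN: "p \<le> N" using D(3) by (simp add: p_def)
    have rp: "real p = real N - 2 * real n'" using D(4) k0 n' by (simp add: p_def)
    define e where "e = 1 - real n' * l"
    have ee: "e0 \<le> e"
    proof -
      have "real n' * l \<le> (real k0 - 1) * l" using D(4) n' l by (intro mult_right_mono) auto
      thus ?thesis by (simp add: e_def e0_def)
    qed
    have mup: "\<mu> ^ p \<le> C4 * X powr e"
    proof -
      have "\<mu> ^ p * real B ^ n \<le> V * KK ^ p" using D(6) by (simp add: \<mu>_def p_def)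
      also have "\<dots> \<le> (C2 * (real B * X)) * KK ^ N"
        using Vu KK pN C2 X by (intro mult_mono power_increasing) auto
      finally have "(\<mu> ^ p * real B ^ n') * real B \<le> (C2 * KK ^ N * X) * real B" by (simp add: n' mult_ac)
      hence 1: "\<mu> ^ p * real B ^ n' \<le> C2 * KK ^ N * X" using B1 by (simp only: mult_le_cancel_right_pos of_nat_0_less_iff)
      have "c ^ k0 * X powr (real n' * l) \<le> c ^ n' * X powr (real n' * l)"
        using c D(4) n' by (intro mult_right_mono power_decreasing) auto
      also note cB
      finally have "\<mu> ^ p * (c ^ k0 * X powr (real n' * l)) \<le> \<mu> ^ p * real B ^ n'" using mu by (intro mult_left_mono) auto
      with 1 have 2: "\<mu> ^ p * (c ^ k0 * X powr (real n' * l)) \<le> C2 * KK ^ N * X" by linarith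
      have pos: "c ^ k0 * X powr (real n' * l) > 0" using c X by simp
      have "\<mu> ^ p \<le> C2 * KK ^ N * X / (c ^ k0 * X powr (real n' * l))" using 2 pos by (simp only: pos_le_divide_eq)
      also have "\<dots> = C4 * X powr e" using X by (simp add: C4_def e_def powr_diff)
      finally show ?thesis .
    qed
    have "real N * e \<le> real p"
    proof -
      have "2 * real n' \<le> (real N * l) * real n'" using l by (intro mult_right_mono) auto
      thus ?thesis unfolding rp e_def by (simp add: algebra_simps)
    qed
    hence muX: "\<mu> \<le> (C5 * X) powr (1 / real N)"
      unfolding C5_def using N1 by (intro height_bound_of_power[OF mu X(1) C4 mup e0 ee]) auto
    have mua: "\<mu> powr (1 + w) \<le> C5 powr a * X powr a"
    proof -
      have "\<mu> powr (1 + w) \<le> ((C5 * X) powr (1 / real N)) powr (1 + w)" using mu w by (intro powr_mono2 muX) auto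
      also have "\<dots> = C5 powr a * X powr a" using C5 X by (simp add: powr_powr powr_mult a_def)
      finally show ?thesis .
    qed
    have val: "\<bar>poly (of_int_poly D) \<zeta>\<bar> * X \<le> (real N + 1) * 2 ^ N * \<mu> * Y"
      unfolding X_def \<mu>_def using D k0 by (intro killer_value_le[OF _ _ x0 ap']) auto
    have "\<bar>poly (of_int_poly D) \<zeta>\<bar> \<le> (real N + 1) * 2 ^ N * \<mu> * Y / X" using val X by (simp add: pos_le_divide_eq)
    hence "\<bar>poly (of_int_poly D) \<zeta>\<bar> * \<mu> powr w \<le> ((real N + 1) * 2 ^ N * \<mu> * Y / X) * \<mu> powr w" by (rule mult_right_mono) simp
    also have "\<dots> = (real N + 1) * 2 ^ N * (\<mu> powr (1 + w)) * X powr (- l - 1)"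
      using mu X by (simp add: powr_add powr_diff Y_def)
    also have "\<dots> \<le> (real N + 1) * 2 ^ N * (C5 powr a * X powr a) * X powr (- l - 1)"
      by (intro mult_right_mono mult_left_mono mua) auto
    also have "\<dots> = C6 * (X powr a * X powr (- l - 1))" by (simp add: C6_def mult_ac)
    also have "X powr a * X powr (- l - 1) = X powr (- (2 * real k0 * \<eta>))"
      unfolding eta2 powr_add[symmetric] by (simp add: algebra_simps)
    also have "C6 * X powr (- (2 * real k0 * \<eta>)) \<le> X powr (real k0 * \<eta>) * X powr (- (2 * real k0 * \<eta>))"
      by (intro mult_right_mono g3) auto
    also have "\<dots> = X powr (- (real k0 * \<eta>))" unfolding powr_add[symmetric] by (simp add: algebra_simps)
    also have "\<dots> \<le> X powr (- (real n * \<eta>))" using D(4) eta X by (intro powr_mono) (auto intro: mult_right_mono)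
    also have "\<dots> = (X powr - \<eta>) ^ n" using X by (simp add: powr_powr powr_realpow[symmetric] mult.commute)
    finally have fin: "\<bar>poly (of_int_poly D) \<zeta>\<bar> * mahler_measure D powr w \<le> (\<bar>real_of_int (x 0)\<bar> powr - \<eta>) ^ degree D"
      by (simp only: X_def \<mu>_def D(2))
    show "\<exists>D :: int poly. D \<noteq> 0 \<and> 1 \<le> degree D \<and> degree D \<le> k0 \<and>
        \<bar>poly (of_int_poly D) \<zeta>\<bar> * mahler_measure D powr w \<le> (\<bar>real_of_int (x 0)\<bar> powr - \<eta>) ^ degree D"
      by (rule exI[of _ D], intro conjI D(1) fin) (use D in auto)
  qed
qed

text \<open>The value at \<zeta>, the Mahler measure and \<theta>^degree are all multiplicative, so
  in a factorisation at least one factor inherits the inequality.\<close>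

lemma irreducible_factor_small:
  fixes D :: "int poly" and \<zeta> w \<theta> :: real
  assumes th: "0 \<le> \<theta>" "\<theta> \<le> 1"
  shows "1 \<le> degree D \<Longrightarrow> \<bar>poly (of_int_poly D) \<zeta>\<bar> * mahler_measure D powr w \<le> \<theta> ^ degree D \<Longrightarrow>
     \<exists>Q. irreducible\<^sub>d Q \<and> degree Q \<le> degree D \<and> \<bar>poly (of_int_poly Q) \<zeta>\<bar> * mahler_measure Q powr w \<le> \<theta>"
proof (induction "degree D" arbitrary: D rule: less_induct)
  case less
  let ?F = "\<lambda>Q :: int poly. \<bar>poly (of_int_poly Q) \<zeta>\<bar> * mahler_measure Q powr w"
  have pow: "\<theta> ^ degree Q \<le> \<theta>" if "1 \<le> degree Q" for Q :: "int poly"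
    using power_decreasing[of 1 "degree Q" \<theta>] th that by simp
  show ?case
  proof (cases "irreducible\<^sub>d D")
    case True
    thus ?thesis using less.prems pow[of D] by (intro exI[of _ D]) auto
  next
    case False
    obtain P R where PR: "0 < degree P" "degree P < degree D" "0 < degree R" "degree R < degree D" "D = P * R"
      by (rule reducible\<^sub>dE[OF False]) (use less.prems in simp, rule that)
    have nz: "P \<noteq> 0" "R \<noteq> 0" using PR by auto
    have F: "?F D = ?F P * ?F R"
      using mahler_measure_ge_0[of P] mahler_measure_ge_0[of R]
      by (simp add: PR(5) mahler_mult hom_distribs abs_mult powr_mult)
    have dd: "degree D = degree P + degree R" using nz by (simp add: PR(5) degree_mult_eq)
    have "?F P \<le> \<theta> ^ degree P \<or> ?F R \<le> \<theta> ^ degree R"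
    proof (rule ccontr)
      assume "\<not> ?thesis"
      hence "\<theta> ^ degree P * \<theta> ^ degree R < ?F P * ?F R" using th by (intro mult_strict_mono') (auto simp: not_le)
      thus False using less.prems(2) unfolding F dd power_add by linarith
    qed
    thus ?thesis
    proof
      assume "?F P \<le> \<theta> ^ degree P"
      from less.hyps[OF PR(2) _ this] PR(1) obtain Q where "irreducible\<^sub>d Q" "degree Q \<le> degree P" "?F Q \<le> \<theta>" by auto
      thus ?thesis using PR(2) by (intro exI[of _ Q]) auto
    next
      assume "?F R \<le> \<theta> ^ degree R"
      from less.hyps[OF PR(4) _ this] PR(3) obtain Q where "irreducible\<^sub>d Q" "degree Q \<le> degree R" "?F Q \<le> \<theta>" by auto
      thus ?thesis using PR(4) by (intro exI[of _ Q]) auto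
    qed
  qed
qed

subsection \<open>Separation of roots of irreducible integer polynomials\<close>

lemma poly_eq_sum_less:
  fixes p :: "'a :: comm_semiring_1 poly"
  assumes "degree p < n"
  shows "p = (\<Sum>t<n. Polynomial.monom (poly.coeff p t) t)"
  using assms by (intro poly_eqI) (auto simp: coeff_sum coeff_eq_0)

lemma poly_eval_sum_less:
  fixes p :: "'a :: comm_semiring_1 poly"
  assumes "degree p < n"
  shows "poly p a = (\<Sum>t<n. poly.coeff p t * a ^ t)"
  by (subst poly_eq_sum_less[OF assms]) (simp add: poly_sum poly_monom)

lemma poly_pderiv_sum_less:
  fixes p :: "'a :: idom poly"
  assumes "degree p < n"
  shows "poly (pderiv p) a = (\<Sum>t<n. poly.coeff p t * (of_nat t * a ^ (t - 1)))"
proof -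
  have "pderiv p = (\<Sum>t<n. Polynomial.monom (of_nat t * poly.coeff p t) (t - 1))"
    by (subst poly_eq_sum_less[OF assms]) (simp add: pderiv_sum pderiv_monom)
  thus ?thesis by (simp add: poly_sum poly_monom mult_ac)
qed

text \<open>Multiplication by the unipotent V replaces the last two columns by the derivatives and
  the values of the row polynomials at \<alpha>. By \<open>ev\<close> and \<open>dv\<close> these
  arise from the columns v and u through a triangular 2 by 2 block with diagonal q, q, so the
  determinant contains the factor q^2.\<close>

lemma det_eval_columns:
  fixes R :: "nat \<Rightarrow> complex poly" and n :: nat
  defines "D \<equiv> Suc (Suc n)"
  assumes degR: "\<And>i. i < D \<Longrightarrow> degree (R i) < D"
    and ev: "\<And>i. i < D \<Longrightarrow> poly (R i) \<alpha> = u i * q"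
    and dv: "\<And>i. i < D \<Longrightarrow> poly (pderiv (R i)) \<alpha> = v i * q + u i * e"
  shows "det (mat D D (\<lambda>(i, j). poly.coeff (R i) (Suc n - j))) =
     det (mat D D (\<lambda>(i, j). if j = Suc n then u i else if j = n then v i else poly.coeff (R i) (Suc n - j))) * q\<^sup>2"
proof -
  let ?A = "mat D D (\<lambda>(i, j). poly.coeff (R i) (Suc n - j))"
  let ?C = "mat D D (\<lambda>(i, j). if j = Suc n then u i else if j = n then v i else poly.coeff (R i) (Suc n - j))"
  define V where "V = mat D D (\<lambda>(r, j). if j = Suc n then \<alpha> ^ (Suc n - r) else if j = n then of_nat (Suc n - r) * \<alpha> ^ (Suc n - r - 1)
     else if r = j then 1 else 0)"
  define dg where "dg j = (if n \<le> j then q else 1)" for j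
  define W where "W = mat D D (\<lambda>(r, j). (if r = j then dg j else 0) + (if r = Suc n then if j = n then e else 0 else 0))"
  have eqm: "?A * V = ?C * W"
  proof (rule eq_matI)
    fix i j assume "i < dim_row (?C * W)" "j < dim_col (?C * W)"
    hence ij: "i < D" "j < D" by (auto simp: W_def)
    have l: "(?A * V) $$ (i, j) = (\<Sum>r<D. poly.coeff (R i) (Suc n - r) * V $$ (r, j))"
      using ij by (simp add: V_def scalar_prod_def atLeast0LessThan)
    have r: "(?C * W) $$ (i, j) = (\<Sum>r<D. ?C $$ (i, r) * ((if r = j then dg j else 0) + (if r = Suc n then if j = n then e else 0 else 0)))"
      using ij by (simp add: W_def scalar_prod_def atLeast0LessThan)
    have r': "\<dots> = ?C $$ (i, j) * dg j + ?C $$ (i, Suc n) * (if j = n then e else 0)"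
    proof -
      have "(\<Sum>r<D. ?C $$ (i, r) * ((if r = j then dg j else 0) + (if r = Suc n then if j = n then e else 0 else 0))) =
        (\<Sum>r<D. (if r = j then ?C $$ (i, r) * dg j else 0) + (if r = Suc n then ?C $$ (i, r) * (if j = n then e else 0) else 0))"
        by (intro sum.cong refl) (simp add: distrib_left)
      also have "\<dots> = ?C $$ (i, j) * dg j + ?C $$ (i, Suc n) * (if j = n then e else 0)"
        using ij by (simp add: sum.distrib D_def)
      finally show ?thesis .
    qed
    have rx: "(\<Sum>r<D. g (Suc n - r)) = (\<Sum>t<D. g t)" for g :: "nat \<Rightarrow> complex"
      using sum.nat_diff_reindex[of g D] by (simp add: D_def)
    consider "j = Suc n" | "j = n" | "j < n" using ij by (force simp: D_def)
    thus "(?A * V) $$ (i, j) = (?C * W) $$ (i, j)"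
    proof cases
      case 1
      have "(\<Sum>r<D. poly.coeff (R i) (Suc n - r) * V $$ (r, j)) = (\<Sum>r<D. poly.coeff (R i) (Suc n - r) * \<alpha> ^ (Suc n - r))"
        using 1 ij by (intro sum.cong refl) (simp add: V_def)
      also have "\<dots> = poly (R i) \<alpha>" unfolding rx[of "\<lambda>t. poly.coeff (R i) t * \<alpha> ^ t"] by (rule poly_eval_sum_less[OF degR[OF ij(1)], symmetric])
      finally show ?thesis unfolding l r r' using 1 ij ev[OF ij(1)] by (simp add: dg_def)
    next
      case 2
      have "(\<Sum>r<D. poly.coeff (R i) (Suc n - r) * V $$ (r, j)) = (\<Sum>r<D. poly.coeff (R i) (Suc n - r) * (of_nat (Suc n - r) * \<alpha> ^ (Suc n - r - 1)))"
        using 2 ij by (intro sum.cong refl) (simp add: V_def)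
      also have "\<dots> = poly (pderiv (R i)) \<alpha>" unfolding rx[of "\<lambda>t. poly.coeff (R i) t * (of_nat t * \<alpha> ^ (t - 1))"]
        by (rule poly_pderiv_sum_less[OF degR[OF ij(1)], symmetric])
      finally show ?thesis unfolding l r r' using 2 ij dv[OF ij(1)] by (simp add: dg_def D_def)
    next
      case 3
      have "(\<Sum>r<D. poly.coeff (R i) (Suc n - r) * V $$ (r, j)) = (\<Sum>r<D. if r = j then poly.coeff (R i) (Suc n - r) else 0)"
        using 3 ij by (intro sum.cong refl) (simp add: V_def)
      also have "\<dots> = poly.coeff (R i) (Suc n - j)" using ij by simp
      finally show ?thesis unfolding l r r' using 3 ij by (simp add: dg_def)
    qed
  qed (auto simp: V_def W_def)
  have Vc: "V \<in> carrier_mat D D" and Wc: "W \<in> carrier_mat D D" by (auto simp: V_def W_def)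
  have "det V = prod_list (diag_mat V)"
    by (rule det_upper_triangular[OF _ Vc], rule upper_triangularI) (auto simp: V_def D_def)
  also have "\<dots> = (\<Prod>i = 0..<D. 1)" unfolding prod_list_diag_prod by (intro prod.cong) (auto simp: V_def D_def)
  finally have dV: "det V = 1" by simp
  have "det W = prod_list (diag_mat W)"
    by (rule det_lower_triangular[OF _ Wc]) (auto simp: W_def D_def)
  also have "\<dots> = (\<Prod>i = 0..<D. dg i)" unfolding prod_list_diag_prod by (intro prod.cong) (auto simp: W_def D_def)
  also have "\<dots> = (\<Prod>i = 0..<n. dg i) * q * q" by (simp add: D_def dg_def)
  also have "(\<Prod>i = 0..<n. dg i) = 1" by (intro prod.neutral) (auto simp: dg_def)
  finally have dW: "det W = q\<^sup>2" by (simp add: power2_eq_square)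
  have "det ?A = det (?A * V)" using dV by (subst det_mult[OF _ Vc]) auto
  also have "\<dots> = det ?C * det W" unfolding eqm by (subst det_mult[OF _ Wc]) auto
  finally show ?thesis by (simp only: dW)
qed

lemma norm_det_le:
  fixes b :: "nat \<Rightarrow> real"
  assumes "\<And>i j. i < n \<Longrightarrow> j < n \<Longrightarrow> norm (f i j :: complex) \<le> b j"
  shows "norm (det (mat n n (\<lambda>(i, j). f i j))) \<le> fact n * (\<Prod>j<n. b j)"
proof -
  have "det (mat n n (\<lambda>(i, j). f i j)) = (\<Sum>p | p permutes {0..<n}. signof p * (\<Prod>i = 0..<n. mat n n (\<lambda>(i, j). f i j) $$ (i, p i)))"
    by (rule det_def') simp
  also have "\<dots> = (\<Sum>p | p permutes {0..<n}. signof p * (\<Prod>i = 0..<n. f i (p i)))"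
  proof (rule sum.cong[OF refl])
    fix p assume "p \<in> {p. p permutes {0..<n}}"
    hence "p i < n" if "i < n" for i using permutes_in_image[of p "{0..<n}" i] that by simp
    hence "(\<Prod>i = 0..<n. mat n n (\<lambda>(i, j). f i j) $$ (i, p i)) = (\<Prod>i = 0..<n. f i (p i))" by (intro prod.cong refl) simp
    thus "signof p * (\<Prod>i = 0..<n. mat n n (\<lambda>(i, j). f i j) $$ (i, p i)) = signof p * (\<Prod>i = 0..<n. f i (p i))" by (simp only:)
  qed
  finally have "norm (det (mat n n (\<lambda>(i, j). f i j))) = norm (\<Sum>p | p permutes {0..<n}. signof p * (\<Prod>i = 0..<n. f i (p i)))" by (simp only:)
  also have "\<dots> \<le> (\<Sum>p | p permutes {0..<n}. norm (signof p * (\<Prod>i = 0..<n. f i (p i))))" by (rule norm_sum)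
  also have "\<dots> \<le> (\<Sum>p | p permutes {0..<n}. \<Prod>j<n. b j)"
  proof (rule sum_mono)
    fix p assume p: "p \<in> {p. p permutes {0..<n}}"
    have "norm (signof p * (\<Prod>i = 0..<n. f i (p i))) = (\<Prod>i = 0..<n. norm (f i (p i)))"
      by (simp add: norm_mult prod_norm[symmetric] sign_def)
    also have "\<dots> \<le> (\<Prod>i = 0..<n. b (p i))"
      using assms p by (intro prod_mono) (auto simp: permutes_in_image)
    also have "\<dots> = (\<Prod>j = 0..<n. b j)" using prod.permute[of p "{0..<n}" b] p by (simp add: comp_def)
    finally show "norm (signof p * (\<Prod>i = 0..<n. f i (p i))) \<le> (\<Prod>j<n. b j)" by (simp add: atLeast0LessThan)
  qed
  also have "\<dots> = fact n * (\<Prod>j<n. b j)" by (simp add: card_permutations[of "{0..<n}" n])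
  finally show ?thesis .
qed

lemma irreducible\<^sub>d_square_free:
  fixes p :: "int poly"
  assumes "irreducible\<^sub>d p"
  shows "square_free p"
  unfolding square_free_def
proof (intro conjI allI impI notI)
  show "p = 0 \<Longrightarrow> False" using assms by (auto simp: irreducible\<^sub>d_def)
  fix q :: "int poly" assume q: "degree q > 0" "q * q dvd p"
  from q(2) obtain r where "p = q * q * r" by (rule dvdE)
  hence r: "p = q * (q * r)" by (simp add: mult.assoc)
  have "p \<noteq> 0" using assms by (auto simp: irreducible\<^sub>d_def)
  hence "q \<noteq> 0" "q * r \<noteq> 0" using r by auto
  hence "degree p = degree q + degree (q * r)" "degree (q * r) = degree q + degree r" using r by (auto simp: degree_mult_eq)
  hence "degree q < degree p" "degree (q * r) < degree p \<or> False" using q(1) by auto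
  thus False using assms r unfolding irreducible\<^sub>d_def by blast
qed

lemma sylvester_mat_rows:
  fixes p q :: "'a :: comm_semiring_1 poly"
  assumes "degree p + degree q = Suc n"
  shows "sylvester_mat p q = mat (Suc n) (Suc n) (\<lambda>(i, j). poly.coeff
     (if i < degree q then Polynomial.monom 1 (degree q - 1 - i) * p else Polynomial.monom 1 (n - i) * q) (n - j))"
proof (rule eq_matI)
  fix i j assume "i < dim_row (mat (Suc n) (Suc n) (\<lambda>(i, j). poly.coeff
     (if i < degree q then Polynomial.monom 1 (degree q - 1 - i) * p else Polynomial.monom 1 (n - i) * q) (n - j)))"
     "j < dim_col (mat (Suc n) (Suc n) (\<lambda>(i, j). poly.coeff
     (if i < degree q then Polynomial.monom 1 (degree q - 1 - i) * p else Polynomial.monom 1 (n - i) * q) (n - j)))"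
  hence ij: "i < Suc n" "j < Suc n" by auto
  have e1: "poly.coeff (Polynomial.monom 1 (degree q - i) * p) (Suc n - j) = poly.coeff (Polynomial.monom 1 (degree q - 1 - i) * p) (n - j)"
    if "i < degree q"
  proof -
    define k where "k = degree q - 1 - i"
    have "degree q - i = Suc k" "degree q - 1 - i = k" using that by (auto simp: k_def)
    moreover have "Suc n - j = Suc (n - j)" using ij by auto
    ultimately show ?thesis by (simp add: coeff_monom_mult)
  qed
  have e2: "poly.coeff (Polynomial.monom 1 (Suc n - i) * q) (Suc n - j) = poly.coeff (Polynomial.monom 1 (n - i) * q) (n - j)"
  proof -
    have "Suc n - j = Suc (n - j)" "Suc n - i = Suc (n - i)" using ij by auto
    thus ?thesis by (simp add: coeff_monom_mult)
  qed
  show "sylvester_mat p q $$ (i, j) = mat (Suc n) (Suc n) (\<lambda>(i, j). poly.coeff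
     (if i < degree q then Polynomial.monom 1 (degree q - 1 - i) * p else Polynomial.monom 1 (n - i) * q) (n - j)) $$ (i, j)"
    using sylvester_index_mat2[of i p q j] ij e1 e2 unfolding assms by auto
qed (use assms in auto)

text \<open>The resultant of Q and Q' is a nonzero integer. At a root \<alpha> of Q the row
  polynomials of the Sylvester matrix take multiples of Q'(\<alpha>) as values, so
  \<open>det_eval_columns\<close> extracts Q'(\<alpha>)^2 and leaves only n = 2 deg Q - 3 columns
  whose size grows with the Mahler measure. A square root then gives the exponent deg Q - 1.\<close>

lemma pderiv_at_root_ge:
  assumes m: "1 \<le> m"
  shows "\<exists>c>0. \<forall>(Q :: int poly) \<alpha> :: complex. irreducible\<^sub>d Q \<longrightarrow> degree Q \<le> k \<longrightarrow> cmod \<alpha> \<le> m \<longrightarrow> poly (of_int_poly Q) \<alpha> = 0 \<longrightarrow>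
     c \<le> cmod (poly (pderiv (of_int_poly Q)) \<alpha>) * mahler_measure Q ^ (degree Q - 1)"
proof -
  define K where "K = 2 * (real k + 1) * 2 ^ k * m ^ (2 * k)"
  define G where "G = fact (2 * k) * K ^ (2 * k)"
  have mp: "1 \<le> m ^ j" for j using m by (rule one_le_power)
  have K1: "2 * (real k + 1) * m ^ (2 * k) \<le> K" "2 * (real k + 1) * 2 ^ k \<le> K"
  proof -
    have "2 * (real k + 1) * m ^ (2 * k) * 1 \<le> 2 * (real k + 1) * m ^ (2 * k) * 2 ^ k"
      using mp[of "2 * k"] by (intro mult_left_mono one_le_power) auto
    thus "2 * (real k + 1) * m ^ (2 * k) \<le> K" by (simp add: K_def mult_ac)
    have "2 * (real k + 1) * 2 ^ k * 1 \<le> 2 * (real k + 1) * 2 ^ k * m ^ (2 * k)"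
      using mp[of "2 * k"] by (intro mult_left_mono) auto
    thus "2 * (real k + 1) * 2 ^ k \<le> K" by (simp add: K_def)
  qed
  have km: "m ^ (2 * k) \<le> (2 * (real k + 1)) * m ^ (2 * k)" using mult_right_mono[of 1 "2 * (real k + 1)" "m ^ (2 * k)"] mp[of "2 * k"] by simp
  have Kge1: "K \<ge> 1" using km K1(1) mp[of "2 * k"] by linarith
  have G1: "G \<ge> 1"
  proof -
    have "1 * 1 \<le> fact (2 * k) * K ^ (2 * k)" using Kge1 by (intro mult_mono fact_ge_1 one_le_power) auto
    thus ?thesis by (simp add: G_def)
  qed
  show ?thesis
  proof (rule exI[of _ "1 / G"], rule conjI, use G1 in simp, intro allI impI)
    fix Q :: "int poly" and \<alpha> :: complex
    assume Q: "irreducible\<^sub>d Q" "degree Q \<le> k" and \<alpha>: "cmod \<alpha> \<le> m" and root: "poly (of_int_poly Q) \<alpha> = 0"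
    define p where "p = (of_int_poly Q :: complex poly)"
    define p' where "p' = pderiv p"
    define h where "h = mahler_measure Q"
    have d0: "degree Q > 0" using Q(1) by (auto simp: irreducible\<^sub>d_def)
    hence "Q \<noteq> 0" by auto
    hence h1: "h \<ge> 1" unfolding h_def by (rule mahler_measure_poly_ge_1)
    have dp: "degree p = degree Q" by (simp add: p_def)
    have dp': "degree p' = degree Q - 1" by (simp add: p'_def degree_pderiv dp)
    have pw: "cmod \<alpha> ^ j \<le> m ^ (2 * k)" if "j \<le> 2 * k" for j
    proof -
      have "cmod \<alpha> ^ j \<le> m ^ j" using \<alpha> by (intro power_mono) auto
      also have "\<dots> \<le> m ^ (2 * k)" using m that by (intro power_increasing)
      finally show ?thesis .
    qed
    have det: "sylvester_mat p p' \<in> carrier_mat (degree p + degree p') (degree p + degree p')" by (rule sylvester_carrier_mat)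
    have res: "1 \<le> cmod (det (sylvester_mat p p'))"
    proof -
      have "p' = of_int_poly (pderiv Q)" by (simp add: p'_def p_def of_int_hom.map_poly_pderiv)
      hence "det (sylvester_mat p p') = of_int (resultant Q (pderiv Q))"
        unfolding p_def by (simp add: resultant_def[symmetric] of_int_hom.resultant_hom)
      moreover have "resultant Q (pderiv Q) \<noteq> 0"
        by (rule square_free_imp_resultant_non_zero[OF irreducible\<^sub>d_square_free[OF Q(1)]])
      ultimately show ?thesis by simp
    qed
    show "1 / G \<le> cmod (poly (pderiv (of_int_poly Q)) \<alpha>) * mahler_measure Q ^ (degree Q - 1)"
    \<comment> \<open>For degree 1 the Sylvester matrix has a single column and the factor q^2
      cannot be extracted; there Q' is the leading coefficient, a nonzero integer.\<close>
    proof (cases "degree Q = 1")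
      case True
      have "poly.coeff Q 1 \<noteq> 0" using True \<open>Q \<noteq> 0\<close> by (metis leading_coeff_0_iff)
      hence "1 \<le> real_of_int \<bar>poly.coeff Q 1\<bar>" by linarith
      moreover have "poly (pderiv p) \<alpha> = of_int (poly.coeff Q 1)"
      proof -
        have "degree (pderiv p) < Suc 0" using dp True by (simp add: degree_pderiv)
        from poly_eval_sum_less[OF this, of \<alpha>] show ?thesis by (simp add: coeff_pderiv p_def)
      qed
      moreover have "1 / G \<le> 1" using G1 by simp
      ultimately show ?thesis using True by (simp add: p_def)
    next
      case False
      define n where "n = 2 * degree Q - 3"
      have n: "2 * degree Q = n + 3" using False d0 by (simp add: n_def)
      have Dn: "degree p + degree p' = Suc (Suc n)" using n d0 by (simp add: dp dp')
      define R where "R i = (if i < degree p' then Polynomial.monom 1 (degree p' - 1 - i) * p else Polynomial.monom 1 (Suc n - i) * p')" for i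
      define u where "u i = (if i < degree p' then 0 else \<alpha> ^ (Suc n - i))" for i
      define v where "v i = (if i < degree p' then \<alpha> ^ (degree p' - 1 - i) else of_nat (Suc n - i) * \<alpha> ^ (Suc n - i - 1))" for i
      have r0: "poly p \<alpha> = 0" using root by (simp add: p_def)
      define F where "F i j = (if j = Suc n then u i else if j = n then v i else poly.coeff (R i) (Suc n - j))" for i j
      have "det (sylvester_mat p p') = det (mat (Suc (Suc n)) (Suc (Suc n)) (\<lambda>(i, j). F i j)) * (poly p' \<alpha>)\<^sup>2"
        unfolding sylvester_mat_rows[OF Dn] R_def[symmetric] F_def
      proof (rule det_eval_columns[where e = "poly (pderiv p') \<alpha>"])
        fix i assume i: "i < Suc (Suc n)"
        show "degree (R i) < Suc (Suc n)"
        proof (cases "i < degree p'")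
          case True
          have "degree (R i) \<le> (degree p' - 1 - i) + degree p"
            unfolding R_def using True by (simp add: order.trans[OF degree_mult_le] degree_monom_eq)
          thus ?thesis using True Dn by linarith
        next
          case False
          have "degree (R i) \<le> (Suc n - i) + degree p'"
            unfolding R_def using False by (simp add: order.trans[OF degree_mult_le] degree_monom_eq)
          thus ?thesis using False Dn dp dp' d0 i by linarith
        qed
        show "poly (R i) \<alpha> = u i * poly p' \<alpha>" by (simp add: R_def u_def r0 poly_monom)
        show "poly (pderiv (R i)) \<alpha> = v i * poly p' \<alpha> + u i * poly (pderiv p') \<alpha>"
          by (simp add: R_def u_def v_def r0 poly_monom pderiv_mult pderiv_monom p'_def)
      qed
      hence dF: "cmod (det (sylvester_mat p p')) = cmod (det (mat (Suc (Suc n)) (Suc (Suc n)) (\<lambda>(i, j). F i j))) * (cmod (poly p' \<alpha>))\<^sup>2"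
        by (simp only: norm_mult norm_power)
      have bd: "cmod (F i j) \<le> (if j < n then K * h else K)" if ij: "i < Suc (Suc n)" "j < Suc (Suc n)" for i j
      proof -
        have cp: "cmod (poly.coeff p t) \<le> 2 ^ k * h" for t
          using coeff_le_mahler[OF Q(2), of t] by (simp add: p_def h_def)
        have cp': "cmod (poly.coeff p' t) \<le> (real k + 1) * (2 ^ k * h)" for t
        proof (cases "Suc t \<le> degree p")
          case True
          have "cmod (poly.coeff p' t) = real (Suc t) * cmod (poly.coeff p (Suc t))"
            unfolding p'_def coeff_pderiv norm_mult norm_of_nat by simp
          also have "\<dots> \<le> (real k + 1) * (2 ^ k * h)" using True Q(2) dp by (intro mult_mono cp) auto
          finally show ?thesis .
        next
          case False
          thus ?thesis using h1 by (simp add: p'_def coeff_pderiv coeff_eq_0)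
        qed
        have cR: "cmod (poly.coeff (R i) t) \<le> K * h" for t
        proof -
          have "(real k + 1) * (2 ^ k * h) \<le> K * h" "2 ^ k * h \<le> K * h"
          proof -
            have "(real k + 1) * 2 ^ k \<le> K" 
            proof -
              have "0 \<le> (real k + 1) * 2 ^ k" by simp
              thus ?thesis using K1(2) by (simp only: mult.assoc)
            qed
            from mult_right_mono[OF this, of h] show "(real k + 1) * (2 ^ k * h) \<le> K * h" using h1 by (simp add: mult.assoc)
            have "1 * 2 ^ k \<le> (real k + 1) * 2 ^ k" by (intro mult_right_mono) auto
            hence "2 ^ k \<le> K" using \<open>(real k + 1) * 2 ^ k \<le> K\<close> by linarith
            thus "2 ^ k * h \<le> K * h" using h1 by (intro mult_right_mono) auto
          qed
          moreover have "0 \<le> K * h" using Kge1 h1 by simp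
          ultimately show ?thesis using cp cp' by (auto simp: R_def coeff_monom_mult intro: order.trans)
        qed
        have tk: "Suc n \<le> 2 * k" using n Q(2) by linarith
        have pK: "cmod \<alpha> ^ j \<le> K" if "j \<le> 2 * k" for j using pw[OF that] km K1(1) by linarith
        have "Suc n - i \<le> 2 * k" using tk by linarith
        hence cu: "cmod (u i) \<le> K" using pK[of "Suc n - i"] Kge1 by (simp add: u_def norm_power)
        have cv: "cmod (v i) \<le> K"
        proof (cases "i < degree p'")
          case True
          moreover have "degree p' - 1 - i \<le> 2 * k" using Q(2) dp' by linarith
          ultimately show ?thesis using pK[of "degree p' - 1 - i"] by (simp add: v_def norm_power)
        next
          case False
          have "cmod (v i) = real (Suc n - i) * cmod \<alpha> ^ (Suc n - i - 1)" using False by (simp add: v_def norm_mult norm_power)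
          also have "\<dots> \<le> (2 * (real k + 1)) * m ^ (2 * k)"
          proof (intro mult_mono pw)
            have "Suc n - i \<le> 2 * k" using tk by linarith
            hence "real (Suc n - i) \<le> real (2 * k)" by (simp only: of_nat_le_iff)
            thus "real (Suc n - i) \<le> 2 * (real k + 1)" by simp
          qed (use tk in auto)
          finally show ?thesis using K1(1) by linarith
        qed
        show ?thesis using cu cv cR ij by (auto simp: F_def)
      qed
      have "1 \<le> cmod (det (mat (Suc (Suc n)) (Suc (Suc n)) (\<lambda>(i, j). F i j))) * (cmod (poly p' \<alpha>))\<^sup>2"
        using res dF by (simp only:)
      also have "\<dots> \<le> (fact (Suc (Suc n)) * (\<Prod>j<Suc (Suc n). if j < n then K * h else K)) * (cmod (poly p' \<alpha>))\<^sup>2"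
        by (rule mult_right_mono[OF norm_det_le[OF bd]]) simp_all
      also have "(\<Prod>j<Suc (Suc n). if j < n then K * h else K) = (\<Prod>j<n. K * h) * K * K" by simp
      also have "\<dots> = K ^ Suc (Suc n) * h ^ n" by (simp add: power_mult_distrib)
      also have "fact (Suc (Suc n)) * (K ^ Suc (Suc n) * h ^ n) * (cmod (poly p' \<alpha>))\<^sup>2 \<le> (G * (h ^ (degree Q - 1))\<^sup>2) * (cmod (poly p' \<alpha>))\<^sup>2"
      proof (rule mult_right_mono)
        have tk: "Suc (Suc n) \<le> 2 * k" using n Q(2) by linarith
        have "fact (Suc (Suc n)) * K ^ Suc (Suc n) \<le> G"
          unfolding G_def using tk Kge1 by (intro mult_mono fact_mono power_increasing) auto
        \<comment> \<open>The exponent n = 2 deg Q - 3 is raised to the even number 2 (deg Q - 1),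
          which makes the right-hand side a square.\<close>
        moreover have "h ^ n \<le> (h ^ (degree Q - 1))\<^sup>2"
          unfolding power_mult[symmetric] using h1 n by (intro power_increasing) auto
        ultimately have "(fact (Suc (Suc n)) * K ^ Suc (Suc n)) * h ^ n \<le> G * (h ^ (degree Q - 1))\<^sup>2"
          using G1 h1 by (intro mult_mono) auto
        thus "fact (Suc (Suc n)) * (K ^ Suc (Suc n) * h ^ n) \<le> G * (h ^ (degree Q - 1))\<^sup>2" by (simp only: mult.assoc)
      qed simp
      finally have "1 \<le> G * (cmod (poly p' \<alpha>) * h ^ (degree Q - 1))\<^sup>2" by (simp add: power_mult_distrib mult_ac)
      hence "1 / G \<le> (cmod (poly p' \<alpha>) * h ^ (degree Q - 1))\<^sup>2" using G1 by (simp add: pos_divide_le_eq mult.commute)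
      moreover have "(1 / G)\<^sup>2 \<le> 1 / G"
      proof -
        have "(1 / G) * (1 / G) \<le> 1 * (1 / G)" using G1 by (intro mult_right_mono) auto
        thus ?thesis by (simp add: power2_eq_square)
      qed
      ultimately have "(1 / G)\<^sup>2 \<le> (cmod (poly p' \<alpha>) * h ^ (degree Q - 1))\<^sup>2" by linarith
      hence "1 / G \<le> cmod (poly p' \<alpha>) * h ^ (degree Q - 1)" by (rule power2_le_imp_le) (use h1 in auto)
      thus ?thesis by (simp add: p'_def p_def h_def)
    qed
  qed
qed

lemma norm_prod_list_le:
  fixes f g :: "'b \<Rightarrow> complex"
  assumes "\<And>a. a \<in> set xs \<Longrightarrow> cmod (f a) \<le> t * cmod (g a)" "0 \<le> t"
  shows "cmod (\<Prod>a\<leftarrow>xs. f a) \<le> t ^ length xs * cmod (\<Prod>a\<leftarrow>xs. g a)"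
  using assms(1)
proof (induction xs)
  case (Cons a xs)
  have "cmod (f a) * cmod (\<Prod>a\<leftarrow>xs. f a) \<le> (t * cmod (g a)) * (t ^ length xs * cmod (\<Prod>a\<leftarrow>xs. g a))"
    by (intro mult_mono Cons.prems Cons.IH mult_nonneg_nonneg norm_ge_zero assms(2)) auto
  thus ?case by (simp add: norm_mult mult_ac)
qed simp

text \<open>For the root \<alpha> nearest to z, every other root a has |\<alpha> - a| \<le> 2 |z -
  a|, so the product giving the derivative at \<alpha> is at most 2^(deg p - 1) times the product in
  p(z) / (z - \<alpha>). The last estimate serves to keep \<alpha> in a bounded region.\<close>

lemma nearest_root:
  fixes p :: "complex poly"
  assumes d: "1 \<le> degree p"
  shows "\<exists>\<alpha>. poly p \<alpha> = 0 \<and> cmod (z - \<alpha>) * cmod (poly (pderiv p) \<alpha>) \<le> 2 ^ (degree p - 1) * cmod (poly p z) \<and>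
     cmod (lead_coeff p) * cmod (z - \<alpha>) ^ degree p \<le> cmod (poly p z)"
proof -
  define rs where "rs = complex_roots_complex p"
  have p: "p = Polynomial.smult (lead_coeff p) (\<Prod>a\<leftarrow>rs. [:- a, 1:])" and len: "length rs = degree p"
    using complex_roots[of p] by (simp_all add: rs_def)
  define \<alpha> where "\<alpha> = arg_min_on (\<lambda>a. cmod (z - a)) (set rs)"
  have ne: "set rs \<noteq> {}" using len d by auto
  have mem: "\<alpha> \<in> set rs" unfolding \<alpha>_def using ne by (intro arg_min_if_finite(1)) auto
  have min: "cmod (z - \<alpha>) \<le> cmod (z - a)" if "a \<in> set rs" for a
    unfolding \<alpha>_def using ne that by (intro arg_min_least) auto
  obtain ys zs where sp: "rs = ys @ \<alpha> # zs" using split_list[OF mem] by auto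
  define q where "q = (\<Prod>a\<leftarrow>ys @ zs. [:- a, 1:])"
  have pq: "p = Polynomial.smult (lead_coeff p) ([:- \<alpha>, 1:] * q)"
    by (subst p) (simp only: sp q_def map_append prod_list.append list.map prod_list.Cons mult_ac)
  have pol: "poly (\<Prod>a\<leftarrow>xs. [:- a, 1:]) w = (\<Prod>a\<leftarrow>xs. w - a)" for xs and w :: complex
    by (induction xs) (simp_all add: algebra_simps)
  have root: "poly p \<alpha> = 0" by (subst pq) simp
  have val: "poly p z = lead_coeff p * ((z - \<alpha>) * poly q z)" by (subst pq) (simp add: algebra_simps)
  have der: "poly (pderiv p) \<alpha> = lead_coeff p * poly q \<alpha>"
  proof -
    have "poly (pderiv ([:- \<alpha>, 1:] * q)) \<alpha> = poly q \<alpha>" unfolding pderiv_mult by (simp add: pderiv_pCons)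
    thus ?thesis by (subst pq) (simp only: pderiv_smult poly_smult)
  qed
  have lq: "length (ys @ zs) = degree p - 1" using len sp by simp
  have "cmod (poly q \<alpha>) \<le> 2 ^ (degree p - 1) * cmod (poly q z)"
    unfolding q_def pol lq[symmetric]
  proof (rule norm_prod_list_le)
    fix a assume "a \<in> set (ys @ zs)"
    hence "cmod (z - \<alpha>) \<le> cmod (z - a)" using min sp by auto
    moreover have "cmod (\<alpha> - a) \<le> cmod (z - \<alpha>) + cmod (z - a)"
      using norm_triangle_ineq4[of "z - a" "z - \<alpha>"] by (simp add: algebra_simps)
    ultimately show "cmod (\<alpha> - a) \<le> 2 * cmod (z - a)" by linarith
  qed simp
  hence "(cmod (z - \<alpha>) * cmod (lead_coeff p)) * cmod (poly q \<alpha>) \<le> (cmod (z - \<alpha>) * cmod (lead_coeff p)) * (2 ^ (degree p - 1) * cmod (poly q z))"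
    by (intro mult_left_mono) auto
  hence 1: "cmod (z - \<alpha>) * cmod (poly (pderiv p) \<alpha>) \<le> 2 ^ (degree p - 1) * cmod (poly p z)"
    by (simp add: der val norm_mult mult_ac)
  have pz: "poly p z = lead_coeff p * (\<Prod>a\<leftarrow>rs. z - a)" by (subst p) (simp only: poly_smult pol)
  have "cmod (z - \<alpha>) ^ length xs \<le> cmod (\<Prod>a\<leftarrow>xs. z - a)" if xs: "set xs \<subseteq> set rs" for xs
    using xs
  proof (induction xs)
    case (Cons a xs)
    thus ?case using min[of a] by (auto simp: norm_mult intro!: mult_mono)
  qed simp
  from this[OF order.refl] have "cmod (z - \<alpha>) ^ degree p \<le> cmod (\<Prod>a\<leftarrow>rs. z - a)" by (simp only: len)
  hence "cmod (lead_coeff p) * cmod (z - \<alpha>) ^ degree p \<le> cmod (poly p z)"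
    unfolding pz norm_mult by (intro mult_left_mono) auto
  with 1 root show ?thesis by blast
qed

subsection \<open>Hausdorff content and upper bounds for the dimension\<close>

text \<open>Without a bound on the diameters coverings are easier to combine; for s > 0 null content
  implies null Hausdorff measure, by \<open>hausdorff_measure_eq_0\<close>.\<close>

definition hausdorff_content :: "real \<Rightarrow> 'a::metric_space set \<Rightarrow> ennreal" where
  "hausdorff_content s A =
     (INF U \<in> {U :: nat \<Rightarrow> 'a set. A \<subseteq> (\<Union>i. U i) \<and> (\<forall>i. bounded (U i))}. \<Sum>i. ennreal (diam_pow s (U i)))"

lemma hausdorff_content_mono: "A \<subseteq> B \<Longrightarrow> hausdorff_content s A \<le> hausdorff_content s B"
  unfolding hausdorff_content_def by (intro INF_superset_mono) auto

lemma hausdorff_content_le: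
  assumes "A \<subseteq> (\<Union>i. U i)" "\<And>i. bounded (U i)" "(\<Sum>i. ennreal (diam_pow s (U i))) \<le> b"
  shows "hausdorff_content s A \<le> b"
  unfolding hausdorff_content_def using assms by (intro INF_lower2[of U]) auto

text \<open>The i-th covering is chosen with slack e / 2^(i + 1), and the double sequence is
  enumerated by the pairing function.\<close>

lemma hausdorff_content_UN_le:
  fixes A :: "nat \<Rightarrow> 'a::metric_space set" and b :: "nat \<Rightarrow> real"
  assumes A: "\<And>i. hausdorff_content s (A i) \<le> ennreal (b i)" and b: "summable b" "\<And>i. 0 \<le> b i"
  shows "hausdorff_content s (\<Union>i. A i) \<le> ennreal (suminf b)"
proof (rule ennreal_le_epsilon)
  fix e :: real assume e: "e > 0"
  have "\<exists>U. A i \<subseteq> (\<Union>k. U k) \<and> (\<forall>k. bounded (U k)) \<and> (\<Sum>k. ennreal (diam_pow s (U k))) < ennreal (b i + e * (1/2) ^ Suc i)" for i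
  proof -
    have "hausdorff_content s (A i) < ennreal (b i + e * (1/2) ^ Suc i)"
      using e b(2)[of i] by (intro le_less_trans[OF A[of i]] ennreal_lessI) (auto intro: add_nonneg_pos)
    thus ?thesis unfolding hausdorff_content_def INF_less_iff by auto
  qed
  hence "\<forall>i. \<exists>U. A i \<subseteq> (\<Union>k. U k) \<and> (\<forall>k. bounded (U k)) \<and> (\<Sum>k. ennreal (diam_pow s (U k))) < ennreal (b i + e * (1/2) ^ Suc i)" by (rule allI)
  from choice[OF this] obtain U where U: "\<forall>i. A i \<subseteq> (\<Union>k. U i k) \<and> (\<forall>k. bounded (U i k)) \<and>
      (\<Sum>k. ennreal (diam_pow s (U i k))) < ennreal (b i + e * (1/2) ^ Suc i)" by (rule exE)
  define W where "W n = U (fst (prod_decode n)) (snd (prod_decode n))" for n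
  show "hausdorff_content s (\<Union>i. A i) \<le> ennreal (suminf b) + ennreal e"
  proof (rule hausdorff_content_le)
    show "(\<Union>i. A i) \<subseteq> (\<Union>n. W n)"
    proof
      fix x assume "x \<in> (\<Union>i. A i)"
      then obtain i where "x \<in> A i" by auto
      then obtain k where "x \<in> U i k" using U by blast
      hence "x \<in> W (prod_encode (i, k))" by (simp add: W_def)
      thus "x \<in> (\<Union>n. W n)" by blast
    qed
    show "bounded (W n)" for n unfolding W_def using U by auto
    have "(\<Sum>n. ennreal (diam_pow s (W n))) = (\<Sum>n. (\<lambda>(i, k). ennreal (diam_pow s (U i k))) (prod_decode n))"
      unfolding W_def by (simp add: case_prod_unfold)
    also have "\<dots> = (\<Sum>i. \<Sum>k. ennreal (diam_pow s (U i k)))"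
      by (subst suminf_ennreal_2dimen[OF refl]) (simp add: comp_def)
    also have "\<dots> \<le> (\<Sum>i. ennreal (b i + e * (1/2) ^ Suc i))"
      using U by (intro suminf_le summableI) (auto intro: less_imp_le)
    also have "\<dots> = ennreal (\<Sum>i. b i + e * (1/2) ^ Suc i)"
      using e b power_half_series by (intro suminf_ennreal2 summable_add summable_mult) (auto simp: sums_iff intro: add_nonneg_nonneg)
    also have "(\<Sum>i. b i + e * (1/2) ^ Suc i) = suminf b + e"
      using sums_unique[OF sums_add[OF summable_sums[OF b(1)] sums_mult[OF power_half_series, of e]]] by simp
    also have "ennreal \<dots> = ennreal (suminf b) + ennreal e"
      using e b by (intro ennreal_plus suminf_nonneg) auto
    finally show "(\<Sum>n. ennreal (diam_pow s (W n))) \<le> ennreal (suminf b) + ennreal e" .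
  qed
qed

lemma hausdorff_content_UN_eq_0:
  assumes "\<And>i::nat. hausdorff_content s (A i) = 0"
  shows "hausdorff_content s (\<Union>i. A i) = 0"
  using hausdorff_content_UN_le[of s A "\<lambda>_. 0"] assms by simp

lemma hausdorff_content_Un_eq_0:
  assumes "hausdorff_content s A = 0" "hausdorff_content s B = 0"
  shows "hausdorff_content s (A \<union> B) = 0"
proof -
  have "hausdorff_content s (\<Union>i::nat. if i = 0 then A else B) = 0"
    using assms by (intro hausdorff_content_UN_eq_0) auto
  moreover have "A \<union> B \<subseteq> (\<Union>i::nat. if i = 0 then A else B)" by (auto intro: exI[of _ "0::nat"] exI[of _ "1::nat"])
  ultimately show ?thesis using hausdorff_content_mono[of "A \<union> B" _ s] by (metis le_zero_eq)
qed

text \<open>Borel-Cantelli: the limsup set lies in every tail union, and the tails of a convergent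
  series tend to 0.\<close>

lemma hausdorff_content_limsup:
  assumes E: "\<And>j::nat. hausdorff_content s (E j) \<le> ennreal (b j)" and b: "summable b" "\<And>j. 0 \<le> b j"
  shows "hausdorff_content s {x. \<exists>\<^sub>F j in sequentially. x \<in> E j} = 0"
proof -
  let ?A = "{x. \<exists>\<^sub>F j in sequentially. x \<in> E j}"
  have le: "hausdorff_content s ?A \<le> 0 + ennreal e" if e: "e > 0" for e
  proof -
    obtain n where n: "norm (\<Sum>i. b (i + n)) < e" using suminf_exist_split[OF e b(1)] by auto
    have "?A \<subseteq> (\<Union>i. E (i + n))"
    proof
      fix x assume "x \<in> ?A"
      then obtain j where "j \<ge> n" "x \<in> E j" by (auto simp: frequently_sequentially)
      thus "x \<in> (\<Union>i. E (i + n))" by (intro UN_I[of "j - n"]) auto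
    qed
    hence "hausdorff_content s ?A \<le> hausdorff_content s (\<Union>i. E (i + n))" by (rule hausdorff_content_mono)
    also have "\<dots> \<le> ennreal (\<Sum>i. b (i + n))"
      using E b by (intro hausdorff_content_UN_le) (auto simp: summable_iff_shift)
    also have "\<dots> \<le> ennreal e" using n by (intro ennreal_leI) auto
    finally show ?thesis by simp
  qed
  have "hausdorff_content s ?A \<le> 0" by (rule ennreal_le_epsilon) (rule le)
  thus ?thesis by simp
qed

lemma diam_pow_nonneg: "0 \<le> diam_pow s U"
  by (simp add: diam_pow_def)

lemma hausdorff_content_finite_UN:
  fixes V :: "'i \<Rightarrow> 'a::metric_space set"
  assumes G: "finite G" "\<And>i. i \<in> G \<Longrightarrow> bounded (V i) \<and> diam_pow s (V i) \<le> d" and c: "real (card G) \<le> c" "0 \<le> d"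
  shows "hausdorff_content s (\<Union>i\<in>G. V i) \<le> ennreal (c * d)"
proof -
  obtain g where g: "bij_betw g {..<card G} G" using ex_bij_betw_nat_finite[OF G(1)] by (auto simp: atLeast0LessThan)
  define U where "U i = (if i < card G then V (g i) else {})" for i
  have gG: "g i \<in> G" if "i < card G" for i using g that by (auto simp: bij_betw_def)
  show ?thesis
  proof (rule hausdorff_content_le)
    show "(\<Union>i\<in>G. V i) \<subseteq> (\<Union>i. U i)"
    proof
      fix x assume "x \<in> (\<Union>i\<in>G. V i)"
      then obtain a where a: "a \<in> G" "x \<in> V a" by auto
      hence "a \<in> g ` {..<card G}" using bij_betw_imp_surj_on[OF g] by simp
      then obtain i where "i < card G" "g i = a" by auto
      hence "x \<in> U i" using a by (simp add: U_def)
      thus "x \<in> (\<Union>i. U i)" by blast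
    qed
    show "bounded (U i)" for i using G(2) gG by (auto simp: U_def)
    have "(\<Sum>i. ennreal (diam_pow s (U i))) = (\<Sum>i\<in>{..<card G}. ennreal (diam_pow s (U i)))"
      by (rule suminf_finite) (auto simp: U_def diam_pow_def)
    also have "\<dots> = ennreal (\<Sum>i\<in>{..<card G}. diam_pow s (U i))" by (intro sum_ennreal diam_pow_nonneg)
    also have "\<dots> \<le> ennreal (\<Sum>i\<in>{..<card G}. d)"
      using G(2) gG by (intro ennreal_leI sum_mono) (auto simp: U_def)
    also have "\<dots> \<le> ennreal (c * d)" using c by (intro ennreal_leI) (auto intro: mult_right_mono)
    finally show "(\<Sum>i. ennreal (diam_pow s (U i))) \<le> ennreal (c * d)" .
  qed
qed

lemma hausdorff_content_countable:
  fixes A :: "'a::metric_space set"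
  assumes "countable A" "s > 0"
  shows "hausdorff_content s A = 0"
proof (cases "A = {}")
  case True
  have "hausdorff_content s ({} :: 'a set) \<le> 0" by (rule hausdorff_content_le[of _ "\<lambda>_. {}"]) (auto simp: diam_pow_def)
  thus ?thesis using True by simp
next
  case False
  have "hausdorff_content s {from_nat_into A i} \<le> 0" for i
    using assms(2) by (intro hausdorff_content_le[of _ "\<lambda>_. {from_nat_into A i}"]) (auto simp: diam_pow_def)
  hence "hausdorff_content s (\<Union>i. {from_nat_into A i}) = 0" by (intro hausdorff_content_UN_eq_0) auto
  moreover have "A = (\<Union>i. {from_nat_into A i})"
    using range_from_nat_into[OF False assms(1)] by blast
  ultimately show ?thesis by simp
qed

text \<open>A covering with total below \<delta> powr s consists of sets of diameter at most
  \<delta>, so coverings of small content are automatically admissible for the premeasure.\<close>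

lemma hausdorff_measure_eq_0:
  assumes "hausdorff_content s A = 0" "s > 0"
  shows "hausdorff_measure s A = 0"
proof -
  have "hausdorff_premeasure s \<delta> A \<le> 0" if \<delta>: "\<delta> > 0" for \<delta>
  proof (rule ennreal_le_epsilon)
    fix e :: real assume e: "e > 0"
    define e' where "e' = min e (\<delta> powr s)"
    have "0 < ennreal e'" using e \<delta> by (simp add: e'_def)
    hence "hausdorff_content s A < ennreal e'" using assms by simp
    then obtain U where U: "A \<subseteq> (\<Union>i. U i)" "\<And>i. bounded (U i)" "(\<Sum>i. ennreal (diam_pow s (U i))) < ennreal e'"
      unfolding hausdorff_content_def INF_less_iff by auto
    have "diameter (U i) \<le> \<delta>" for i
    proof (rule ccontr)
      assume *: "\<not> ?thesis"
      hence ne: "U i \<noteq> {}" using \<delta> by auto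
      have "ennreal (diam_pow s (U i)) \<le> (\<Sum>i. ennreal (diam_pow s (U i)))"
        using sum_le_suminf[of "\<lambda>i. ennreal (diam_pow s (U i))" "{i}"] by simp
      hence "ennreal (diam_pow s (U i)) < ennreal e'" using U(3) by (rule le_less_trans)
      hence "diameter (U i) powr s < e'" using ne assms(2) diam_pow_nonneg[of s "U i"] by (simp add: ennreal_less_iff diam_pow_def)
      moreover have "\<delta> powr s < diameter (U i) powr s" using * \<delta> assms(2) by (intro powr_less_mono2) auto
      ultimately show False by (simp add: e'_def)
    qed
    hence "hausdorff_premeasure s \<delta> A \<le> (\<Sum>i. ennreal (diam_pow s (U i)))"
      unfolding hausdorff_premeasure_def using U(1,2) by (intro INF_lower) auto
    also have "\<dots> \<le> ennreal e'" using U(3) by simp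
    also have "\<dots> \<le> 0 + ennreal e" by (simp add: e'_def ennreal_leI)
    finally show "hausdorff_premeasure s \<delta> A \<le> 0 + ennreal e" .
  qed
  hence "hausdorff_measure s A \<le> 0" unfolding hausdorff_measure_def by (intro SUP_least) auto
  thus ?thesis by simp
qed

lemma hausdorff_dim_le:
  assumes "0 \<le> s" "\<And>s'. s < s' \<Longrightarrow> hausdorff_content s' A = 0"
  shows "hausdorff_dim A \<le> ereal s"
proof (rule ereal_le_epsilon2)
  fix e :: real assume "e > 0"
  hence "hausdorff_measure (s + e) A = 0" using assms by (intro hausdorff_measure_eq_0) auto
  hence "hausdorff_dim A \<le> ereal (s + e)"
    unfolding hausdorff_dim_def using assms(1) \<open>e > 0\<close> by (intro Inf_lower) auto
  thus "hausdorff_dim A \<le> ereal s + ereal e" by simp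
qed

text \<open>A unit interval is covered by k + 1 intervals of length 1 / k, whose sum is of order
  k^(1 - s).\<close>

lemma hausdorff_content_real_eq_0:
  assumes s: "s > 1"
  shows "hausdorff_content s (A :: real set) = 0"
proof -
  have unit: "hausdorff_content s {a..a + 1} = 0" for a :: real
  proof -
    have le: "hausdorff_content s {a..a + 1} \<le> ennreal (2 * real k powr (1 - s))" if k: "k \<ge> 1" for k
    proof -
      let ?V = "\<lambda>i::nat. {a + real i / real k..a + real (i + 1) / real k}"
      have "{a..a + 1} \<subseteq> (\<Union>i\<in>{..k}. ?V i)"
      proof
        fix x assume x: "x \<in> {a..a + 1}"
        define i where "i = nat \<lfloor>(x - a) * real k\<rfloor>"
        have "0 \<le> (x - a) * real k" using x by simp
        hence i: "real i \<le> (x - a) * real k" "(x - a) * real k < real i + 1" unfolding i_def by linarith+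
        have "(x - a) * real k \<le> 1 * real k" using x by (intro mult_right_mono) auto
        hence ik: "i \<le> k" using i(1) by linarith
        have "real i / real k \<le> x - a" using i(1) k by (simp add: pos_divide_le_eq)
        moreover have "x - a \<le> real (i + 1) / real k" using i(2) k by (simp add: pos_le_divide_eq)
        ultimately have "x \<in> ?V i" unfolding atLeastAtMost_iff by linarith
        thus "x \<in> (\<Union>i\<in>{..k}. ?V i)" using ik by (intro UN_I[of i]) auto
      qed
      hence "hausdorff_content s {a..a + 1} \<le> hausdorff_content s (\<Union>i\<in>{..k}. ?V i)" by (rule hausdorff_content_mono)
      also have "\<dots> \<le> ennreal (2 * real k * (1 / real k) powr s)"
      proof (rule hausdorff_content_finite_UN)
        fix i
        have "a + real i / real k \<le> a + real (i + 1) / real k" by (simp add: divide_right_mono)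
        moreover have "(a + real (i + 1) / real k) - (a + real i / real k) = 1 / real k" by (simp add: add_divide_distrib)
        ultimately show "bounded (?V i) \<and> diam_pow s (?V i) \<le> (1 / real k) powr s"
          using s by (simp add: diam_pow_def)
        show "real (card {..k}) \<le> 2 * real k" using k by simp
      qed auto
      also have "2 * real k * (1 / real k) powr s = 2 * real k powr (1 - s)"
        using k by (simp add: powr_diff powr_divide)
      finally show ?thesis .
    qed
    have "(\<lambda>k. ennreal (2 * real k powr (1 - s))) \<longlonglongrightarrow> ennreal (2 * 0)"
      using s by (intro tendsto_ennrealI tendsto_mult tendsto_const tendsto_neg_powr filterlim_real_sequentially) auto
    hence "hausdorff_content s {a..a + 1} \<le> ennreal (2 * 0)"
      by (rule tendsto_lowerbound) (use le in \<open>auto simp: eventually_sequentially\<close>)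
    thus ?thesis by simp
  qed
  have "A \<subseteq> (\<Union>j. {real_of_int (int_decode j)..real_of_int (int_decode j) + 1})"
  proof
    fix x assume "x \<in> A"
    have "x \<in> {real_of_int (int_decode (int_encode \<lfloor>x\<rfloor>))..real_of_int (int_decode (int_encode \<lfloor>x\<rfloor>)) + 1}"
      by simp
    thus "x \<in> (\<Union>j. {real_of_int (int_decode j)..real_of_int (int_decode j) + 1})" by blast
  qed
  from hausdorff_content_mono[OF this, of s]
  show ?thesis using hausdorff_content_UN_eq_0[of s "\<lambda>j. {real_of_int (int_decode j)..real_of_int (int_decode j) + 1}"] unit by simp
qed

lemma hausdorff_dim_real_le_1: "hausdorff_dim (A :: real set) \<le> 1"
  using hausdorff_dim_le[of 1 A] hausdorff_content_real_eq_0 by (simp add: one_ereal_def)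

subsection \<open>Covering the well approximable numbers\<close>

lemma finite_int_polys:
  "finite {p :: int poly. degree p \<le> k \<and> (\<forall>i. \<bar>poly.coeff p i\<bar> \<le> int b)}" (is "finite ?S")
proof (rule finite_subset)
  show "?S \<subseteq> (\<lambda>f. \<Sum>i\<le>k. Polynomial.monom (f i) i) ` PiE {..k} (\<lambda>_. {- int b..int b})"
  proof
    fix p assume p: "p \<in> ?S"
    have "p = (\<Sum>i\<le>k. Polynomial.monom (restrict (poly.coeff p) {..k} i) i)"
      using p poly_as_sum_of_monoms'[of p k] by simp
    moreover have "- int b \<le> poly.coeff p i \<and> poly.coeff p i \<le> int b" for i
    proof -
      have "\<bar>poly.coeff p i\<bar> \<le> int b" using p by blast
      thus ?thesis by linarith
    qed
    hence "restrict (poly.coeff p) {..k} \<in> PiE {..k} (\<lambda>_. {- int b..int b})" by auto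
    ultimately show "p \<in> (\<lambda>f. \<Sum>i\<le>k. Polynomial.monom (f i) i) ` PiE {..k} (\<lambda>_. {- int b..int b})" by (rule image_eqI)
  qed
qed (intro finite_imageI finite_PiE, auto)

lemma countable_real_algebraic: "countable {\<zeta> :: real. \<exists>Q :: int poly. Q \<noteq> 0 \<and> poly (of_int_poly Q) \<zeta> = 0}"
proof (rule countable_subset)
  let ?S = "\<lambda>n. {p :: int poly. degree p \<le> n \<and> (\<forall>i. \<bar>poly.coeff p i\<bar> \<le> int n)} - {0}"
  show "{\<zeta> :: real. \<exists>Q :: int poly. Q \<noteq> 0 \<and> poly (of_int_poly Q) \<zeta> = 0} \<subseteq> (\<Union>n. \<Union>Q\<in>?S n. {\<zeta>. poly (of_int_poly Q) \<zeta> = 0})"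
  proof
    fix \<zeta> :: real assume "\<zeta> \<in> {\<zeta> :: real. \<exists>Q :: int poly. Q \<noteq> 0 \<and> poly (of_int_poly Q) \<zeta> = 0}"
    then obtain Q :: "int poly" where Q: "Q \<noteq> 0" "poly (of_int_poly Q) \<zeta> = 0" by auto
    define n where "n = degree Q + nat (\<Sum>i\<le>degree Q. \<bar>poly.coeff Q i\<bar>)"
    have "\<bar>poly.coeff Q i\<bar> \<le> int n" for i
    proof (cases "i \<le> degree Q")
      case True
      have "\<bar>poly.coeff Q i\<bar> \<le> (\<Sum>i\<le>degree Q. \<bar>poly.coeff Q i\<bar>)" using True by (intro member_le_sum) auto
      thus ?thesis unfolding n_def by linarith
    qed (simp add: coeff_eq_0)
    hence "Q \<in> ?S n" using Q by (simp add: n_def)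
    thus "\<zeta> \<in> (\<Union>n. \<Union>Q\<in>?S n. {\<zeta>. poly (of_int_poly Q) \<zeta> = 0})" using Q(2) by (intro UN_I[of n] UN_I[of Q]) auto
  qed
  have 1: "countable {\<zeta> :: real. poly (of_int_poly Q) \<zeta> = 0}" if "Q \<in> ?S n" for n and Q :: "int poly"
    by (rule countable_finite, rule poly_roots_finite) (use that in simp)
  have 2: "countable (\<Union>Q\<in>?S n. {\<zeta> :: real. poly (of_int_poly Q) \<zeta> = 0})" for n
  proof (rule countable_UN)
    show "countable (?S n)" by (rule countable_finite, rule finite_Diff, rule finite_int_polys)
  qed (rule 1)
  show "countable (\<Union>n. \<Union>Q\<in>?S n. {\<zeta> :: real. poly (of_int_poly Q) \<zeta> = 0})"
    by (rule countable_UN[OF countableI_type]) (rule 2)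
qed

lemma poly_of_int_complex: "poly (of_int_poly Q) (complex_of_real z) = complex_of_real (poly (of_int_poly Q) z)"
  by (simp add: poly_altdef)

text \<open>The lower bound for the derivative at the nearest complex root turns a small value into
  a small distance; the value being at most 1 confines that root to a disc of radius m + 1. Taking
  real parts only shortens the distance to z, so non-real roots serve as centres too.\<close>

lemma near_root_of_small_value:
  assumes m: "0 \<le> m"
  shows "\<exists>C>0. \<forall>(Q :: int poly) z. irreducible\<^sub>d Q \<longrightarrow> degree Q \<le> k \<longrightarrow> \<bar>z\<bar> \<le> m \<longrightarrow> \<bar>poly (of_int_poly Q) z\<bar> \<le> 1 \<longrightarrow>
     (\<exists>\<alpha> :: complex. poly (of_int_poly Q) \<alpha> = 0 \<and>
        \<bar>z - Re \<alpha>\<bar> \<le> C * \<bar>poly (of_int_poly Q) z\<bar> * mahler_measure Q ^ (k - 1))"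
proof -
  have "1 \<le> m + 1" using m by simp
  from pderiv_at_root_ge[OF this, of k] obtain c where c: "c > 0" and
    cb: "\<forall>(Q :: int poly) \<alpha> :: complex. irreducible\<^sub>d Q \<longrightarrow> degree Q \<le> k \<longrightarrow> cmod \<alpha> \<le> m + 1 \<longrightarrow> poly (of_int_poly Q) \<alpha> = 0 \<longrightarrow>
     c \<le> cmod (poly (pderiv (of_int_poly Q)) \<alpha>) * mahler_measure Q ^ (degree Q - 1)" by (elim exE conjE)
  show ?thesis
  proof (rule exI[of _ "2 ^ k / c"], rule conjI, use c in simp, intro allI impI)
    fix Q :: "int poly" and z :: real
    assume Q: "irreducible\<^sub>d Q" "degree Q \<le> k" and z: "\<bar>z\<bar> \<le> m" and small: "\<bar>poly (of_int_poly Q) z\<bar> \<le> 1"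
    let ?p = "of_int_poly Q :: complex poly" and ?z = "complex_of_real z" and ?h = "mahler_measure Q"
    have d: "1 \<le> degree Q" using Q(1) by (auto simp: irreducible\<^sub>d_def)
    hence Q0: "Q \<noteq> 0" by auto
    have h: "?h \<ge> 1" by (rule mahler_measure_poly_ge_1[OF Q0])
    have "1 \<le> degree ?p" using d by simp
    from nearest_root[OF this, of ?z] obtain \<alpha> where a: "poly ?p \<alpha> = 0"
      "cmod (?z - \<alpha>) * cmod (poly (pderiv ?p) \<alpha>) \<le> 2 ^ (degree ?p - 1) * cmod (poly ?p ?z)"
      "cmod (lead_coeff ?p) * cmod (?z - \<alpha>) ^ degree ?p \<le> cmod (poly ?p ?z)" by (elim exE conjE)
    have v: "cmod (poly ?p ?z) = \<bar>poly (of_int_poly Q) z\<bar>" by (simp only: poly_of_int_complex norm_of_real)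
    have "1 \<le> cmod (lead_coeff ?p)"
    proof -
      have "lead_coeff Q \<noteq> 0" using Q0 by simp
      hence "1 \<le> real_of_int \<bar>lead_coeff Q\<bar>" by linarith
      thus ?thesis by simp
    qed
    hence "1 * cmod (?z - \<alpha>) ^ degree ?p \<le> cmod (lead_coeff ?p) * cmod (?z - \<alpha>) ^ degree ?p" by (intro mult_right_mono) auto
    hence "cmod (?z - \<alpha>) ^ degree Q \<le> 1" using a(3) v small by simp
    hence za: "cmod (?z - \<alpha>) \<le> 1" using d power_le_one_iff[of "cmod (?z - \<alpha>)" "degree Q"] by simp
    have "cmod \<alpha> \<le> cmod ?z + cmod (?z - \<alpha>)" using norm_triangle_ineq4[of ?z "?z - \<alpha>"] by simp
    hence am: "cmod \<alpha> \<le> m + 1" using za z by simp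
    have cc: "c \<le> cmod (poly (pderiv ?p) \<alpha>) * ?h ^ (degree Q - 1)"
      by (rule cb[THEN spec, THEN spec, THEN mp, THEN mp, THEN mp, THEN mp, OF Q am a(1)])
    have "cmod (?z - \<alpha>) * c \<le> cmod (?z - \<alpha>) * (cmod (poly (pderiv ?p) \<alpha>) * ?h ^ (degree Q - 1))"
      by (intro mult_left_mono cc) auto
    also have "\<dots> = (cmod (?z - \<alpha>) * cmod (poly (pderiv ?p) \<alpha>)) * ?h ^ (degree Q - 1)" by (simp only: mult.assoc)
    also have "\<dots> \<le> (2 ^ (degree ?p - 1) * cmod (poly ?p ?z)) * ?h ^ (degree Q - 1)"
      using h by (intro mult_right_mono a(2)) auto
    also have "\<dots> \<le> (2 ^ k * cmod (poly ?p ?z)) * ?h ^ (k - 1)"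
      using h Q(2) by (intro mult_mono power_increasing mult_nonneg_nonneg) auto
    finally have "cmod (?z - \<alpha>) * c \<le> 2 ^ k * \<bar>poly (of_int_poly Q) z\<bar> * ?h ^ (k - 1)" by (simp only: v)
    hence "cmod (?z - \<alpha>) \<le> (2 ^ k / c) * \<bar>poly (of_int_poly Q) z\<bar> * ?h ^ (k - 1)"
      using c by (simp add: pos_le_divide_eq)
    moreover have "\<bar>z - Re \<alpha>\<bar> \<le> cmod (?z - \<alpha>)" using abs_Re_le_cmod[of "?z - \<alpha>"] by simp
    ultimately show "\<exists>\<alpha> :: complex. poly (of_int_poly Q) \<alpha> = 0 \<and>
        \<bar>z - Re \<alpha>\<bar> \<le> (2 ^ k / c) * \<bar>poly (of_int_poly Q) z\<bar> * ?h ^ (k - 1)"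
      using a(1) by (intro exI[of _ \<alpha>] conjI) auto
  qed
qed

section \<open>Summation over dyadic heights\<close>

lemma dyadic_level:
  fixes M :: real
  assumes "1 \<le> M"
  shows "\<exists>j::nat. 2 ^ j \<le> M \<and> M < 2 ^ Suc j"
proof -
  define n where "n = (LEAST n::nat. M < 2 ^ n)"
  obtain k :: nat where "M < 2 ^ k" using real_arch_pow[of 2 M] by auto
  hence n: "M < 2 ^ n" unfolding n_def by (rule LeastI)
  have "n \<noteq> 0" using n assms by (intro notI) simp
  then obtain j where j: "n = Suc j" by (cases n) auto
  have "\<not> M < 2 ^ j" using not_less_Least[of j "\<lambda>n. M < 2 ^ n"] j n_def by simp
  thus ?thesis using n j by (intro exI[of _ j]) auto
qed

text \<open>All heights below 2^(j + 1) are included. This does not change the order of the count,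
  and it provides the finite set of all smaller heights when a polynomial of large height has to be
  forced.\<close>

definition height_level :: "nat \<Rightarrow> nat \<Rightarrow> int poly set" where
  "height_level k j = {Q. irreducible\<^sub>d Q \<and> degree Q \<le> k \<and> mahler_measure Q < 2 ^ Suc j}"

lemma height_level_finite_card: "finite (height_level k j)" "card (height_level k j) \<le> 2 ^ ((k + j + 3) * (k + 1))"
proof -
  let ?b = "2 ^ (k + j + 1) :: nat"
  have sub: "height_level k j \<subseteq> {p. degree p \<le> k \<and> (\<forall>i. \<bar>poly.coeff p i\<bar> \<le> int ?b)}"
  proof
    fix Q assume "Q \<in> height_level k j"
    hence Q: "degree Q \<le> k" "mahler_measure Q < 2 ^ Suc j" by (auto simp: height_level_def)
    have "\<bar>poly.coeff Q i\<bar> \<le> int ?b" for i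
    proof -
      have "\<bar>real_of_int (poly.coeff Q i)\<bar> \<le> 2 ^ k * mahler_measure Q" by (rule coeff_le_mahler[OF Q(1)])
      also have "\<dots> \<le> 2 ^ k * 2 ^ Suc j" using Q(2) by (intro mult_left_mono) auto
      also have "\<dots> = real_of_int (int ?b)" by (simp add: power_add)
      finally show ?thesis by linarith
    qed
    thus "Q \<in> {p. degree p \<le> k \<and> (\<forall>i. \<bar>poly.coeff p i\<bar> \<le> int ?b)}" using Q(1) by blast
  qed
  show fin: "finite (height_level k j)" by (rule finite_subset[OF sub finite_int_polys])
  have "card (height_level k j) \<le> (2 * ?b + 1) ^ (k + 1)"
    by (rule card_polys_le[OF fin]) (use sub in blast)
  also have "\<dots> \<le> (2 ^ (k + j + 3)) ^ (k + 1)"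
  proof (rule power_mono)
    have "1 \<le> ?b" by simp
    moreover have "2 ^ (k + j + 3) = 4 * ?b" by (simp add: power_add)
    ultimately show "2 * ?b + 1 \<le> 2 ^ (k + j + 3)" by linarith
  qed simp
  also have "\<dots> = 2 ^ ((k + j + 3) * (k + 1))" by (simp only: power_mult)
  finally show "card (height_level k j) \<le> 2 ^ ((k + j + 3) * (k + 1))" .
qed

text \<open>The error is measured against |x 0| itself, with |x 0| unbounded, instead of against a
  bound X. For irrational \<zeta> this follows from an exponent greater than l.\<close>

definition well_approximable :: "nat \<Rightarrow> real \<Rightarrow> real set" where
  "well_approximable N l = {\<zeta>. \<forall>T. \<exists>x :: nat \<Rightarrow> int. T \<le> \<bar>real_of_int (x 0)\<bar> \<and>
     (\<forall>i\<le>N. \<bar>\<zeta> ^ i * real_of_int (x 0) - real_of_int (x i)\<bar> \<le> \<bar>real_of_int (x 0)\<bar> powr - l)}"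

text \<open>Here the exponent deg D in \<open>killer_of_approximation\<close> pays off: an
  irreducible factor keeps a full negative power of |x 0|, which lies below \<delta> once |x 0| is
  large.\<close>

lemma irreducible_small_value:
  fixes l m w :: real
  assumes k0: "1 \<le> k0" "2 * k0 \<le> N + 1" and l: "l > 0" "(real k0 - 1) * l < 1" "1 < real k0 * l" "2 \<le> real N * l"
    and m: "1 \<le> m" and w: "0 \<le> w" "w < real N * (1 + l) - 1"
    and z: "\<zeta> \<in> well_approximable N l" "\<bar>\<zeta>\<bar> \<le> m" and d: "0 < \<delta>" "\<delta> \<le> 1"
  shows "\<exists>Q. irreducible\<^sub>d Q \<and> degree Q \<le> k0 \<and> \<bar>poly (of_int_poly Q) \<zeta>\<bar> * mahler_measure Q powr w < \<delta>"
proof -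
  from killer_of_approximation[OF k0 l m w] obtain \<eta> X0 where eta: "\<eta> > 0" and X0: "X0 \<ge> 1" and
   K: "\<forall>\<zeta> (x :: nat \<Rightarrow> int). \<bar>\<zeta>\<bar> \<le> m \<longrightarrow> X0 \<le> \<bar>real_of_int (x 0)\<bar> \<longrightarrow>
     (\<forall>i\<le>N. \<bar>\<zeta> ^ i * real_of_int (x 0) - real_of_int (x i)\<bar> \<le> \<bar>real_of_int (x 0)\<bar> powr - l) \<longrightarrow>
     (\<exists>D :: int poly. D \<noteq> 0 \<and> 1 \<le> degree D \<and> degree D \<le> k0 \<and>
        \<bar>poly (of_int_poly D) \<zeta>\<bar> * mahler_measure D powr w \<le> (\<bar>real_of_int (x 0)\<bar> powr - \<eta>) ^ degree D)"
    by (elim exE conjE)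
  from z(1) have "\<forall>T. \<exists>x :: nat \<Rightarrow> int. T \<le> \<bar>real_of_int (x 0)\<bar> \<and>
     (\<forall>i\<le>N. \<bar>\<zeta> ^ i * real_of_int (x 0) - real_of_int (x i)\<bar> \<le> \<bar>real_of_int (x 0)\<bar> powr - l)"
    unfolding well_approximable_def by (rule CollectD)
  from this[THEN spec, of "max X0 ((2 / \<delta>) powr (1 / \<eta>))"]
  obtain x :: "nat \<Rightarrow> int" where x: "max X0 ((2 / \<delta>) powr (1 / \<eta>)) \<le> \<bar>real_of_int (x 0)\<bar>"
    "\<forall>i\<le>N. \<bar>\<zeta> ^ i * real_of_int (x 0) - real_of_int (x i)\<bar> \<le> \<bar>real_of_int (x 0)\<bar> powr - l"
    by (elim exE conjE)
  define X where "X = \<bar>real_of_int (x 0)\<bar>"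
  have X: "X0 \<le> X" "(2 / \<delta>) powr (1 / \<eta>) \<le> X" "1 \<le> X" using x(1) X0 by (auto simp: X_def)
  have "2 / \<delta> \<le> X powr \<eta>" using X d eta by (intro powr_ge_of_ge) auto
  hence "2 \<le> X powr \<eta> * \<delta>" using d by (simp add: pos_divide_le_eq)
  moreover have "X powr \<eta> * X powr - \<eta> = 1" using X by (simp add: powr_minus)
  ultimately have th: "X powr - \<eta> < \<delta>"
  proof -
    assume a: "2 \<le> X powr \<eta> * \<delta>" and b: "X powr \<eta> * X powr - \<eta> = 1"
    have "X powr \<eta> * X powr - \<eta> < X powr \<eta> * \<delta>" using a b by linarith
    thus ?thesis using X by (simp add: mult_less_cancel_left_pos)
  qed
  from K[THEN spec, THEN spec, THEN mp, THEN mp, THEN mp, OF z(2) _ x(2)] X(1)[unfolded X_def]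
  obtain D :: "int poly" where D: "1 \<le> degree D" "degree D \<le> k0"
    "\<bar>poly (of_int_poly D) \<zeta>\<bar> * mahler_measure D powr w \<le> (X powr - \<eta>) ^ degree D" unfolding X_def by blast
  have "0 \<le> X powr - \<eta>" "X powr - \<eta> \<le> 1" using th d by auto
  from irreducible_factor_small[OF this D(1,3)] obtain Q where Q: "irreducible\<^sub>d Q" "degree Q \<le> degree D"
     "\<bar>poly (of_int_poly Q) \<zeta>\<bar> * mahler_measure Q powr w \<le> X powr - \<eta>" by (elim exE conjE)
  thus ?thesis using th D(2) by (intro exI[of _ Q]) auto
qed

text \<open>For transcendental \<zeta> the quantity \<open>?F Q\<close> is positive on the finitely
  many Q of height below 2^(J + 1). Asking for less than their minimum forces a polynomial of larger
  height, so infinitely many dyadic levels occur.\<close>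

lemma well_approximable_level:
  fixes l m w :: real
  assumes k0: "1 \<le> k0" "2 * k0 \<le> N + 1" and l: "l > 0" "(real k0 - 1) * l < 1" "1 < real k0 * l" "2 \<le> real N * l"
    and m: "1 \<le> m" and w: "0 \<le> w" "w < real N * (1 + l) - 1"
    and z: "\<zeta> \<in> well_approximable N l" "\<bar>\<zeta>\<bar> \<le> m" and tr: "\<not> (\<exists>Q :: int poly. Q \<noteq> 0 \<and> poly (of_int_poly Q) \<zeta> = 0)"
  shows "\<exists>\<^sub>F j in sequentially. \<exists>Q. irreducible\<^sub>d Q \<and> degree Q \<le> k0 \<and> 2 ^ j \<le> mahler_measure Q \<and> mahler_measure Q < 2 ^ Suc j \<and>
     \<bar>poly (of_int_poly Q) \<zeta>\<bar> * mahler_measure Q powr w \<le> 1"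
  unfolding frequently_sequentially
proof
  fix J
  let ?F = "\<lambda>Q. \<bar>poly (of_int_poly Q) \<zeta>\<bar> * mahler_measure Q powr w"
  define \<delta> where "\<delta> = Min (insert 1 (?F ` height_level k0 J))"
  have fin: "finite (insert 1 (?F ` height_level k0 J))" using height_level_finite_card(1) by simp
  have Fpos: "?F Q > 0" if "irreducible\<^sub>d Q" for Q
  proof -
    have "Q \<noteq> 0" using that by (auto simp: irreducible\<^sub>d_def)
    thus ?thesis using tr mahler_measure_poly_ge_1[of Q] by (intro mult_pos_pos) auto
  qed
  have d1: "\<delta> \<le> 1" and dF: "\<And>Q. Q \<in> height_level k0 J \<Longrightarrow> \<delta> \<le> ?F Q" unfolding \<delta>_def using fin by auto
  have "\<delta> \<in> insert 1 (?F ` height_level k0 J)" unfolding \<delta>_def by (rule Min_in[OF fin]) simp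
  hence d0: "\<delta> > 0" using Fpos by (auto simp: height_level_def)
  from irreducible_small_value[OF k0 l m w z d0 d1] obtain Q where Q: "irreducible\<^sub>d Q" "degree Q \<le> k0" "?F Q < \<delta>" by (elim exE conjE)
  have "Q \<notin> height_level k0 J" using dF[of Q] Q(3) by auto
  hence MJ: "2 ^ Suc J \<le> mahler_measure Q" using Q by (auto simp: height_level_def)
  have "(1::real) \<le> 2 ^ Suc J" by (rule one_le_power) simp
  with MJ have "1 \<le> mahler_measure Q" by linarith
  from dyadic_level[OF this] obtain j where j: "2 ^ j \<le> mahler_measure Q" "mahler_measure Q < 2 ^ Suc j" by (elim exE conjE)
  have "(2::real) ^ Suc J < 2 ^ Suc j" using MJ j(2) by linarith
  hence "Suc J < Suc j" by (rule power_less_imp_less_exp[rotated]) simp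
  thus "\<exists>n\<ge>J. \<exists>Q. irreducible\<^sub>d Q \<and> degree Q \<le> k0 \<and> 2 ^ n \<le> mahler_measure Q \<and> mahler_measure Q < 2 ^ Suc n \<and> ?F Q \<le> 1"
    using Q j d1 by (intro exI[of _ j] conjI exI[of _ Q]) auto
qed

text \<open>Level j has at most about 2^(j (k0 + 1)) polynomials with at most k0 roots each, and
  \<open>near_root_of_small_value\<close> gives the radius 2^(-j w) 2^(j (k0 - 1)) = 2^(-j t) up to
  a constant, t = w - k0 + 1. The sum of s-th powers is geometric with ratio 2^(k0 + 1 - s t) < 1.
  Algebraic numbers form a countable set, and the rest is exhausted by bounded parts.\<close>

lemma well_approximable_null:
  fixes l w s :: real
  assumes k0: "1 \<le> k0" "2 * k0 \<le> N + 1" and l: "l > 0" "(real k0 - 1) * l < 1" "1 < real k0 * l" "2 \<le> real N * l"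
    and w: "0 \<le> w" "w < real N * (1 + l) - 1" and s: "s > 0" "real k0 + 1 < s * (w - real k0 + 1)"
  shows "hausdorff_content s (well_approximable N l) = 0"
proof -
  let ?Alg = "{\<zeta> :: real. \<exists>Q :: int poly. Q \<noteq> 0 \<and> poly (of_int_poly Q) \<zeta> = 0}"
  have part: "hausdorff_content s {\<zeta> \<in> well_approximable N l - ?Alg. \<bar>\<zeta>\<bar> \<le> real (Suc mm)} = 0" for mm
  proof -
    define m where "m = real (Suc mm)"
    have m: "1 \<le> m" "0 \<le> m" by (auto simp: m_def)
    from near_root_of_small_value[OF m(2), of k0] obtain C where C: "C > 0" and
      near: "\<forall>(Q :: int poly) z. irreducible\<^sub>d Q \<longrightarrow> degree Q \<le> k0 \<longrightarrow> \<bar>z\<bar> \<le> m \<longrightarrow> \<bar>poly (of_int_poly Q) z\<bar> \<le> 1 \<longrightarrow>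
     (\<exists>\<alpha> :: complex. poly (of_int_poly Q) \<alpha> = 0 \<and>
        \<bar>z - Re \<alpha>\<bar> \<le> C * \<bar>poly (of_int_poly Q) z\<bar> * mahler_measure Q ^ (k0 - 1))" by (elim exE conjE)
    define t where "t = w - real k0 + 1"
    define \<rho> where "\<rho> j = C * 2 ^ (k0 - 1) * 2 powr (- real j * t)" for j :: nat
    have rho: "\<rho> j > 0" for j using C by (simp add: \<rho>_def)
    define G where "G j = Sigma (height_level k0 j) (\<lambda>Q. {\<alpha> :: complex. poly (of_int_poly Q) \<alpha> = 0})" for j
    define E where "E j = (\<Union>x\<in>G j. cball (Re (snd x)) (\<rho> j))" for j
    define c where "c j = real k0 * 2 ^ ((k0 + j + 3) * (k0 + 1))" for j :: nat
    define b where "b j = c j * (2 * \<rho> j) powr s" for j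
    have roots: "finite {\<alpha> :: complex. poly (of_int_poly Q) \<alpha> = 0} \<and> card {\<alpha> :: complex. poly (of_int_poly Q) \<alpha> = 0} \<le> k0"
      if "Q \<in> height_level k0 j" for Q j
    proof -
      have Q: "degree Q > 0" "degree Q \<le> k0" using that by (auto simp: height_level_def irreducible\<^sub>d_def)
      hence "of_int_poly Q \<noteq> (0 :: complex poly)" by auto
      hence "finite {\<alpha> :: complex. poly (of_int_poly Q) \<alpha> = 0}" "card {\<alpha> :: complex. poly (of_int_poly Q) \<alpha> = 0} \<le> degree (of_int_poly Q :: complex poly)"
        by (rule poly_roots_finite, rule card_poly_roots_bound)
      thus ?thesis using Q(2) by simp
    qed
    have finG: "finite (G j)" for j unfolding G_def using height_level_finite_card(1) roots by (intro finite_SigmaI) auto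
    have cardG: "real (card (G j)) \<le> c j" for j
    proof -
      have "card (G j) = (\<Sum>Q\<in>height_level k0 j. card {\<alpha> :: complex. poly (of_int_poly Q) \<alpha> = 0})"
        unfolding G_def using height_level_finite_card(1) roots by (intro card_SigmaI) auto
      also have "\<dots> \<le> (\<Sum>Q\<in>height_level k0 j. k0)" using roots by (intro sum_mono) auto
      also have "\<dots> = card (height_level k0 j) * k0" by simp
      also have "\<dots> \<le> 2 ^ ((k0 + j + 3) * (k0 + 1)) * k0" by (intro mult_le_mono1 height_level_finite_card(2))
      finally have "real (card (G j)) \<le> real (2 ^ ((k0 + j + 3) * (k0 + 1)) * k0)" by (simp only: of_nat_le_iff)
      thus ?thesis by (simp add: c_def mult.commute)
    qed
    have Ec: "hausdorff_content s (E j) \<le> ennreal (b j)" for j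
      unfolding E_def b_def
    proof (rule hausdorff_content_finite_UN[OF finG _ cardG])
      fix x :: "int poly \<times> complex"
      show "bounded (cball (Re (snd x)) (\<rho> j)) \<and> diam_pow s (cball (Re (snd x)) (\<rho> j)) \<le> (2 * \<rho> j) powr s"
        using s rho[of j] by (simp add: diam_pow_def diameter_cball)
    qed simp
    define r where "r = 2 powr (real k0 + 1 - s * t)"
    define Kc where "Kc = real k0 * 2 ^ ((k0 + 3) * (k0 + 1)) * (2 * C * 2 ^ (k0 - 1)) powr s"
    have bj: "b j = Kc * r ^ j" for j
    proof -
      have e1: "c j = real k0 * 2 ^ ((k0 + 3) * (k0 + 1)) * 2 powr (real j * (real k0 + 1))"
      proof -
        have "(k0 + j + 3) * (k0 + 1) = (k0 + 3) * (k0 + 1) + j * (k0 + 1)" by (simp add: algebra_simps)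
        hence "(2::real) ^ ((k0 + j + 3) * (k0 + 1)) = 2 ^ ((k0 + 3) * (k0 + 1)) * 2 ^ (j * (k0 + 1))" by (simp only: power_add)
        also have "(2::real) ^ (j * (k0 + 1)) = 2 powr real (j * (k0 + 1))" by (simp only: powr_realpow zero_less_numeral)
        also have "real (j * (k0 + 1)) = real j * (real k0 + 1)" by (simp only: of_nat_mult of_nat_add of_nat_1)
        finally show ?thesis by (simp only: c_def mult.assoc)
      qed
      have e2: "(2 * \<rho> j) powr s = (2 * C * 2 ^ (k0 - 1)) powr s * 2 powr (- (real j * t * s))"
      proof -
        have "2 * \<rho> j = (2 * C * 2 ^ (k0 - 1)) * 2 powr (- real j * t)" by (simp add: \<rho>_def mult_ac)
        thus ?thesis using C by (simp add: powr_mult powr_powr)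
      qed
      have "2 powr (real j * (real k0 + 1)) * 2 powr (- (real j * t * s)) = r ^ j"
      proof -
        have "r ^ j = 2 powr ((real k0 + 1 - s * t) * real j)" by (simp add: r_def powr_powr powr_realpow[symmetric])
        moreover have "real j * (real k0 + 1) + - (real j * t * s) = (real k0 + 1 - s * t) * real j" by (simp add: algebra_simps)
        ultimately show ?thesis by (simp only: powr_add[symmetric])
      qed
      moreover have "b j = Kc * (2 powr (real j * (real k0 + 1)) * 2 powr (- (real j * t * s)))"
        unfolding b_def e1 e2 Kc_def by (simp only: mult_ac)
      ultimately show ?thesis by (simp only:)
    qed
    have r: "0 \<le> r" "r < 1"
    proof -
      have "real k0 + 1 - s * t < 0" using s(2) by (simp add: t_def)
      thus "r < 1" unfolding r_def by (simp add: powr_less_one)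
    qed (simp add: r_def)
    have "summable b" unfolding bj[abs_def] using r by (intro summable_mult summable_geometric) auto
    moreover have "0 \<le> b j" for j by (simp add: b_def c_def)
    ultimately have null: "hausdorff_content s {x. \<exists>\<^sub>F j in sequentially. x \<in> E j} = 0"
      by (intro hausdorff_content_limsup[OF Ec])
    have "{\<zeta> \<in> well_approximable N l - ?Alg. \<bar>\<zeta>\<bar> \<le> m} \<subseteq> {x. \<exists>\<^sub>F j in sequentially. x \<in> E j}"
    proof
      fix \<zeta> assume "\<zeta> \<in> {\<zeta> \<in> well_approximable N l - ?Alg. \<bar>\<zeta>\<bar> \<le> m}"
      hence z: "\<zeta> \<in> well_approximable N l" "\<bar>\<zeta>\<bar> \<le> m" "\<not> (\<exists>Q :: int poly. Q \<noteq> 0 \<and> poly (of_int_poly Q) \<zeta> = 0)" by blast+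
      have "\<exists>\<^sub>F j in sequentially. \<zeta> \<in> E j"
      proof (rule frequently_elim1[OF well_approximable_level[OF k0 l m(1) w z]])
        fix j assume "\<exists>Q. irreducible\<^sub>d Q \<and> degree Q \<le> k0 \<and> 2 ^ j \<le> mahler_measure Q \<and> mahler_measure Q < 2 ^ Suc j \<and>
          \<bar>poly (of_int_poly Q) \<zeta>\<bar> * mahler_measure Q powr w \<le> 1"
        then obtain Q where Q: "irreducible\<^sub>d Q" "degree Q \<le> k0" "2 ^ j \<le> mahler_measure Q" "mahler_measure Q < 2 ^ Suc j"
          "\<bar>poly (of_int_poly Q) \<zeta>\<bar> * mahler_measure Q powr w \<le> 1" by (elim exE conjE)
        let ?h = "mahler_measure Q"
        have p2: "(1::real) \<le> 2 ^ j" by (rule one_le_power) simp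
        have h1: "1 \<le> ?h" using p2 Q(3) by linarith
        have hw: "1 \<le> ?h powr w" using h1 w(1) by (rule ge_one_powr_ge_zero)
        have "\<bar>poly (of_int_poly Q) \<zeta>\<bar> \<le> 1 / ?h powr w" by (subst pos_le_divide_eq) (use Q(5) hw in linarith)+
        also have "\<dots> \<le> 1 / (2 ^ j) powr w" using Q(3) w(1) p2 h1 by (intro divide_left_mono powr_mono2 mult_pos_pos) auto
        also have "\<dots> = 2 powr (- real j * w)" by (simp add: powr_powr powr_realpow[symmetric] powr_minus divide_simps)
        finally have v: "\<bar>poly (of_int_poly Q) \<zeta>\<bar> \<le> 2 powr (- real j * w)" .
        have "(2::real) powr (- real j * w) \<le> 2 powr 0" using w(1) by (intro powr_mono) auto
        hence v1: "\<bar>poly (of_int_poly Q) \<zeta>\<bar> \<le> 1" using v by simp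
        from near[THEN spec, THEN spec, THEN mp, THEN mp, THEN mp, THEN mp, OF Q(1,2) z(2) v1] obtain \<alpha> :: complex where
          a: "poly (of_int_poly Q) \<alpha> = 0" "\<bar>\<zeta> - Re \<alpha>\<bar> \<le> C * \<bar>poly (of_int_poly Q) \<zeta>\<bar> * ?h ^ (k0 - 1)" by (elim exE conjE)
        have "C * \<bar>poly (of_int_poly Q) \<zeta>\<bar> * ?h ^ (k0 - 1) \<le> C * 2 powr (- real j * w) * (2 ^ Suc j) ^ (k0 - 1)"
          using C Q(4) h1 v by (intro mult_mono power_mono) auto
        also have "\<dots> = \<rho> j"
        proof -
          have "((2::real) ^ Suc j) ^ (k0 - 1) = 2 ^ (k0 - 1) * 2 powr (real j * (real k0 - 1))"
          proof -
            have "((2::real) ^ Suc j) ^ (k0 - 1) = 2 ^ (k0 - 1) * 2 ^ (j * (k0 - 1))" by (simp add: power_mult_distrib power_mult)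
            also have "(2::real) ^ (j * (k0 - 1)) = 2 powr real (j * (k0 - 1))" by (simp only: powr_realpow zero_less_numeral)
            finally show ?thesis using k0(1) by simp
          qed
          moreover have "2 powr (- real j * w) * 2 powr (real j * (real k0 - 1)) = 2 powr (- real j * t)"
            unfolding powr_add[symmetric] t_def by (simp add: algebra_simps)
          ultimately show ?thesis unfolding \<rho>_def by (simp only: mult_ac)
        qed
        finally have "\<zeta> \<in> cball (Re \<alpha>) (\<rho> j)" using a(2) by (simp add: dist_real_def abs_minus_commute)
        moreover have "(Q, \<alpha>) \<in> G j" using Q a(1) by (simp add: G_def height_level_def)
        ultimately show "\<zeta> \<in> E j" unfolding E_def by (intro UN_I[of "(Q, \<alpha>)"]) auto
      qed
      thus "\<zeta> \<in> {x. \<exists>\<^sub>F j in sequentially. x \<in> E j}" by simp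
    qed
    from hausdorff_content_mono[OF this, of s] null show ?thesis by (simp add: m_def)
  qed
  have "well_approximable N l \<subseteq> (\<Union>mm. {\<zeta> \<in> well_approximable N l - ?Alg. \<bar>\<zeta>\<bar> \<le> real (Suc mm)}) \<union> ?Alg"
  proof
    fix \<zeta> assume z: "\<zeta> \<in> well_approximable N l"
    obtain mm :: nat where "\<bar>\<zeta>\<bar> \<le> real mm" using real_arch_simple by blast
    hence "\<bar>\<zeta>\<bar> \<le> real (Suc mm)" by simp
    thus "\<zeta> \<in> (\<Union>mm. {\<zeta> \<in> well_approximable N l - ?Alg. \<bar>\<zeta>\<bar> \<le> real (Suc mm)}) \<union> ?Alg" using z by blast
  qed
  from hausdorff_content_mono[OF this, of s]
  show ?thesis
    using hausdorff_content_Un_eq_0[OF hausdorff_content_UN_eq_0[OF part] hausdorff_content_countable[OF countable_real_algebraic s(1)]]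
    by simp
qed

text \<open>For irrational \<zeta> the distances of x \<zeta> to the integers have a positive
  minimum over 0 < |x| \<le> n, so errors tending to 0 force |x| to infinity. A rational number can
  reuse one fixed x for all X and is set aside.\<close>

lemma approx_exponent_gt_subset:
  assumes N: "N \<ge> 1" and l: "l > 0"
  shows "{\<zeta>. ereal l < approx_exponent N \<zeta>} \<subseteq> well_approximable N l \<union> \<rat>"
proof
  fix \<zeta> :: real assume "\<zeta> \<in> {\<zeta>. ereal l < approx_exponent N \<zeta>}"
  hence "ereal l < approx_exponent N \<zeta>" by simp
  then obtain l' :: real where ll: "l < l'" and fr: "\<exists>\<^sub>F X :: real in at_top.
        \<exists>(x :: int) (y :: nat \<Rightarrow> int). 1 \<le> \<bar>x\<bar> \<and> real_of_int \<bar>x\<bar> \<le> X \<and>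
          (MAX i\<in>{1..N}. \<bar>\<zeta> ^ i * real_of_int x - real_of_int (y i)\<bar>) \<le> X powr (- l')"
    unfolding approx_exponent_def less_Sup_iff by auto
  show "\<zeta> \<in> well_approximable N l \<union> \<rat>"
  proof (cases "\<zeta> \<in> \<rat>")
    case False
    have "\<exists>x :: nat \<Rightarrow> int. T \<le> \<bar>real_of_int (x 0)\<bar> \<and>
       (\<forall>i\<le>N. \<bar>\<zeta> ^ i * real_of_int (x 0) - real_of_int (x i)\<bar> \<le> \<bar>real_of_int (x 0)\<bar> powr - l)" for T
    proof -
      define n where "n = \<lceil>\<bar>T\<bar>\<rceil>"
      let ?g = "\<lambda>x :: int. \<bar>\<zeta> * real_of_int x - real_of_int (round (\<zeta> * real_of_int x))\<bar>"
      define \<delta> where "\<delta> = Min (insert 1 (?g ` ({- n..n} - {0})))"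
      have fin: "finite (insert 1 (?g ` ({- n..n} - {0})))" by simp
      have gpos: "?g x > 0" if "x \<noteq> 0" for x
      proof (rule ccontr)
        assume "\<not> ?thesis"
        hence "\<zeta> * real_of_int x = real_of_int (round (\<zeta> * real_of_int x))" by linarith
        hence "\<zeta> = real_of_int (round (\<zeta> * real_of_int x)) / real_of_int x" using that by (simp add: field_simps)
        hence "\<zeta> \<in> \<rat>" by (metis Rats_divide Rats_of_int)
        thus False using False by blast
      qed
      have "\<delta> \<in> insert 1 (?g ` ({- n..n} - {0}))" unfolding \<delta>_def by (rule Min_in[OF fin]) simp
      hence "\<delta> = 1 \<or> (\<exists>x. x \<noteq> 0 \<and> \<delta> = ?g x)" by blast
      hence d0: "\<delta> > 0"
      proof (elim disjE exE conjE)
        fix x :: int assume "x \<noteq> 0" and dx: "\<delta> = ?g x"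
        show ?thesis unfolding dx by (rule gpos) fact
      qed simp
      have dg: "\<delta> \<le> ?g x" if "x \<in> {- n..n} - {0}" for x unfolding \<delta>_def using that by (intro Min_le[OF fin]) auto
      have "((\<lambda>X :: real. X powr (- l')) \<longlongrightarrow> 0) at_top" using ll l by (intro tendsto_neg_powr filterlim_ident) auto
      hence "\<forall>\<^sub>F X in at_top. X powr (- l') < \<delta>" using d0 by (rule order_tendstoD(2))
      from frequently_eventually_frequently[OF fr this] obtain X and x :: int and y :: "nat \<Rightarrow> int" where
        X: "1 \<le> \<bar>x\<bar>" "real_of_int \<bar>x\<bar> \<le> X" "(MAX i\<in>{1..N}. \<bar>\<zeta> ^ i * real_of_int x - real_of_int (y i)\<bar>) \<le> X powr (- l')" "X powr (- l') < \<delta>"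
        using frequently_ex by (elim frequentlyE) blast
      have yb: "\<bar>\<zeta> ^ i * real_of_int x - real_of_int (y i)\<bar> \<le> X powr (- l')" if "i \<in> {1..N}" for i
        using X(3) that by (intro order.trans[OF Max_ge X(3)]) auto
      have "?g x \<le> \<bar>\<zeta> * real_of_int x - real_of_int (y 1)\<bar>" using round_diff_minimal[of "\<zeta> * real_of_int x" "y 1"] by simp
      also have "\<dots> \<le> X powr (- l')" using yb[of 1] N by simp
      finally have "?g x < \<delta>" using X(4) by linarith
      hence "x \<notin> {- n..n} - {0}" using dg[of x] by linarith
      hence "n < \<bar>x\<bar>" using X(1) by auto
      hence T: "T \<le> \<bar>real_of_int x\<bar>" unfolding n_def by linarith
      have X1: "1 \<le> X" using X(1,2) by linarith
      have "X powr (- l') \<le> X powr (- l)" using X1 ll by (intro powr_mono) auto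
      also have "\<dots> \<le> \<bar>real_of_int x\<bar> powr - l" using X(1,2) l by (intro powr_mono2') auto
      finally have XX: "X powr (- l') \<le> \<bar>real_of_int x\<bar> powr - l" .
      show ?thesis
      proof (rule exI[of _ "\<lambda>i. if i = 0 then x else y i"], intro conjI allI impI)
        fix i assume "i \<le> N"
        show "\<bar>\<zeta> ^ i * real_of_int (if 0 = (0::nat) then x else y 0) - real_of_int (if i = 0 then x else y i)\<bar>
           \<le> \<bar>real_of_int (if 0 = (0::nat) then x else y 0)\<bar> powr - l"
          using yb[of i] XX \<open>i \<le> N\<close> by (cases "i = 0") auto
      qed (use T in simp)
    qed
    thus ?thesis by (simp add: well_approximable_def)
  qed simp
qed

theorem approx_exponent_gt_null:
  fixes l s :: real
  assumes k0: "1 \<le> k0" "2 * k0 \<le> N + 1" and l: "l > 0" "(real k0 - 1) * l < 1" "1 < real k0 * l" "2 \<le> real N * l"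
    and s: "(real k0 + 1) / (real N * (1 + l) - real k0) < s"
  shows "hausdorff_content s {\<zeta>. ereal l < approx_exponent N \<zeta>} = 0"
proof -
  define D where "D = real N * (1 + l) - real k0"
  have N1: "N \<ge> 1" using k0 by linarith
  have D: "D > 0"
  proof -
    have "real (2 * k0) \<le> real (N + 1)" using k0(2) by (simp only: of_nat_le_iff)
    hence "2 * real k0 \<le> real N + 1" by simp
    moreover have "D = real N + real N * l - real k0" by (simp add: D_def algebra_simps)
    ultimately show ?thesis using l(4) by linarith
  qed
  have s0: "s > 0"
  proof -
    have "0 < (real k0 + 1) / D" using D by simp
    thus ?thesis using s by (simp add: D_def)
  qed
  have "(real k0 + 1) / s < D" using s s0 D by (simp add: D_def divide_less_eq mult.commute)
  \<comment> \<open>In terms of d = w - k0 + 1 the summation condition reads k0 + 1 < s d and the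
    approximation condition d < N (1 + l) - k0.\<close>
  then obtain d where d: "(real k0 + 1) / s < d" "d < D" using dense by blast
  define w where "w = d + real k0 - 1"
  have dpos: "0 < d" using less_trans[OF _ d(1), of 0] s0 by simp
  have "hausdorff_content s (well_approximable N l) = 0"
  proof (rule well_approximable_null[OF k0 l, of w])
    show "0 \<le> w" using dpos k0(1) by (simp add: w_def)
    show "w < real N * (1 + l) - 1" using d(2) by (simp add: w_def D_def)
    show "real k0 + 1 < s * (w - real k0 + 1)" using d(1) s0 by (simp add: w_def pos_divide_less_eq mult.commute)
  qed (rule s0)
  hence "hausdorff_content s (well_approximable N l \<union> \<rat>) = 0"
    using hausdorff_content_countable[OF countable_rat s0] by (rule hausdorff_content_Un_eq_0)
  with hausdorff_content_mono[OF approx_exponent_gt_subset[OF N1 l(1)], of s] show ?thesis by simp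
qed

subsection \<open>Asymptotics\<close>

lemma h_dim_nonneg: "0 \<le> h_dim N l"
  unfolding h_dim_def by (rule hausdorff_dim_nonneg)

lemma h_dim_le_1: "h_dim N l \<le> 1"
  unfolding h_dim_def by (rule hausdorff_dim_real_le_1)

text \<open>Compares the limit value f with the bound at x = N: rounding n and keeping l = L / N
  perturb the leading term \<sigma> x^2 of the denominator by O(x), a relative loss of O(1 /
  x).\<close>

lemma ratio_loss:
  fixes \<sigma> L f x :: real
  assumes s: "0 < \<sigma>" and L: "0 \<le> L" and f: "0 \<le> f" "f \<le> 1" and x: "x > 0"
  shows "f - ((\<sigma> * L + 2 + 2 * L) / \<sigma>) / x \<le> f * (\<sigma> * x * x) / ((\<sigma> * x + 2) * (x + L)) \<or> x < 1"
proof (cases "x < 1")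
  case False
  define den where "den = (\<sigma> * x + 2) * (x + L)"
  define c where "c = \<sigma> * L + 2 + 2 * L"
  have c0: "c \<ge> 0" using s L by (simp add: c_def)
  have sx: "0 < \<sigma> * x" "0 < \<sigma> * x * x" using s x by auto
  have den1: "\<sigma> * x * x \<le> den" unfolding den_def using s L x by (intro mult_mono) auto
  have dpos: "den > 0" using den1 sx by linarith
  have dd: "den = \<sigma> * x * x + (\<sigma> * L + 2) * x + 2 * L" by (simp add: den_def algebra_simps)
  have "2 * L \<le> 2 * L * x" using L False mult_left_mono[of 1 x "2 * L"] by simp
  hence "den - \<sigma> * x * x \<le> c * x" by (simp add: dd c_def algebra_simps)
  hence "(den - \<sigma> * x * x) / den \<le> c * x / den" using dpos by (intro divide_right_mono) auto
  also have "\<dots> \<le> c * x / (\<sigma> * x * x)" using c0 x s sx den1 dpos by (intro divide_left_mono mult_pos_pos) auto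
  also have "\<dots> = (c / \<sigma>) / x" using x by simp
  finally have 1: "1 - \<sigma> * x * x / den \<le> (c / \<sigma>) / x" using dpos by (simp add: diff_divide_distrib)
  have "f * (1 - \<sigma> * x * x / den) \<le> 1 * (1 - \<sigma> * x * x / den)"
    using f den1 dpos by (intro mult_right_mono) auto
  with 1 have "f - f * (\<sigma> * x * x / den) \<le> (c / \<sigma>) / x" by (simp add: right_diff_distrib)
  thus ?thesis by (simp add: den_def c_def)
qed simp

text \<open>At \<nu> = 1 - \<sigma> the limit \<nu> (1 - \<nu> L) / (1 - \<nu>) becomes (1 -
  \<sigma>) / (1 + \<sigma>), because L (1 - \<sigma>) (1 + \<sigma>) = 1; rationalised, this is the
  stated value f. At L = 1, where \<sigma> = 0, Dirichlet's theorem is used instead.\<close>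

lemma h_dim_lower:
  fixes L :: real
  assumes L: "L \<ge> 1"
  defines "f \<equiv> 1 / (2 * L - 1 + 2 * sqrt (L\<^sup>2 - L))"
  shows "\<exists>C. \<forall>N::nat. N \<ge> 1 \<longrightarrow> ereal (f - C / real N) \<le> h_dim N (L / real N)"
proof (cases "L = 1")
  case True
  have "f = 1" by (simp add: f_def True)
  thus ?thesis using True h_dim_1 by (intro exI[of _ 0]) (simp add: one_ereal_def[symmetric])
next
  case False
  hence L1: "L > 1" using L by simp
  define \<sigma> where "\<sigma> = sqrt (1 - 1 / L)"
  have q: "0 < 1 - 1 / L" "1 - 1 / L < 1" using L1 by auto
  have s0: "0 < \<sigma>" using q by (simp add: \<sigma>_def)
  have s1: "\<sigma> < 1" unfolding \<sigma>_def using q(2) real_sqrt_lt_1_iff by blast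
  have s2: "\<sigma>\<^sup>2 = 1 - 1 / L" using q by (simp add: \<sigma>_def)
  hence sL: "L * \<sigma>\<^sup>2 = L - 1" using L1 by (simp add: right_diff_distrib)
  have sq: "sqrt (L\<^sup>2 - L) = L * \<sigma>"
  proof (rule real_sqrt_unique)
    have "(L * \<sigma>)\<^sup>2 = L * (L * \<sigma>\<^sup>2)" by (simp add: power2_eq_square)
    also have "\<dots> = L\<^sup>2 - L" unfolding sL by (simp add: power2_eq_square algebra_simps)
    finally show "(L * \<sigma>)\<^sup>2 = L\<^sup>2 - L" .
  qed (use L1 s0 in simp)
  have den: "2 * L - 1 + 2 * sqrt (L\<^sup>2 - L) = L * (1 + \<sigma>)\<^sup>2"
    unfolding sq using sL by (simp add: power2_eq_square algebra_simps)
  have LL: "L * (1 - \<sigma>) * (1 + \<sigma>) = 1" using sL by (simp add: power2_eq_square algebra_simps)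
  have f: "f = (1 - \<sigma>) / (1 + \<sigma>)"
  proof -
    have "(1 - \<sigma>) * (L * (1 + \<sigma>)\<^sup>2) = (L * (1 - \<sigma>) * (1 + \<sigma>)) * (1 + \<sigma>)" by (simp add: power2_eq_square mult_ac)
    also have "\<dots> = 1 + \<sigma>" by (simp only: LL mult_1_left)
    finally have "1 / (L * (1 + \<sigma>)\<^sup>2) = (1 - \<sigma>) / (1 + \<sigma>)" using s0 L1 by (simp add: frac_eq_eq mult.commute)
    thus ?thesis unfolding f_def den .
  qed
  have nuL: "(1 - \<sigma>) * L = 1 / (1 + \<sigma>)" using LL s0 by (simp add: eq_divide_eq mult.commute)
  have f01: "0 \<le> f" "f \<le> 1" using s0 s1 by (auto simp: f)
  define C0 where "C0 = (\<sigma> * L + 2 + 2 * L) / \<sigma>"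
  define C where "C = C0 + 1 / (1 - \<sigma>)"
  have C0: "C0 \<ge> 0" using s0 L1 by (simp add: C0_def)
  have "ereal (f - C / real N) \<le> h_dim N (L / real N)" if N: "N \<ge> 1" for N
  proof -
    define n where "n = nat \<lfloor>(1 - \<sigma>) * real N\<rfloor>"
    have nn: "0 \<le> (1 - \<sigma>) * real N" using s1 by simp
    have n: "real n \<le> (1 - \<sigma>) * real N" "(1 - \<sigma>) * real N < real n + 1" using nn unfolding n_def by linarith+
    show ?thesis
    \<comment> \<open>n = 0 means (1 - \<sigma>) N < 1; the summand 1 / (1 - \<sigma>) of C makes
      the claimed bound nonpositive for these N.\<close>
    proof (cases "n = 0")
      case True
      hence "(1 - \<sigma>) * real N < 1" using n(2) by simp
      hence "1 < (1 / (1 - \<sigma>)) / real N" using N s1 by (simp add: field_simps)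
      also have "\<dots> \<le> C / real N" using C0 by (intro divide_right_mono) (auto simp: C_def)
      finally have "f - C / real N \<le> 0" using f01 by linarith
      hence "ereal (f - C / real N) \<le> 0" by (simp add: zero_ereal_def)
      thus ?thesis using h_dim_nonneg order.trans by blast
    next
      case False
      have Np: "real N > 0" using N by simp
      have "(1 - \<sigma>) * real N < real N" using s0 N by (simp add: algebra_simps)
      hence nN: "n + 1 \<le> N" using n(1) by linarith
      define l where "l = L / real N"
      have nl: "real n * l \<le> 1 / (1 + \<sigma>)"
      proof -
        have "real n * l \<le> ((1 - \<sigma>) * real N) * l" using L1 by (intro mult_right_mono n(1)) (simp add: l_def)
        also have "\<dots> = (1 - \<sigma>) * L" using N by (simp add: l_def)
        finally show ?thesis by (simp only: nuL)
      qed
      have lt1: "1 / (1 + \<sigma>) < 1" using s0 by simp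
      have main: "ereal ((real n + 1) * (1 - real n * l) / (real (N + 1 - n) * (1 + l))) \<le> h_dim N l"
      proof (rule h_dim_ge)
        have "real N * l = L" using N by (simp add: l_def)
        thus "1 \<le> real N * l" using L1 by simp
        show "real n * l < 1" using nl lt1 by linarith
      qed (use False nN in auto)
      have nl1: "0 \<le> 1 - real n * l" using nl lt1 by linarith
      have a1: "\<sigma> / (1 + \<sigma>) \<le> 1 - real n * l"
      proof -
        have "1 - 1 / (1 + \<sigma>) = \<sigma> / (1 + \<sigma>)" using s0 by (simp add: divide_simps)
        thus ?thesis using nl by linarith
      qed
      have a2: "real (N + 1 - n) \<le> \<sigma> * real N + 2"
      proof -
        have "real (N + 1 - n) = real N + 1 - real n" using nN by (simp add: of_nat_diff)
        thus ?thesis using n(2) by (simp add: algebra_simps)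
      qed
      have a3: "0 < real (N + 1 - n)" using nN by simp
      have l0: "0 < 1 + l" using L1 by (simp add: l_def add_pos_nonneg)
      have "f - C0 / real N \<le> f * (\<sigma> * real N * real N) / ((\<sigma> * real N + 2) * (real N + L))"
        using ratio_loss[of \<sigma> L f "real N"] s0 L1 f01 N unfolding C0_def by auto
      also have "\<dots> = ((1 - \<sigma>) * real N * (\<sigma> / (1 + \<sigma>))) / ((\<sigma> * real N + 2) * (1 + l))"
      proof -
        have "(real N + L) = real N * (1 + l)" using N by (simp add: l_def distrib_left)
        thus ?thesis using N by (simp add: f)
      qed
      also have "\<dots> \<le> ((real n + 1) * (1 - real n * l)) / (real (N + 1 - n) * (1 + l))"
        using s0 s1 n(2) a1 a2 a3 l0 Np nl1
        by (intro frac_le mult_mono mult_nonneg_nonneg mult_pos_pos divide_nonneg_pos) auto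
      finally have "f - C0 / real N \<le> (real n + 1) * (1 - real n * l) / (real (N + 1 - n) * (1 + l))" .
      moreover have "f - C / real N \<le> f - C0 / real N" using s1 by (intro diff_left_mono divide_right_mono) (auto simp: C_def)
      ultimately have "ereal (f - C / real N) \<le> ereal ((real n + 1) * (1 - real n * l) / (real (N + 1 - n) * (1 + l)))" by simp
      thus ?thesis using main by (simp only: l_def order.trans)
    qed
  qed
  thus ?thesis by blast
qed

text \<open>k0 is the least integer strictly above N / L, so an exponent l slightly below L / N
  satisfies both (k0 - 1) l < 1 and k0 l > 1. Up to O(1 / N), the bound (k0 + 1) / (N (1 + l) - k0)
  is then (N / L) / (N - N / L) = 1 / (L - 1).\<close>

lemma h_dim_upper:
  fixes L :: real
  assumes L: "L > 2"
  shows "\<exists>C. \<forall>N::nat. N \<ge> 1 \<longrightarrow> h_dim N (L / real N) \<le> ereal (1 / (L - 1) + C / real N)"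
proof -
  define C where "C = L / (L - 2) + 2 * L / (L - 1)"
  have "h_dim N (L / real N) \<le> ereal (1 / (L - 1) + C / real N)" if N: "N \<ge> 1" for N
  \<comment> \<open>For N below L / (L - 2) the condition 2 k0 \<le> N + 1 may fail, but then C / N
    is at least 1 and the trivial bound suffices.\<close>
  proof (cases "L / (L - 2) \<le> real N")
    case False
    have "1 \<le> (L / (L - 2)) / real N" by (subst pos_le_divide_eq) (use N False in linarith)+
    also have "\<dots> \<le> C / real N" using L by (intro divide_right_mono) (auto simp: C_def)
    also have "\<dots> \<le> 1 / (L - 1) + C / real N" using L by simp
    finally have "1 \<le> ereal (1 / (L - 1) + C / real N)" by (simp add: one_ereal_def)
    thus ?thesis using h_dim_le_1 order.trans by blast
  next
    case True
    define y where "y = real N / L"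
    have y: "0 < y" using N L by (simp add: y_def)
    define k0 where "k0 = nat \<lfloor>y\<rfloor> + 1"
    have k: "y < real k0" "real k0 \<le> y + 1" using y unfolding k0_def by linarith+
    have yL: "y * (L / real N) = 1" using N L by (simp add: y_def)
    have Ny: "real N = L * y" using L by (simp add: y_def)
    have "L \<le> real N * (L - 2)" using True L by (simp add: pos_divide_le_eq)
    hence "L \<le> L * (y * (L - 2))" by (simp add: Ny mult_ac)
    hence "1 \<le> y * (L - 2)" using L by simp
    hence "2 * y + 2 \<le> real N + 1" by (simp add: Ny algebra_simps)
    hence "2 * real k0 \<le> real N + 1" using k(2) by linarith
    hence k2: "1 \<le> k0" "2 * k0 \<le> N + 1" by (auto simp: k0_def)
    have "1 / real k0 < L / real N"
    proof -
      have "y * (L / real N) < real k0 * (L / real N)" using k(1) L N by (intro mult_strict_right_mono) auto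
      hence *: "1 < real k0 * (L / real N)" by (simp only: yL)
      show ?thesis
      proof (rule mult_imp_div_pos_less)
        show "0 < real k0" using k2(1) by simp
        show "1 < L / real N * real k0" using * by (subst mult.commute)
      qed
    qed
    moreover have "2 / real N < L / real N" "(L - 1) / real N < L / real N" using L N by (auto intro: divide_strict_right_mono)
    \<comment> \<open>The three lower limits give k0 l > 1, N l > 2 and N l > L - 1; the last one
      keeps the denominator N (1 + l) - k0 at least y (L - 1).\<close>
    ultimately have "Max {1 / real k0, 2 / real N, (L - 1) / real N} < L / real N" by simp
    then obtain l where l: "Max {1 / real k0, 2 / real N, (L - 1) / real N} < l" "l < L / real N" using dense by blast
    have l1: "1 / real k0 < l" "2 / real N < l" "(L - 1) / real N < l" using l(1) by auto
    have l0: "l > 0" using l1(1) by (rule less_trans[rotated]) (use k2 in simp)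
    have c1: "1 < real k0 * l" using l1(1) k2(1) by (simp add: pos_divide_less_eq mult.commute)
    have c2: "2 \<le> real N * l" using l1(2) N by (simp add: pos_divide_less_eq mult.commute)
    have c3: "L - 1 \<le> real N * l" using l1(3) N by (simp add: pos_divide_less_eq mult.commute)
    have c4: "(real k0 - 1) * l < 1"
    proof -
      have "(real k0 - 1) * l \<le> y * l" using k(2) l0 by (intro mult_right_mono) auto
      also have "\<dots> < y * (L / real N)" using l(2) y by (rule mult_strict_left_mono)
      finally show ?thesis by (simp only: yL)
    qed
    have b: "(real k0 + 1) / (real N * (1 + l) - real k0) \<le> 1 / (L - 1) + C / real N"
    proof -
      have "y * (L - 1) = real N - y" by (simp add: Ny algebra_simps)
      hence d: "y * (L - 1) \<le> real N * (1 + l) - real k0" using c3 k(2) L by (simp add: distrib_left)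
      have "(real k0 + 1) / (real N * (1 + l) - real k0) \<le> (y + 2) / (y * (L - 1))"
        using k y L by (intro frac_le d) auto
      also have "\<dots> = 1 / (L - 1) + (2 / (L - 1)) / y" using y L by (simp add: add_divide_distrib)
      also have "(2 / (L - 1)) / y = (2 * L / (L - 1)) / real N" using y L by (simp add: Ny)
      also have "\<dots> \<le> C / real N" using L by (intro divide_right_mono) (auto simp: C_def)
      finally show ?thesis by simp
    qed
    have "h_dim N (L / real N) \<le> hausdorff_dim {\<zeta>. ereal l < approx_exponent N \<zeta>}"
      unfolding h_dim_def
    proof (rule hausdorff_dim_mono, rule Collect_mono, rule impI)
      fix \<zeta> assume "ereal (L / real N) \<le> approx_exponent N \<zeta>"
      moreover have "ereal l < ereal (L / real N)" using l(2) by simp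
      ultimately show "ereal l < approx_exponent N \<zeta>" by (rule less_le_trans[rotated])
    qed
    also have "\<dots> \<le> ereal (1 / (L - 1) + C / real N)"
    proof (rule hausdorff_dim_le)
      show "0 \<le> 1 / (L - 1) + C / real N" using L by (simp add: C_def)
      fix s' assume "1 / (L - 1) + C / real N < s'"
      thus "hausdorff_content s' {\<zeta>. ereal l < approx_exponent N \<zeta>} = 0"
        using b by (intro approx_exponent_gt_null[OF k2 l0 c4 c1 c2]) auto
    qed
    finally show ?thesis .
  qed
  thus ?thesis by blast
qed

text \<open>For N = 2 m the choice k0 = m works for every l slightly above 1 / m = 2 / N, and then
  (m + 1) / (N (1 + l) - m) is at most (m + 1) / (m + 2). As the exponent is strictly greater than 2
  / N, countably many l j decreasing to 1 / m suffice.\<close>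

lemma g_dim_upper:
  assumes N: "N = 2 * m" "m \<ge> 1"
  shows "g_dim N (2 / real N) \<le> ereal ((real N + 2) / (real N + 4))"
proof -
  \<comment> \<open>The increment of at most 1 / m^2 keeps (m - 1) l j at most 1 - 1 / m^2, hence
    below 1.\<close>
  define l where "l j = 1 / real m + 1 / (real m ^ 2 * real (Suc j))" for j
  have m0: "real m > 0" using N(2) by simp
  have eq: "(real N + 2) / (real N + 4) = (real m + 1) / (real m + 2)"
    using mult_divide_mult_cancel_left[of 2 "real m + 1" "real m + 2"] by (simp add: N algebra_simps)
  have lgt: "1 / real m < l j" for j using m0 by (simp add: l_def)
  have lle: "l j \<le> 1 / real m + 1 / real m ^ 2" for j
    unfolding l_def using m0 by (intro add_left_mono divide_left_mono) auto
  have cover: "{\<zeta>. ereal (2 / real N) < approx_exponent N \<zeta>} \<subseteq> (\<Union>j. {\<zeta>. ereal (l j) < approx_exponent N \<zeta>})"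
  proof
    fix \<zeta> assume "\<zeta> \<in> {\<zeta>. ereal (2 / real N) < approx_exponent N \<zeta>}"
    hence "ereal (1 / real m) < approx_exponent N \<zeta>" by (simp add: N)
    then obtain r where r: "ereal (1 / real m) < ereal r" "ereal r < approx_exponent N \<zeta>" using ereal_dense2 by blast
    have d: "r - 1 / real m > 0" using r(1) by simp
    obtain j where j: "inverse (real (Suc j)) < real m ^ 2 * (r - 1 / real m)" using reals_Archimedean[of "real m ^ 2 * (r - 1 / real m)"] d m0 by auto
    have "1 / (real m ^ 2 * real (Suc j)) = inverse (real (Suc j)) / real m ^ 2" by (simp add: divide_inverse)
    also have "\<dots> < r - 1 / real m" using j m0 by (simp add: pos_divide_less_eq mult.commute)
    finally have "ereal (l j) < ereal r" by (simp add: l_def)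
    hence "ereal (l j) < approx_exponent N \<zeta>" using r(2) by (rule less_trans)
    thus "\<zeta> \<in> (\<Union>j. {\<zeta>. ereal (l j) < approx_exponent N \<zeta>})" by blast
  qed
  have "hausdorff_dim {\<zeta>. ereal (2 / real N) < approx_exponent N \<zeta>} \<le> ereal ((real m + 1) / (real m + 2))"
  proof (rule hausdorff_dim_le)
    show "0 \<le> (real m + 1) / (real m + 2)" by simp
    fix s assume s: "(real m + 1) / (real m + 2) < s"
    have "hausdorff_content s {\<zeta>. ereal (l j) < approx_exponent N \<zeta>} = 0" for j
    proof (rule approx_exponent_gt_null[OF N(2)])
      have ml: "1 < real m * l j" using lgt[of j] m0 by (simp add: pos_divide_less_eq mult.commute)
      show "2 * m \<le> N + 1" by (simp add: N)
      show "0 < l j" by (rule less_trans[OF _ lgt[of j]]) (use m0 in simp)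
      show "1 < real m * l j" by (rule ml)
      show "2 \<le> real N * l j" using ml by (simp add: N)
      have "(real m - 1) * l j \<le> (real m - 1) * (1 / real m + 1 / real m ^ 2)"
        using N(2) by (intro mult_left_mono lle) auto
      also have "\<dots> = 1 - 1 / real m ^ 2" using m0 by (simp add: field_simps power2_eq_square)
      also have "\<dots> < 1" using m0 by simp
      finally show "(real m - 1) * l j < 1" .
      have "real m + 2 \<le> real N * (1 + l j) - real m" using ml by (simp add: N algebra_simps)
      hence "(real m + 1) / (real N * (1 + l j) - real m) \<le> (real m + 1) / (real m + 2)" by (intro frac_le) auto
      thus "(real m + 1) / (real N * (1 + l j) - real m) < s" using s by linarith
    qed
    hence "hausdorff_content s (\<Union>j. {\<zeta>. ereal (l j) < approx_exponent N \<zeta>}) = 0" by (rule hausdorff_content_UN_eq_0)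
    thus "hausdorff_content s {\<zeta>. ereal (2 / real N) < approx_exponent N \<zeta>} = 0"
      using hausdorff_content_mono[OF cover, of s] by simp
  qed
  thus ?thesis unfolding g_dim_def eq .
qed

lemma ereal_upper_mono:
  assumes "\<exists>C. \<forall>N::nat. N \<ge> 1 \<longrightarrow> d N \<le> ereal (a + C / real N)" "a \<le> b"
  shows "\<exists>C. \<forall>N::nat. N \<ge> 1 \<longrightarrow> d N \<le> ereal (b + C / real N)"
proof -
  from assms(1) obtain C where C: "\<forall>N::nat. N \<ge> 1 \<longrightarrow> d N \<le> ereal (a + C / real N)" by blast
  have "d N \<le> ereal (b + C / real N)" if "N \<ge> 1" for N
    using C[rule_format, OF that] by (rule order.trans) (use assms(2) in simp)
  thus ?thesis by blast
qed

theorem theorem4p7: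
  shows "(\<forall>L::real. L \<ge> 1 \<longrightarrow>
            (\<exists>C1 C2 :: real. \<forall>N::nat. N \<ge> 1 \<longrightarrow>
               h_dim N (L / real N)
                 \<ge> ereal (1 / (2 * L - 1 + 2 * sqrt (L\<^sup>2 - L)) - C1 / real N) \<and>
               1 / (2 * L - 1 + 2 * sqrt (L\<^sup>2 - L)) - C1 / real N
                 \<ge> 1 / (4 * L) - C2 / real N))
       \<and> (\<forall>L::real. L \<ge> 3 \<longrightarrow>
            (\<exists>C :: real. \<forall>N::nat. N \<ge> 1 \<longrightarrow>
               h_dim N (L / real N) \<le> ereal (1 / (L - 2) + C / real N)))
       \<and> (\<forall>L::real. L \<ge> 2 \<longrightarrow>
            (\<exists>C :: real. \<forall>N::nat. N \<ge> 1 \<longrightarrow>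
               h_dim N (L / real N)
                 \<le> ereal (2 * L / (2 * L - 1 + sqrt (4 * L\<^sup>2 - 8 * L + 1)) + C / real N)))
       \<and> (\<forall>N::nat. N \<ge> 2 \<and> even N \<longrightarrow>
            g_dim N (2 / real N) \<le> ereal ((real N + 2) / (real N + 4)))"
proof (intro conjI allI impI)
  fix L :: real assume L: "L \<ge> 1"
  from h_dim_lower[OF L] obtain C where C: "\<forall>N::nat. N \<ge> 1 \<longrightarrow>
    ereal (1 / (2 * L - 1 + 2 * sqrt (L\<^sup>2 - L)) - C / real N) \<le> h_dim N (L / real N)" by (rule exE)
  \<comment> \<open>This bounds the denominator by 4 L, so one constant serves as both C1 and
    C2.\<close>
  have s1: "sqrt (L\<^sup>2 - L) \<le> L" using L by (intro real_le_lsqrt) auto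
  have "0 \<le> L * (L - 1)" using L by (intro mult_nonneg_nonneg) auto
  hence s0: "0 \<le> sqrt (L\<^sup>2 - L)" by (simp add: power2_eq_square right_diff_distrib)
  have "1 / (4 * L) \<le> 1 / (2 * L - 1 + 2 * sqrt (L\<^sup>2 - L))" by (rule frac_le) (use s0 s1 L in linarith)+
  thus "\<exists>C1 C2 :: real. \<forall>N::nat. N \<ge> 1 \<longrightarrow>
               h_dim N (L / real N) \<ge> ereal (1 / (2 * L - 1 + 2 * sqrt (L\<^sup>2 - L)) - C1 / real N) \<and>
               1 / (2 * L - 1 + 2 * sqrt (L\<^sup>2 - L)) - C1 / real N \<ge> 1 / (4 * L) - C2 / real N"
    using C by (intro exI[of _ C]) auto
next
  fix L :: real assume L: "L \<ge> 3"
  show "\<exists>C :: real. \<forall>N::nat. N \<ge> 1 \<longrightarrow> h_dim N (L / real N) \<le> ereal (1 / (L - 2) + C / real N)"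
  proof (rule ereal_upper_mono[OF h_dim_upper])
    show "1 / (L - 1) \<le> 1 / (L - 2)" using L by (intro frac_le) auto
  qed (use L in simp)
next
  fix L :: real assume L: "L \<ge> 2"
  show "\<exists>C :: real. \<forall>N::nat. N \<ge> 1 \<longrightarrow> h_dim N (L / real N)
     \<le> ereal (2 * L / (2 * L - 1 + sqrt (4 * L\<^sup>2 - 8 * L + 1)) + C / real N)"
  \<comment> \<open>At L = 2 the radicand is 1 and the bound equals 1, which holds for any subset of
    the line; \<open>h_dim_upper\<close> covers L > 2.\<close>
  proof (cases "L = 2")
    case True
    have e: "2 * L / (2 * L - 1 + sqrt (4 * L\<^sup>2 - 8 * L + 1)) = 1" by (simp add: True)
    show ?thesis unfolding e using h_dim_le_1 by (intro exI[of _ 0]) (simp add: one_ereal_def[symmetric])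
  next
    case False
    show ?thesis
    proof (rule ereal_upper_mono[OF h_dim_upper])
      \<comment> \<open>In terms of z = L (L - 2) the radicand is 4 z + 1 \<le> (2 z + 1)^2. Hence
        the denominator is at most 2 L (L - 1), which compares the stated bound with 1 / (L -
        1).\<close>
      define z where "z = L * (L - 2)"
      have z: "z \<ge> 0" using L by (simp add: z_def)
      have "sqrt (4 * L\<^sup>2 - 8 * L + 1) \<le> 2 * z + 1"
      proof (rule real_le_lsqrt)
        have "4 * L\<^sup>2 - 8 * L + 1 = 4 * z + 1" by (simp add: z_def power2_eq_square algebra_simps)
        moreover have "4 * z + 1 \<le> (2 * z + 1)\<^sup>2" using z by (simp add: power2_eq_square algebra_simps)
        ultimately show "4 * L\<^sup>2 - 8 * L + 1 \<le> (2 * z + 1)\<^sup>2" by linarith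
      qed (use z in simp)
      hence le: "2 * L - 1 + sqrt (4 * L\<^sup>2 - 8 * L + 1) \<le> 2 * L * (L - 1)" by (simp add: z_def algebra_simps)
      have "4 * L\<^sup>2 - 8 * L + 1 = 4 * z + 1" by (simp add: z_def power2_eq_square algebra_simps)
      hence "0 \<le> sqrt (4 * L\<^sup>2 - 8 * L + 1)" using z by simp
      hence pos: "0 < 2 * L - 1 + sqrt (4 * L\<^sup>2 - 8 * L + 1)" using L by linarith
      have "1 / (L - 1) = 2 * L / (2 * L * (L - 1))" using L by simp
      also have "\<dots> \<le> 2 * L / (2 * L - 1 + sqrt (4 * L\<^sup>2 - 8 * L + 1))" using L le pos by (intro divide_left_mono mult_pos_pos) auto
      finally show "1 / (L - 1) \<le> 2 * L / (2 * L - 1 + sqrt (4 * L\<^sup>2 - 8 * L + 1))" .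
    qed (use L False in simp)
  qed
next
  fix N :: nat assume "N \<ge> 2 \<and> even N"
  then obtain m where "N = 2 * m" "m \<ge> 1" by (auto elim!: evenE)
  thus "g_dim N (2 / real N) \<le> ereal ((real N + 2) / (real N + 4))" by (rule g_dim_upper)
qed

end
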